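(* Let $(\bar{\boldsymbol\Psi},\bar\phi,\bar\epsilon)$, with $\bar{\boldsymbol\Psi}=\{\bar\psi_1,\dots,\bar\psi_N\}$ and $\bar\epsilon=\{\bar\epsilon_1,\dots,\bar\epsilon_N\}$, be the solution (spatial parts of the canonical wavefunctions, electrostatic potential, eigenvalues) of the continuous Kohn-Sham eigenvalue problem on $\Omega$ for a system of $2N$ electrons, and let $(\bar{\boldsymbol\Psi}^h,\bar\phi^h,\bar\epsilon^h)$, with $\bar{\boldsymbol\Psi}^h=\{\bar\psi^h_1,\dots,\bar\psi^h_N\}$ and $\bar\epsilon^h=\{\bar\epsilon^h_1,\dots,\bar\epsilon^h_N\}$, be the solution of the corresponding discrete finite-element problem in $X_h$ (both problems, and the energy functional $E(\cdot,\cdot)$, are as in the context). Write $\delta\psi_i=\bar\psi_i^h-\bar\psi_i$ and $\delta\phi=\bar\phi^h-\bar\phi$, and let $E_h=E(\bar{\boldsymbol\Psi}^h,\bar\phi^h)$ and $E=E(\bar{\boldsymbol\Psi},\bar\phi)$ be the ground-state energies of the discrete and the continuous problem. Then, in the neighborhood of $(\bar{\boldsymbol\Psi},\bar\phi,\bar\epsilon)$, the finite-element approximation error in the ground-state energy can be bounded as follows: $$ \begin{aligned} |E_h-E|\le{}& 2\sum_{i=1}^{N}\Bigl[\tfrac12\int_\Omega|\nabla\delta\psi_i|^2\,d\mathbf r+\Bigl|\bar\epsilon_i\int_\Omega(\delta\psi_i)^2\,d\mathbf r\Bigr|+\Bigl|\int_\Omega F'(\rho(\bar{\boldsymbol\Psi}))(\delta\psi_i)^2\,d\mathbf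 r\Bigr|\\ &\qquad+\Bigl|\int_\Omega(\delta\psi_i)^2\,\bar\phi\,d\mathbf r\Bigr|+2\Bigl|\int_\Omega\bar\psi_i\,\delta\psi_i\,\delta\phi\,d\mathbf r\Bigr|\Bigr]+\frac1{8\pi}\int_\Omega|\nabla\delta\phi|^2\,d\mathbf r\\ &+8\Bigl|\int_\Omega F''(\rho(\bar{\boldsymbol\Psi}))\Bigl(\sum_{i=1}^N\bar\psi_i\,\delta\psi_i\Bigr)^2 d\mathbf r\Bigr| . \end{aligned} $$
   Context: Setting. $\Omega\subset\mathbb R^3$ is a bounded domain (a large enough domain for non-periodic problems, or the supercell for periodic problems), and $\mathbb X=H^1_0(\Omega)$ (non-periodic) or $\mathbb X=H^1_{per}(\Omega)$ (periodic). All wavefunctions are taken real-valued and orthonormal. The nuclear charge distribution $b$ on $\Omega$ is a fixed bounded smooth function. Density. The system has $2N$ electrons (each of $N$ spatial orbitals is doubly occupied). For $\boldsymbol\Psi=\{\psi_1,\dots,\psi_N\}\in\mathbb X^N$, $\rho(\boldsymbol\Psi)=2\sum_{i=1}^N\psi_i^2$. Exchange-correlation. $F(\rho)=\varepsilon_{xc}(\rho)\rho$ with $\varepsilon_{xc}=\varepsilon_x+\varepsilon_c$ (local density approximation), where $\varepsilon_x(\rho)=-\frac34(3/\pi)^{1/3}\rho^{1/3}$ and, with $r_s=(3/(4\pi\rho))^{1/3}$, $\varepsilon_c(\rho)=\gamma/(1+\beta_1\sqrt{r_s}+\beta_2r_s)$ for $r_s\ge1$ and $\varepsilon_c(\rho)=A\log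 r_s+B+Cr_s\log r_s+Dr_s$ for $r_s<1$. Here $\gamma,\beta_1,\beta_2,A,B,C,D$ are fixed real constants (the Ceperley-Alder constants). $F'$ and $F''$ denote derivatives with respect to $\rho$. Energy functional. For $\boldsymbol\Psi\in\mathbb X^N$ and $\phi\in\mathbb X$, $$E(\boldsymbol\Psi,\phi)=2\sum_{i=1}^N\int_\Omega\tfrac12|\nabla\psi_i|^2\,d\mathbf r+\int_\Omega F(\rho(\boldsymbol\Psi))\,d\mathbf r-\frac1{8\pi}\int_\Omega|\nabla\phi|^2\,d\mathbf r+\int_\Omega(\rho(\boldsymbol\Psi)+b)\phi\,d\mathbf r.$$ Continuous problem. $(\bar{\boldsymbol\Psi},\bar\phi,\bar\epsilon)\in\mathbb X^N\times\mathbb X\times\mathbb R^N$ satisfies $\int_\Omega\bar\psi_i\bar\psi_j\,d\mathbf r=\delta_{ij}$ and, for all $v\in\mathbb X$ and $i=1,\dots,N$, $$\tfrac12\int_\Omega\nabla\bar\psi_i\cdot\nabla v\,d\mathbf r+\int_\Omega F'(\rho(\bar{\boldsymbol\Psi}))\bar\psi_i v\,d\mathbf r+\int_\Omega\bar\phi\,\bar\psi_i v\,d\mathbf r=\bar\epsilon_i\int_\Omega\bar\psi_i v\,d\mathbf r,\qquad \frac1{4\pi}\int_\Omega\nabla\bar\phi\cdot\nabla v\,d\mathbf r=\int_\Omega(\rho(\bar{\boldsymbol\Psi})+b)v\,d\mathbf r.$$ Discrete problem. $X_h\subset\mathbb X$ is a finite-dimensional (finite-element) subspace; $(\bar{\boldsymbol\Psi}^h,\bar\phi^h,\bar\epsilon^h)\in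 X_h^N\times X_h\times\mathbb R^N$ satisfies $\int_\Omega\bar\psi^h_i\bar\psi^h_j\,d\mathbf r=\delta_{ij}$ and the same equations with $(\bar{\boldsymbol\Psi},\bar\phi,\bar\epsilon)$ replaced by $(\bar{\boldsymbol\Psi}^h,\bar\phi^h,\bar\epsilon^h)$, for all test functions $v\in X_h$.
   Formalization: The constants have the Ceperley-Alder signs and make F differentiable for all ρ>0 (rounded published values leave a jump at r_s=1), F''(ρ(Ψ̄)) exists a.e. where ρ>0, and "ground state" means that the ε̄_i are the N lowest eigenvalues of the continuous problem. *)

theory Defs
  imports "HOL-Analysis.Analysis"
begin

section \<open>Sobolev spaces on a domain in three-dimensional space\<close>

type_synonym pt = "real ^ 3"
type_synonym fld = "pt \<Rightarrow> real"

text \<open>Elements of function spaces are represented by functions on the whole space of which only the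
  values on \<open>\<Omega>\<close> matter, and those only up to null sets.\<close>

abbreviation int_over :: "pt set \<Rightarrow> fld \<Rightarrow> real" where
  "int_over \<Omega> f \<equiv> integral\<^sup>L (lebesgue_on \<Omega>) f"

definition partial_at :: "3 \<Rightarrow> fld \<Rightarrow> fld" where
  "partial_at i f x = frechet_derivative f (at x) (axis i 1)"

primrec Ck_on :: "nat \<Rightarrow> pt set \<Rightarrow> fld \<Rightarrow> bool" where
  "Ck_on 0 S f \<longleftrightarrow> continuous_on S f"
| "Ck_on (Suc k) S f \<longleftrightarrow> f differentiable_on S \<and> (\<forall>i. Ck_on k S (partial_at i f))"

text \<open>Only meant for open \<open>S\<close>.\<close>

definition smooth_on :: "pt set \<Rightarrow> fld \<Rightarrow> bool" where
  "smooth_on S f \<longleftrightarrow> (\<forall>k. Ck_on k S f)"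

definition test_functions :: "pt set \<Rightarrow> fld set" where
  "test_functions \<Omega> =
     {\<eta>. smooth_on UNIV \<eta> \<and> compact (closure {x. \<eta> x \<noteq> 0}) \<and> closure {x. \<eta> x \<noteq> 0} \<subseteq> \<Omega>}"

definition L2_fun :: "pt set \<Rightarrow> (pt \<Rightarrow> 'b::euclidean_space) \<Rightarrow> bool" where
  "L2_fun \<Omega> f \<longleftrightarrow> f \<in> borel_measurable (lebesgue_on \<Omega>) \<and>
     integrable (lebesgue_on \<Omega>) (\<lambda>x. (norm (f x))\<^sup>2)"

definition has_weak_gradient :: "pt set \<Rightarrow> fld \<Rightarrow> (pt \<Rightarrow> pt) \<Rightarrow> bool" where
  "has_weak_gradient \<Omega> u g \<longleftrightarrow> L2_fun \<Omega> u \<and> L2_fun \<Omega> g \<and>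
     (\<forall>\<eta>\<in>test_functions \<Omega>. \<forall>i.
        int_over \<Omega> (\<lambda>x. u x * partial_at i \<eta> x) = - int_over \<Omega> (\<lambda>x. g x $ i * \<eta> x))"

text \<open>The weak gradient is unique up to null sets, so integrals do not depend on the choice.\<close>

definition weak_grad :: "pt set \<Rightarrow> fld \<Rightarrow> pt \<Rightarrow> pt" where
  "weak_grad \<Omega> u = (SOME g. has_weak_gradient \<Omega> u g)"

definition H1 :: "pt set \<Rightarrow> fld set" where
  "H1 \<Omega> = {u. \<exists>g. has_weak_gradient \<Omega> u g}"

definition grad_sq :: "pt set \<Rightarrow> fld \<Rightarrow> real" where
  "grad_sq \<Omega> u = int_over \<Omega> (\<lambda>x. (norm (weak_grad \<Omega> u x))\<^sup>2)"

definition grad_inner :: "pt set \<Rightarrow> fld \<Rightarrow> fld \<Rightarrow> real" where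
  "grad_inner \<Omega> u v = int_over \<Omega> (\<lambda>x. weak_grad \<Omega> u x \<bullet> weak_grad \<Omega> v x)"

definition h1_norm :: "pt set \<Rightarrow> fld \<Rightarrow> real" where
  "h1_norm \<Omega> u = sqrt (int_over \<Omega> (\<lambda>x. (u x)\<^sup>2) + grad_sq \<Omega> u)"

definition H1_closure :: "pt set \<Rightarrow> fld set \<Rightarrow> fld set" where
  "H1_closure \<Omega> D = {u\<in>H1 \<Omega>. \<forall>e>0. \<exists>\<eta>\<in>D. h1_norm \<Omega> (\<lambda>x. u x - \<eta> x) < e}"

definition H1_0 :: "pt set \<Rightarrow> fld set" where
  "H1_0 \<Omega> = H1_closure \<Omega> (test_functions \<Omega>)"

text \<open>A supercell is an open parallelepiped with corner \<open>x0\<close>; its edges are the rows of \<open>a\<close>.\<close>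

definition supercell :: "pt \<Rightarrow> real ^ 3 ^ 3 \<Rightarrow> pt set" where
  "supercell x0 a = {x0 + (\<Sum>i\<in>UNIV. t $ i *\<^sub>R a $ i) | t. \<forall>i. 0 < t $ i \<and> t $ i < (1::real)}"

definition smooth_periodic :: "real ^ 3 ^ 3 \<Rightarrow> fld set" where
  "smooth_periodic a = {\<eta>. smooth_on UNIV \<eta> \<and> (\<forall>x i. \<eta> (x + a $ i) = \<eta> x)}"

definition H1_per :: "pt \<Rightarrow> real ^ 3 ^ 3 \<Rightarrow> fld set" where
  "H1_per x0 a = H1_closure (supercell x0 a) (smooth_periodic a)"

text \<open>A domain together with its space of trial functions: homogeneous Dirichlet conditions on a
  bounded domain, or periodic conditions on a supercell.\<close>

definition admissible :: "pt set \<Rightarrow> fld set \<Rightarrow> bool" where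
  "admissible \<Omega> X \<longleftrightarrow>
     (open \<Omega> \<and> connected \<Omega> \<and> bounded \<Omega> \<and> \<Omega> \<noteq> {} \<and> X = H1_0 \<Omega>) \<or>
     (\<exists>x0 a. invertible a \<and> \<Omega> = supercell x0 a \<and> X = H1_per x0 a)"

definition finite_dim_subspace :: "fld set \<Rightarrow> fld set \<Rightarrow> bool" where
  "finite_dim_subspace V X \<longleftrightarrow> V \<subseteq> X \<and>
     (\<exists>m (e :: nat \<Rightarrow> fld). V = {\<lambda>x. \<Sum>k<m. c k * e k x | c. True})"

section \<open>Exchange and correlation in the local density approximation\<close>

record corr_const =
  c_gamma :: real
  c_beta1 :: real
  c_beta2 :: real
  c_A :: real
  c_B :: real
  c_C :: real
  c_D :: real

text \<open>The sign pattern of the Ceperley-Alder constants in the parametrization of Perdew and Zunger,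
  for instance \<open>\<gamma> = -0.1423, \<beta>\<^sub>1 = 1.0529, \<beta>\<^sub>2 = 0.3334, A = 0.0311, B = -0.048, C = 0.0020,
  D = -0.0116\<close>. Numerical values are left open because printed values are rounded and then let the two
  branches of the correlation energy meet only approximately at \<open>r\<^sub>s = 1\<close>.\<close>

definition ceperley_alder_signs :: "corr_const \<Rightarrow> bool" where
  "ceperley_alder_signs k \<longleftrightarrow> c_gamma k < 0 \<and> c_beta1 k > 0 \<and> c_beta2 k > 0 \<and>
     c_A k > 0 \<and> c_B k < 0 \<and> c_C k > 0 \<and> c_D k < 0"

definition eps_x :: "real \<Rightarrow> real" where
  "eps_x \<rho> = - (3 / 4) * (3 / pi) powr (1 / 3) * \<rho> powr (1 / 3)"

definition wigner_seitz :: "real \<Rightarrow> real" where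
  "wigner_seitz \<rho> = (3 / (4 * pi * \<rho>)) powr (1 / 3)"

definition eps_c :: "corr_const \<Rightarrow> real \<Rightarrow> real" where
  "eps_c k \<rho> = (let r = wigner_seitz \<rho> in
     if r \<ge> 1 then c_gamma k / (1 + c_beta1 k * sqrt r + c_beta2 k * r)
     else c_A k * ln r + c_B k + c_C k * r * ln r + c_D k * r)"

text \<open>At zero density \<open>wigner_seitz\<close> is a junk value, but the factor \<open>\<rho>\<close> gives the limit value 0.\<close>

definition xc :: "corr_const \<Rightarrow> real \<Rightarrow> real" where
  "xc k \<rho> = (eps_x \<rho> + eps_c k \<rho>) * \<rho>"

text \<open>Densities are nonnegative, so derivatives are taken within the half line: two-sided at positive
  densities, one-sided at 0. The function \<open>xc'\<close> has no derivative at 0; the arbitrary value of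
  \<open>xc''\<close> there is harmless because it is only ever multiplied by 0.\<close>

definition xc' :: "corr_const \<Rightarrow> real \<Rightarrow> real" where
  "xc' k \<rho> = vector_derivative (xc k) (at \<rho> within {0..})"

definition xc'' :: "corr_const \<Rightarrow> real \<Rightarrow> real" where
  "xc'' k \<rho> = vector_derivative (xc' k) (at \<rho> within {0..})"

section \<open>The Kohn-Sham problem\<close>

text \<open>A family of \<open>N\<close> orbitals is a function on \<open>nat\<close> of which the indices below \<open>N\<close> are used.\<close>

definition ks_density :: "nat \<Rightarrow> (nat \<Rightarrow> fld) \<Rightarrow> fld" where
  "ks_density N \<Psi> x = 2 * (\<Sum>i<N. (\<Psi> i x)\<^sup>2)"

definition energy :: "corr_const \<Rightarrow> pt set \<Rightarrow> fld \<Rightarrow> nat \<Rightarrow> (nat \<Rightarrow> fld) \<Rightarrow> fld \<Rightarrow> real" where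
  "energy k \<Omega> b N \<Psi> \<phi> =
     2 * (\<Sum>i<N. int_over \<Omega> (\<lambda>x. 1 / 2 * (norm (weak_grad \<Omega> (\<Psi> i) x))\<^sup>2))
     + int_over \<Omega> (\<lambda>x. xc k (ks_density N \<Psi> x))
     - 1 / (8 * pi) * grad_sq \<Omega> \<phi>
     + int_over \<Omega> (\<lambda>x. (ks_density N \<Psi> x + b x) * \<phi> x)"

text \<open>Bilinear form of the Kohn-Sham operator at density \<open>\<rho>\<close> and potential \<open>\<phi>\<close>.\<close>

definition ks_form :: "corr_const \<Rightarrow> pt set \<Rightarrow> fld \<Rightarrow> fld \<Rightarrow> fld \<Rightarrow> fld \<Rightarrow> real" where
  "ks_form k \<Omega> \<rho> \<phi> u v =
     1 / 2 * grad_inner \<Omega> u v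
     + int_over \<Omega> (\<lambda>x. xc' k (\<rho> x) * u x * v x)
     + int_over \<Omega> (\<lambda>x. \<phi> x * u x * v x)"

text \<open>With \<open>V\<close> the full space this is the continuous problem, with \<open>V\<close> a finite-dimensional
  subspace it is the discrete one.\<close>

definition ks_solution ::
  "corr_const \<Rightarrow> pt set \<Rightarrow> fld \<Rightarrow> nat \<Rightarrow> fld set \<Rightarrow> (nat \<Rightarrow> fld) \<Rightarrow> fld \<Rightarrow> (nat \<Rightarrow> real) \<Rightarrow> bool" where
  "ks_solution k \<Omega> b N V \<Psi> \<phi> \<epsilon> \<longleftrightarrow>
     (\<forall>i<N. \<Psi> i \<in> V) \<and> \<phi> \<in> V \<and>
     (\<forall>i<N. \<forall>j<N. int_over \<Omega> (\<lambda>x. \<Psi> i x * \<Psi> j x) = (if i = j then 1 else 0)) \<and>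
     (\<forall>v\<in>V. \<forall>i<N. ks_form k \<Omega> (ks_density N \<Psi>) \<phi> (\<Psi> i) v = \<epsilon> i * int_over \<Omega> (\<lambda>x. \<Psi> i x * v x)) \<and>
     (\<forall>v\<in>V. 1 / (4 * pi) * grad_inner \<Omega> \<phi> v = int_over \<Omega> (\<lambda>x. (ks_density N \<Psi> x + b x) * v x))"

text \<open>The solution is a ground state: by the variational principle, the condition says that the
  occupied eigenvalues are the \<open>N\<close> lowest ones of the Kohn-Sham operator, with multiplicity.\<close>

definition occupies_lowest ::
  "corr_const \<Rightarrow> pt set \<Rightarrow> nat \<Rightarrow> fld set \<Rightarrow> (nat \<Rightarrow> fld) \<Rightarrow> fld \<Rightarrow> (nat \<Rightarrow> real) \<Rightarrow> bool" where
  "occupies_lowest k \<Omega> N V \<Psi> \<phi> \<epsilon> \<longleftrightarrow>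
     (\<forall>v\<in>V. (\<forall>j<N. int_over \<Omega> (\<lambda>x. \<Psi> j x * v x) = 0) \<longrightarrow>
        (\<forall>i<N. \<epsilon> i * int_over \<Omega> (\<lambda>x. (v x)\<^sup>2) \<le> ks_form k \<Omega> (ks_density N \<Psi>) \<phi> v v))"

end

theory Submission imports Defs begin

text \<open>Inserting the Kohn-Sham equations and the normalization of the orbitals into the energy difference
  leaves terms of second order. Those that are not visible on the right hand side are the Taylor remainder
  of \<open>F\<close> and the integral of \<open>(\<Sum>i<N. (\<delta>\<psi> i x)\<^sup>2) * \<delta>\<phi> x\<close>.

  From above, concavity of \<open>F (s\<^sup>2)\<close> in the variable \<open>s = sqrt \<rho>\<close>, with a margin provided by the exchange
  energy, absorbs that integral together with the gradient of \<open>\<delta>\<phi>\<close>; under periodic conditions its mean, which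
  the gradient does not see, is absorbed because the ground state has no zeros, so that the density is bounded
  away from 0. From below, both terms are small compared with the squared H1 norm of the orbital errors, and that
  norm is controlled by the gradients: by the Poincare inequality and, under periodic conditions, because
  orthonormality against the ground state, which has one sign, rules out constant errors.\<close>

section \<open>Smooth functions\<close>

text \<open>The bound carries no higher order term, so each remainder must be paid from the room
  between the exact expansion and the right hand side. The gradient of \<open>\<delta>\<phi>\<close>
  enters the expansion with factor \<open>-1/(8\<pi>)\<close> and the bound with
  \<open>+1/(8\<pi>)\<close>, which leaves \<open>1/(4\<pi>)\<close> of it for the estimate from
  above. The gradients of the orbital errors enter both with the same factor, so from above nothing
  of them is left over; from below there are two copies, one for the Taylor remainder and one for
  the cubic integral. This is why smallness does not suffice from above and a pointwise gain is
  required: with \<open>D\<close> the sum of the squared orbital errors, exchange yields a multiple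
  of \<open>D^(4/3)\<close>. By Young's inequality with exponents 4/3 and 4 it leaves the fourth
  power of \<open>\<delta>\<phi>\<close>, whose integral is of the order of the square of the
  gradient energy, hence small against that energy itself. The same L4 bound, Ladyzhenskaya's
  inequality in three dimensions, makes products of two trial functions square integrable, starts
  the De Giorgi iteration and dominates the Taylor remainder.\<close>

text \<open>The powers of \<open>inverse t\<close> close the family under differentiation.\<close>

definition bump_atom :: "nat \<Rightarrow> real \<Rightarrow> real" where
  "bump_atom m t = (if t > 0 then exp (- inverse t) * inverse t ^ m else 0)"

text \<open>The exponential dominates \<open>(s / n)^n\<close> with \<open>s = 1 / t\<close>. Taking
  \<open>n = m + 2\<close> leaves two spare powers of \<open>t\<close>, and this quadratic vanishing
  is what gives derivative 0 at the origin.\<close>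

lemma bump_atom_bound:
  "\<bar>bump_atom m t\<bar> \<le> real (Suc (Suc m)) ^ Suc (Suc m) * t\<^sup>2"
proof (cases "t > 0")
  case True
  define s where "s = inverse t"
  define n where "n = Suc (Suc m)"
  have s: "s > 0" using True by (simp add: s_def)
  have "(s / real n) ^ n \<le> (1 + s / real n) ^ n"
    using s by (intro power_mono) (auto simp: n_def)
  also have "\<dots> \<le> exp s"
    using s by (intro exp_ge_one_plus_x_over_n_power_n) (auto simp: n_def)
  finally have "s ^ n \<le> real n ^ n * exp s"
    by (simp add: power_divide divide_le_eq n_def mult.commute)
  then have "s ^ m * s\<^sup>2 \<le> real n ^ n * exp s"
    by (simp add: n_def power2_eq_square algebra_simps)
  then have "exp (- s) * s ^ m * s\<^sup>2 \<le> real n ^ n"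
    by (simp add: exp_minus field_simps)
  then have "exp (- s) * s ^ m * (s * t)\<^sup>2 \<le> real n ^ n * t\<^sup>2"
    by (simp add: power_mult_distrib mult_right_mono flip: mult.assoc)
  then show ?thesis using True s by (simp add: bump_atom_def s_def n_def)
next
  case False then show ?thesis by (simp add: bump_atom_def)
qed

lemma bump_atom_deriv:
  "(bump_atom m has_real_derivative (bump_atom (Suc (Suc m)) t - m * bump_atom (Suc m) t)) (at t)"
proof -
  consider "t > 0" | "t < 0" | "t = 0" by linarith
  then show ?thesis
  proof cases
    case 1
    have e: "real m * inverse t ^ (m - 1) * inverse t = real m * inverse t ^ m"
      by (cases m) simp_all
    have "((\<lambda>t. exp (- inverse t) * inverse t ^ m) has_real_derivative
        exp (- inverse t) * (inverse t * inverse t) * inverse t ^ m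
        + (real m * inverse t ^ (m - 1) * - (inverse t * inverse t)) * exp (- inverse t)) (at t)"
      by (rule derivative_eq_intros refl | use 1 in force)+
    also have "exp (- inverse t) * (inverse t * inverse t) * inverse t ^ m
        + (real m * inverse t ^ (m - 1) * - (inverse t * inverse t)) * exp (- inverse t)
        = exp (- inverse t) * (inverse t * inverse t) * inverse t ^ m
        - (real m * inverse t ^ (m - 1) * inverse t) * inverse t * exp (- inverse t)" by (simp add: mult.assoc)
    also have "\<dots> = bump_atom (Suc (Suc m)) t - m * bump_atom (Suc m) t"
      unfolding e using 1 by (simp add: bump_atom_def mult_ac)
    finally have "((\<lambda>t. exp (- inverse t) * inverse t ^ m) has_real_derivative
        (bump_atom (Suc (Suc m)) t - m * bump_atom (Suc m) t)) (at t)" .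
    then show ?thesis
      by (rule has_field_derivative_transform_within_open[where S="{0<..}"])
        (use 1 in \<open>auto simp: bump_atom_def\<close>)
  next
    case 2
    have "((\<lambda>t. 0) has_real_derivative (bump_atom (Suc (Suc m)) t - m * bump_atom (Suc m) t)) (at t)"
      using 2 by (auto simp: bump_atom_def)
    then show ?thesis
      by (rule has_field_derivative_transform_within_open[where S="{..<0}"])
        (use 2 in \<open>auto simp: bump_atom_def\<close>)
  next
    case 3
    let ?C = "real (Suc (Suc m)) ^ Suc (Suc m)"
    \<comment> \<open>At 0 the difference quotient is the quotient itself, and the quadratic bound
      makes it at most a multiple of \<open>\<bar>h\<bar>\<close>.\<close>
    have "((\<lambda>h. bump_atom m h / h) \<longlongrightarrow> 0) (at 0)"
    proof (rule tendsto_0_le[where K=1 and f="\<lambda>h. ?C * h"])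
      show "((\<lambda>h. ?C * h) \<longlongrightarrow> 0) (at 0)" by (auto intro!: tendsto_eq_intros)
      show "\<forall>\<^sub>F h in at 0. norm (bump_atom m h / h) \<le> norm (?C * h) * 1"
      proof (rule always_eventually, intro allI)
        fix h :: real
        show "norm (bump_atom m h / h) \<le> norm (?C * h) * 1"
        proof (cases "h = 0")
          case False
          have "\<bar>bump_atom m h\<bar> \<le> ?C * \<bar>h\<bar> * \<bar>h\<bar>"
            using bump_atom_bound[of m h] by (simp only: power2_eq_square mult.assoc abs_mult_self_eq)
          then have "\<bar>bump_atom m h\<bar> / \<bar>h\<bar> \<le> ?C * \<bar>h\<bar>"
            using False by (subst pos_divide_le_eq) auto
          then show ?thesis by (simp only: real_norm_def abs_divide abs_mult) simp
        qed simp
      qed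
    qed
    then show ?thesis using 3 by (simp add: DERIV_def bump_atom_def)
  qed
qed

text \<open>\<open>Ck_on\<close> recurses on partial derivatives, which for a product, an inverse or a square root involve
  the other operations, so smoothness is proved for all of them at once.\<close>

inductive smooth_closure :: "fld \<Rightarrow> bool" where
  base: "smooth_on UNIV f \<Longrightarrow> smooth_closure f"
| const: "smooth_closure (\<lambda>x. c)"
| atom: "smooth_closure (\<lambda>x. bump_atom m (c * x $ i + d))"
| add: "smooth_closure f \<Longrightarrow> smooth_closure g \<Longrightarrow> smooth_closure (\<lambda>x. f x + g x)"
| mult: "smooth_closure f \<Longrightarrow> smooth_closure g \<Longrightarrow> smooth_closure (\<lambda>x. f x * g x)"
| inv: "smooth_closure f \<Longrightarrow> (\<And>x. f x > 0) \<Longrightarrow> smooth_closure (\<lambda>x. inverse (f x))"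
| sqrt: "smooth_closure f \<Longrightarrow> (\<And>x. f x > 0) \<Longrightarrow> smooth_closure (\<lambda>x. sqrt (f x))"

lemma partial_at_eqI:
  assumes "\<And>x. (f has_derivative F x) (at x)"
  shows "partial_at i f = (\<lambda>x. F x (axis i 1))"
  unfolding partial_at_def using frechet_derivative_at[OF assms] by metis

text \<open>A class of differentiable functions that contains its own partial derivatives consists
  of smooth functions, by induction on the order in \<open>Ck_on\<close>. Each rule of
  \<open>smooth_closure\<close> only has to express its partial derivatives by the other
  rules.\<close>

lemma smooth_closure_step:
  assumes "smooth_closure f"
  shows "f differentiable_on UNIV \<and> (\<forall>i. smooth_closure (partial_at i f))"
  using assms
proof induction
  case (base f)
  have "Ck_on (Suc 0) UNIV f" using base unfolding smooth_on_def by blast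
  moreover have "smooth_on UNIV (partial_at i f)" for i
    unfolding smooth_on_def using base[unfolded smooth_on_def] Ck_on.simps(2) by blast
  ultimately show ?case using smooth_closure.base by auto
next
  case (const c)
  have "partial_at i (\<lambda>x. c) = (\<lambda>x. 0)" for i
    by (rule partial_at_eqI) (auto intro!: derivative_eq_intros)
  then show ?case using smooth_closure.const by (simp add: differentiable_on_def)
next
  case (atom m c j d)
  have D: "((\<lambda>x::pt. bump_atom m (c * x $ j + d)) has_derivative
     (\<lambda>h. (bump_atom (Suc (Suc m)) (c * x $ j + d) - m * bump_atom (Suc m) (c * x $ j + d)) * (c * h $ j))) (at x)" for x
  proof -
    have 1: "((\<lambda>x::pt. c * x $ j + d) has_derivative (\<lambda>h. c * h $ j)) (at x)"
      by (auto intro!: derivative_eq_intros bounded_linear.has_derivative[OF bounded_linear_vec_nth] )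
    from has_derivative_compose[OF 1 bump_atom_deriv[unfolded has_field_derivative_def, of m "c * x $ j + d"]]
    show ?thesis by simp
  qed
  have "partial_at i (\<lambda>x::pt. bump_atom m (c * x $ j + d)) =
     (\<lambda>x. (bump_atom (Suc (Suc m)) (c * x $ j + d) + (- real m) * bump_atom (Suc m) (c * x $ j + d)) * (c * (axis i 1 :: pt) $ j))" for i
    by (subst partial_at_eqI[OF D]) simp
  moreover have "smooth_closure (\<lambda>x. (bump_atom (Suc (Suc m)) (c * x $ j + d) + (- real m) * bump_atom (Suc m) (c * x $ j + d)) * (c * (axis i 1 :: pt) $ j))" for i
    by (intro smooth_closure.add smooth_closure.mult smooth_closure.const smooth_closure.atom)
  ultimately show ?case using D by (auto simp: differentiable_on_def differentiable_def)
next
  case (add f g)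
  then have D: "(f has_derivative frechet_derivative f (at x)) (at x)"
    "(g has_derivative frechet_derivative g (at x)) (at x)" for x
    by (auto simp: differentiable_on_def frechet_derivative_works)
  note E = has_derivative_add[OF D]
  have "partial_at i (\<lambda>x. f x + g x) = (\<lambda>x. partial_at i f x + partial_at i g x)" for i
    by (subst partial_at_eqI[OF E]) (simp add: partial_at_def)
  then show ?case using add E by (auto simp: differentiable_on_def differentiable_def intro: smooth_closure.add)
next
  case (mult f g)
  then have D: "(f has_derivative frechet_derivative f (at x)) (at x)"
    "(g has_derivative frechet_derivative g (at x)) (at x)" for x
    by (auto simp: differentiable_on_def frechet_derivative_works)
  note E = has_derivative_mult[OF D]
  have "partial_at i (\<lambda>x. f x * g x) = (\<lambda>x. f x * partial_at i g x + partial_at i f x * g x)" for i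
    by (subst partial_at_eqI[OF E]) (simp add: partial_at_def)
  moreover have "smooth_closure (\<lambda>x. f x * partial_at i g x + partial_at i f x * g x)" for i
    using mult by (intro smooth_closure.add smooth_closure.mult smooth_closure.const smooth_closure.inv smooth_closure.sqrt) auto
  ultimately show ?case using E by (auto simp: differentiable_on_def differentiable_def)
next
  case (inv f)
  then have D: "(f has_derivative frechet_derivative f (at x)) (at x)" for x
    by (auto simp: differentiable_on_def frechet_derivative_works)
  have E: "((\<lambda>x. inverse (f x)) has_derivative
     (\<lambda>h. - (inverse (f x) * frechet_derivative f (at x) h * inverse (f x)))) (at x)" for x
    using Deriv.has_derivative_inverse[OF _ D] inv.hyps(2)[of x] by force
  have "partial_at i (\<lambda>x. inverse (f x)) = (\<lambda>x. (-1) * (inverse (f x) * partial_at i f x * inverse (f x)))" for i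
    by (subst partial_at_eqI[OF E]) (simp add: partial_at_def)
  moreover have "smooth_closure (\<lambda>x. (-1) * (inverse (f x) * partial_at i f x * inverse (f x)))" for i
    using inv by (intro smooth_closure.add smooth_closure.mult smooth_closure.const smooth_closure.inv smooth_closure.sqrt) auto
  ultimately show ?case using E by (auto simp: differentiable_on_def differentiable_def)
next
  case (sqrt f)
  then have D: "(f has_derivative frechet_derivative f (at x)) (at x)" for x
    by (auto simp: differentiable_on_def frechet_derivative_works)
  have E: "((\<lambda>x. sqrt (f x)) has_derivative
     (\<lambda>h. frechet_derivative f (at x) h * (inverse (sqrt (f x)) / 2))) (at x)" for x
  proof -
    have "(sqrt has_derivative (*) (inverse (sqrt (f x)) / 2)) (at (f x))"
      using DERIV_real_sqrt[OF sqrt.hyps(2)[of x]] by (simp add: has_field_derivative_def)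
    from has_derivative_compose[OF D this] show ?thesis by (simp add: mult.commute)
  qed
  have "partial_at i (\<lambda>x. sqrt (f x)) = (\<lambda>x. (1/2) * (partial_at i f x * inverse (sqrt (f x))))" for i
    by (subst partial_at_eqI[OF E]) (simp add: partial_at_def)
  moreover have "smooth_closure (\<lambda>x. (1/2) * (partial_at i f x * inverse (sqrt (f x))))" for i
    using sqrt by (intro smooth_closure.add smooth_closure.mult smooth_closure.const smooth_closure.inv smooth_closure.sqrt) auto
  ultimately show ?case using E by (auto simp: differentiable_on_def differentiable_def)
qed

lemma smooth_closure_smooth:
  assumes "smooth_closure f" shows "smooth_on UNIV f"
proof -
  have "Ck_on k UNIV g" if "smooth_closure g" for k g
    using that
  proof (induction k arbitrary: g)
    case 0 then show ?case using smooth_closure_step differentiable_imp_continuous_on by auto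
  next
    case (Suc k) then show ?case using smooth_closure_step by auto
  qed
  then show ?thesis using assms by (auto simp: smooth_on_def)
qed

lemma smooth_on_closure_iff: "smooth_closure f \<longleftrightarrow> smooth_on UNIV f"
  using smooth_closure_smooth smooth_closure.base by blast

lemma smooth_differentiable:
  assumes "smooth_on UNIV f"
  shows "f differentiable at x" "continuous_on UNIV f" "continuous_on UNIV (partial_at i f)"
    "smooth_on UNIV (partial_at i f)"
proof -
  have "Ck_on (Suc (Suc 0)) UNIV f" "Ck_on (Suc 0) UNIV f" "Ck_on 0 UNIV f" using assms unfolding smooth_on_def by blast+
  then show "f differentiable at x" "continuous_on UNIV f"
    by (auto simp: differentiable_on_def)
  show sm: "smooth_on UNIV (partial_at i f)"
    unfolding smooth_on_def using assms[unfolded smooth_on_def] Ck_on.simps(2) by blast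
  show "continuous_on UNIV (partial_at i f)" using sm[unfolded smooth_on_def] Ck_on.simps(1) by blast
qed

lemma smooth_on_UNIV_intros:
  "smooth_on UNIV (\<lambda>x. c)"
  "smooth_on UNIV f \<Longrightarrow> smooth_on UNIV g \<Longrightarrow> smooth_on UNIV (\<lambda>x. f x + g x)"
  "smooth_on UNIV f \<Longrightarrow> smooth_on UNIV g \<Longrightarrow> smooth_on UNIV (\<lambda>x. f x * g x)"
  "smooth_on UNIV f \<Longrightarrow> smooth_on UNIV g \<Longrightarrow> smooth_on UNIV (\<lambda>x. f x - g x)"
proof -
  show "smooth_on UNIV (\<lambda>x. c)" by (rule smooth_closure_smooth) (rule smooth_closure.const)
  assume f: "smooth_on UNIV f" and g: "smooth_on UNIV g"
  show "smooth_on UNIV (\<lambda>x. f x + g x)" "smooth_on UNIV (\<lambda>x. f x * g x)"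
    using f g by (auto simp flip: smooth_on_closure_iff intro: smooth_closure.add smooth_closure.mult)
  have "smooth_closure (\<lambda>x. f x + (-1) * g x)"
    using f g unfolding smooth_on_closure_iff[symmetric]
    by (intro smooth_closure.add smooth_closure.mult smooth_closure.const)
  then show "smooth_on UNIV (\<lambda>x. f x - g x)" by (simp add: smooth_on_closure_iff)
qed

lemma smooth_deriv:
  assumes "smooth_on UNIV f"
  shows "(f has_derivative (\<lambda>h. (\<chi> i. partial_at i f x) \<bullet> h)) (at x)"
proof -
  let ?D = "frechet_derivative f (at x)"
  have D: "(f has_derivative ?D) (at x)"
    using smooth_differentiable(1)[OF assms] by (simp add: frechet_derivative_works)
  then have "linear ?D" by (rule has_derivative_linear)
  have "?D h = (\<chi> i. partial_at i f x) \<bullet> h" for h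
  proof -
    have "?D h = ?D (\<Sum>i\<in>UNIV. h $ i *\<^sub>R axis i 1)"
      by (simp add: basis_expansion flip: scalar_mult_eq_scaleR)
    also have "\<dots> = (\<Sum>i\<in>UNIV. h $ i * ?D (axis i 1))"
      by (simp add: linear_sum[OF \<open>linear ?D\<close>] linear_scale[OF \<open>linear ?D\<close>])
    also have "\<dots> = (\<chi> i. partial_at i f x) \<bullet> h"
      by (simp add: inner_vec_def partial_at_def mult.commute)
    finally show ?thesis .
  qed
  then show ?thesis using D by (metis (no_types, lifting) ext)
qed

lemma partial_at_mult:
  assumes "smooth_on UNIV f" "smooth_on UNIV g"
  shows "partial_at i (\<lambda>x. f x * g x) x = f x * partial_at i g x + partial_at i f x * g x"
  using partial_at_eqI[OF has_derivative_mult[OF smooth_deriv[OF assms(1)] smooth_deriv[OF assms(2)]]]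
  by (simp add: inner_axis)

text \<open>A product of one-dimensional bumps. The factor \<open>c\<close> sharpens the profile
  without moving the support, so that large \<open>c\<close> approximates the indicator of the open
  box from within the test functions.\<close>

definition box_bump :: "pt \<Rightarrow> pt \<Rightarrow> real \<Rightarrow> fld" where
  "box_bump a b c x = (\<Prod>i\<in>UNIV. bump_atom 0 (c * (x $ i - a $ i)) * bump_atom 0 (c * (b $ i - x $ i)))"

lemma box_bump_smooth: "smooth_on UNIV (box_bump a b c)"
proof -
  have "smooth_closure (\<lambda>x. \<Prod>i\<in>S. bump_atom 0 (c * x $ i + (- c * a $ i)) * bump_atom 0 ((- c) * x $ i + c * b $ i))"
    if "finite S" for S
    using that
  proof induction
    case empty then show ?case using smooth_closure.const by simp
  next
    case (insert i S)
    then show ?case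
      by (simp only: prod.insert[OF insert.hyps]) (intro smooth_closure.mult smooth_closure.atom)
  qed
  from this[of UNIV] show ?thesis
    by (simp add: smooth_on_closure_iff box_bump_def[abs_def] algebra_simps)
qed

lemma bump_atom_0: "0 \<le> bump_atom 0 t" "bump_atom 0 t \<le> 1" "bump_atom 0 t > 0 \<longleftrightarrow> t > 0"
  by (auto simp: bump_atom_def)

lemma box_bump_bounds: "0 \<le> box_bump a b c x" "box_bump a b c x \<le> 1"
  by (auto simp: box_bump_def bump_atom_0 intro!: prod_nonneg prod_le_1 mult_le_one)

lemma box_bump_pos:
  assumes "c > 0" shows "box_bump a b c x > 0 \<longleftrightarrow> x \<in> box a b"
proof -
  have "box_bump a b c x = 0 \<longleftrightarrow> x \<notin> box a b"
  proof -
    have "bump_atom 0 t = 0 \<longleftrightarrow> \<not> t > 0" for t by (auto simp: bump_atom_def)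
    then show ?thesis using assms by (auto simp: box_bump_def mem_box_cart mult_le_0_iff not_less)
  qed
  then show ?thesis using box_bump_bounds(1)[of a b c x] by (metis less_le)
qed

lemma box_bump_test_function:
  assumes "c > 0" "cbox a b \<subseteq> \<Omega>"
  shows "box_bump a b c \<in> test_functions \<Omega>"
proof -
  have "closure {x. box_bump a b c x \<noteq> 0} \<subseteq> cbox a b"
    using box_bump_pos[OF assms(1), of a b] box_bump_bounds(1)[of a b c]
    by (intro closure_minimal) (auto simp: less_le box_subset_cbox[THEN subsetD])
  moreover from this have "bounded (closure {x. box_bump a b c x \<noteq> 0})"
    using bounded_cbox bounded_subset by blast
  ultimately show ?thesis
    using box_bump_smooth assms(2) by (auto simp: test_functions_def compact_eq_bounded_closed)
qed

lemma box_bump_limit: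
  "(\<lambda>n. box_bump a b (real (Suc n)) x) \<longlonglongrightarrow> indicator (box a b) x"
proof -
  have 1: "(\<lambda>n. bump_atom 0 (real (Suc n) * t)) \<longlonglongrightarrow> (if t > 0 then 1 else 0)" for t
  proof (cases "t > 0")
    case True
    have "(\<lambda>n. exp (- (inverse (real (Suc n)) * inverse t))) \<longlonglongrightarrow> exp (- (0 * inverse t))"
      by (intro tendsto_intros LIMSEQ_inverse_real_of_nat)
    then show ?thesis using True by (simp add: bump_atom_def zero_less_mult_iff)
  next
    case False
    then have "\<not> real (Suc n) * t > 0" for n by (simp add: zero_less_mult_iff)
    then show ?thesis using False by (simp add: bump_atom_def)
  qed
  have "(\<lambda>n. box_bump a b (real (Suc n)) x) \<longlonglongrightarrow>
      (\<Prod>i\<in>UNIV. (if x $ i - a $ i > 0 then 1 else 0) * (if b $ i - x $ i > 0 then 1 else 0))"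
    unfolding box_bump_def by (intro tendsto_prod tendsto_mult 1)
  also have "(\<Prod>i\<in>UNIV. (if x $ i - a $ i > 0 then 1 else 0) * (if b $ i - x $ i > 0 then 1 else 0)) = (indicator (box a b) x :: real)"
    by (auto simp: indicator_def mem_box_cart)
  finally show ?thesis .
qed

text \<open>By translation invariance every difference quotient has integral 0. The quotients
  converge to the partial derivative and are dominated, by the mean value theorem, by its maximum on
  a slightly larger ball.\<close>

lemma integral_partial_eq_0:
  assumes f: "smooth_on UNIV f" and supp: "\<And>x. x \<notin> cball 0 R \<Longrightarrow> f x = 0"
  shows "(\<integral>x. partial_at i f x \<partial>lborel) = 0"
proof -
  define e :: pt where "e = axis i 1"
  define h where "h n = inverse (real (Suc n))" for n
  have h: "h n > 0" "h n \<le> 1" for n by (auto simp: h_def inverse_le_1_iff)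
  have cf: "continuous_on UNIV f" "continuous_on UNIV (partial_at i f)" using smooth_differentiable[OF f] by auto
  have f_meas: "f \<in> borel_measurable borel" "partial_at i f \<in> borel_measurable borel"
    using cf by (auto intro: borel_measurable_continuous_onI)
  have "compact (partial_at i f ` cball 0 (R + 1))"
    using cf by (intro compact_continuous_image) (auto intro: continuous_on_subset)
  then obtain B where B: "\<And>x. x \<in> cball 0 (R + 1) \<Longrightarrow> \<bar>partial_at i f x\<bar> \<le> B"
    by (metis (no_types, lifting) bounded_iff compact_imp_bounded image_eqI real_norm_def)
  have intf: "integrable lborel f"
  proof -
    have "integrable lborel (\<lambda>x. indicator (cball 0 R) x *\<^sub>R f x)"
      using cf by (intro borel_integrable_compact) (auto intro: continuous_on_subset)
    also have "(\<lambda>x. indicator (cball 0 R) x *\<^sub>R f x) = f"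
      using supp by (auto simp: indicator_def fun_eq_iff)
    finally show ?thesis .
  qed
  have d: "((\<lambda>t. f (x + t *\<^sub>R e)) has_real_derivative partial_at i f (x + t *\<^sub>R e)) (at t)" for x t
  proof -
    have "((\<lambda>t. x + t *\<^sub>R e) has_derivative (\<lambda>t. t *\<^sub>R e)) (at t)"
      by (auto intro!: derivative_eq_intros)
    from has_derivative_compose[OF this smooth_deriv[OF f]]
    show ?thesis by (simp add: has_field_derivative_def e_def inner_axis mult.commute[of _ "partial_at i f _"])
  qed
  define q where "q n x = (f (x + h n *\<^sub>R e) - f x) / h n" for n x
  have shift: "(\<integral>x. f (x + v) \<partial>lborel) = (\<integral>x. f x \<partial>lborel)" "integrable lborel (\<lambda>x. f (x + v))" for v
  proof -
    have "integral\<^sup>L lborel f = integral\<^sup>L (distr lborel borel ((+) v)) f" by (simp add: lborel_distr_plus)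
    also have "\<dots> = (\<integral>x. f (v + x) \<partial>lborel)" using f_meas by (subst integral_distr) auto
    finally show "(\<integral>x. f (x + v) \<partial>lborel) = (\<integral>x. f x \<partial>lborel)" by (simp add: add.commute)
    have "integrable (distr lborel borel ((+) v)) f" using intf by (simp add: lborel_distr_plus)
    then show "integrable lborel (\<lambda>x. f (x + v))"
      using f_meas by (subst (asm) integrable_distr_eq) (auto simp: add.commute)
  qed
  have q0: "(\<integral>x. q n x \<partial>lborel) = 0" for n
    unfolding q_def using shift intf by (simp add: Bochner_Integration.integral_diff)
  have "(\<lambda>n. \<integral>x. q n x \<partial>lborel) \<longlonglongrightarrow> (\<integral>x. partial_at i f x \<partial>lborel)"
  proof (rule integral_dominated_convergence[where w="\<lambda>x. indicator (cball 0 (R+1)) x * B"])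
    show "partial_at i f \<in> borel_measurable lborel" "q n \<in> borel_measurable lborel" for n
      using f_meas by (auto simp: q_def[abs_def])
    have "integrable lborel (\<lambda>x. indicator (cball 0 (R+1)) x *\<^sub>R B)"
      by (intro borel_integrable_compact) auto
    then show "integrable lborel (\<lambda>x::pt. indicator (cball 0 (R+1)) x * B)" by simp
    show "AE x in lborel. (\<lambda>n. q n x) \<longlonglongrightarrow> partial_at i f x"
    proof (rule AE_I2)
      fix x
      have "((\<lambda>t. f (x + t *\<^sub>R e)) has_real_derivative partial_at i f x) (at 0)"
        using d[of x 0] by simp
      then have "(\<lambda>t. (f (x + t *\<^sub>R e) - f x) / t) \<midarrow>0\<rightarrow> partial_at i f x"
        by (simp add: DERIV_def)
      moreover have "h \<longlonglongrightarrow> 0" "\<forall>\<^sub>F n in sequentially. h n \<noteq> 0"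
        using LIMSEQ_inverse_real_of_nat h by (auto simp: h_def[abs_def])
      ultimately have "((\<lambda>n. (f (x + h n *\<^sub>R e) - f x) / h n) \<longlongrightarrow> partial_at i f x) sequentially"
        using filterlim_compose[of "\<lambda>t. (f (x + t *\<^sub>R e) - f x) / t" _ "at 0" h sequentially]
        by (auto simp: filterlim_at)
      then show "(\<lambda>n. q n x) \<longlonglongrightarrow> partial_at i f x" by (simp add: q_def)
    qed
    show "AE x in lborel. norm (q n x) \<le> indicator (cball 0 (R+1)) x * B" for n
    proof (rule AE_I2)
      fix x
      show "norm (q n x) \<le> indicator (cball 0 (R+1)) x * B"
      proof (cases "f (x + h n *\<^sub>R e) = f x")
        case True
        have "B \<ge> 0" if "x \<in> cball 0 (R+1)" using B[OF that] by linarith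
        then show ?thesis using True by (auto simp: q_def indicator_def)
      next
        case False
        then have n: "norm x \<le> R \<or> norm (x + h n *\<^sub>R e) \<le> R" using supp[of x] supp[of "x + h n *\<^sub>R e"] by (metis dist_0_norm mem_cball)
        \<comment> \<open>One end of the segment lies in the ball of radius \<open>R\<close>, as
          \<open>f\<close> differs at the two ends; since \<open>h n \<le> 1\<close>, the whole
          segment stays in the ball of radius \<open>R + 1\<close>.\<close>
        have mem: "x + t *\<^sub>R e \<in> cball 0 (R+1)" if "0 \<le> t" "t \<le> h n" for t
          using n
        proof
          assume "norm x \<le> R"
          then show ?thesis using norm_triangle_ineq[of x "t *\<^sub>R e"] that h[of n] by (simp add: e_def)
        next
          assume "norm (x + h n *\<^sub>R e) \<le> R"
          moreover have "x + t *\<^sub>R e = (x + h n *\<^sub>R e) + (t - h n) *\<^sub>R e" by (simp add: algebra_simps)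
          ultimately have "norm (x + t *\<^sub>R e) \<le> R + norm ((t - h n) *\<^sub>R e)"
            by (metis norm_triangle_mono order_refl)
          then show ?thesis using that h[of n] by (simp add: e_def)
        qed
        obtain z where z: "0 < z" "z < h n" "f (x + h n *\<^sub>R e) - f (x + 0 *\<^sub>R e) = (h n - 0) * partial_at i f (x + z *\<^sub>R e)"
          using MVT2[of 0 "h n" "\<lambda>t. f (x + t *\<^sub>R e)", OF h(1) d] by blast
        then show ?thesis using B[OF mem[of z]] mem[of 0] h[of n] by (simp add: q_def)
      qed
    qed
  qed
  then show ?thesis using q0 LIMSEQ_unique by (simp add: LIMSEQ_const_iff)
qed

lemma integrable_lebesgue_on_iff:
  fixes f :: "pt \<Rightarrow> 'b::{banach, second_countable_topology}"
  assumes "\<Omega> \<in> sets lebesgue"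
  shows "integrable (lebesgue_on \<Omega>) f \<longleftrightarrow> integrable lebesgue (\<lambda>x. indicator \<Omega> x *\<^sub>R f x)"
    "integral\<^sup>L (lebesgue_on \<Omega>) f = (\<integral>x. indicator \<Omega> x *\<^sub>R f x \<partial>lebesgue)"
proof -
  have "\<Omega> \<inter> space lebesgue \<in> sets lebesgue" using assms by simp
  show "integrable (lebesgue_on \<Omega>) f \<longleftrightarrow> integrable lebesgue (\<lambda>x. indicator \<Omega> x *\<^sub>R f x)"
    by (rule integrable_restrict_space[OF \<open>\<Omega> \<inter> space lebesgue \<in> sets lebesgue\<close>])
  show "integral\<^sup>L (lebesgue_on \<Omega>) f = (\<integral>x. indicator \<Omega> x *\<^sub>R f x \<partial>lebesgue)"
    by (rule integral_restrict_space[OF \<open>\<Omega> \<inter> space lebesgue \<in> sets lebesgue\<close>])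
qed

lemma test_functions_vanish:
  assumes "\<zeta> \<in> test_functions \<Omega>"
  shows "smooth_on UNIV \<zeta>" "x \<notin> \<Omega> \<Longrightarrow> \<zeta> x = 0" "\<exists>R. \<forall>x. x \<notin> cball 0 R \<longrightarrow> \<zeta> x = 0"
    "x \<notin> \<Omega> \<Longrightarrow> partial_at i \<zeta> x = 0"
proof -
  let ?S = "closure {x. \<zeta> x \<noteq> 0}"
  have S: "smooth_on UNIV \<zeta>" "compact ?S" "?S \<subseteq> \<Omega>" using assms by (auto simp: test_functions_def)
  have out: "\<zeta> x = 0" if "x \<notin> ?S" for x using that closure_subset[of "{x. \<zeta> x \<noteq> 0}"] by blast
  show "smooth_on UNIV \<zeta>" by (rule S)
  show "x \<notin> \<Omega> \<Longrightarrow> \<zeta> x = 0" using S(3) out by blast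
  obtain R where "\<forall>y\<in>?S. dist 0 y \<le> R" using compact_imp_bounded[OF S(2)] unfolding bounded_any_center[where a=0] ..
  then have "?S \<subseteq> cball 0 R" by (simp add: subset_eq)
  then show "\<exists>R. \<forall>x. x \<notin> cball 0 R \<longrightarrow> \<zeta> x = 0" using out by blast
  assume "x \<notin> \<Omega>"
  then have x: "x \<in> - ?S" using S by auto
  have "open (- ?S)" by (rule open_Compl[OF closed_closure])
  have "((\<lambda>_. 0::real) has_derivative (\<lambda>_. 0)) (at x)" by simp
  then have "(\<zeta> has_derivative (\<lambda>_. 0)) (at x)"
    by (rule has_derivative_transform_within_open[OF _ \<open>open (- ?S)\<close> x]) (metis ComplD out)
  then show "partial_at i \<zeta> x = 0"
    unfolding partial_at_def using frechet_derivative_at by metis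
qed

text \<open>The product with a test function has compact support, so its partial derivative
  integrates to 0 over the whole space; outside \<Omega> both integrands vanish.\<close>

lemma smooth_partial_parts:
  assumes u: "smooth_on UNIV u" and z: "\<zeta> \<in> test_functions \<Omega>" and \<Omega>: "\<Omega> \<in> sets lebesgue"
  shows "int_over \<Omega> (\<lambda>x. u x * partial_at i \<zeta> x) = - int_over \<Omega> (\<lambda>x. partial_at i u x * \<zeta> x)"
proof -
  note z' = test_functions_vanish[OF z]
  obtain R where R: "\<And>x. x \<notin> cball 0 R \<Longrightarrow> \<zeta> x = 0" using z'(3) by blast
  have cont: "continuous_on UNIV u" "continuous_on UNIV (partial_at i u)" "continuous_on UNIV \<zeta>" "continuous_on UNIV (partial_at i \<zeta>)"
    using smooth_differentiable[OF u] smooth_differentiable[OF z'(1)] by auto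
  \<comment> \<open>Read as a test function on the ball, \<open>\<zeta>\<close> has partial
    derivatives that vanish outside the ball as well.\<close>
  have z2: "\<zeta> \<in> test_functions (cball 0 R)"
  proof -
    have "{x. \<zeta> x \<noteq> 0} \<subseteq> cball 0 R" using R by blast
    then show ?thesis using z closure_minimal[OF _ closed_cball] by (simp add: test_functions_def)
  qed
  have R': "x \<notin> cball 0 R \<Longrightarrow> partial_at i \<zeta> x = 0" for x using test_functions_vanish(4)[OF z2] by blast
  have int: "integrable lborel (\<lambda>x. w x * v x)"
    if "continuous_on UNIV w" "continuous_on UNIV v" "\<And>x. x \<notin> cball 0 R \<Longrightarrow> v x = 0" for w v :: fld
  proof -
    have "integrable lborel (\<lambda>x. indicator (cball 0 R) x *\<^sub>R (w x * v x))"
      using that by (intro borel_integrable_compact continuous_intros) (auto intro: continuous_on_subset)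
    also have "(\<lambda>x. indicator (cball 0 R) x *\<^sub>R (w x * v x)) = (\<lambda>x. w x * v x)"
      using that(3) by (auto simp: indicator_def fun_eq_iff)
    finally show ?thesis .
  qed
  have i1: "integrable lborel (\<lambda>x. u x * partial_at i \<zeta> x)" and i2: "integrable lborel (\<lambda>x. partial_at i u x * \<zeta> x)"
    using int cont R R' by blast+
  have "(\<integral>x. partial_at i (\<lambda>x. u x * \<zeta> x) x \<partial>lborel) = 0"
    by (rule integral_partial_eq_0[of _ R]) (use u z' R in \<open>auto intro: smooth_on_UNIV_intros\<close>)
  then have *: "(\<integral>x. u x * partial_at i \<zeta> x \<partial>lborel) = - (\<integral>x. partial_at i u x * \<zeta> x \<partial>lborel)"
    using i1 i2 by (simp add: partial_at_mult[OF u z'(1)] Bochner_Integration.integral_add)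
  have "int_over \<Omega> (\<lambda>x. u x * partial_at i \<zeta> x) = (\<integral>x. u x * partial_at i \<zeta> x \<partial>lborel)"
    using \<Omega> i1 by (subst integral_completion[symmetric]) (auto simp: integrable_lebesgue_on_iff indicator_def z'(4) intro!: Bochner_Integration.integral_cong)
  moreover have "int_over \<Omega> (\<lambda>x. partial_at i u x * \<zeta> x) = (\<integral>x. partial_at i u x * \<zeta> x \<partial>lborel)"
    using \<Omega> i2 by (subst integral_completion[symmetric]) (auto simp: integrable_lebesgue_on_iff indicator_def z'(2) intro!: Bochner_Integration.integral_cong)
  ultimately show ?thesis using * by simp
qed

text \<open>Bumps that converge to the indicator of a box show that \<open>g\<close> has integral 0
  over every closed box inside \<Omega>. Differentiating the integral over shrinking cubes then
  gives \<open>g = 0\<close> almost everywhere.\<close>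

lemma fundamental_lemma:
  fixes g :: fld
  assumes \<Omega>: "open \<Omega>" and g: "integrable (lebesgue_on \<Omega>) g"
    and orth: "\<And>\<eta>. \<eta> \<in> test_functions \<Omega> \<Longrightarrow> int_over \<Omega> (\<lambda>x. g x * \<eta> x) = 0"
  shows "AE x in lebesgue_on \<Omega>. g x = 0"
proof -
  have \<Omega>s: "\<Omega> \<in> sets lebesgue" using \<Omega> by simp
  \<comment> \<open>Extension by 0 to the whole space, because the differentiation theorem asks for
    integrability on all boxes.\<close>
  define G where "G x = indicator \<Omega> x *\<^sub>R g x" for x
  have G: "integrable lebesgue G" using g \<Omega>s by (simp add: integrable_lebesgue_on_iff G_def[abs_def])
  have abs: "G absolutely_integrable_on S" if "S \<in> sets lebesgue" for S
    unfolding set_integrable_def using integrable_mult_indicator[OF that G] .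
  have box0: "integral (cbox a b) G = 0" if ab: "cbox a b \<subseteq> \<Omega>" for a b
  proof -
    have "(\<lambda>n. int_over \<Omega> (\<lambda>x. g x * box_bump a b (real (Suc n)) x)) \<longlonglongrightarrow> int_over \<Omega> (\<lambda>x. g x * indicator (box a b) x)"
    proof (rule integral_dominated_convergence[where w="\<lambda>x. norm (g x)"])
      have bm: "f \<in> borel_measurable (lebesgue_on \<Omega>)" if "f \<in> borel_measurable borel" for f :: fld
        using that by (simp add: measurable_completion measurable_restrict_space1)
      have [measurable]: "box_bump a b c \<in> borel_measurable (lebesgue_on \<Omega>)" for c
        by (intro bm borel_measurable_continuous_onI smooth_differentiable(2) box_bump_smooth)
      have [measurable]: "(indicator (box a b) :: fld) \<in> borel_measurable (lebesgue_on \<Omega>)"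
        by (intro bm) auto
      have [measurable]: "g \<in> borel_measurable (lebesgue_on \<Omega>)" using g by auto
      show "(\<lambda>x. g x * indicator (box a b) x) \<in> borel_measurable (lebesgue_on \<Omega>)"
        "(\<lambda>x. g x * box_bump a b (real (Suc n)) x) \<in> borel_measurable (lebesgue_on \<Omega>)" for n
        by measurable
      show "integrable (lebesgue_on \<Omega>) (\<lambda>x. norm (g x))" using g by auto
      show "AE x in lebesgue_on \<Omega>. (\<lambda>n. g x * box_bump a b (real (Suc n)) x) \<longlonglongrightarrow> g x * indicator (box a b) x"
        by (intro AE_I2 tendsto_mult tendsto_const box_bump_limit)
      show "AE x in lebesgue_on \<Omega>. norm (g x * box_bump a b (real (Suc n)) x) \<le> norm (g x)" for n
        using box_bump_bounds[of a b "real (Suc n)"] by (intro AE_I2) (auto simp: abs_mult mult_left_le)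
    qed
    moreover have "int_over \<Omega> (\<lambda>x. g x * box_bump a b (real (Suc n)) x) = 0" for n
      by (intro orth box_bump_test_function ab) simp
    ultimately have "int_over \<Omega> (\<lambda>x. g x * indicator (box a b) x) = 0"
      by (simp add: LIMSEQ_const_iff)
    then have "(LINT x:box a b|lebesgue. G x) = 0"
      using \<Omega>s by (simp add: integrable_lebesgue_on_iff set_lebesgue_integral_def G_def mult_ac)
    then have "integral (box a b) G = 0"
      using set_lebesgue_integral_eq_integral(2)[OF abs[of "box a b"]] by simp
    then show ?thesis by (simp add: integral_open_interval)
  qed
  have "G integrable_on cbox a b" for a b
    using abs[of "cbox a b"] by (simp add: absolutely_integrable_on_def)
  then obtain N where N: "negligible N"
    "\<And>x e. \<lbrakk>x \<notin> N; 0 < e\<rbrakk> \<Longrightarrow> \<exists>d>0. \<forall>h. 0 < h \<and> h < d \<longrightarrow>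
       norm (integral (cbox x (x + h *\<^sub>R One)) G /\<^sub>R h ^ DIM(pt) - G x) < e"
    using integrable_ccontinuous_explicit by blast
  have zero: "g x = 0" if x: "x \<in> \<Omega>" "x \<notin> N" for x
  proof -
    obtain e where e: "e > 0" "ball x e \<subseteq> \<Omega>" using \<Omega> x(1) openE by blast
    have sub: "cbox x (x + h *\<^sub>R One) \<subseteq> \<Omega>" if "0 < h" "h < e / 3" for h
    proof
      fix y assume "y \<in> cbox x (x + h *\<^sub>R One)"
      then have "x \<bullet> b \<le> y \<bullet> b \<and> y \<bullet> b \<le> x \<bullet> b + h" if "b \<in> Basis" for b
        using that by (auto simp: mem_box inner_add_left)
      from this[OF axis_in_Basis_iff[THEN iffD2], of 1] have y: "\<bar>y $ i - x $ i\<bar> \<le> h" for i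
        by (simp add: inner_axis abs_le_iff) (smt (verit))
      have "norm (y - x) \<le> (\<Sum>i\<in>UNIV. \<bar>(y - x) $ i\<bar>)" by (rule norm_le_l1_cart)
      also have "\<dots> \<le> (\<Sum>i\<in>(UNIV::3 set). h)" using y by (intro sum_mono) simp
      also have "\<dots> < e" using that by simp
      finally show "y \<in> \<Omega>" using e(2) by (auto simp: dist_norm norm_minus_commute)
    qed
    have "norm (G x) < r" if r: "r > 0" for r
    proof -
      obtain d where d: "d > 0" "\<And>h. 0 < h \<and> h < d \<Longrightarrow>
         norm (integral (cbox x (x + h *\<^sub>R One)) G /\<^sub>R h ^ DIM(pt) - G x) < r"
        using N(2)[OF x(2) r] by blast
      define h where "h = min d (e / 3) / 2"
      have h: "0 < h" "h < d" "h < e / 3" using d e by (auto simp: h_def)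
      show ?thesis using d(2)[of h] h box0[OF sub[of h]] by simp
    qed
    then have "G x = 0" by (metis less_irrefl zero_less_norm_iff)
    then show ?thesis using x by (simp add: G_def)
  qed
  show ?thesis
    using zero N(1) \<Omega>s by (intro AE_I'[of "N \<inter> \<Omega>"]) (auto simp: null_sets_restrict_space negligible_iff_null_sets intro: null_set_Int2)
qed

section \<open>The exchange-correlation energy\<close>

definition exchange_const :: real where "exchange_const = (3 / pi) powr (1 / 3)"

text \<open>The derivative of \<open>\<lambda>\<rho>. eps_c k \<rho> * \<rho>\<close> on the two branches, written in the square root \<open>q\<close> of the
  Wigner-Seitz radius at low density and in the radius \<open>r\<close> itself at high density.\<close>

definition corr_low :: "corr_const \<Rightarrow> real \<Rightarrow> real" where
  "corr_low k q = c_gamma k * (1 + 7/6 * c_beta1 k * q + 4/3 * c_beta2 k * q\<^sup>2) / (1 + c_beta1 k * q + c_beta2 k * q\<^sup>2)\<^sup>2"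

definition corr_high :: "corr_const \<Rightarrow> real \<Rightarrow> real" where
  "corr_high k r = c_A k * ln r + c_B k - c_A k / 3 + 2/3 * c_C k * r * ln r + (2 * c_D k - c_C k) / 3 * r"

lemma wigner_seitz_pos: "\<rho> > 0 \<Longrightarrow> wigner_seitz \<rho> > 0"
  by (simp add: wigner_seitz_def)

lemma wigner_seitz_eq: "\<rho> > 0 \<Longrightarrow> wigner_seitz \<rho> = (3 / (4 * pi)) powr (1/3) * \<rho> powr (- (1/3))"
  by (simp add: wigner_seitz_def powr_divide powr_mult powr_minus_divide)

lemma wigner_seitz_cube: "\<rho> > 0 \<Longrightarrow> wigner_seitz \<rho> ^ 3 = 3 / (4 * pi * \<rho>)"
  by (simp add: wigner_seitz_def powr_powr flip: powr_realpow)

lemma wigner_seitz_ge_1_iff: "\<rho> > 0 \<Longrightarrow> wigner_seitz \<rho> \<ge> 1 \<longleftrightarrow> \<rho> \<le> 3 / (4 * pi)"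
proof -
  assume \<rho>: "\<rho> > 0"
  have "wigner_seitz \<rho> \<ge> 1 \<longleftrightarrow> wigner_seitz \<rho> ^ 3 \<ge> 1 ^ 3"
    using power_mono_iff[of 1 "wigner_seitz \<rho>" 3] wigner_seitz_pos[OF \<rho>] by simp
  also have "\<dots> \<longleftrightarrow> \<rho> \<le> 3 / (4 * pi)"
    using \<rho> by (simp add: wigner_seitz_cube field_simps)
  finally show ?thesis .
qed

lemma wigner_seitz_deriv [derivative_intros]:
  assumes "\<rho> > 0" shows "(wigner_seitz has_real_derivative - wigner_seitz \<rho> / (3 * \<rho>)) (at \<rho>)"
proof -
  have "((\<lambda>\<rho>. (3 / (4 * pi)) powr (1/3) * \<rho> powr (- (1/3))) has_real_derivative
      (3 / (4 * pi)) powr (1/3) * (- (1/3) * \<rho> powr (- (1/3) - 1))) (at \<rho>)"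
    using assms by (auto intro!: derivative_eq_intros)
  also have "\<rho> powr (- (1/3) - 1) = \<rho> powr (- (1/3)) / \<rho>"
    by (subst powr_diff) (use assms in simp)
  also have "(3 / (4 * pi)) powr (1/3) * (- (1/3) * (\<rho> powr (- (1/3)) / \<rho>)) = - wigner_seitz \<rho> / (3 * \<rho>)"
    using assms by (simp only: wigner_seitz_eq) (simp add: field_simps)
  finally show ?thesis
    by (rule has_field_derivative_transform_within_open[where S="{0<..}"])
      (use assms in \<open>auto simp: wigner_seitz_eq\<close>)
qed

lemma exchange_deriv:
  assumes "\<rho> > 0"
  shows "((\<lambda>\<rho>. eps_x \<rho> * \<rho>) has_real_derivative - exchange_const * \<rho> powr (1/3)) (at \<rho>)"
proof -
  have "((\<lambda>\<rho>. - (3/4) * exchange_const * \<rho> powr (1/3) * \<rho>) has_real_derivative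
    - (3/4) * exchange_const * ((1/3 * \<rho> powr (1/3 - 1)) * \<rho> + \<rho> powr (1/3))) (at \<rho>)"
    using assms by (auto intro!: derivative_eq_intros simp: algebra_simps)
  also have "\<rho> powr (1/3 - 1) = \<rho> powr (1/3) / \<rho>"
    by (subst powr_diff) (use assms in simp)
  also have "- (3/4) * exchange_const * ((1/3 * (\<rho> powr (1/3) / \<rho>)) * \<rho> + \<rho> powr (1/3)) = - exchange_const * \<rho> powr (1/3)"
    using assms by simp
  finally show ?thesis by (simp add: eps_x_def[abs_def] exchange_const_def)
qed

lemma corr_low_deriv:
  assumes k: "ceperley_alder_signs k" and \<rho>: "\<rho> > 0"
  shows "((\<lambda>\<rho>. c_gamma k / (1 + c_beta1 k * sqrt (wigner_seitz \<rho>) + c_beta2 k * wigner_seitz \<rho>) * \<rho>)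
      has_real_derivative corr_low k (sqrt (wigner_seitz \<rho>))) (at \<rho>)"
proof -
  define q where "q = sqrt (wigner_seitz \<rho>)"
  have q: "q > 0" "wigner_seitz \<rho> = q\<^sup>2" using wigner_seitz_pos[OF \<rho>] by (auto simp: q_def)
  define d where "d = 1 + c_beta1 k * q + c_beta2 k * q\<^sup>2"
  have d: "d > 0" using k q by (simp add: d_def ceperley_alder_signs_def add_pos_nonneg)
  have dq: "((\<lambda>\<rho>. sqrt (wigner_seitz \<rho>)) has_real_derivative - q / (6 * \<rho>)) (at \<rho>)"
    using wigner_seitz_pos[OF \<rho>] \<rho> q(1)
    by (auto intro!: derivative_eq_intros simp: q_def[symmetric] q(2) field_simps power2_eq_square)
  have dr: "(wigner_seitz has_real_derivative - q\<^sup>2 / (3 * \<rho>)) (at \<rho>)" using wigner_seitz_deriv[OF \<rho>] by (simp add: q)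
  have dd: "((\<lambda>\<rho>. 1 + c_beta1 k * sqrt (wigner_seitz \<rho>) + c_beta2 k * wigner_seitz \<rho>)
      has_real_derivative c_beta1 k * (- q / (6 * \<rho>)) + c_beta2 k * (- q\<^sup>2 / (3 * \<rho>))) (at \<rho>)"
    by (intro DERIV_cong[OF DERIV_add[OF DERIV_add[OF DERIV_const DERIV_cmult[OF dq]] DERIV_cmult[OF dr]]]) simp
  have "((\<lambda>\<rho>. c_gamma k / (1 + c_beta1 k * sqrt (wigner_seitz \<rho>) + c_beta2 k * wigner_seitz \<rho>) * \<rho>)
      has_real_derivative (- c_gamma k * (c_beta1 k * (- q / (6 * \<rho>)) + c_beta2 k * (- q\<^sup>2 / (3 * \<rho>))) / d\<^sup>2) * \<rho> + c_gamma k / d) (at \<rho>)"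
    by (rule DERIV_cong[OF DERIV_mult[OF DERIV_divide[OF DERIV_const dd] DERIV_ident]])
      (use d q(1) in \<open>simp_all add: q(2) d_def power2_eq_square\<close>)
  also have "(- c_gamma k * (c_beta1 k * (- q / (6 * \<rho>)) + c_beta2 k * (- q\<^sup>2 / (3 * \<rho>))) / d\<^sup>2) * \<rho> + c_gamma k / d
     = c_gamma k * (c_beta1 k * q / 6 + c_beta2 k * q\<^sup>2 / 3 + d) / d\<^sup>2"
    using d \<rho> by (simp add: field_simps power2_eq_square)
  also have "\<dots> = corr_low k q"
    by (simp add: corr_low_def d_def field_simps)
  finally show ?thesis by (simp add: q_def)
qed

lemma corr_high_deriv:
  assumes \<rho>: "\<rho> > 0"
  shows "((\<lambda>\<rho>. (c_A k * ln (wigner_seitz \<rho>) + c_B k + c_C k * wigner_seitz \<rho> * ln (wigner_seitz \<rho>) + c_D k * wigner_seitz \<rho>) * \<rho>)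
      has_real_derivative corr_high k (wigner_seitz \<rho>)) (at \<rho>)"
proof -
  define r where "r = wigner_seitz \<rho>"
  have r: "r > 0" using wigner_seitz_pos[OF \<rho>] by (simp add: r_def)
  have dr: "(wigner_seitz has_real_derivative - r / (3 * \<rho>)) (at \<rho>)" using wigner_seitz_deriv[OF \<rho>] by (simp add: r_def)
  have "((\<lambda>\<rho>. (c_A k * ln (wigner_seitz \<rho>) + c_B k + c_C k * wigner_seitz \<rho> * ln (wigner_seitz \<rho>) + c_D k * wigner_seitz \<rho>) * \<rho>)
      has_real_derivative (c_A k * (- r / (3 * \<rho>) / r) + (c_C k * (- r / (3 * \<rho>)) * ln r + c_C k * r * (- r / (3 * \<rho>) / r)) + c_D k * (- r / (3 * \<rho>))) * \<rho>
       + (c_A k * ln r + c_B k + c_C k * r * ln r + c_D k * r)) (at \<rho>)"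
    using r \<rho> by (auto intro!: derivative_eq_intros dr simp: r_def[symmetric] algebra_simps)
  also have "(c_A k * (- r / (3 * \<rho>) / r) + (c_C k * (- r / (3 * \<rho>)) * ln r + c_C k * r * (- r / (3 * \<rho>) / r)) + c_D k * (- r / (3 * \<rho>))) * \<rho>
       + (c_A k * ln r + c_B k + c_C k * r * ln r + c_D k * r) = corr_high k r"
    using r \<rho> by (simp add: corr_high_def field_simps)
  finally show ?thesis by (simp add: r_def)
qed

lemma xc_sum: "xc k = (\<lambda>\<rho>. eps_x \<rho> * \<rho> + eps_c k \<rho> * \<rho>)"
  by (simp add: xc_def[abs_def] algebra_simps)

lemma xc_has_derivative:
  assumes F': "\<forall>\<rho>>0. xc k differentiable at \<rho>" and \<rho>: "\<rho> > 0"
  shows "(xc k has_real_derivative xc' k \<rho>) (at \<rho>)"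
proof -
  have "at \<rho> within {0..} = at \<rho>" using \<rho> by (intro at_within_interior) simp
  then show ?thesis
    using F' \<rho> by (auto simp: xc'_def vector_derivative_works has_real_derivative_iff_has_vector_derivative)
qed

text \<open>The derivative of \<open>xc\<close> exists by hypothesis, so it can be read off from one
  side of the point. This covers the density where the branches meet: each branch formula holds up
  to it on its own side, and both one-sided derivatives give \<open>xc'\<close>.\<close>

lemma xc'_eq_one_sided:
  assumes F': "\<forall>\<rho>>0. xc k differentiable at \<rho>" and \<rho>: "\<rho> > 0"
    and G: "(G has_real_derivative d) (at \<rho>)"
    and S: "S = {\<rho>/2..\<rho>} \<or> S = {\<rho>..2*\<rho>}" and eq: "\<And>x. x \<in> S \<Longrightarrow> G x = eps_c k x * x"
  shows "xc' k \<rho> = - exchange_const * \<rho> powr (1/3) + d"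
proof -
  have ne: "at \<rho> within S \<noteq> bot" and mem: "\<rho> \<in> S"
    using S \<rho> by (auto simp: at_within_Icc_at_left at_within_Icc_at_right)
  have "((\<lambda>\<rho>. eps_x \<rho> * \<rho> + G \<rho>) has_real_derivative - exchange_const * \<rho> powr (1/3) + d) (at \<rho> within S)"
    by (intro DERIV_add has_field_derivative_at_within[OF exchange_deriv[OF \<rho>]] has_field_derivative_at_within[OF G])
  then have "(xc k has_real_derivative - exchange_const * \<rho> powr (1/3) + d) (at \<rho> within S)"
    by (rule has_field_derivative_transform_within[where d=1]) (use mem eq in \<open>auto simp: xc_sum\<close>)
  moreover have "(xc k has_real_derivative xc' k \<rho>) (at \<rho> within S)"
    by (rule has_field_derivative_at_within[OF xc_has_derivative[OF F' \<rho>]])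
  ultimately show ?thesis
    using vector_derivative_unique_within[OF ne] by (auto simp: has_real_derivative_iff_has_vector_derivative)
qed

lemma xc'_low:
  assumes F': "\<forall>\<rho>>0. xc k differentiable at \<rho>" and k: "ceperley_alder_signs k"
    and \<rho>: "0 < \<rho>" "\<rho> \<le> 3 / (4 * pi)"
  shows "xc' k \<rho> = - exchange_const * \<rho> powr (1/3) + corr_low k (sqrt (wigner_seitz \<rho>))"
  by (rule xc'_eq_one_sided[OF F' \<rho>(1) corr_low_deriv[OF k \<rho>(1)], of "{\<rho>/2..\<rho>}"])
    (use \<rho> wigner_seitz_ge_1_iff in \<open>auto simp: eps_c_def Let_def\<close>)

lemma xc'_high:
  assumes F': "\<forall>\<rho>>0. xc k differentiable at \<rho>" and \<rho>: "\<rho> \<ge> 3 / (4 * pi)"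
  shows "xc' k \<rho> = - exchange_const * \<rho> powr (1/3) + corr_high k (wigner_seitz \<rho>)"
proof -
  define \<rho>1 :: real where "\<rho>1 = 3 / (4 * pi)"
  let ?G = "\<lambda>\<rho>. (c_A k * ln (wigner_seitz \<rho>) + c_B k + c_C k * wigner_seitz \<rho> * ln (wigner_seitz \<rho>) + c_D k * wigner_seitz \<rho>) * \<rho>"
  have \<rho>1: "\<rho>1 > 0" by (simp add: \<rho>1_def)
  have \<rho>p: "\<rho> > 0" using \<rho> \<rho>1 unfolding \<rho>1_def by linarith
  have eq: "?G x = eps_c k x * x" if "x > \<rho>1" for x
  proof -
    have "x > 0" using that \<rho>1 by linarith
    then show ?thesis using that wigner_seitz_ge_1_iff[of x] by (auto simp: eps_c_def Let_def \<rho>1_def)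
  qed
  have cont: "isCont (\<lambda>x. eps_x x * x + ?G x) \<rho>1" "isCont (xc k) \<rho>1"
    using DERIV_isCont[OF DERIV_add[OF exchange_deriv corr_high_deriv], OF \<rho>1 \<rho>1] DERIV_isCont[OF xc_has_derivative[OF F' \<rho>1]]
    by auto
  \<comment> \<open>At \<open>\<rho>1\<close> the definition takes the low density branch. That the
    high density formula has the same value there follows from the continuity of \<open>xc\<close>
    and a limit from the right.\<close>
  have "(xc k \<longlongrightarrow> eps_x \<rho>1 * \<rho>1 + ?G \<rho>1) (at_right \<rho>1)"
  proof (rule Lim_transform_eventually)
    show "((\<lambda>x. eps_x x * x + ?G x) \<longlongrightarrow> eps_x \<rho>1 * \<rho>1 + ?G \<rho>1) (at_right \<rho>1)"
      using cont(1) unfolding isCont_def by (rule tendsto_within_subset) auto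
    show "\<forall>\<^sub>F x in at_right \<rho>1. eps_x x * x + ?G x = xc k x"
      using eq by (auto simp: eventually_at_filter xc_sum intro!: always_eventually)
  qed
  moreover have "(xc k \<longlongrightarrow> xc k \<rho>1) (at_right \<rho>1)"
    using cont(2) unfolding isCont_def by (rule tendsto_within_subset) auto
  ultimately have "xc k \<rho>1 = eps_x \<rho>1 * \<rho>1 + ?G \<rho>1"
    by (intro tendsto_unique[of "at_right \<rho>1"]) auto
  then have "?G x = eps_c k x * x" if "x \<ge> \<rho>1" for x
    using eq[of x] that by (cases "x = \<rho>1") (auto simp: xc_sum)
  then show ?thesis
    by (intro xc'_eq_one_sided[OF F' \<rho>p corr_high_deriv[OF \<rho>p], of "{\<rho>..2*\<rho>}"])
      (use \<rho> in \<open>auto simp: \<rho>1_def\<close>)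
qed

text \<open>Of the denominator only \<open>c_beta2 k * r\<close> is kept, and \<open>1 / r\<close>
  is a multiple of the cube root of the density.\<close>

lemma eps_c_small:
  assumes k: "ceperley_alder_signs k" and \<rho>: "0 < \<rho>" "\<rho> \<le> 3 / (4 * pi)"
  shows "\<bar>eps_c k \<rho>\<bar> \<le> \<bar>c_gamma k\<bar> / c_beta2 k * (3 / (4 * pi)) powr (-1/3) * \<rho> powr (1/3)"
proof -
  define r where "r = wigner_seitz \<rho>"
  have r: "r \<ge> 1" using \<rho> by (simp add: r_def wigner_seitz_ge_1_iff)
  have ri: "inverse r = (3 / (4 * pi)) powr (-1/3) * \<rho> powr (1/3)"
    using \<rho> by (simp add: r_def wigner_seitz_eq powr_minus)
  have b: "c_beta2 k > 0" "c_beta1 k > 0" "c_beta1 k * sqrt r \<ge> 0" using k r by (auto simp: ceperley_alder_signs_def)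
  have "\<bar>eps_c k \<rho>\<bar> = \<bar>c_gamma k\<bar> / (1 + c_beta1 k * sqrt r + c_beta2 k * r)"
    using r b by (simp add: eps_c_def Let_def r_def[symmetric] abs_divide add_nonneg_nonneg)
  also have "\<dots> \<le> \<bar>c_gamma k\<bar> / (c_beta2 k * r)"
    using r b by (intro divide_left_mono mult_pos_pos add_pos_pos) (auto intro: add_nonneg_pos)
  also have "\<dots> = \<bar>c_gamma k\<bar> / c_beta2 k * inverse r" by (simp add: field_simps)
  finally show ?thesis by (simp add: ri mult.assoc)
qed

text \<open>Near 0 both energies per particle are of the order of the cube root of the density, so
  \<open>xc k \<rho> / \<rho>\<close> tends to 0; the filter excludes the point 0 itself, where the
  energies per particle are default values.\<close>

lemma xc_deriv_0:
  assumes k: "ceperley_alder_signs k"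
  shows "(xc k has_real_derivative 0) (at 0 within {0..})" "xc' k 0 = 0"
proof -
  define K where "K = (3/4) * (3 / pi) powr (1 / 3) + \<bar>c_gamma k\<bar> / c_beta2 k * (3 / (4 * pi)) powr (-1/3)"
  have "((\<lambda>\<rho>. xc k \<rho> / \<rho>) \<longlongrightarrow> 0) (at 0 within {0..})"
  proof (rule tendsto_0_le[where K=1 and f="\<lambda>\<rho>. K * \<rho> powr (1/3)"])
    have "((\<lambda>\<rho>. K * \<rho> powr (1/3)) \<longlongrightarrow> K * 0 powr (1/3)) (at 0 within {0..})"
      by (intro tendsto_mult tendsto_const tendsto_powr2 tendsto_ident_at) (auto simp: eventually_at_filter)
    then show "((\<lambda>\<rho>. K * \<rho> powr (1/3)) \<longlongrightarrow> 0) (at 0 within {0..})" by simp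
    have "\<forall>\<^sub>F \<rho> in at 0 within {0..}. \<rho> < 3 / (4 * pi)"
      by (rule order_tendstoD[OF tendsto_ident_at]) simp
    moreover have "\<forall>\<^sub>F \<rho> in at (0::real) within {0..}. \<rho> > 0" by (auto simp: eventually_at_filter)
    ultimately show "\<forall>\<^sub>F \<rho> in at 0 within {0..}. norm (xc k \<rho> / \<rho>) \<le> norm (K * \<rho> powr (1/3)) * 1"
    proof eventually_elim
      case (elim \<rho>)
      have "norm (xc k \<rho> / \<rho>) = \<bar>eps_x \<rho> + eps_c k \<rho>\<bar>" using elim by (simp add: xc_def)
      also have "\<dots> \<le> \<bar>eps_x \<rho>\<bar> + \<bar>eps_c k \<rho>\<bar>" by simp
      also have "\<dots> \<le> K * \<rho> powr (1/3)"
        using eps_c_small[OF k, of \<rho>] elim by (simp add: K_def eps_x_def abs_mult algebra_simps)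
      also have "\<dots> \<le> norm (K * \<rho> powr (1/3)) * 1" by simp
      finally show ?case .
    qed
  qed
  then show D: "(xc k has_real_derivative 0) (at 0 within {0..})"
    by (simp add: has_field_derivative_iff xc_def)
  have "at (0::real) within {0..} \<noteq> bot" using trivial_limit_at_right_real by (simp add: at_within_Ici_at_right)
  then show "xc' k 0 = 0"
    unfolding xc'_def using D by (intro vector_derivative_within) (auto simp: has_real_derivative_iff_has_vector_derivative)
qed

section \<open>Monotonicity of the exchange-correlation potential in the square root of the
  density\<close>

lemma radius_sq_deriv:
  assumes "y > 0"
  shows "((\<lambda>y. wigner_seitz (y\<^sup>2)) has_real_derivative - (2/3) * wigner_seitz (y\<^sup>2) / y) (at y)"
proof -
  have "((\<lambda>y. wigner_seitz (y\<^sup>2)) has_real_derivative - wigner_seitz (y\<^sup>2) / (3 * y\<^sup>2) * (2 * y)) (at y)"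
    using assms by (intro DERIV_chain2[OF wigner_seitz_deriv]) (auto intro!: derivative_eq_intros)
  then show ?thesis using assms by (simp add: power2_eq_square field_simps)
qed

text \<open>For the whole potential, \<open>y * F'(y^2)\<close> is half the derivative of
  \<open>F (y^2)\<close>. The sign of its derivative therefore decides concavity in
  \<open>y\<close>, and a lower bound measures by how much convexity fails. Here only the
  correlation part at low density is treated.\<close>

lemma corr_low_sq_deriv:
  assumes k: "ceperley_alder_signs k" and y: "y > 0"
  obtains d where "((\<lambda>y. y * corr_low k (sqrt (wigner_seitz (y\<^sup>2)))) has_real_derivative d) (at y)"
    "d \<le> 0" "d \<ge> 3 * c_gamma k"
proof -
  define b c where "b = c_beta1 k" and "c = c_beta2 k"
  have bc: "b > 0" "c > 0" "c_gamma k < 0" using k by (auto simp: b_def c_def ceperley_alder_signs_def)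
  define q where "q = sqrt (wigner_seitz (y\<^sup>2))"
  have q: "q > 0" "wigner_seitz (y\<^sup>2) = q\<^sup>2" using wigner_seitz_pos[of "y\<^sup>2"] y by (auto simp: q_def)
  define D where "D = 1 + b * q + c * q\<^sup>2"
  have D: "D \<ge> 1" using bc q by (simp add: D_def)
  define h where "h = (1 + 7/6 * b * q + 4/3 * c * q\<^sup>2) / D\<^sup>2"
  \<comment> \<open>\<open>- p / q\<close> is the numerator of the derivative of
    \<open>corr_low\<close>, after one factor \<open>D\<close> has been cancelled. Expanded in
    powers of \<open>q\<close>, all coefficients of \<open>p\<close> are positive, so the sign is
    visible.\<close>
  define p where "p = 5/6 * b * q + (7/6 * b\<^sup>2 + 4/3 * c) * q\<^sup>2 + 7/2 * b * c * q ^ 3 + 8/3 * c\<^sup>2 * q ^ 4"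
  have dq: "((\<lambda>y. sqrt (wigner_seitz (y\<^sup>2))) has_real_derivative - q / (3 * y)) (at y)"
  proof -
    have "(sqrt has_real_derivative inverse q / 2) (at (wigner_seitz (y\<^sup>2)))"
      using DERIV_real_sqrt[OF wigner_seitz_pos[of "y\<^sup>2"]] y by (simp only: q_def zero_less_power)
    from DERIV_chain2[OF this radius_sq_deriv[OF y]]
    have "((\<lambda>y. sqrt (wigner_seitz (y\<^sup>2))) has_real_derivative inverse q / 2 * (- (2/3) * q\<^sup>2 / y)) (at y)"
      by (simp only: q(2))
    then show ?thesis using q y by (simp add: field_simps power2_eq_square)
  qed
  have "((\<lambda>q. corr_low k q) has_real_derivative c_gamma k * (- p / q / D ^ 3)) (at q)"
  proof -
    have N: "((\<lambda>q. c_gamma k * (1 + 7/6 * b * q + 4/3 * c * q\<^sup>2)) has_real_derivative c_gamma k * (7/6 * b + 8/3 * c * q)) (at q)"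
      by (auto intro!: derivative_eq_intros)
    have D2: "((\<lambda>q. (1 + b * q + c * q\<^sup>2)\<^sup>2) has_real_derivative 2 * D * (b + 2 * c * q)) (at q)"
      by (auto intro!: derivative_eq_intros simp: D_def algebra_simps)
    have "((\<lambda>q. corr_low k q) has_real_derivative
        (c_gamma k * (7/6 * b + 8/3 * c * q) * D\<^sup>2 - c_gamma k * (1 + 7/6 * b * q + 4/3 * c * q\<^sup>2) * (2 * D * (b + 2 * c * q))) / (D\<^sup>2 * D\<^sup>2)) (at q)"
      using DERIV_divide[OF N D2] D unfolding corr_low_def[abs_def] b_def[symmetric] c_def[symmetric] D_def[symmetric]
      by simp
    also have "(c_gamma k * (7/6 * b + 8/3 * c * q) * D\<^sup>2 - c_gamma k * (1 + 7/6 * b * q + 4/3 * c * q\<^sup>2) * (2 * D * (b + 2 * c * q))) / (D\<^sup>2 * D\<^sup>2)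
       = c_gamma k * ((7/6 * b + 8/3 * c * q) * D - (1 + 7/6 * b * q + 4/3 * c * q\<^sup>2) * (2 * (b + 2 * c * q))) / D ^ 3"
      using D by (simp add: field_simps power2_eq_square power3_eq_cube)
    also have "(7/6 * b + 8/3 * c * q) * D - (1 + 7/6 * b * q + 4/3 * c * q\<^sup>2) * (2 * (b + 2 * c * q)) = - p / q"
      using q unfolding D_def p_def by (simp add: field_simps power2_eq_square power3_eq_cube power4_eq_xxxx)
    finally show ?thesis by simp
  qed
  then have "(corr_low k has_real_derivative c_gamma k * (- p / q / D ^ 3)) (at (sqrt (wigner_seitz (y\<^sup>2))))"
    by (simp only: q_def)
  from DERIV_mult[OF DERIV_ident DERIV_chain2[OF this dq]]
  have "((\<lambda>y. y * corr_low k (sqrt (wigner_seitz (y\<^sup>2)))) has_real_derivative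
      1 * corr_low k q + c_gamma k * (- p / q / D ^ 3) * (- q / (3 * y)) * y) (at y)"
    unfolding q_def[symmetric] .
  also have "1 * corr_low k q + c_gamma k * (- p / q / D ^ 3) * (- q / (3 * y)) * y = c_gamma k * (h + p / (3 * D ^ 3))"
    using q y by (simp add: corr_low_def h_def D_def b_def c_def field_simps)
  finally have der: "((\<lambda>y. y * corr_low k (sqrt (wigner_seitz (y\<^sup>2)))) has_real_derivative c_gamma k * (h + p / (3 * D ^ 3))) (at y)" .
  have p: "p \<ge> 0" using bc q by (simp add: p_def)
  have h: "h \<ge> 0" using bc q by (simp add: h_def)
  have "1 + 7/6 * b * q + 4/3 * c * q\<^sup>2 \<le> 4/3 * D" using bc q by (simp add: D_def)
  also have "\<dots> \<le> 4/3 * D\<^sup>2" using D by (simp add: power2_eq_square)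
  finally have h2: "h \<le> 4/3" using D by (simp add: h_def pos_divide_le_eq)
  \<comment> \<open>Compared coefficient by coefficient. This gives
    \<open>p / (3 * D^3) \<le> 4/3\<close>, and together with \<open>h \<le> 4/3\<close> the sum
    stays below the constant 3 of the statement.\<close>
  have "4 * D\<^sup>2 - p = 4 + 43/6 * (b * q) + (17/6 * b\<^sup>2 + 20/3 * c) * q\<^sup>2 + 9/2 * b * c * q ^ 3 + 4/3 * c\<^sup>2 * q ^ 4"
    unfolding D_def p_def by (simp add: field_simps power2_eq_square power3_eq_cube power4_eq_xxxx)
  also have "\<dots> \<ge> 0" using bc q by simp
  finally have "p \<le> 4 * D\<^sup>2" by simp
  also have "\<dots> \<le> 4 * D ^ 3" using D by (simp add: power_increasing)
  finally have p2: "p / (3 * D ^ 3) \<le> 4/3" using D by (simp add: pos_divide_le_eq)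
  show thesis
  proof (rule that[OF der])
    show "c_gamma k * (h + p / (3 * D ^ 3)) \<le> 0"
      using bc h p D by (intro mult_nonpos_nonneg) auto
    have "c_gamma k * (h + p / (3 * D ^ 3)) \<ge> c_gamma k * 3"
      using bc h2 p2 by (intro mult_left_mono_neg) auto
    then show "c_gamma k * (h + p / (3 * D ^ 3)) \<ge> 3 * c_gamma k" by simp
  qed
qed

text \<open>At high density \<open>r \<le> 1\<close>, so the logarithm is nonpositive and each term
  of the explicit derivative has a sign by the signs of the constants. For the lower bound
  \<open>ln r\<close> is replaced by \<open>1 - 1 / r\<close>.\<close>

lemma corr_high_sq_deriv:
  assumes k: "ceperley_alder_signs k" and y: "y\<^sup>2 \<ge> 3 / (4 * pi)" "y > 0"
  obtains d where "((\<lambda>y. y * corr_high k (wigner_seitz (y\<^sup>2))) has_real_derivative d) (at y)"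
    "d \<le> 0" "d \<ge> - (4 * c_A k * pi / 3 * y\<^sup>2 - c_B k + c_A k + c_C k - c_D k)"
proof -
  have k': "c_A k > 0" "c_B k < 0" "c_C k > 0" "c_D k < 0" using k by (auto simp: ceperley_alder_signs_def)
  define r where "r = wigner_seitz (y\<^sup>2)"
  have r0: "r > 0" using y by (simp add: r_def wigner_seitz_pos)
  have r1: "r \<le> 1"
  proof (rule ccontr)
    assume "\<not> r \<le> 1"
    then have "r ^ 3 > 1" by (intro one_less_power) auto
    then show False using y by (simp add: r_def wigner_seitz_cube field_simps)
  qed
  have ln: "ln r \<le> 0" "ln r \<ge> 1 - inverse r"
    using r0 r1 ln_add_one_self_le_self2 ln_le_minus_one[of "inverse r"] by (auto simp: ln_inverse)
  \<comment> \<open>The crude step from \<open>1 / r\<close> to its cube turns the logarithmic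
    growth into a quadratic polynomial in \<open>y\<close>, which a multiple of
    \<open>1 + 3 * y^2\<close>, the derivative of \<open>y + y^3\<close>, can absorb.\<close>
  have y2: "inverse r \<le> 4 * pi / 3 * y\<^sup>2"
  proof -
    have "inverse r \<le> inverse r ^ 3" using r0 r1 by (intro self_le_power) (auto simp: one_le_inverse_iff)
    also have "\<dots> = 4 * pi / 3 * y\<^sup>2" using y by (simp add: power_inverse r_def wigner_seitz_cube field_simps)
    finally show ?thesis .
  qed
  have dr: "((\<lambda>y. wigner_seitz (y\<^sup>2)) has_real_derivative - (2/3) * r / y) (at y)"
    using radius_sq_deriv[OF y(2)] by (simp add: r_def)
  have "((\<lambda>r. corr_high k r) has_real_derivative c_A k / r + 2/3 * c_C k * (ln r + 1) + (2 * c_D k - c_C k) / 3) (at r)"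
    unfolding corr_high_def[abs_def] using r0 by (auto intro!: derivative_eq_intros simp: field_simps)
  then have "(corr_high k has_real_derivative c_A k / r + 2/3 * c_C k * (ln r + 1) + (2 * c_D k - c_C k) / 3) (at (wigner_seitz (y\<^sup>2)))"
    by (simp only: r_def)
  from DERIV_mult[OF DERIV_ident DERIV_chain2[OF this dr]]
  have "((\<lambda>y. y * corr_high k (wigner_seitz (y\<^sup>2))) has_real_derivative
      corr_high k r + (c_A k / r + 2/3 * c_C k * (ln r + 1) + (2 * c_D k - c_C k) / 3) * (- (2/3) * r / y) * y) (at y)"
    unfolding r_def[symmetric] by simp
  also have "corr_high k r + (c_A k / r + 2/3 * c_C k * (ln r + 1) + (2 * c_D k - c_C k) / 3) * (- (2/3) * r / y) * y
     = c_A k * ln r + c_B k - c_A k + 2/9 * c_C k * (r * ln r) + r * (2 * c_D k - 5 * c_C k) / 9"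
    using r0 y by (simp add: corr_high_def field_simps)
  finally have der: "((\<lambda>y. y * corr_high k (wigner_seitz (y\<^sup>2))) has_real_derivative
     c_A k * ln r + c_B k - c_A k + 2/9 * c_C k * (r * ln r) + r * (2 * c_D k - 5 * c_C k) / 9) (at y)" .
  have a1: "c_A k * ln r \<le> 0" "c_C k * (r * ln r) \<le> 0" "r * (2 * c_D k - 5 * c_C k) \<le> 0"
    using k' ln r0 by (auto simp: mult_nonneg_nonpos)
  have rln: "r * ln r \<ge> -1"
  proof -
    have "r * ln r \<ge> r * (1 - inverse r)" using ln r0 by (intro mult_left_mono) auto
    then show ?thesis using r0 by (simp add: algebra_simps)
  qed
  have a3: "c_C k * (r * ln r) \<ge> c_C k * (-1)" using k' rln by (intro mult_left_mono) auto
  have a2: "c_A k * ln r \<ge> c_A k * (1 - 4 * pi / 3 * y\<^sup>2)" "r * (5 * c_C k - 2 * c_D k) \<le> 1 * (5 * c_C k - 2 * c_D k)"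
    using k' ln y2 rln r1 by (auto intro!: mult_left_mono mult_right_mono)
  show thesis
  proof (rule that[OF der])
    show "c_A k * ln r + c_B k - c_A k + 2/9 * c_C k * (r * ln r) + r * (2 * c_D k - 5 * c_C k) / 9 \<le> 0"
      using a1 k' by linarith
    have e: "r * (2 * c_D k - 5 * c_C k) = - (r * (5 * c_C k - 2 * c_D k))"
      "4 * c_A k * pi / 3 * y\<^sup>2 = c_A k * (4 * pi / 3 * y\<^sup>2)"
      "2/9 * c_C k * (r * ln r) = 2/9 * (c_C k * (r * ln r))"
      by (simp_all add: algebra_simps)
    have key: "- (Y - c_B k + c_A k + c_C k - c_D k) \<le> X + c_B k - c_A k + 2/9 * W + (- Z) / 9"
      if "X \<ge> c_A k - Y" "Z \<le> 5 * c_C k - 2 * c_D k" "W \<ge> - c_C k" for X Y Z W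
      using that k' by linarith
    show "- (4 * c_A k * pi / 3 * y\<^sup>2 - c_B k + c_A k + c_C k - c_D k)
       \<le> c_A k * ln r + c_B k - c_A k + 2/9 * c_C k * (r * ln r) + r * (2 * c_D k - 5 * c_C k) / 9"
      unfolding e by (rule key) (use a2 a3 in \<open>simp_all add: right_diff_distrib\<close>)
  qed
qed

lemma powr_two_thirds_le: "y \<ge> 0 \<Longrightarrow> (y::real) powr (2/3) \<le> 1 + y\<^sup>2"
proof (cases "y \<le> 1")
  case True
  assume "y \<ge> 0"
  then have "y powr (2/3) \<le> 1" using True powr_mono2[of "2/3" y 1] by simp
  then show ?thesis by (smt (verit) zero_le_power2)
next
  case False
  then have "y powr (2/3) \<le> y powr 2" by (intro powr_mono) auto
  then show ?thesis using False by simp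
qed

lemma powr_five_thirds_deriv:
  "y > 0 \<Longrightarrow> ((\<lambda>y::real. y powr (5/3)) has_real_derivative 5/3 * y powr (2/3)) (at y)"
  by (auto intro!: derivative_eq_intros)

text \<open>Piecewise monotonicity glued at the density where the two branches of the correlation
  energy meet.\<close>

lemma mono_on_glue:
  fixes h :: "real \<Rightarrow> real"
  assumes y1: "y1 > 0" and h0: "\<And>y. y > 0 \<Longrightarrow> h 0 \<le> h y"
    and l: "\<And>y. 0 < y \<Longrightarrow> y \<le> y1 \<Longrightarrow> h y = l y" and u: "\<And>y. y1 \<le> y \<Longrightarrow> h y = u y"
    and dl: "\<And>y. 0 < y \<Longrightarrow> y \<le> y1 \<Longrightarrow> \<exists>d. (l has_real_derivative d) (at y) \<and> 0 \<le> d"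
    and du: "\<And>y. y1 \<le> y \<Longrightarrow> \<exists>d. (u has_real_derivative d) (at y) \<and> 0 \<le> d"
    and xy: "0 \<le> x" "x \<le> y"
  shows "h x \<le> h y"
proof -
  have L: "h x \<le> h y" if "0 < x" "x \<le> y" "y \<le> y1" for x y
    using DERIV_nonneg_imp_nondecreasing[of x y l] dl l[of x] l[of y] that by force
  have U: "h x \<le> h y" if "y1 \<le> x" "x \<le> y" for x y
    using DERIV_nonneg_imp_nondecreasing[of x y u] du u[of x] u[of y] that by force
  consider "x = 0" | "x > 0" "y \<le> y1" | "y1 \<le> x" | "0 < x" "x < y1" "y1 < y" using xy by linarith
  then show ?thesis
  proof cases
    case 1 then show ?thesis using h0[of y] xy by (cases "y = 0") auto
  next
    case 2 then show ?thesis using L xy by auto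
  next
    case 3 then show ?thesis using U xy by auto
  next
    case 4 then show ?thesis using L[of x y1] U[of y1 y] by auto
  qed
qed

lemma powr_sq: "y > 0 \<Longrightarrow> y * (y\<^sup>2) powr (1/3) = y powr (5/3)" for y :: real
proof -
  assume "y > 0"
  then have "(y\<^sup>2) powr (1/3) = y powr (2/3)" by (simp add: powr_powr flip: powr_numeral)
  moreover have "y * y powr (2/3) = y powr (1 + 2/3)" using \<open>y > 0\<close> by (subst powr_add) simp
  ultimately show ?thesis by simp
qed

lemma sq_ge_iff: "y > 0 \<Longrightarrow> y\<^sup>2 \<ge> 3 / (4 * pi) \<longleftrightarrow> y \<ge> sqrt (3 / (4 * pi))" "y > 0 \<Longrightarrow> y\<^sup>2 \<le> 3 / (4 * pi) \<longleftrightarrow> y \<le> sqrt (3 / (4 * pi))"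
  by (metis real_sqrt_le_iff real_sqrt_abs abs_of_pos)+

lemma xc'_sq:
  assumes F': "\<forall>\<rho>>0. xc k differentiable at \<rho>" and k: "ceperley_alder_signs k" and y: "y > 0"
  shows "y \<le> sqrt (3 / (4 * pi)) \<Longrightarrow> y * xc' k (y\<^sup>2) = - exchange_const * y powr (5/3) + y * corr_low k (sqrt (wigner_seitz (y\<^sup>2)))"
    "y \<ge> sqrt (3 / (4 * pi)) \<Longrightarrow> y * xc' k (y\<^sup>2) = - exchange_const * y powr (5/3) + y * corr_high k (wigner_seitz (y\<^sup>2))"
proof -
  have *: "y * (- exchange_const * y\<^sup>2 powr (1/3) + v) = - exchange_const * y powr (5/3) + y * v" for v
    unfolding powr_sq[OF y, symmetric] by (simp add: algebra_simps)
  have y2: "y\<^sup>2 > 0" using y by simp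
  show "y * xc' k (y\<^sup>2) = - exchange_const * y powr (5/3) + y * corr_low k (sqrt (wigner_seitz (y\<^sup>2)))" if "y \<le> sqrt (3 / (4 * pi))"
    unfolding xc'_low[OF F' k y2 sq_ge_iff(2)[OF y, THEN iffD2, OF that]] by (rule *)
  show "y * xc' k (y\<^sup>2) = - exchange_const * y powr (5/3) + y * corr_high k (wigner_seitz (y\<^sup>2))" if "y \<ge> sqrt (3 / (4 * pi))"
    unfolding xc'_high[OF F' sq_ge_iff(1)[OF y, THEN iffD2, OF that]] by (rule *)
qed

lemma exchange_const_pos: "exchange_const > 0" by (simp add: exchange_const_def)

text \<open>Exchange contributes exactly \<open>- exchange_const * y powr (5/3)\<close>. Once this
  is added back, only correlation is left, which is nonincreasing on both branches; thus
  \<open>exchange_const\<close> is the full margin of concavity that exchange provides.\<close>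

lemma xc'_upper_mono:
  assumes F': "\<forall>\<rho>>0. xc k differentiable at \<rho>" and k: "ceperley_alder_signs k" and xy: "0 \<le> x" "x \<le> y"
  shows "y * xc' k (y\<^sup>2) + exchange_const * y powr (5/3) \<le> x * xc' k (x\<^sup>2) + exchange_const * x powr (5/3)"
proof -
  let ?h = "\<lambda>y. - (y * xc' k (y\<^sup>2) + exchange_const * y powr (5/3))"
  let ?l = "\<lambda>y. - (y * corr_low k (sqrt (wigner_seitz (y\<^sup>2))))" and ?u = "\<lambda>y. - (y * corr_high k (wigner_seitz (y\<^sup>2)))"
  have pos: "sqrt (3 / (4 * pi)) > 0" by simp
  have dl: "\<exists>d. (?l has_real_derivative d) (at y) \<and> 0 \<le> d" if "0 < y" for y
    using corr_low_sq_deriv[OF k that] by (metis DERIV_minus neg_0_le_iff_le)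
  have du: "\<exists>d. (?u has_real_derivative d) (at y) \<and> 0 \<le> d" if y: "sqrt (3 / (4 * pi)) \<le> y" for y
  proof -
    have "y > 0" using y pos by linarith
    then show ?thesis
      using corr_high_sq_deriv[OF k, of y] sq_ge_iff(1)[of y] y by (metis DERIV_minus neg_0_le_iff_le)
  qed
  have l: "?h y = ?l y" if "0 < y" "y \<le> sqrt (3 / (4 * pi))" for y
    using xc'_sq(1)[OF F' k that] by simp
  have u: "?h y = ?u y" if "sqrt (3 / (4 * pi)) \<le> y" for y
    using xc'_sq(2)[OF F' k _ that] that pos by (simp add: less_le_trans[OF pos that])
  have low: "?l y \<ge> 0" if y: "y > 0" for y
  proof -
    have "corr_low k q \<le> 0" if "q \<ge> 0" for q
      using k that by (auto simp: corr_low_def ceperley_alder_signs_def intro!: divide_nonpos_nonneg mult_nonpos_nonneg)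
    then have "corr_low k (sqrt (wigner_seitz (y\<^sup>2))) \<le> 0" using wigner_seitz_pos[of "y\<^sup>2"] y by simp
    then show ?thesis using y by (simp add: mult_nonneg_nonpos)
  qed
  \<comment> \<open>The value at 0 is 0 because of the factor \<open>y\<close>. On the low density
    branch the sign of \<open>corr_low\<close> decides; beyond it, monotonicity on the high density
    branch is chained through the matching point.\<close>
  have h0: "?h 0 \<le> ?h y" if y: "y > 0" for y
  proof (cases "y \<le> sqrt (3 / (4 * pi))")
    case True then show ?thesis using l[OF y] low[OF y] by simp
  next
    case False
    have "?h 0 \<le> ?l (sqrt (3 / (4 * pi)))" using low[OF pos] by simp
    also have "\<dots> = ?u (sqrt (3 / (4 * pi)))" using l[of "sqrt (3 / (4 * pi))"] u[of "sqrt (3 / (4 * pi))"] pos by simp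
    also have "\<dots> \<le> ?u y" using DERIV_nonneg_imp_nondecreasing[of "sqrt (3 / (4 * pi))" y ?u] du False by force
    also have "\<dots> = ?h y" using u[of y] False by simp
    finally show ?thesis .
  qed
  have "?h x \<le> ?h y"
    by (rule mono_on_glue[OF pos h0 l u dl du xy])
  then show ?thesis by simp
qed

text \<open>The negative parts of the derivative grow at most quadratically in \<open>y\<close>, the
  exchange part because \<open>y powr (2/3) \<le> 1 + y^2\<close>. A multiple of
  \<open>y + y^3\<close>, whose derivative is \<open>1 + 3 * y^2\<close>, outweighs them.\<close>

lemma xc'_lower_mono:
  assumes F': "\<forall>\<rho>>0. xc k differentiable at \<rho>" and k: "ceperley_alder_signs k"
  obtains K where "K > 0" "\<And>x y. 0 \<le> x \<Longrightarrow> x \<le> y \<Longrightarrow> x * xc' k (x\<^sup>2) + K * (x + x ^ 3) \<le> y * xc' k (y\<^sup>2) + K * (y + y ^ 3)"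
proof -
  have k': "c_A k > 0" "c_B k < 0" "c_C k > 0" "c_D k < 0" "c_gamma k < 0" using k by (auto simp: ceperley_alder_signs_def)
  \<comment> \<open>The first summand pays for exchange, the second for correlation at low density,
    the remaining ones for correlation at high density.\<close>
  define K where "K = 5/3 * exchange_const - 3 * c_gamma k + 4 * c_A k * pi / 3 - c_B k + c_A k + c_C k - c_D k"
  have "c_A k * pi > 0" using k' by simp
  then have Kp: "K > 0" using k' exchange_const_pos unfolding K_def by linarith
  have Ke: "5/3 * exchange_const * y powr (2/3) \<le> 5/3 * exchange_const * (1 + y\<^sup>2)" if "y \<ge> 0" for y
    using powr_two_thirds_le[OF that] exchange_const_pos by (intro mult_left_mono) auto
  let ?e = "\<lambda>y. - exchange_const * y powr (5/3) + K * (y + y ^ 3)"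
  have de: "(?e has_real_derivative - (5/3 * exchange_const * y powr (2/3)) + K * (1 + 3 * y\<^sup>2)) (at y)" if "y > 0" for y
    by (rule DERIV_cong[OF DERIV_add[OF DERIV_cmult[OF powr_five_thirds_deriv[OF that]] DERIV_cmult[OF DERIV_add[OF DERIV_ident DERIV_pow]]]]) simp
  let ?h = "\<lambda>y. y * xc' k (y\<^sup>2) + K * (y + y ^ 3)"
  let ?l = "\<lambda>y. y * corr_low k (sqrt (wigner_seitz (y\<^sup>2))) + ?e y" and ?u = "\<lambda>y. y * corr_high k (wigner_seitz (y\<^sup>2)) + ?e y"
  have pos: "sqrt (3 / (4 * pi)) > 0" by simp
  have dl: "\<exists>d. (?l has_real_derivative d) (at y) \<and> 0 \<le> d" if y: "0 < y" for y
  proof -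
    obtain d where d: "((\<lambda>y. y * corr_low k (sqrt (wigner_seitz (y\<^sup>2)))) has_real_derivative d) (at y)" "d \<ge> 3 * c_gamma k"
      using corr_low_sq_deriv[OF k y] by metis
    have "- d + 5/3 * exchange_const * (1 + y\<^sup>2) \<le> K * (1 + 3 * y\<^sup>2)"
    proof -
      have "- d + 5/3 * exchange_const * (1 + y\<^sup>2) \<le> - (3 * c_gamma k) * (1 + y\<^sup>2) + 5/3 * exchange_const * (1 + y\<^sup>2)"
      proof -
        have "- (3 * c_gamma k) * 1 \<le> - (3 * c_gamma k) * (1 + y\<^sup>2)" using k' by (intro mult_left_mono) auto
        then show ?thesis using d(2) by linarith
      qed
      also have "\<dots> = (5/3 * exchange_const - 3 * c_gamma k) * (1 + y\<^sup>2)" by (simp add: algebra_simps)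
      also have "\<dots> \<le> K * (1 + 3 * y\<^sup>2)" using k' Kp by (intro mult_mono) (auto simp: K_def)
      finally show ?thesis .
    qed
    then have "0 \<le> d + (- (5/3 * exchange_const * y powr (2/3)) + K * (1 + 3 * y\<^sup>2))" using Ke[of y] y by linarith
    then show ?thesis using DERIV_add[OF d(1) de[OF y]] by blast
  qed
  have du: "\<exists>d. (?u has_real_derivative d) (at y) \<and> 0 \<le> d" if y: "sqrt (3 / (4 * pi)) \<le> y" for y
  proof -
    have yp: "y > 0" using y pos by linarith
    obtain d where d: "((\<lambda>y. y * corr_high k (wigner_seitz (y\<^sup>2))) has_real_derivative d) (at y)"
      "d \<ge> - (4 * c_A k * pi / 3 * y\<^sup>2 - c_B k + c_A k + c_C k - c_D k)"
      using corr_high_sq_deriv[OF k _ yp] sq_ge_iff(1)[OF yp] y by metis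
    let ?m = "- c_B k + c_A k + c_C k - c_D k"
    have "- d + 5/3 * exchange_const * (1 + y\<^sup>2) \<le> 4 * c_A k * pi / 3 * (1 + y\<^sup>2) + ?m * (1 + y\<^sup>2) + 5/3 * exchange_const * (1 + y\<^sup>2)"
    proof -
      have "?m \<le> ?m * (1 + y\<^sup>2)" "4 * c_A k * pi / 3 * y\<^sup>2 \<le> 4 * c_A k * pi / 3 * (1 + y\<^sup>2)"
        using k' mult_left_mono[of 1 "1 + y\<^sup>2" ?m] by (simp_all add: mult_left_mono)
      then show ?thesis using d(2) by linarith
    qed
    also have "\<dots> = (4 * c_A k * pi / 3 + ?m + 5/3 * exchange_const) * (1 + y\<^sup>2)" by (simp add: algebra_simps)
    also have "\<dots> \<le> K * (1 + 3 * y\<^sup>2)" using k' Kp by (intro mult_mono) (auto simp: K_def)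
    finally have "0 \<le> d + (- (5/3 * exchange_const * y powr (2/3)) + K * (1 + 3 * y\<^sup>2))" using Ke[of y] yp by linarith
    then show ?thesis using DERIV_add[OF d(1) de[OF yp]] by blast
  qed
  have l: "?h y = ?l y" if "0 < y" "y \<le> sqrt (3 / (4 * pi))" for y
    using xc'_sq(1)[OF F' k that] by simp
  have u: "?h y = ?u y" if "sqrt (3 / (4 * pi)) \<le> y" for y
    using xc'_sq(2)[OF F' k _ that] that pos by (simp add: less_le_trans[OF pos that])
  \<comment> \<open>The arguments by derivatives cover positive \<open>y\<close> only. The value
    \<open>?h 0 = 0\<close> is compared with them through the behaviour near 0, where
    \<open>?h\<close> exceeds every given negative number.\<close>
  have lim: "\<exists>d>0. \<forall>y. 0 < y \<and> y < d \<longrightarrow> ?h y > - e" if e: "e > 0" for e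
  proof -
    have c: "\<bar>y * corr_low k (sqrt (wigner_seitz (y\<^sup>2)))\<bar> \<le> 4/3 * \<bar>c_gamma k\<bar> * y" if y: "y > 0" for y
    proof -
      define q where "q = sqrt (wigner_seitz (y\<^sup>2))"
      define D where "D = 1 + c_beta1 k * q + c_beta2 k * q\<^sup>2"
      have q: "q > 0" using wigner_seitz_pos[of "y\<^sup>2"] y by (simp add: q_def)
      have b: "c_beta1 k * q > 0" "c_beta2 k * q\<^sup>2 > 0" using k q by (auto simp: ceperley_alder_signs_def)
      then have D: "D \<ge> 1" by (simp add: D_def)
      have "1 + 7/6 * c_beta1 k * q + 4/3 * c_beta2 k * q\<^sup>2 \<le> 4/3 * D" using b unfolding D_def mult.assoc distrib_left by linarith
      also have "\<dots> \<le> 4/3 * D\<^sup>2" using D by (simp add: power2_eq_square)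
      finally have "(1 + 7/6 * c_beta1 k * q + 4/3 * c_beta2 k * q\<^sup>2) / D\<^sup>2 \<le> 4/3" using D by (simp add: pos_divide_le_eq)
      then have "\<bar>c_gamma k\<bar> * ((1 + 7/6 * c_beta1 k * q + 4/3 * c_beta2 k * q\<^sup>2) / D\<^sup>2) \<le> \<bar>c_gamma k\<bar> * (4/3)"
        by (intro mult_left_mono) auto
      moreover have "\<bar>corr_low k q\<bar> = \<bar>c_gamma k\<bar> * ((1 + 7/6 * c_beta1 k * q + 4/3 * c_beta2 k * q\<^sup>2) / D\<^sup>2)"
      proof -
        have "0 \<le> 1 + 7/6 * c_beta1 k * q + 4/3 * c_beta2 k * q\<^sup>2" using b unfolding mult.assoc by linarith
        then show ?thesis by (simp only: corr_low_def D_def[symmetric] abs_mult abs_divide abs_of_nonneg abs_power2 times_divide_eq_right)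
      qed
      ultimately have "\<bar>corr_low k q\<bar> * y \<le> 4/3 * \<bar>c_gamma k\<bar> * y" using y by (intro mult_right_mono) auto
      then show ?thesis using y by (simp add: q_def abs_mult mult.commute)
    qed
    have "((\<lambda>y. - (4/3 * \<bar>c_gamma k\<bar> * y) + ?e y) \<longlongrightarrow> - (4/3 * \<bar>c_gamma k\<bar> * 0) + (- exchange_const * 0 powr (5/3) + K * (0 + 0 ^ 3))) (at_right 0)"
      by (intro tendsto_intros tendsto_powr2) (auto simp: eventually_at_filter)
    then have "\<forall>\<^sub>F y in at_right 0. - (4/3 * \<bar>c_gamma k\<bar> * y) + ?e y > - e"
      using e by (intro order_tendstoD(1)) auto
    then obtain d where d: "d > 0" "\<And>y. 0 < y \<Longrightarrow> y < d \<Longrightarrow> - (4/3 * \<bar>c_gamma k\<bar> * y) + ?e y > - e"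
      by (auto simp: eventually_at_right_field)
    show ?thesis
    proof (intro exI[of _ "min d (sqrt (3 / (4 * pi)))"] conjI allI impI)
      show "0 < min d (sqrt (3 / (4 * pi)))" using d pos by simp
      fix y assume y: "0 < y \<and> y < min d (sqrt (3 / (4 * pi)))"
      then show "?h y > - e" using d(2)[of y] c[of y] l[of y] by (auto simp: abs_le_iff)
    qed
  qed
  have h0: "?h 0 \<le> ?h y" if y: "y > 0" for y
  proof (rule ccontr)
    assume "\<not> ?h 0 \<le> ?h y"
    then have neg: "?h y < 0" by simp
    then have "- ?h y > 0" by linarith
    from lim[OF this] obtain d where d: "d > 0" "\<forall>z. 0 < z \<and> z < d \<longrightarrow> ?h z > - (- ?h y)" by blast
    \<comment> \<open>A point below \<open>y\<close>, inside the range of the limit and on the low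
      density branch; monotonicity between \<open>z\<close> and \<open>y\<close> then contradicts
      the limit.\<close>
    define z where "z = min (min d y) (sqrt (3 / (4 * pi))) / 2"
    have z: "0 < z" "z < d" "z \<le> y" "z \<le> sqrt (3 / (4 * pi))" using d(1) y pos unfolding z_def by linarith+
    have L: "?h a \<le> ?h b" if "0 < a" "a \<le> b" "b \<le> sqrt (3 / (4 * pi))" for a b
      using DERIV_nonneg_imp_nondecreasing[of a b ?l] dl l[of a] l[of b] that by force
    have U: "?h a \<le> ?h b" if "sqrt (3 / (4 * pi)) \<le> a" "a \<le> b" for a b
      using DERIV_nonneg_imp_nondecreasing[of a b ?u] du u[of a] u[of b] that by force
    have "?h z \<le> ?h y"
      using L[of z y] L[of z "sqrt (3 / (4 * pi))"] U[of "sqrt (3 / (4 * pi))" y] z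
      by (cases "y \<le> sqrt (3 / (4 * pi))") auto
    then show False using d(2)[rule_format, of z] z by linarith
  qed
  show thesis
    by (rule that[OF Kp]) (rule mono_on_glue[OF pos h0 l u dl du])
qed

section \<open>Iterated integrals in three coordinates and Ladyzhenskaya's inequality\<close>

definition pt_of :: "real \<Rightarrow> real \<Rightarrow> real \<Rightarrow> pt" where "pt_of x y z = vector [x, y, z]"

lemma pt_of_nth [simp]: "pt_of x y z $ 1 = x" "pt_of x y z $ 2 = y" "pt_of x y z $ 3 = z"
  by (simp_all add: pt_of_def)

lemma pt_of_eq: "pt_of x y z = x *\<^sub>R axis 1 1 + y *\<^sub>R axis 2 1 + z *\<^sub>R axis 3 1"
  by (simp add: vec_eq_iff forall_3 axis_def)

lemma pt_of_measurable [measurable]: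
  "(\<lambda>p. pt_of (fst p) (fst (snd p)) (snd (snd p))) \<in> borel_measurable (borel \<Otimes>\<^sub>M (borel \<Otimes>\<^sub>M borel))"
  unfolding pt_of_eq by measurable

text \<open>Lebesgue measure is determined by its values on boxes. The product form gives access to
  integration along coordinate lines.\<close>

lemma lborel_eq_distr_triple:
  "(lborel :: pt measure) = distr (lborel \<Otimes>\<^sub>M (lborel \<Otimes>\<^sub>M lborel)) borel (\<lambda>p. pt_of (fst p) (fst (snd p)) (snd (snd p)))"
proof (rule lborel_eqI)
  fix l u :: pt assume lu: "\<And>b. b \<in> Basis \<Longrightarrow> l \<bullet> b \<le> u \<bullet> b"
  let ?T = "\<lambda>p. pt_of (fst p) (fst (snd p)) (snd (snd p))"
  have le: "l $ i \<le> u $ i" for i using lu[of "axis i 1"] by (simp add: inner_axis)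
  have T: "?T -` box l u \<inter> space (lborel \<Otimes>\<^sub>M (lborel \<Otimes>\<^sub>M lborel)) = box (l $ 1) (u $ 1) \<times> box (l $ 2) (u $ 2) \<times> box (l $ 3) (u $ 3)"
    by (auto simp: mem_box_cart forall_3 space_pair_measure box_real)
  have "emeasure (distr (lborel \<Otimes>\<^sub>M (lborel \<Otimes>\<^sub>M lborel)) borel ?T) (box l u)
      = emeasure (lborel \<Otimes>\<^sub>M (lborel \<Otimes>\<^sub>M lborel)) (box (l $ 1) (u $ 1) \<times> box (l $ 2) (u $ 2) \<times> box (l $ 3) (u $ 3))"
    by (subst emeasure_distr) (auto simp: T)
  also have "\<dots> = emeasure lborel (box (l $ 1) (u $ 1)) * (emeasure lborel (box (l $ 2) (u $ 2)) * emeasure lborel (box (l $ 3) (u $ 3)))"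
  proof -
    have "sigma_finite_measure (lborel \<Otimes>\<^sub>M lborel :: (real \<times> real) measure)"
      unfolding lborel_prod by (rule lborel.sigma_finite_measure_axioms)
    then show ?thesis
      by (subst sigma_finite_measure.emeasure_pair_measure_Times; (subst lborel.emeasure_pair_measure_Times)?; simp)
  qed
  also have "\<dots> = ennreal (\<Prod>i\<in>UNIV. (u - l) $ i)"
    using le[of 1] le[of 2] le[of 3] unfolding UNIV_3 by (simp add: ennreal_mult' mult.assoc)
  also have "(\<Prod>i\<in>UNIV. (u - l) $ i) = (\<Prod>b\<in>Basis. (u - l) \<bullet> b)"
    by (simp add: Basis_vec_def UNION_singleton_eq_range prod.reindex inj_on_def axis_eq_axis inner_axis)
  finally show "emeasure (distr (lborel \<Otimes>\<^sub>M (lborel \<Otimes>\<^sub>M lborel)) borel ?T) (box l u) = ennreal (\<Prod>b\<in>Basis. (u - l) \<bullet> b)" .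
qed simp

lemma nn_integral_triple:
  assumes [measurable]: "f \<in> borel_measurable borel"
  shows "(\<integral>\<^sup>+x. f (x::pt) \<partial>lborel) = (\<integral>\<^sup>+z. \<integral>\<^sup>+y. \<integral>\<^sup>+x. f (pt_of x y z) \<partial>lborel \<partial>lborel \<partial>lborel)"
proof -
  have "(\<integral>\<^sup>+x. f (x::pt) \<partial>lborel) = (\<integral>\<^sup>+p. f (pt_of (fst p) (fst (snd p)) (snd (snd p))) \<partial>(lborel \<Otimes>\<^sub>M (lborel \<Otimes>\<^sub>M lborel)))"
    by (subst lborel_eq_distr_triple) (subst nn_integral_distr; simp)
  also have "\<dots> = (\<integral>\<^sup>+q. \<integral>\<^sup>+x. f (pt_of x (fst q) (snd q)) \<partial>lborel \<partial>(lborel \<Otimes>\<^sub>M lborel))"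
  proof -
    interpret p: pair_sigma_finite "lborel :: real measure" "lborel \<Otimes>\<^sub>M lborel :: (real \<times> real) measure"
      unfolding lborel_prod ..
    show ?thesis by (subst p.nn_integral_snd[symmetric]) (auto simp: split_beta')
  qed
  also have "\<dots> = (\<integral>\<^sup>+z. \<integral>\<^sup>+y. \<integral>\<^sup>+x. f (pt_of x y z) \<partial>lborel \<partial>lborel \<partial>lborel)"
  proof -
    have [measurable]: "(\<lambda>(q, x). f (pt_of x (fst q) (snd q))) \<in> borel_measurable ((lborel \<Otimes>\<^sub>M lborel) \<Otimes>\<^sub>M lborel)"
      unfolding pt_of_eq by measurable
    show ?thesis by (subst lborel_pair.nn_integral_snd[symmetric]) (auto simp: split_beta')
  qed
  finally show ?thesis .
qed

text \<open>The fundamental theorem of calculus for the square of \<open>u\<close>, started at a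
  zero of \<open>u\<close>.\<close>

lemma sq_le_integral_1d:
  fixes u u' :: "real \<Rightarrow> real"
  assumes d: "\<And>t. (u has_real_derivative u' t) (at t)" and c: "continuous_on UNIV u'" and z: "u a = 0" "a \<le> t"
  shows "ennreal ((u t)\<^sup>2) \<le> (\<integral>\<^sup>+s. ennreal (2 * \<bar>u s * u' s\<bar>) \<partial>lborel)"
proof -
  have cu: "continuous_on UNIV u" using d by (meson DERIV_continuous_on has_field_derivative_at_within)
  have "((\<lambda>s. 2 * (u s * u' s)) has_integral (u t)\<^sup>2 - (u a)\<^sup>2) {a..t}"
    using z(2) by (intro fundamental_theorem_of_calculus)
      (auto intro!: derivative_eq_intros d[THEN has_field_derivative_at_within] simp flip: has_real_derivative_iff_has_vector_derivative)
  then have "((\<lambda>s. 2 * (u s * u' s)) has_integral (u t)\<^sup>2) {a..t}" using z by simp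
  moreover have int: "(\<lambda>s. 2 * \<bar>u s * u' s\<bar>) integrable_on {a..t}"
    using cu c by (intro integrable_continuous_real continuous_intros) (auto intro: continuous_on_subset)
  ultimately have "(u t)\<^sup>2 \<le> integral {a..t} (\<lambda>s. 2 * \<bar>u s * u' s\<bar>)"
    by (intro has_integral_le[OF _ integrable_integral[OF int]]) auto
  also have "ennreal \<dots> = (\<integral>\<^sup>+s. ennreal (2 * \<bar>u s * u' s\<bar>) * indicator {a..t} s \<partial>lborel)"
    by (rule nn_integral_has_integral_lebesgue'[OF _ integrable_integral[OF int], symmetric]) auto
  also have "\<dots> \<le> (\<integral>\<^sup>+s. ennreal (2 * \<bar>u s * u' s\<bar>) \<partial>lborel)"
    by (intro nn_integral_mono) (auto simp: indicator_def)
  finally show ?thesis by (simp add: ennreal_leI)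
qed

lemma ennreal_two_mult_le: "2 * (a * b) \<le> a\<^sup>2 + b\<^sup>2" for a b :: ennreal
proof (cases "a = top \<or> b = top")
  case True then show ?thesis by (auto simp: power2_eq_square ennreal_top_mult ennreal_mult_top)
next
  case False
  then obtain x y where "a = ennreal x" "0 \<le> x" "b = ennreal y" "0 \<le> y"
    by (metis ennreal_cases)
  moreover have "2 * (x * y) \<le> x\<^sup>2 + y\<^sup>2" using sum_squares_bound[of x y] by simp
  ultimately show ?thesis
    by (simp add: ennreal_power flip: ennreal_mult ennreal_plus ennreal_numeral)
qed

lemma smooth_sq_le_line_integral:
  assumes u: "smooth_on UNIV u" and supp: "\<And>x. x \<notin> cball 0 R \<Longrightarrow> u x = 0"
  shows "ennreal ((u (pt_of x y z))\<^sup>2) \<le> (\<integral>\<^sup>+s. ennreal (2 * \<bar>u (pt_of s y z) * partial_at 1 u (pt_of s y z)\<bar>) \<partial>lborel)"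
    "ennreal ((u (pt_of x y z))\<^sup>2) \<le> (\<integral>\<^sup>+s. ennreal (2 * \<bar>u (pt_of x s z) * partial_at 2 u (pt_of x s z)\<bar>) \<partial>lborel)"
    "ennreal ((u (pt_of x y z))\<^sup>2) \<le> (\<integral>\<^sup>+s. ennreal (2 * \<bar>u (pt_of x y s) * partial_at 3 u (pt_of x y s)\<bar>) \<partial>lborel)"
proof -
  have out: "u p = 0" if "\<bar>p $ i\<bar> > R" for p i
    using supp[of p] component_le_norm_cart[of p i] that by auto
  have line: "ennreal ((u (p t))\<^sup>2) \<le> (\<integral>\<^sup>+s. ennreal (2 * \<bar>u (p s) * partial_at i u (p s)\<bar>) \<partial>lborel)"
    if p: "\<And>s. p s = q + s *\<^sub>R axis i 1" and pi: "\<And>s. p s $ i = s" for p q i t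
  \<comment> \<open>The starting point lies to the left of \<open>t\<close> and outside the support
    of \<open>u\<close>.\<close>
  proof (rule sq_le_integral_1d[where a="- \<bar>R\<bar> - \<bar>t\<bar> - 1"])
    fix s
    have "((\<lambda>s. q + s *\<^sub>R axis i 1) has_derivative (\<lambda>h. h *\<^sub>R (axis i 1 :: pt))) (at s)"
      by (auto intro!: derivative_eq_intros)
    from has_derivative_compose[OF this smooth_deriv[OF u]]
    show "((\<lambda>s. u (p s)) has_real_derivative partial_at i u (p s)) (at s)"
      by (simp add: p has_field_derivative_def inner_axis mult.commute[of _ "partial_at i u _"])
  next
    show "continuous_on UNIV (\<lambda>s. partial_at i u (p s))"
      unfolding p by (intro continuous_on_compose2[OF smooth_differentiable(3)[OF u]] continuous_intros) auto
    show "u (p (- \<bar>R\<bar> - \<bar>t\<bar> - 1)) = 0" by (rule out[of _ i]) (simp add: pi)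
  qed simp
  show "ennreal ((u (pt_of x y z))\<^sup>2) \<le> (\<integral>\<^sup>+s. ennreal (2 * \<bar>u (pt_of s y z) * partial_at 1 u (pt_of s y z)\<bar>) \<partial>lborel)"
    by (rule line[of "\<lambda>s. pt_of s y z" "pt_of 0 y z" 1]) (simp_all add: pt_of_eq axis_def)
  show "ennreal ((u (pt_of x y z))\<^sup>2) \<le> (\<integral>\<^sup>+s. ennreal (2 * \<bar>u (pt_of x s z) * partial_at 2 u (pt_of x s z)\<bar>) \<partial>lborel)"
    by (rule line[of "\<lambda>s. pt_of x s z" "pt_of x 0 z" 2]) (simp_all add: pt_of_eq axis_def)
  show "ennreal ((u (pt_of x y z))\<^sup>2) \<le> (\<integral>\<^sup>+s. ennreal (2 * \<bar>u (pt_of x y s) * partial_at 3 u (pt_of x y s)\<bar>) \<partial>lborel)"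
    by (rule line[of "\<lambda>s. pt_of x y s" "pt_of x y 0" 3]) (simp_all add: pt_of_eq axis_def)
qed

text \<open>In a horizontal plane the square of \<open>u\<close> is bounded by a line integral in
  either of the two directions; the product of the bounds gives the planar inequality. The third
  direction bounds the L2 norm on every plane by the H1 norm, and integration over the height
  finishes.\<close>

lemma Ladyzhenskaya_smooth:
  assumes u: "smooth_on UNIV u" and supp: "\<And>x. x \<notin> cball 0 R \<Longrightarrow> u x = 0"
  defines "g \<equiv> \<lambda>x. \<Sum>i\<in>UNIV. (partial_at i u x)\<^sup>2"
  shows "(\<integral>\<^sup>+x. ennreal (u x ^ 4) \<partial>lborel) \<le> 2 * (\<integral>\<^sup>+x. ennreal ((u x)\<^sup>2 + g x) \<partial>lborel) * (\<integral>\<^sup>+x. ennreal (g x) \<partial>lborel)"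
proof -
  have [measurable]: "u \<in> borel_measurable borel" "partial_at i u \<in> borel_measurable borel" for i
    using smooth_differentiable[OF u] by (auto intro: borel_measurable_continuous_onI)
  have [measurable]: "(\<lambda>(x, y). pt_of x y z) \<in> borel_measurable (borel \<Otimes>\<^sub>M borel)"
    "(\<lambda>(x, y, z). pt_of x y z) \<in> borel_measurable (borel \<Otimes>\<^sub>M (borel \<Otimes>\<^sub>M borel))" for z
    unfolding pt_of_eq by measurable
  have g3: "g x = (partial_at 1 u x)\<^sup>2 + (partial_at 2 u x)\<^sup>2 + (partial_at 3 u x)\<^sup>2" for x
    unfolding g_def sum_3 ..
  define c where "c i x = ennreal (2 * \<bar>u x * partial_at i u x\<bar>)" for i x
  have cm [measurable]: "c i \<in> borel_measurable borel" for i unfolding c_def[abs_def] by measurable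
  have pm: "(\<lambda>p. f (pt_of (h1 p) (h2 p) (h3 p))) \<in> borel_measurable M"
    if [measurable]: "f \<in> borel_measurable borel" "h1 \<in> borel_measurable M" "h2 \<in> borel_measurable M" "h3 \<in> borel_measurable M"
    for f :: "pt \<Rightarrow> ennreal" and h1 h2 h3 and M :: "'c measure"
    unfolding pt_of_eq by measurable
  define H where "H = (\<integral>\<^sup>+x. ennreal ((u x)\<^sup>2 + g x) \<partial>lborel)"
  define B where "B z = (\<integral>\<^sup>+y. \<integral>\<^sup>+x. ennreal ((u (pt_of x y z))\<^sup>2) \<partial>lborel \<partial>lborel)" for z
  define D where "D i z = (\<integral>\<^sup>+y. \<integral>\<^sup>+x. ennreal ((partial_at i u (pt_of x y z))\<^sup>2) \<partial>lborel \<partial>lborel)" for i z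
  define a where "a i z = (\<integral>\<^sup>+y. \<integral>\<^sup>+x. c i (pt_of x y z) \<partial>lborel \<partial>lborel)" for i z
  have swap: "(\<integral>\<^sup>+y. \<integral>\<^sup>+x. f (pt_of x y z) \<partial>lborel \<partial>lborel) = (\<integral>\<^sup>+p. f (pt_of (snd p) (fst p) z) \<partial>(lborel \<Otimes>\<^sub>M lborel))"
    "(\<integral>\<^sup>+x. \<integral>\<^sup>+y. f (pt_of x y z) \<partial>lborel \<partial>lborel) = (\<integral>\<^sup>+p. f (pt_of (snd p) (fst p) z) \<partial>(lborel \<Otimes>\<^sub>M lborel))"
    if f: "f \<in> borel_measurable borel" for f :: "pt \<Rightarrow> ennreal" and z
  proof -
    have m: "(\<lambda>p. f (pt_of (snd p) (fst p) z)) \<in> borel_measurable (lborel \<Otimes>\<^sub>M lborel)" by (rule pm[OF f]) auto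
    show "(\<integral>\<^sup>+y. \<integral>\<^sup>+x. f (pt_of x y z) \<partial>lborel \<partial>lborel) = (\<integral>\<^sup>+p. f (pt_of (snd p) (fst p) z) \<partial>(lborel \<Otimes>\<^sub>M lborel))"
      using lborel.nn_integral_fst[OF m] by simp
    show "(\<integral>\<^sup>+x. \<integral>\<^sup>+y. f (pt_of x y z) \<partial>lborel \<partial>lborel) = (\<integral>\<^sup>+p. f (pt_of (snd p) (fst p) z) \<partial>(lborel \<Otimes>\<^sub>M lborel))"
      using lborel_pair.nn_integral_snd[OF m] by simp
  qed
  \<comment> \<open>Cauchy-Schwarz on the plane at height \<open>z\<close>; the 4 is the square of
    the factor 2 from differentiating a square.\<close>
  have a_sq: "(a i z)\<^sup>2 \<le> 4 * (B z * D i z)" for i z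
  proof -
    define U P where "U p = ennreal \<bar>u (pt_of (snd p) (fst p) z)\<bar>"
      and "P p = ennreal \<bar>partial_at i u (pt_of (snd p) (fst p) z)\<bar>" for p
    have UP': "U \<in> borel_measurable (borel \<Otimes>\<^sub>M borel)" "P \<in> borel_measurable (borel \<Otimes>\<^sub>M borel)"
      unfolding U_def[abs_def] P_def[abs_def]
      by (rule pm[of "\<lambda>x. ennreal \<bar>u x\<bar>"] pm[of "\<lambda>x. ennreal \<bar>partial_at i u x\<bar>"]; simp)+
    then have UP: "U \<in> borel_measurable (lborel \<Otimes>\<^sub>M lborel)" "P \<in> borel_measurable (lborel \<Otimes>\<^sub>M lborel)"
      unfolding measurable_cong_sets[OF sets_pair_measure_cong[OF sets_lborel sets_lborel] refl] .
    have four: "(2::ennreal)\<^sup>2 = 4" by simp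
    have "a i z = (\<integral>\<^sup>+p. c i (pt_of (snd p) (fst p) z) \<partial>(lborel \<Otimes>\<^sub>M lborel))"
      unfolding a_def by (rule swap(1)[OF cm])
    also have "\<dots> = (\<integral>\<^sup>+p. 2 * (U p * P p) \<partial>(lborel \<Otimes>\<^sub>M lborel))"
      by (simp add: c_def U_def P_def abs_mult ennreal_mult)
    also have "\<dots> = 2 * (\<integral>\<^sup>+p. U p * P p \<partial>(lborel \<Otimes>\<^sub>M lborel))"
      by (rule nn_integral_cmult) (use UP UP' in measurable)
    finally have e: "a i z = 2 * (\<integral>\<^sup>+p. U p * P p \<partial>(lborel \<Otimes>\<^sub>M lborel))" .
    have "(a i z)\<^sup>2 = (2 * (\<integral>\<^sup>+p. U p * P p \<partial>(lborel \<Otimes>\<^sub>M lborel)))\<^sup>2"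
      unfolding e ..
    also have "\<dots> = 4 * (\<integral>\<^sup>+p. U p * P p \<partial>(lborel \<Otimes>\<^sub>M lborel))\<^sup>2"
      by (simp only: power_mult_distrib four)
    also have "\<dots> \<le> 4 * ((\<integral>\<^sup>+p. (U p)\<^sup>2 \<partial>(lborel \<Otimes>\<^sub>M lborel)) * (\<integral>\<^sup>+p. (P p)\<^sup>2 \<partial>(lborel \<Otimes>\<^sub>M lborel)))"
      by (rule mult_left_mono[OF Cauchy_Schwarz_nn_integral[OF UP]]) simp
    also have "\<dots> = 4 * (B z * D i z)"
    proof -
      have "B z = (\<integral>\<^sup>+p. (U p)\<^sup>2 \<partial>(lborel \<Otimes>\<^sub>M lborel))"
        unfolding B_def U_def by (subst swap(1)[of "\<lambda>x. ennreal ((u x)\<^sup>2)"]) (simp_all add: ennreal_power)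
      moreover have "D i z = (\<integral>\<^sup>+p. (P p)\<^sup>2 \<partial>(lborel \<Otimes>\<^sub>M lborel))"
        unfolding D_def P_def by (subst swap(1)[of "\<lambda>x. ennreal ((partial_at i u x)\<^sup>2)"]) (simp_all add: ennreal_power)
      ultimately show ?thesis by simp
    qed
    finally show ?thesis .
  qed
  have u_le: "ennreal ((u (pt_of x y z))\<^sup>2) \<le> (\<integral>\<^sup>+s. c 1 (pt_of s y z) \<partial>lborel)"
     "ennreal ((u (pt_of x y z))\<^sup>2) \<le> (\<integral>\<^sup>+s. c 2 (pt_of x s z) \<partial>lborel)"
     "ennreal ((u (pt_of x y z))\<^sup>2) \<le> (\<integral>\<^sup>+s. c 3 (pt_of x y s) \<partial>lborel)" for x y z
    unfolding c_def by (rule smooth_sq_le_line_integral[OF u supp]; assumption)+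
  have m1: "(\<lambda>t. \<integral>\<^sup>+s. c i (pt_of s t z) \<partial>lborel) \<in> borel_measurable lborel"
    "(\<lambda>t. \<integral>\<^sup>+s. c i (pt_of t s z) \<partial>lborel) \<in> borel_measurable lborel"
    "(\<lambda>s. c i (pt_of s y z)) \<in> borel_measurable lborel"
    "(\<lambda>s. c i (pt_of y s z)) \<in> borel_measurable lborel" for i y z
  proof -
    show "(\<lambda>t. \<integral>\<^sup>+s. c i (pt_of s t z) \<partial>lborel) \<in> borel_measurable lborel"
      "(\<lambda>t. \<integral>\<^sup>+s. c i (pt_of t s z) \<partial>lborel) \<in> borel_measurable lborel"
      by (rule lborel.borel_measurable_nn_integral, unfold split_beta', rule pm[OF cm], auto)+
    show "(\<lambda>s. c i (pt_of s y z)) \<in> borel_measurable lborel" "(\<lambda>s. c i (pt_of y s z)) \<in> borel_measurable lborel"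
      by (rule pm[OF cm], auto)+
  qed
  have m3: "(\<lambda>(y, s). \<integral>\<^sup>+x. c 3 (pt_of x y s) \<partial>lborel) \<in> borel_measurable (lborel \<Otimes>\<^sub>M lborel)"
    unfolding split_beta' by (rule lborel.borel_measurable_nn_integral, unfold split_beta', rule pm[OF cm]) auto
  \<comment> \<open>The L2 norm on a single plane is bounded uniformly in its height, because
    \<open>u_le(3)\<close> integrates over all heights.\<close>
  have B_le: "B z \<le> H" for z
  proof -
    have "B z \<le> (\<integral>\<^sup>+y. \<integral>\<^sup>+x. \<integral>\<^sup>+s. c 3 (pt_of x y s) \<partial>lborel \<partial>lborel \<partial>lborel)"
      unfolding B_def by (intro nn_integral_mono u_le)
    also have "\<dots> = (\<integral>\<^sup>+y. \<integral>\<^sup>+s. \<integral>\<^sup>+x. c 3 (pt_of x y s) \<partial>lborel \<partial>lborel \<partial>lborel)"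
      by (rule nn_integral_cong, rule lborel_pair.Fubini', unfold split_beta', rule pm[OF cm]) auto
    also have "\<dots> = (\<integral>\<^sup>+s. \<integral>\<^sup>+y. \<integral>\<^sup>+x. c 3 (pt_of x y s) \<partial>lborel \<partial>lborel \<partial>lborel)"
      by (rule lborel_pair.Fubini') (use m3 in simp)
    also have "\<dots> = (\<integral>\<^sup>+x. c 3 x \<partial>lborel)" by (rule nn_integral_triple[symmetric]) simp
    also have "\<dots> \<le> H"
      unfolding H_def
    proof (intro nn_integral_mono)
      fix x
      have "2 * \<bar>u x * partial_at 3 u x\<bar> \<le> (u x)\<^sup>2 + (partial_at 3 u x)\<^sup>2"
        using sum_squares_bound[of "\<bar>u x\<bar>" "\<bar>partial_at 3 u x\<bar>"] by (simp add: abs_mult)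
      also have "(partial_at 3 u x)\<^sup>2 \<le> g x" by (simp add: g3)
      finally show "c 3 x \<le> ennreal ((u x)\<^sup>2 + g x)" by (simp add: c_def ennreal_leI)
    qed
    finally show ?thesis .
  qed
  \<comment> \<open>The bound in the first direction does not depend on \<open>x\<close> and the one
    in the second not on \<open>y\<close>, so the integral of their product over the plane
    factorizes. The factor 2 carried along makes room for
    \<open>2 * (a * b) \<le> a^2 + b^2\<close>.\<close>
  have I_le: "(\<integral>\<^sup>+y. \<integral>\<^sup>+x. ennreal (u (pt_of x y z) ^ 4) \<partial>lborel \<partial>lborel) \<le> 2 * (H * (D 1 z + D 2 z))" for z
  proof -
    have "(\<integral>\<^sup>+y. \<integral>\<^sup>+x. ennreal (u (pt_of x y z) ^ 4) \<partial>lborel \<partial>lborel)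
       = (\<integral>\<^sup>+y. \<integral>\<^sup>+x. ennreal ((u (pt_of x y z))\<^sup>2) * ennreal ((u (pt_of x y z))\<^sup>2) \<partial>lborel \<partial>lborel)"
      by (simp flip: ennreal_mult power_add)
    also have "\<dots> \<le> (\<integral>\<^sup>+y. \<integral>\<^sup>+x. (\<integral>\<^sup>+s. c 1 (pt_of s y z) \<partial>lborel) * (\<integral>\<^sup>+s. c 2 (pt_of x s z) \<partial>lborel) \<partial>lborel \<partial>lborel)"
      by (intro nn_integral_mono mult_mono u_le) auto
    also have "\<dots> = (\<integral>\<^sup>+y. (\<integral>\<^sup>+s. c 1 (pt_of s y z) \<partial>lborel) * (\<integral>\<^sup>+x. \<integral>\<^sup>+s. c 2 (pt_of x s z) \<partial>lborel \<partial>lborel) \<partial>lborel)"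
      by (rule nn_integral_cong, rule nn_integral_cmult, rule m1)
    also have "\<dots> = a 1 z * (\<integral>\<^sup>+x. \<integral>\<^sup>+s. c 2 (pt_of x s z) \<partial>lborel \<partial>lborel)"
      unfolding a_def by (rule nn_integral_multc, rule m1)
    also have "(\<integral>\<^sup>+x. \<integral>\<^sup>+s. c 2 (pt_of x s z) \<partial>lborel \<partial>lborel) = a 2 z"
      unfolding a_def swap[OF cm] ..
    finally have 1: "2 * (\<integral>\<^sup>+y. \<integral>\<^sup>+x. ennreal (u (pt_of x y z) ^ 4) \<partial>lborel \<partial>lborel) \<le> 2 * (a 1 z * a 2 z)"
      by (intro mult_left_mono) auto
    also have "\<dots> \<le> (a 1 z)\<^sup>2 + (a 2 z)\<^sup>2" by (rule ennreal_two_mult_le)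
    also have "\<dots> \<le> 4 * (B z * D 1 z) + 4 * (B z * D 2 z)" by (intro add_mono a_sq)
    also have "\<dots> \<le> 4 * (H * D 1 z) + 4 * (H * D 2 z)" by (intro add_mono mult_mono B_le) auto
    also have "\<dots> = 2 * (2 * (H * (D 1 z + D 2 z)))" by (simp add: distrib_left mult.assoc[symmetric])
    finally show ?thesis by (subst (asm) ennreal_mult_le_mult_iff) auto
  qed
  have "(\<integral>\<^sup>+x. ennreal (u x ^ 4) \<partial>lborel) \<le> (\<integral>\<^sup>+z. 2 * (H * (D 1 z + D 2 z)) \<partial>lborel)"
    by (subst nn_integral_triple) (auto intro!: nn_integral_mono I_le)
  also have "\<dots> = 2 * (H * ((\<integral>\<^sup>+z. D 1 z \<partial>lborel) + (\<integral>\<^sup>+z. D 2 z \<partial>lborel)))"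
  proof -
    have Dm: "D i \<in> borel_measurable lborel" for i
    proof -
      have f: "(\<lambda>x. ennreal ((partial_at i u x)\<^sup>2)) \<in> borel_measurable borel" by simp
      have "(\<lambda>z. \<integral>\<^sup>+p. ennreal ((partial_at i u (pt_of (snd p) (fst p) z))\<^sup>2) \<partial>(lborel \<Otimes>\<^sub>M lborel)) \<in> borel_measurable lborel"
        unfolding lborel_prod
        by (rule lborel.borel_measurable_nn_integral, unfold split_beta' lborel_prod[symmetric], rule pm[OF f]) auto
      then show ?thesis unfolding D_def[abs_def] swap(1)[OF f] .
    qed
    show ?thesis using Dm by (simp add: nn_integral_cmult nn_integral_add)
  qed
  also have "(\<integral>\<^sup>+z. D 1 z \<partial>lborel) + (\<integral>\<^sup>+z. D 2 z \<partial>lborel) = (\<integral>\<^sup>+x. ennreal ((partial_at 1 u x)\<^sup>2) + ennreal ((partial_at 2 u x)\<^sup>2) \<partial>lborel)"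
    unfolding D_def by (subst (1 2) nn_integral_triple[symmetric]) (simp_all add: nn_integral_add)
  also have "\<dots> \<le> (\<integral>\<^sup>+x. ennreal (g x) \<partial>lborel)"
    by (intro nn_integral_mono) (auto simp: g3 intro!: ennreal_leI simp flip: ennreal_plus)
  finally show ?thesis unfolding H_def by (simp add: mult.assoc mult_left_mono)
qed

section \<open>Weak gradients\<close>

lemma tendsto_zero_bounded:
  fixes f g :: "nat \<Rightarrow> real"
  assumes "\<And>n. 0 \<le> f n" "\<And>n. f n \<le> g n" "g \<longlonglongrightarrow> 0"
  shows "f \<longlonglongrightarrow> 0"
  by (rule tendsto_sandwich[OF _ _ tendsto_const assms(3)]) (use assms in simp_all)

text \<open>The integral of the square of \<open>G * f - K * g\<close> is nonnegative and equals
  \<open>G * (F * G - K^2)\<close>. If \<open>G = 0\<close>, then \<open>g\<close> vanishes almost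
  everywhere and so does \<open>K\<close>.\<close>

lemma Cauchy_Schwarz_integral:
  fixes f g :: "'a \<Rightarrow> real"
  assumes [measurable]: "f \<in> borel_measurable M" "g \<in> borel_measurable M"
    and f: "integrable M (\<lambda>x. (f x)\<^sup>2)" and g: "integrable M (\<lambda>x. (g x)\<^sup>2)"
  shows "integrable M (\<lambda>x. f x * g x)" "(\<integral>x. f x * g x \<partial>M)\<^sup>2 \<le> (\<integral>x. (f x)\<^sup>2 \<partial>M) * (\<integral>x. (g x)\<^sup>2 \<partial>M)"
proof -
  show fg: "integrable M (\<lambda>x. f x * g x)"
  proof (rule Bochner_Integration.integrable_bound[OF Bochner_Integration.integrable_add[OF f g]])
    show "AE x in M. norm (f x * g x) \<le> norm ((f x)\<^sup>2 + (g x)\<^sup>2)"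
    proof (rule AE_I2)
      fix x
      have "2 * \<bar>f x * g x\<bar> \<le> (f x)\<^sup>2 + (g x)\<^sup>2"
        using sum_squares_bound[of "\<bar>f x\<bar>" "\<bar>g x\<bar>"] by (simp add: abs_mult)
      then show "norm (f x * g x) \<le> norm ((f x)\<^sup>2 + (g x)\<^sup>2)" by simp
    qed
  qed measurable
  define F G K where "F = (\<integral>x. (f x)\<^sup>2 \<partial>M)" and "G = (\<integral>x. (g x)\<^sup>2 \<partial>M)" and "K = (\<integral>x. f x * g x \<partial>M)"
  have "0 \<le> (\<integral>x. (G * f x - K * g x)\<^sup>2 \<partial>M)" by (rule Bochner_Integration.integral_nonneg) simp
  also have "(\<lambda>x. (G * f x - K * g x)\<^sup>2) = (\<lambda>x. G\<^sup>2 * (f x)\<^sup>2 - 2 * G * K * (f x * g x) + K\<^sup>2 * (g x)\<^sup>2)"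
    by (simp add: power2_eq_square algebra_simps)
  also have "(\<integral>x. \<dots> x \<partial>M) = G\<^sup>2 * F - 2 * G * K * K + K\<^sup>2 * G"
    using f g fg by (simp add: F_def G_def K_def)
  finally have "0 \<le> G * (F * G - K\<^sup>2)" by (simp add: power2_eq_square algebra_simps)
  moreover have "G \<ge> 0" by (simp add: G_def)
  moreover have "K\<^sup>2 \<le> F * G" if "G = 0"
  proof -
    have "AE x in M. (g x)\<^sup>2 = 0" using that g by (subst (asm) G_def) (simp add: integral_nonneg_eq_0_iff_AE)
    then have "K = (\<integral>x. 0 \<partial>M)" unfolding K_def by (intro integral_cong_AE) auto
    then show ?thesis using that by simp
  qed
  ultimately have "K\<^sup>2 \<le> F * G" by (cases "G = 0") (auto simp: zero_le_mult_iff)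
  then show "(\<integral>x. f x * g x \<partial>M)\<^sup>2 \<le> (\<integral>x. (f x)\<^sup>2 \<partial>M) * (\<integral>x. (g x)\<^sup>2 \<partial>M)"
    by (simp add: F_def G_def K_def)
qed

lemma L2_funD:
  assumes "L2_fun \<Omega> f"
  shows "f \<in> borel_measurable (lebesgue_on \<Omega>)" "integrable (lebesgue_on \<Omega>) (\<lambda>x. (norm (f x))\<^sup>2)"
  using assms by (auto simp: L2_fun_def)

lemma L2_fun_lincomb:
  fixes f g :: "pt \<Rightarrow> 'b::euclidean_space"
  assumes f: "L2_fun \<Omega> f" and g: "L2_fun \<Omega> g"
  shows "L2_fun \<Omega> (\<lambda>x. f x + c *\<^sub>R g x)"
  unfolding L2_fun_def
proof
  note [measurable] = L2_funD(1)[OF f] L2_funD(1)[OF g]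
  show "(\<lambda>x. f x + c *\<^sub>R g x) \<in> borel_measurable (lebesgue_on \<Omega>)" by measurable
  show "integrable (lebesgue_on \<Omega>) (\<lambda>x. (norm (f x + c *\<^sub>R g x))\<^sup>2)"
  proof (rule Bochner_Integration.integrable_bound)
    show "integrable (lebesgue_on \<Omega>) (\<lambda>x. 2 * (norm (f x))\<^sup>2 + 2 * c\<^sup>2 * (norm (g x))\<^sup>2)"
      using L2_funD(2)[OF f] L2_funD(2)[OF g] by auto
    show "AE x in lebesgue_on \<Omega>. norm ((norm (f x + c *\<^sub>R g x))\<^sup>2) \<le> norm (2 * (norm (f x))\<^sup>2 + 2 * c\<^sup>2 * (norm (g x))\<^sup>2)"
    proof (rule AE_I2)
      fix x
      have "(norm (f x + c *\<^sub>R g x))\<^sup>2 \<le> (norm (f x) + norm (c *\<^sub>R g x))\<^sup>2"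
        by (intro power_mono norm_triangle_ineq) simp
      also have "\<dots> \<le> 2 * (norm (f x))\<^sup>2 + 2 * (norm (c *\<^sub>R g x))\<^sup>2"
        using sum_squares_bound[of "norm (f x)" "norm (c *\<^sub>R g x)"] by (simp add: power2_sum)
      also have "\<dots> = 2 * (norm (f x))\<^sup>2 + 2 * c\<^sup>2 * (norm (g x))\<^sup>2" by (simp add: power_mult_distrib)
      finally show "norm ((norm (f x + c *\<^sub>R g x))\<^sup>2) \<le> norm (2 * (norm (f x))\<^sup>2 + 2 * c\<^sup>2 * (norm (g x))\<^sup>2)" by simp
    qed
  qed measurable
qed

lemma L2_fun_diff:
  fixes f g :: "pt \<Rightarrow> 'b::euclidean_space"
  assumes "L2_fun \<Omega> f" "L2_fun \<Omega> g" shows "L2_fun \<Omega> (\<lambda>x. f x - g x)"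
  using L2_fun_lincomb[OF assms, of "-1"] by simp

lemma L2_fun_inner:
  fixes f g :: "pt \<Rightarrow> 'b::euclidean_space"
  assumes f: "L2_fun \<Omega> f" and g: "L2_fun \<Omega> g"
  shows "integrable (lebesgue_on \<Omega>) (\<lambda>x. f x \<bullet> g x)"
proof (rule Bochner_Integration.integrable_bound)
  note [measurable] = L2_funD(1)[OF f] L2_funD(1)[OF g]
  show "integrable (lebesgue_on \<Omega>) (\<lambda>x. norm (f x) * norm (g x))"
    using Cauchy_Schwarz_integral(1)[of "\<lambda>x. norm (f x)" _ "\<lambda>x. norm (g x)"] L2_funD[OF f] L2_funD[OF g] by simp
  show "AE x in lebesgue_on \<Omega>. norm (f x \<bullet> g x) \<le> norm (norm (f x) * norm (g x))"
    using Cauchy_Schwarz_ineq2 by (intro AE_I2) auto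
qed (use L2_funD(1)[OF f] L2_funD(1)[OF g] in measurable)

lemma L2_fun_component: "L2_fun \<Omega> g \<Longrightarrow> L2_fun \<Omega> (\<lambda>x. g x $ i)" for g :: "pt \<Rightarrow> pt"
  unfolding L2_fun_def
proof (elim conjE, intro conjI)
  assume [measurable]: "g \<in> borel_measurable (lebesgue_on \<Omega>)" and i: "integrable (lebesgue_on \<Omega>) (\<lambda>x. (norm (g x))\<^sup>2)"
  show [measurable]: "(\<lambda>x. g x $ i) \<in> borel_measurable (lebesgue_on \<Omega>)"
    unfolding cart_eq_inner_axis by measurable
  show "integrable (lebesgue_on \<Omega>) (\<lambda>x. (norm (g x $ i))\<^sup>2)"
  proof (rule Bochner_Integration.integrable_bound[OF i])
    have "(norm (g x $ i))\<^sup>2 \<le> (norm (g x))\<^sup>2" for x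
      by (intro power_mono) (simp_all add: component_le_norm_cart)
    then show "AE x in lebesgue_on \<Omega>. norm ((norm (g x $ i))\<^sup>2) \<le> norm ((norm (g x))\<^sup>2)"
      by (intro AE_I2) simp
  qed measurable
qed

locale bounded_open =
  fixes \<Omega> :: "pt set"
  assumes open_dom: "open \<Omega>" and bounded_dom: "bounded \<Omega>"
begin

abbreviation "M \<equiv> lebesgue_on \<Omega>"

abbreviation intg :: "fld \<Rightarrow> real" where "intg g \<equiv> int_over \<Omega> g"

abbreviation L2 :: "(pt \<Rightarrow> 'b::euclidean_space) \<Rightarrow> bool" where "L2 g \<equiv> L2_fun \<Omega> g"

abbreviation wgrad :: "fld \<Rightarrow> pt \<Rightarrow> pt" where "wgrad u \<equiv> weak_grad \<Omega> u"

abbreviation gsq :: "fld \<Rightarrow> real" where "gsq u \<equiv> grad_sq \<Omega> u"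

lemma dom_sets [simp]: "\<Omega> \<in> sets lebesgue"
  using open_dom by simp

lemma dom_lmeasurable: "\<Omega> \<in> lmeasurable"
  using open_dom bounded_dom by (simp add: lmeasurable_open)

sublocale finite_measure M
  by (rule finite_measure_lebesgue_on[OF dom_lmeasurable])

lemma continuous_measurable [measurable (raw)]:
  fixes f :: "pt \<Rightarrow> 'b::euclidean_space"
  shows "continuous_on UNIV f \<Longrightarrow> f \<in> borel_measurable M"
  by (simp add: measurable_completion measurable_restrict_space1 borel_measurable_continuous_onI)

lemma continuous_bounded:
  fixes f :: "pt \<Rightarrow> 'b::euclidean_space"
  assumes "continuous_on UNIV f"
  obtains B where "B \<ge> 0" "\<And>x. x \<in> \<Omega> \<Longrightarrow> norm (f x) \<le> B"
proof -
  have "compact (f ` closure \<Omega>)"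
    using bounded_dom assms by (intro compact_continuous_image) (auto intro: continuous_on_subset)
  then obtain B where "\<forall>y\<in>f ` closure \<Omega>. norm y \<le> B" using compact_imp_bounded bounded_iff by blast
  then have "\<And>x. x \<in> \<Omega> \<Longrightarrow> norm (f x) \<le> max B 0" using closure_subset[of \<Omega>] by (metis imageI max.coboundedI1 subsetD)
  then show thesis using that[of "max B 0"] by auto
qed

lemma L2_fun_continuous:
  fixes f :: "pt \<Rightarrow> 'b::euclidean_space"
  assumes c: "continuous_on UNIV f"
  shows "L2 f"
proof -
  obtain B where B: "B \<ge> 0" "\<And>x. x \<in> \<Omega> \<Longrightarrow> norm (f x) \<le> B" using continuous_bounded[OF c] by metis
  have [measurable]: "f \<in> borel_measurable M" by (rule continuous_measurable[OF c])
  have "integrable M (\<lambda>x. (norm (f x))\<^sup>2)"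
    by (rule integrable_const_bound[where B="B\<^sup>2"]) (auto intro!: AE_I2 power_mono B)
  then show ?thesis by (simp add: L2_fun_def)
qed

lemma L2_fun_test: "\<eta> \<in> test_functions \<Omega> \<Longrightarrow> L2 \<eta>" "\<eta> \<in> test_functions \<Omega> \<Longrightarrow> L2 (partial_at i \<eta>)"
  using test_functions_vanish(1) smooth_differentiable by (auto intro!: L2_fun_continuous)

lemma L2_fun_integrable: "L2 (f :: fld) \<Longrightarrow> integrable M f"
  using L2_fun_inner[of \<Omega> f "\<lambda>_. 1"] L2_fun_continuous[of "\<lambda>_. 1::real"] by simp

lemma has_weak_gradientD:
  assumes "has_weak_gradient \<Omega> u g" "\<eta> \<in> test_functions \<Omega>"
  shows "intg (\<lambda>x. u x * partial_at i \<eta> x) = - intg (\<lambda>x. g x $ i * \<eta> x)"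
  using assms by (simp add: has_weak_gradient_def)

text \<open>The fundamental lemma applied to each component. As \<open>weak_grad\<close> is a
  choice, this is what allows any explicitly known gradient to be used in its place.\<close>

lemma weak_gradient_unique:
  assumes g: "has_weak_gradient \<Omega> u g" and g': "has_weak_gradient \<Omega> u g'"
  shows "AE x in M. g x = g' x"
proof -
  have L: "L2 g" "L2 g'" using g g' by (auto simp: has_weak_gradient_def)
  have "AE x in M. g x $ i - g' x $ i = 0" for i
  proof (rule fundamental_lemma[OF open_dom])
    note Li = L2_fun_component[OF L(1), of i] L2_fun_component[OF L(2), of i]
    show "integrable M (\<lambda>x. g x $ i - g' x $ i)"
      using L2_fun_integrable[OF L2_fun_diff[OF Li]] .
    fix \<eta> assume \<eta>: "\<eta> \<in> test_functions \<Omega>"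
    have "intg (\<lambda>x. g x $ i * \<eta> x) = intg (\<lambda>x. g' x $ i * \<eta> x)"
      using has_weak_gradientD[OF g \<eta>, of i] has_weak_gradientD[OF g' \<eta>, of i] by linarith
    then show "intg (\<lambda>x. (g x $ i - g' x $ i) * \<eta> x) = 0"
      using L2_fun_inner[OF Li(1) L2_fun_test(1)[OF \<eta>]] L2_fun_inner[OF Li(2) L2_fun_test(1)[OF \<eta>]]
      by (simp add: left_diff_distrib)
  qed
  then have "AE x in M. \<forall>i\<in>UNIV. g x $ i - g' x $ i = 0" by (intro AE_finite_allI) auto
  then show ?thesis by eventually_elim (simp add: vec_eq_iff)
qed

lemma weak_grad: "u \<in> H1 \<Omega> \<Longrightarrow> has_weak_gradient \<Omega> u (wgrad u)"
  unfolding H1_def weak_grad_def mem_Collect_eq by (erule someI_ex)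

lemma has_weak_gradient_H1: "has_weak_gradient \<Omega> u g \<Longrightarrow> u \<in> H1 \<Omega>"
  by (auto simp: H1_def)

lemma weak_grad_AE: "has_weak_gradient \<Omega> u g \<Longrightarrow> AE x in M. wgrad u x = g x"
  using weak_gradient_unique weak_grad has_weak_gradient_H1 by blast

lemma has_weak_gradient_L2:
  assumes "has_weak_gradient \<Omega> u g" shows "L2 u" "L2 g"
  using assms by (auto simp: has_weak_gradient_def)

lemma grad_sq_eq:
  assumes "has_weak_gradient \<Omega> u g" shows "gsq u = intg (\<lambda>x. (norm (g x))\<^sup>2)"
proof -
  note [measurable] = L2_funD(1)[OF has_weak_gradient_L2(2)[OF assms]]
    L2_funD(1)[OF has_weak_gradient_L2(2)[OF weak_grad[OF has_weak_gradient_H1[OF assms]]]]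
  show ?thesis unfolding grad_sq_def by (rule integral_cong_AE) (use weak_grad_AE[OF assms] in auto)
qed

lemma has_weak_gradient_lincomb:
  assumes u: "has_weak_gradient \<Omega> u g" and v: "has_weak_gradient \<Omega> v h"
  shows "has_weak_gradient \<Omega> (\<lambda>x. u x + c * v x) (\<lambda>x. g x + c *\<^sub>R h x)"
  unfolding has_weak_gradient_def
proof (intro conjI ballI allI)
  note L = has_weak_gradient_L2[OF u] has_weak_gradient_L2[OF v]
  show "L2 (\<lambda>x. u x + c * v x)" using L2_fun_lincomb[OF L(1) L(3), of c] by simp
  show "L2 (\<lambda>x. g x + c *\<^sub>R h x)" by (rule L2_fun_lincomb[OF L(2) L(4)])
  fix \<eta> i assume \<eta>: "\<eta> \<in> test_functions \<Omega>"
  note T = L2_fun_test[OF \<eta>]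
  note I = L2_fun_inner[OF L(1) T(2)[of i]] L2_fun_inner[OF L(3) T(2)[of i]]
    L2_fun_inner[OF L2_fun_component[OF L(2), of i] T(1)] L2_fun_inner[OF L2_fun_component[OF L(4), of i] T(1)]
  have "intg (\<lambda>x. (u x + c * v x) * partial_at i \<eta> x) = intg (\<lambda>x. u x * partial_at i \<eta> x) + c * intg (\<lambda>x. v x * partial_at i \<eta> x)"
    using I by (simp add: distrib_right mult.assoc)
  also have "\<dots> = - intg (\<lambda>x. g x $ i * \<eta> x) + c * - intg (\<lambda>x. h x $ i * \<eta> x)"
    unfolding has_weak_gradientD[OF u \<eta>] has_weak_gradientD[OF v \<eta>] ..
  also have "\<dots> = - intg (\<lambda>x. (g x + c *\<^sub>R h x) $ i * \<eta> x)"
    using I by (simp add: distrib_right mult.assoc)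
  finally show "intg (\<lambda>x. (u x + c * v x) * partial_at i \<eta> x) = - intg (\<lambda>x. (g x + c *\<^sub>R h x) $ i * \<eta> x)" .
qed

lemma has_weak_gradient_smooth:
  assumes u: "smooth_on UNIV u"
  shows "has_weak_gradient \<Omega> u (\<lambda>x. \<chi> i. partial_at i u x)"
  unfolding has_weak_gradient_def
proof (intro conjI ballI allI)
  show "L2 u" by (rule L2_fun_continuous[OF smooth_differentiable(2)[OF u]])
  show "L2 (\<lambda>x. \<chi> i. partial_at i u x)"
    by (intro L2_fun_continuous continuous_on_vec_lambda smooth_differentiable(3)[OF u])
  fix \<eta> i assume "\<eta> \<in> test_functions \<Omega>"
  then show "intg (\<lambda>x. u x * partial_at i \<eta> x) = - intg (\<lambda>x. (\<chi> i. partial_at i u x) $ i * \<eta> x)"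
    using smooth_partial_parts[OF u] by simp
qed

lemma L2_tendsto_inner:
  fixes f :: "nat \<Rightarrow> fld"
  assumes f: "\<And>n. L2 (f n)" and F: "L2 F" and h: "L2 h"
    and lim: "(\<lambda>n. intg (\<lambda>x. (f n x - F x)\<^sup>2)) \<longlonglongrightarrow> 0"
  shows "(\<lambda>n. intg (\<lambda>x. f n x * h x)) \<longlonglongrightarrow> intg (\<lambda>x. F x * h x)"
proof -
  have d: "L2 (\<lambda>x. f n x - F x)" for n by (rule L2_fun_diff[OF f F])
  have CS: "(intg (\<lambda>x. (f n x - F x) * h x))\<^sup>2 \<le> intg (\<lambda>x. (f n x - F x)\<^sup>2) * intg (\<lambda>x. (h x)\<^sup>2)" for n
    using L2_funD[OF d[of n]] L2_funD[OF h] by (intro Cauchy_Schwarz_integral) auto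
  have "(\<lambda>n. intg (\<lambda>x. (f n x - F x)\<^sup>2) * intg (\<lambda>x. (h x)\<^sup>2)) \<longlonglongrightarrow> 0"
    using lim by (rule tendsto_mult_left_zero)
  then have "(\<lambda>n. (intg (\<lambda>x. (f n x - F x) * h x))\<^sup>2) \<longlonglongrightarrow> 0"
    by (rule tendsto_sandwich[OF _ _ tendsto_const, rotated 2]) (auto intro!: always_eventually CS)
  then have "(\<lambda>n. sqrt ((intg (\<lambda>x. (f n x - F x) * h x))\<^sup>2)) \<longlonglongrightarrow> sqrt 0" by (rule tendsto_real_sqrt)
  then have "(\<lambda>n. intg (\<lambda>x. (f n x - F x) * h x)) \<longlonglongrightarrow> 0" by (simp add: tendsto_rabs_zero_iff)
  moreover have "intg (\<lambda>x. (f n x - F x) * h x) = intg (\<lambda>x. f n x * h x) - intg (\<lambda>x. F x * h x)" for n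
    using L2_fun_inner[OF f[of n] h] L2_fun_inner[OF F h] by (simp add: left_diff_distrib)
  ultimately show ?thesis by (simp add: LIM_zero_iff)
qed

text \<open>Both sides of the defining identity are L2 inner products with a fixed function, hence
  continuous under the two limits.\<close>

lemma weak_gradient_closed:
  assumes u: "\<And>n. has_weak_gradient \<Omega> (u n) (g n)"
    and v: "L2 v" and h: "L2 h"
    and limu: "(\<lambda>n. intg (\<lambda>x. (u n x - v x)\<^sup>2)) \<longlonglongrightarrow> 0"
    and limg: "(\<lambda>n. intg (\<lambda>x. (norm (g n x - h x))\<^sup>2)) \<longlonglongrightarrow> 0"
  shows "has_weak_gradient \<Omega> v h"
  unfolding has_weak_gradient_def
proof (intro conjI ballI allI v h)
  fix \<eta> i assume \<eta>: "\<eta> \<in> test_functions \<Omega>"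
  note T = L2_fun_test[OF \<eta>]
  note L = has_weak_gradient_L2[OF u]
  have "(\<lambda>n. intg (\<lambda>x. u n x * partial_at i \<eta> x)) \<longlonglongrightarrow> intg (\<lambda>x. v x * partial_at i \<eta> x)"
    by (rule L2_tendsto_inner[OF L(1) v T(2) limu])
  moreover have "(\<lambda>n. intg (\<lambda>x. g n x $ i * \<eta> x)) \<longlonglongrightarrow> intg (\<lambda>x. h x $ i * \<eta> x)"
  proof (rule L2_tendsto_inner[OF L2_fun_component[OF L(2)] L2_fun_component[OF h] T(1)])
    have "intg (\<lambda>x. (g n x $ i - h x $ i)\<^sup>2) \<le> intg (\<lambda>x. (norm (g n x - h x))\<^sup>2)" for n
    proof (rule integral_mono_AE)
      note D = L2_fun_diff[OF L(2)[of n] h]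
      show "integrable M (\<lambda>x. (g n x $ i - h x $ i)\<^sup>2)" using L2_funD(2)[OF L2_fun_component[OF D, of i]] by simp
      show "integrable M (\<lambda>x. (norm (g n x - h x))\<^sup>2)" using L2_funD(2)[OF D] .
      show "AE x in M. (g n x $ i - h x $ i)\<^sup>2 \<le> (norm (g n x - h x))\<^sup>2"
        using component_le_norm_cart[of "g n x - h x" i for x] by (intro AE_I2) (metis abs_le_square_iff abs_norm_cancel vector_minus_component)
    qed
    then show "(\<lambda>n. intg (\<lambda>x. (g n x $ i - h x $ i)\<^sup>2)) \<longlonglongrightarrow> 0"
      by (intro tendsto_sandwich[OF _ _ tendsto_const limg] always_eventually allI) auto
  qed
  then have "(\<lambda>n. intg (\<lambda>x. u n x * partial_at i \<eta> x)) \<longlonglongrightarrow> - intg (\<lambda>x. h x $ i * \<eta> x)"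
    unfolding has_weak_gradientD[OF u \<eta>] by (rule tendsto_minus)
  ultimately show "intg (\<lambda>x. v x * partial_at i \<eta> x) = - intg (\<lambda>x. h x $ i * \<eta> x)"
    by (rule LIMSEQ_unique)
qed

lemma L2_tendsto_norm:
  fixes f :: "nat \<Rightarrow> pt \<Rightarrow> 'b::euclidean_space"
  assumes f: "\<And>n. L2 (f n)" and F: "L2 F"
    and lim: "(\<lambda>n. integral\<^sup>L M (\<lambda>x. (norm (f n x - F x))\<^sup>2)) \<longlonglongrightarrow> 0"
  shows "(\<lambda>n. integral\<^sup>L M (\<lambda>x. (norm (f n x))\<^sup>2)) \<longlonglongrightarrow> integral\<^sup>L M (\<lambda>x. (norm (F x))\<^sup>2)"
proof -
  define d where "d n x = f n x - F x" for n x
  have d: "L2 (d n)" for n unfolding d_def by (rule L2_fun_diff[OF f F])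
  have I: "integrable M (\<lambda>x. d n x \<bullet> F x)" for n by (rule L2_fun_inner[OF d F])
  have CS: "(integral\<^sup>L M (\<lambda>x. d n x \<bullet> F x))\<^sup>2 \<le> integral\<^sup>L M (\<lambda>x. (norm (d n x))\<^sup>2) * integral\<^sup>L M (\<lambda>x. (norm (F x))\<^sup>2)" for n
  proof -
    have J: "integrable M (\<lambda>x. norm (d n x) * norm (F x))"
      using L2_funD[OF d[of n]] L2_funD[OF F] by (intro Cauchy_Schwarz_integral(1)) auto
    have "\<bar>integral\<^sup>L M (\<lambda>x. d n x \<bullet> F x)\<bar> \<le> integral\<^sup>L M (\<lambda>x. \<bar>d n x \<bullet> F x\<bar>)" by (rule integral_abs_bound)
    also have "\<dots> \<le> integral\<^sup>L M (\<lambda>x. norm (d n x) * norm (F x))"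
      using I J by (intro integral_mono Cauchy_Schwarz_ineq2) auto
    finally have "\<bar>integral\<^sup>L M (\<lambda>x. d n x \<bullet> F x)\<bar> \<le> integral\<^sup>L M (\<lambda>x. norm (d n x) * norm (F x))" .
    from power_mono[OF this abs_ge_zero, of 2]
    have "(integral\<^sup>L M (\<lambda>x. d n x \<bullet> F x))\<^sup>2 \<le> (integral\<^sup>L M (\<lambda>x. norm (d n x) * norm (F x)))\<^sup>2"
      unfolding power2_abs .
    also have "\<dots> \<le> integral\<^sup>L M (\<lambda>x. (norm (d n x))\<^sup>2) * integral\<^sup>L M (\<lambda>x. (norm (F x))\<^sup>2)"
      using L2_funD[OF d[of n]] L2_funD[OF F] by (intro Cauchy_Schwarz_integral(2)) auto
    finally show ?thesis .
  qed
  have "(\<lambda>n. integral\<^sup>L M (\<lambda>x. (norm (d n x))\<^sup>2) * integral\<^sup>L M (\<lambda>x. (norm (F x))\<^sup>2)) \<longlonglongrightarrow> 0"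
    using lim unfolding d_def by (rule tendsto_mult_left_zero)
  then have "(\<lambda>n. (integral\<^sup>L M (\<lambda>x. d n x \<bullet> F x))\<^sup>2) \<longlonglongrightarrow> 0"
    by (rule tendsto_sandwich[OF _ _ tendsto_const, rotated 2]) (auto intro!: always_eventually CS)
  then have "(\<lambda>n. sqrt ((integral\<^sup>L M (\<lambda>x. d n x \<bullet> F x))\<^sup>2)) \<longlonglongrightarrow> sqrt 0" by (rule tendsto_real_sqrt)
  then have l1: "(\<lambda>n. integral\<^sup>L M (\<lambda>x. d n x \<bullet> F x)) \<longlonglongrightarrow> 0" by (simp add: tendsto_rabs_zero_iff)
  have "(norm (f n x))\<^sup>2 = (norm (d n x))\<^sup>2 + 2 * (d n x \<bullet> F x) + (norm (F x))\<^sup>2" for n x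
    unfolding d_def power2_norm_eq_inner by (simp add: inner_diff_left inner_diff_right inner_commute)
  then have "integral\<^sup>L M (\<lambda>x. (norm (f n x))\<^sup>2)
      = integral\<^sup>L M (\<lambda>x. (norm (d n x))\<^sup>2) + 2 * integral\<^sup>L M (\<lambda>x. d n x \<bullet> F x) + integral\<^sup>L M (\<lambda>x. (norm (F x))\<^sup>2)" for n
    using L2_funD(2)[OF d[of n]] L2_funD(2)[OF F] I[of n] by simp
  moreover have "(\<lambda>n. integral\<^sup>L M (\<lambda>x. (norm (d n x))\<^sup>2) + 2 * integral\<^sup>L M (\<lambda>x. d n x \<bullet> F x) + integral\<^sup>L M (\<lambda>x. (norm (F x))\<^sup>2))
      \<longlonglongrightarrow> 0 + 2 * 0 + integral\<^sup>L M (\<lambda>x. (norm (F x))\<^sup>2)"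
    using lim unfolding d_def[symmetric] by (intro tendsto_add tendsto_mult tendsto_const l1)
  ultimately show ?thesis by simp
qed

definition h1_sq :: "fld \<Rightarrow> real" where
  "h1_sq u = intg (\<lambda>x. (u x)\<^sup>2) + gsq u"

lemma grad_sq_nonneg: "gsq u \<ge> 0" by (simp add: grad_sq_def)

lemma h1_sq_nonneg: "h1_sq u \<ge> 0" by (simp add: h1_sq_def grad_sq_nonneg)

lemma h1_norm_sqrt: "h1_norm \<Omega> u = sqrt (h1_sq u)" by (simp add: h1_norm_def h1_sq_def)

lemma h1_sq_less: "h1_norm \<Omega> u < e \<Longrightarrow> h1_sq u < e\<^sup>2"
  using h1_sq_nonneg[of u] unfolding h1_norm_sqrt
  by (metis real_sqrt_pow2 power_strict_mono real_sqrt_ge_zero zero_less_numeral)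

lemma h1_norm_less: "e > 0 \<Longrightarrow> h1_sq u < e\<^sup>2 \<Longrightarrow> h1_norm \<Omega> u < e"
  unfolding h1_norm_sqrt by (metis less_le real_sqrt_less_iff real_sqrt_abs abs_of_pos)

lemma h1_sq_eq:
  assumes "has_weak_gradient \<Omega> u g" shows "h1_sq u = intg (\<lambda>x. (u x)\<^sup>2) + intg (\<lambda>x. (norm (g x))\<^sup>2)"
  by (simp add: h1_sq_def grad_sq_eq[OF assms])

lemma integral_norm_sq_add_le:
  fixes f g :: "pt \<Rightarrow> 'b::euclidean_space"
  assumes f: "L2 f" and g: "L2 g"
  shows "integral\<^sup>L M (\<lambda>x. (norm (f x + g x))\<^sup>2) \<le> 2 * integral\<^sup>L M (\<lambda>x. (norm (f x))\<^sup>2) + 2 * integral\<^sup>L M (\<lambda>x. (norm (g x))\<^sup>2)"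
proof -
  have "integral\<^sup>L M (\<lambda>x. (norm (f x + g x))\<^sup>2) \<le> integral\<^sup>L M (\<lambda>x. 2 * (norm (f x))\<^sup>2 + 2 * (norm (g x))\<^sup>2)"
  proof (rule integral_mono)
    show "integrable M (\<lambda>x. (norm (f x + g x))\<^sup>2)" using L2_funD(2)[OF L2_fun_lincomb[OF f g, of 1]] by simp
    show "integrable M (\<lambda>x. 2 * (norm (f x))\<^sup>2 + 2 * (norm (g x))\<^sup>2)" using L2_funD(2)[OF f] L2_funD(2)[OF g] by simp
    fix x
    have "(norm (f x + g x))\<^sup>2 \<le> (norm (f x) + norm (g x))\<^sup>2" by (intro power_mono norm_triangle_ineq) simp
    also have "\<dots> \<le> 2 * (norm (f x))\<^sup>2 + 2 * (norm (g x))\<^sup>2"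
      using sum_squares_bound[of "norm (f x)" "norm (g x)"] by (simp add: power2_sum)
    finally show "(norm (f x + g x))\<^sup>2 \<le> 2 * (norm (f x))\<^sup>2 + 2 * (norm (g x))\<^sup>2" .
  qed
  then show ?thesis using L2_funD(2)[OF f] L2_funD(2)[OF g] by simp
qed

lemma h1_sq_add_le:
  assumes u: "u \<in> H1 \<Omega>" and v: "v \<in> H1 \<Omega>"
  shows "h1_sq (\<lambda>x. u x + v x) \<le> 2 * h1_sq u + 2 * h1_sq v"
proof -
  note U = weak_grad[OF u] and V = weak_grad[OF v]
  have "h1_sq (\<lambda>x. u x + v x) = intg (\<lambda>x. (u x + v x)\<^sup>2) + intg (\<lambda>x. (norm (wgrad u x + wgrad v x))\<^sup>2)"
    using h1_sq_eq[OF has_weak_gradient_lincomb[OF U V, of 1]] by simp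
  then show ?thesis
    using integral_norm_sq_add_le[OF has_weak_gradient_L2(1)[OF U] has_weak_gradient_L2(1)[OF V]]
      integral_norm_sq_add_le[OF has_weak_gradient_L2(2)[OF U] has_weak_gradient_L2(2)[OF V]]
    by (simp add: h1_sq_eq[OF U] h1_sq_eq[OF V])
qed

abbreviation grad :: "fld \<Rightarrow> pt \<Rightarrow> pt" where "grad u x \<equiv> \<chi> i. partial_at i u x"

end

text \<open>Treats both boundary conditions at once: \<open>D\<close> will be the compactly
  supported test functions or the smooth periodic functions. What is proved for the smooth elements
  of \<open>D\<close> passes to its closure by density.\<close>

locale trial_space = bounded_open +
  fixes D :: "fld set"
  assumes D_smooth: "\<eta> \<in> D \<Longrightarrow> smooth_on UNIV \<eta>"
    and D_lincomb: "\<eta> \<in> D \<Longrightarrow> \<zeta> \<in> D \<Longrightarrow> (\<lambda>x. \<eta> x + c * \<zeta> x) \<in> D"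
begin

abbreviation "X \<equiv> H1_closure \<Omega> D"

lemma X_H1: "u \<in> X \<Longrightarrow> u \<in> H1 \<Omega>" by (simp add: H1_closure_def)

lemma X_grad: "u \<in> X \<Longrightarrow> has_weak_gradient \<Omega> u (wgrad u)"
  by (rule weak_grad[OF X_H1])

lemma D_grad: "\<eta> \<in> D \<Longrightarrow> has_weak_gradient \<Omega> \<eta> (grad \<eta>)"
  by (rule has_weak_gradient_smooth[OF D_smooth])

lemma X_approx:
  assumes u: "u \<in> X"
  obtains \<zeta> where "\<And>n. \<zeta> n \<in> D" "(\<lambda>n. intg (\<lambda>x. (\<zeta> n x - u x)\<^sup>2)) \<longlonglongrightarrow> 0"
    "(\<lambda>n. intg (\<lambda>x. (norm (grad (\<zeta> n) x - wgrad u x))\<^sup>2)) \<longlonglongrightarrow> 0"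
proof -
  have "\<forall>n. \<exists>\<eta>\<in>D. h1_norm \<Omega> (\<lambda>x. u x - \<eta> x) < inverse (real (Suc n))"
    using u by (auto simp: H1_closure_def)
  then obtain \<zeta> where \<zeta>: "\<And>n. \<zeta> n \<in> D" "\<And>n. h1_norm \<Omega> (\<lambda>x. u x - \<zeta> n x) < inverse (real (Suc n))" by metis
  have e: "h1_sq (\<lambda>x. u x - \<zeta> n x) = intg (\<lambda>x. (\<zeta> n x - u x)\<^sup>2) + intg (\<lambda>x. (norm (grad (\<zeta> n) x - wgrad u x))\<^sup>2)" for n
    using h1_sq_eq[OF has_weak_gradient_lincomb[OF X_grad[OF u] D_grad[OF \<zeta>(1)[of n]], of "-1"]]
    by (simp add: power2_commute[of "u _"] norm_minus_commute[of "wgrad u _"])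
  have b: "intg (\<lambda>x. (\<zeta> n x - u x)\<^sup>2) + intg (\<lambda>x. (norm (grad (\<zeta> n) x - wgrad u x))\<^sup>2) \<le> (inverse (real (Suc n)))\<^sup>2" for n
    using h1_sq_less[OF \<zeta>(2)[of n]] unfolding e by simp
  have l: "(\<lambda>n. (inverse (real (Suc n)))\<^sup>2) \<longlonglongrightarrow> 0"
    using tendsto_power[OF LIMSEQ_inverse_real_of_nat, of 2] by simp
  have nn: "0 \<le> intg (\<lambda>x. (\<zeta> n x - u x)\<^sup>2)" "0 \<le> intg (\<lambda>x. (norm (grad (\<zeta> n) x - wgrad u x))\<^sup>2)" for n
    by simp_all
  have b1: "intg (\<lambda>x. (\<zeta> n x - u x)\<^sup>2) \<le> (inverse (real (Suc n)))\<^sup>2"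
    "intg (\<lambda>x. (norm (grad (\<zeta> n) x - wgrad u x))\<^sup>2) \<le> (inverse (real (Suc n)))\<^sup>2" for n
    using b[of n] nn[of n] by linarith+
  have "(\<lambda>n. intg (\<lambda>x. (\<zeta> n x - u x)\<^sup>2)) \<longlonglongrightarrow> 0"
    by (rule tendsto_sandwich[OF _ _ tendsto_const l]) (intro always_eventually allI nn b1)+
  moreover have "(\<lambda>n. intg (\<lambda>x. (norm (grad (\<zeta> n) x - wgrad u x))\<^sup>2)) \<longlonglongrightarrow> 0"
    by (rule tendsto_sandwich[OF _ _ tendsto_const l]) (intro always_eventually allI nn b1)+
  ultimately show thesis by (rule that[OF \<zeta>(1)])
qed

lemma D_subset_X: "\<eta> \<in> D \<Longrightarrow> \<eta> \<in> X"
proof -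
  assume \<eta>: "\<eta> \<in> D"
  have "h1_sq (\<lambda>x. 0) = 0"
    using h1_sq_eq[OF has_weak_gradient_lincomb[OF D_grad[OF \<eta>] D_grad[OF \<eta>], of "-1"]] by simp
  then have "h1_norm \<Omega> (\<lambda>x. \<eta> x - \<eta> x) < e" if "e > 0" for e
    using that by (simp add: h1_norm_sqrt)
  then show "\<eta> \<in> X"
    unfolding H1_closure_def mem_Collect_eq using has_weak_gradient_H1[OF D_grad[OF \<eta>]] \<eta> by (intro conjI allI impI bexI[of _ \<eta>])
qed

text \<open>A limit of elements of the closure lies in the closure: \<open>v\<close> is approximated
  by some \<open>u n\<close>, and this by an element of \<open>D\<close>, each within
  \<open>e / 2\<close>.\<close>

lemma X_closed:
  assumes u: "\<And>n. u n \<in> X" "\<And>n. has_weak_gradient \<Omega> (u n) (g n)"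
    and v: "L2 v" and h: "L2 h"
    and limu: "(\<lambda>n. intg (\<lambda>x. (u n x - v x)\<^sup>2)) \<longlonglongrightarrow> 0"
    and limg: "(\<lambda>n. intg (\<lambda>x. (norm (g n x - h x))\<^sup>2)) \<longlonglongrightarrow> 0"
  shows "v \<in> X" "has_weak_gradient \<Omega> v h"
proof -
  show V: "has_weak_gradient \<Omega> v h" by (rule weak_gradient_closed[OF u(2) v h limu limg])
  have "\<exists>\<eta>\<in>D. h1_norm \<Omega> (\<lambda>x. v x - \<eta> x) < e" if e: "e > 0" for e
  proof -
    have d: "h1_sq (\<lambda>x. v x - u n x) = intg (\<lambda>x. (u n x - v x)\<^sup>2) + intg (\<lambda>x. (norm (g n x - h x))\<^sup>2)" for n
      using h1_sq_eq[OF has_weak_gradient_lincomb[OF V u(2)[of n], of "-1"]]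
      by (simp add: power2_commute[of "v _"] norm_minus_commute[of "h _"])
    have "(\<lambda>n. h1_sq (\<lambda>x. v x - u n x)) \<longlonglongrightarrow> 0" unfolding d using tendsto_add[OF limu limg] by simp
    then have "\<forall>\<^sub>F n in sequentially. h1_sq (\<lambda>x. v x - u n x) < (e/2)\<^sup>2 "
      using e by (intro order_tendstoD) auto
    then obtain n where n: "h1_sq (\<lambda>x. v x - u n x) < (e/2)\<^sup>2" by (auto simp: eventually_sequentially)
    obtain \<eta> where \<eta>: "\<eta> \<in> D" "h1_norm \<Omega> (\<lambda>x. u n x - \<eta> x) < e / 2"
    proof -
      have "\<exists>\<eta>\<in>D. h1_norm \<Omega> (\<lambda>x. u n x - \<eta> x) < e / 2"
        using u(1)[of n] half_gt_zero[OF e] unfolding H1_closure_def by blast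
      then show thesis by (elim bexE) (rule that)
    qed
    have 1: "(\<lambda>x. v x - u n x) \<in> H1 \<Omega>" "(\<lambda>x. u n x - \<eta> x) \<in> H1 \<Omega>"
      using has_weak_gradient_H1[OF has_weak_gradient_lincomb[OF V u(2)[of n], of "-1"]]
        has_weak_gradient_H1[OF has_weak_gradient_lincomb[OF u(2)[of n] D_grad[OF \<eta>(1)], of "-1"]] by simp_all
    have "h1_sq (\<lambda>x. v x - \<eta> x) \<le> 2 * h1_sq (\<lambda>x. v x - u n x) + 2 * h1_sq (\<lambda>x. u n x - \<eta> x)"
      using h1_sq_add_le[OF 1] by simp
    also have "\<dots> < e\<^sup>2"
      using n h1_sq_less[OF \<eta>(2)] by (simp add: power_divide)
    finally show ?thesis by (intro bexI[OF h1_norm_less[OF e] \<eta>(1)])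
  qed
  then show "v \<in> X"
    unfolding H1_closure_def mem_Collect_eq using has_weak_gradient_H1[OF V] by (intro conjI allI impI)
qed

lemma X_lincomb:
  assumes u: "u \<in> X" and v: "v \<in> X"
  shows "(\<lambda>x. u x + c * v x) \<in> X"
proof -
  obtain \<zeta> where z: "\<And>n. \<zeta> n \<in> D" "(\<lambda>n. intg (\<lambda>x. (\<zeta> n x - u x)\<^sup>2)) \<longlonglongrightarrow> 0"
    "(\<lambda>n. intg (\<lambda>x. (norm (grad (\<zeta> n) x - wgrad u x))\<^sup>2)) \<longlonglongrightarrow> 0" by (rule X_approx[OF u]) (rule that; assumption)
  obtain \<xi> where x: "\<And>n. \<xi> n \<in> D" "(\<lambda>n. intg (\<lambda>x. (\<xi> n x - v x)\<^sup>2)) \<longlonglongrightarrow> 0"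
    "(\<lambda>n. intg (\<lambda>x. (norm (grad (\<xi> n) x - wgrad v x))\<^sup>2)) \<longlonglongrightarrow> 0" by (rule X_approx[OF v]) (rule that; assumption)
  note W = has_weak_gradient_lincomb[OF X_grad[OF u] X_grad[OF v], of c]
  note Wn = has_weak_gradient_lincomb[OF D_grad[OF z(1)] D_grad[OF x(1)], of _ c]
  \<comment> \<open>Stated for vector-valued functions, so that it serves for the functions and for
    their gradients.\<close>
  have gen: "(\<lambda>n. integral\<^sup>L M (\<lambda>x. (norm ((a n x + c *\<^sub>R b n x) - (A x + c *\<^sub>R B x)))\<^sup>2)) \<longlonglongrightarrow> 0"
    if L: "\<And>n. L2 (a n)" "\<And>n. L2 (b n)" "L2 A" "L2 B"
      and la: "(\<lambda>n. integral\<^sup>L M (\<lambda>x. (norm (a n x - A x))\<^sup>2)) \<longlonglongrightarrow> 0" and lb: "(\<lambda>n. integral\<^sup>L M (\<lambda>x. (norm (b n x - B x))\<^sup>2)) \<longlonglongrightarrow> 0"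
    for a b :: "nat \<Rightarrow> pt \<Rightarrow> 'b::euclidean_space" and A B
  proof -
    have bnd: "integral\<^sup>L M (\<lambda>x. (norm ((a n x + c *\<^sub>R b n x) - (A x + c *\<^sub>R B x)))\<^sup>2)
      \<le> 2 * integral\<^sup>L M (\<lambda>x. (norm (a n x - A x))\<^sup>2) + 2 * c\<^sup>2 * integral\<^sup>L M (\<lambda>x. (norm (b n x - B x))\<^sup>2)" for n
    proof -
      have "L2 (\<lambda>x. c *\<^sub>R (b n x - B x))"
        using L2_fun_lincomb[OF L2_fun_continuous[of "\<lambda>_. 0"] L2_fun_diff[OF L(2)[of n] L(4)], of c] by simp
      from integral_norm_sq_add_le[OF L2_fun_diff[OF L(1)[of n] L(3)] this]
      have "integral\<^sup>L M (\<lambda>x. (norm ((a n x - A x) + c *\<^sub>R (b n x - B x)))\<^sup>2)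
        \<le> 2 * integral\<^sup>L M (\<lambda>x. (norm (a n x - A x))\<^sup>2) + 2 * integral\<^sup>L M (\<lambda>x. (norm (c *\<^sub>R (b n x - B x)))\<^sup>2)" .
      moreover have e1: "(a n x - A x) + c *\<^sub>R (b n x - B x) = (a n x + c *\<^sub>R b n x) - (A x + c *\<^sub>R B x)" for x
        by (simp add: algebra_simps)
      moreover have e2: "integral\<^sup>L M (\<lambda>x. (norm (c *\<^sub>R (b n x - B x)))\<^sup>2) = c\<^sup>2 * integral\<^sup>L M (\<lambda>x. (norm (b n x - B x))\<^sup>2)"
        by (simp add: power_mult_distrib)
      ultimately show ?thesis unfolding e1 e2 mult.assoc by blast
    qed
    have "(\<lambda>n. 2 * integral\<^sup>L M (\<lambda>x. (norm (a n x - A x))\<^sup>2) + 2 * c\<^sup>2 * integral\<^sup>L M (\<lambda>x. (norm (b n x - B x))\<^sup>2)) \<longlonglongrightarrow> 2 * 0 + 2 * c\<^sup>2 * 0"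
      by (intro tendsto_intros la lb)
    then have lim: "(\<lambda>n. 2 * integral\<^sup>L M (\<lambda>x. (norm (a n x - A x))\<^sup>2) + 2 * c\<^sup>2 * integral\<^sup>L M (\<lambda>x. (norm (b n x - B x))\<^sup>2)) \<longlonglongrightarrow> 0"
      by simp
    show ?thesis by (rule tendsto_zero_bounded[OF _ bnd lim]) simp
  qed
  show ?thesis
  proof (rule X_closed(1)[OF D_subset_X[OF D_lincomb[OF z(1) x(1)]] Wn])
    show "L2 (\<lambda>x. u x + c * v x)" "L2 (\<lambda>x. wgrad u x + c *\<^sub>R wgrad v x)"
      using has_weak_gradient_L2[OF W] .
    show "(\<lambda>n. intg (\<lambda>x. (\<zeta> n x + c * \<xi> n x - (u x + c * v x))\<^sup>2)) \<longlonglongrightarrow> 0"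
    proof -
      have "(\<lambda>n. intg (\<lambda>x. (norm (\<zeta> n x - u x))\<^sup>2)) \<longlonglongrightarrow> 0"
        "(\<lambda>n. intg (\<lambda>x. (norm (\<xi> n x - v x))\<^sup>2)) \<longlonglongrightarrow> 0"
        unfolding real_norm_def power2_abs by (rule z(2) x(2))+
      from gen[OF has_weak_gradient_L2(1)[OF D_grad[OF z(1)]] has_weak_gradient_L2(1)[OF D_grad[OF x(1)]]
        has_weak_gradient_L2(1)[OF X_grad[OF u]] has_weak_gradient_L2(1)[OF X_grad[OF v]] this]
      show ?thesis unfolding real_norm_def power2_abs real_scaleR_def .
    qed
    show "(\<lambda>n. intg (\<lambda>x. (norm ((grad (\<zeta> n) x + c *\<^sub>R grad (\<xi> n) x) - (wgrad u x + c *\<^sub>R wgrad v x)))\<^sup>2)) \<longlonglongrightarrow> 0"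
      by (rule gen[OF has_weak_gradient_L2(2)[OF D_grad[OF z(1)]] has_weak_gradient_L2(2)[OF D_grad[OF x(1)]]
        has_weak_gradient_L2(2)[OF X_grad[OF u]] has_weak_gradient_L2(2)[OF X_grad[OF v]] z(3) x(3)])
  qed
qed

lemma X_diff: "u \<in> X \<Longrightarrow> v \<in> X \<Longrightarrow> (\<lambda>x. u x - v x) \<in> X"
  using X_lincomb[of u v "-1"] by simp

end

section \<open>Passage of inequalities and of the chain rule to the closure\<close>

context trial_space
begin

lemma AE_subseq:
  fixes f :: "nat \<Rightarrow> fld"
  assumes f: "\<And>n. L2 (f n)" and F: "L2 F"
    and lim: "(\<lambda>n. intg (\<lambda>x. (f n x - F x)\<^sup>2)) \<longlonglongrightarrow> 0"
  obtains r where "strict_mono r" "AE x in M. (\<lambda>n. f (r n) x) \<longlonglongrightarrow> F x"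
proof -
  have "integrable M (\<lambda>x. (f n x - F x)\<^sup>2)" for n using L2_funD(2)[OF L2_fun_diff[OF f[of n] F]] by simp
  from tendsto_L1_AE_subseq[of M "\<lambda>n x. (f n x - F x)\<^sup>2", OF this] lim
  obtain r where r: "strict_mono r" "AE x in M. (\<lambda>n. (f (r n) x - F x)\<^sup>2) \<longlonglongrightarrow> 0" by auto
  have "AE x in M. (\<lambda>n. f (r n) x) \<longlonglongrightarrow> F x"
    using r(2)
  proof eventually_elim
    case (elim x)
    from tendsto_real_sqrt[OF elim] have "(\<lambda>n. f (r n) x - F x) \<longlonglongrightarrow> 0" by (simp add: tendsto_rabs_zero_iff)
    then show ?case by (simp add: LIM_zero_iff)
  qed
  then show thesis using that r(1) by blast
qed

lemma X_approx_AE: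
  assumes u: "u \<in> X"
  obtains \<zeta> where "\<And>n. \<zeta> n \<in> D" "(\<lambda>n. intg (\<lambda>x. (\<zeta> n x - u x)\<^sup>2)) \<longlonglongrightarrow> 0"
    "(\<lambda>n. intg (\<lambda>x. (norm (grad (\<zeta> n) x - wgrad u x))\<^sup>2)) \<longlonglongrightarrow> 0"
    "AE x in M. (\<lambda>n. \<zeta> n x) \<longlonglongrightarrow> u x"
proof -
  obtain \<zeta> where z: "\<And>n. \<zeta> n \<in> D" "(\<lambda>n. intg (\<lambda>x. (\<zeta> n x - u x)\<^sup>2)) \<longlonglongrightarrow> 0"
    "(\<lambda>n. intg (\<lambda>x. (norm (grad (\<zeta> n) x - wgrad u x))\<^sup>2)) \<longlonglongrightarrow> 0" by (rule X_approx[OF u]) (rule that; assumption)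
  obtain r where r: "strict_mono r" "AE x in M. (\<lambda>n. \<zeta> (r n) x) \<longlonglongrightarrow> u x"
    by (rule AE_subseq[OF has_weak_gradient_L2(1)[OF D_grad[OF z(1)]] has_weak_gradient_L2(1)[OF X_grad[OF u]] z(2)]) (rule that; assumption)
  show thesis
    by (rule that[of "\<lambda>n. \<zeta> (r n)"])
      (use z(1) r LIMSEQ_subseq_LIMSEQ[OF z(2) r(1)] LIMSEQ_subseq_LIMSEQ[OF z(3) r(1)] in \<open>auto simp: o_def\<close>)
qed

text \<open>Convergence in H1 yields an almost everywhere convergent subsequence. Fatou's lemma then
  transfers the bound and at the same time proves that the fourth power is integrable.\<close>

lemma X_L4:
  assumes bound: "\<And>\<zeta>. \<zeta> \<in> D \<Longrightarrow> (\<integral>\<^sup>+x. ennreal (\<zeta> x ^ 4) \<partial>M) \<le> ennreal (C * (h1_sq \<zeta>)\<^sup>2)"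
    and C: "C \<ge> 0" and u: "u \<in> X"
  shows "integrable M (\<lambda>x. u x ^ 4)" "intg (\<lambda>x. u x ^ 4) \<le> C * (h1_sq u)\<^sup>2"
proof -
  obtain \<zeta> where z: "\<And>n. \<zeta> n \<in> D" "(\<lambda>n. intg (\<lambda>x. (\<zeta> n x - u x)\<^sup>2)) \<longlonglongrightarrow> 0"
    "(\<lambda>n. intg (\<lambda>x. (norm (grad (\<zeta> n) x - wgrad u x))\<^sup>2)) \<longlonglongrightarrow> 0"
    "AE x in M. (\<lambda>n. \<zeta> n x) \<longlonglongrightarrow> u x" by (rule X_approx_AE[OF u]) (rule that; assumption)
  note Lz = has_weak_gradient_L2[OF D_grad[OF z(1)]] and Lu = has_weak_gradient_L2[OF X_grad[OF u]]
  have [measurable]: "u \<in> borel_measurable M" "\<zeta> n \<in> borel_measurable M" for n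
    using L2_funD(1)[OF Lu(1)] L2_funD(1)[OF Lz(1)] by auto
  have "(\<lambda>n. intg (\<lambda>x. (norm (\<zeta> n x))\<^sup>2)) \<longlonglongrightarrow> intg (\<lambda>x. (norm (u x))\<^sup>2)"
    using z(2) by (intro L2_tendsto_norm[OF Lz(1) Lu(1)]) simp
  moreover have "(\<lambda>n. intg (\<lambda>x. (norm (grad (\<zeta> n) x))\<^sup>2)) \<longlonglongrightarrow> intg (\<lambda>x. (norm (wgrad u x))\<^sup>2)"
    by (intro L2_tendsto_norm[OF Lz(2) Lu(2)] z(3))
  ultimately have "(\<lambda>n. h1_sq (\<zeta> n)) \<longlonglongrightarrow> h1_sq u"
    unfolding h1_sq_eq[OF D_grad[OF z(1)]] h1_sq_eq[OF X_grad[OF u]] by (intro tendsto_add) simp_all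
  then have l: "(\<lambda>n. ennreal (C * (h1_sq (\<zeta> n))\<^sup>2)) \<longlonglongrightarrow> ennreal (C * (h1_sq u)\<^sup>2)"
    by (intro tendsto_ennrealI tendsto_intros)
  have "(\<integral>\<^sup>+x. ennreal (u x ^ 4) \<partial>M) = (\<integral>\<^sup>+x. liminf (\<lambda>n. ennreal (\<zeta> n x ^ 4)) \<partial>M)"
  proof (rule nn_integral_cong_AE)
    show "AE x in M. ennreal (u x ^ 4) = liminf (\<lambda>n. ennreal (\<zeta> n x ^ 4))"
      using z(4)
    proof eventually_elim
      case (elim x)
      then have "(\<lambda>n. ennreal (\<zeta> n x ^ 4)) \<longlonglongrightarrow> ennreal (u x ^ 4)" by (intro tendsto_ennrealI tendsto_power)
      from lim_imp_Liminf[OF trivial_limit_sequentially this] show ?case by (rule sym)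
    qed
  qed
  also have "\<dots> \<le> liminf (\<lambda>n. \<integral>\<^sup>+x. ennreal (\<zeta> n x ^ 4) \<partial>M)" by (rule nn_integral_liminf) measurable
  also have "\<dots> \<le> liminf (\<lambda>n. ennreal (C * (h1_sq (\<zeta> n))\<^sup>2))" by (intro Liminf_mono always_eventually allI bound z(1))
  also have "\<dots> = ennreal (C * (h1_sq u)\<^sup>2)" using l by (simp add: lim_imp_Liminf)
  finally have n: "(\<integral>\<^sup>+x. ennreal (u x ^ 4) \<partial>M) \<le> ennreal (C * (h1_sq u)\<^sup>2)" .
  then show i: "integrable M (\<lambda>x. u x ^ 4)"
    by (intro integrableI_nonneg) (auto intro!: le_less_trans[OF n])
  show "intg (\<lambda>x. u x ^ 4) \<le> C * (h1_sq u)\<^sup>2"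
    using n C by (subst (asm) nn_integral_eq_integral[OF i]) auto
qed

text \<open>All three terms are continuous in H1. The weight \<open>a\<close> of the mean is 0 under
  Dirichlet conditions and the inverse volume under periodic ones.\<close>

lemma X_Poincare:
  assumes bound: "\<And>\<zeta>. \<zeta> \<in> D \<Longrightarrow> intg (\<lambda>x. (\<zeta> x)\<^sup>2) - a * (intg \<zeta>)\<^sup>2 \<le> C * gsq \<zeta>"
    and u: "u \<in> X"
  shows "intg (\<lambda>x. (u x)\<^sup>2) - a * (intg u)\<^sup>2 \<le> C * gsq u"
proof -
  obtain \<zeta> where z: "\<And>n. \<zeta> n \<in> D" "(\<lambda>n. intg (\<lambda>x. (\<zeta> n x - u x)\<^sup>2)) \<longlonglongrightarrow> 0"
    "(\<lambda>n. intg (\<lambda>x. (norm (grad (\<zeta> n) x - wgrad u x))\<^sup>2)) \<longlonglongrightarrow> 0" by (rule X_approx[OF u]) (rule that; assumption)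
  note Lz = has_weak_gradient_L2[OF D_grad[OF z(1)]] and Lu = has_weak_gradient_L2[OF X_grad[OF u]]
  have l1: "(\<lambda>n. intg (\<lambda>x. (norm (\<zeta> n x))\<^sup>2)) \<longlonglongrightarrow> intg (\<lambda>x. (norm (u x))\<^sup>2)"
    using z(2) by (intro L2_tendsto_norm[OF Lz(1) Lu(1)]) simp
  have l2: "(\<lambda>n. gsq (\<zeta> n)) \<longlonglongrightarrow> gsq u"
    unfolding grad_sq_eq[OF D_grad[OF z(1)]] grad_sq_eq[OF X_grad[OF u]]
    by (intro L2_tendsto_norm[OF Lz(2) Lu(2)] z(3))
  have l3: "(\<lambda>n. intg (\<zeta> n)) \<longlonglongrightarrow> intg u"
    using L2_tendsto_inner[OF Lz(1) Lu(1) L2_fun_continuous[of "\<lambda>_. 1"] z(2)] by simp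
  have "(\<lambda>n. intg (\<lambda>x. (\<zeta> n x)\<^sup>2) - a * (intg (\<zeta> n))\<^sup>2) \<longlonglongrightarrow> intg (\<lambda>x. (u x)\<^sup>2) - a * (intg u)\<^sup>2"
    using l1 by (intro tendsto_intros l3) simp
  moreover have "(\<lambda>n. C * gsq (\<zeta> n)) \<longlonglongrightarrow> C * gsq u" by (intro tendsto_intros l2)
  ultimately show ?thesis using bound[OF z(1)] by (intro LIMSEQ_le[OF _ _ exI[of _ 0]]) auto
qed

text \<open>The chain rule holds for the approximants, and the error of their gradients splits in
  two: \<open>v\<close> has the bounded factor \<open>f'\<close> and a gradient difference that
  tends to 0, while \<open>w\<close> has the fixed gradient of \<open>u\<close> and tends to 0 by
  dominated convergence along an almost everywhere convergent sequence.\<close>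

lemma X_compose_C1:
  assumes der: "\<And>y. (f has_real_derivative f' y) (at y)" and cont: "continuous_on UNIV f'" and B: "\<And>y. \<bar>f' y\<bar> \<le> B"
    and D: "\<And>\<zeta>. \<zeta> \<in> D \<Longrightarrow> (\<lambda>x. f (\<zeta> x)) \<in> D" and u: "u \<in> X"
  shows "(\<lambda>x. f (u x)) \<in> X" "has_weak_gradient \<Omega> (\<lambda>x. f (u x)) (\<lambda>x. f' (u x) *\<^sub>R wgrad u x)"
proof -
  have B0: "B \<ge> 0" using B[of 0] by linarith
  obtain \<zeta> where z: "\<And>n. \<zeta> n \<in> D" "(\<lambda>n. intg (\<lambda>x. (\<zeta> n x - u x)\<^sup>2)) \<longlonglongrightarrow> 0"
    "(\<lambda>n. intg (\<lambda>x. (norm (grad (\<zeta> n) x - wgrad u x))\<^sup>2)) \<longlonglongrightarrow> 0"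
    "AE x in M. (\<lambda>n. \<zeta> n x) \<longlonglongrightarrow> u x" by (rule X_approx_AE[OF u]) (rule that; assumption)
  note Lz = has_weak_gradient_L2[OF D_grad[OF z(1)]] and Lu = has_weak_gradient_L2[OF X_grad[OF u]]
  have f'm [measurable]: "f' \<in> borel_measurable borel" by (rule borel_measurable_continuous_onI[OF cont])
  have fm [measurable]: "f \<in> borel_measurable borel"
    by (rule borel_measurable_continuous_onI) (meson der DERIV_continuous_on has_field_derivative_at_within)
  have [measurable]: "u \<in> borel_measurable M" "\<zeta> n \<in> borel_measurable M" "wgrad u \<in> borel_measurable M"
    "grad (\<zeta> n) \<in> borel_measurable M" for n
    using L2_funD(1)[OF Lu(1)] L2_funD(1)[OF Lz(1)] L2_funD(1)[OF Lu(2)] L2_funD(1)[OF Lz(2)] by auto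
  have lip: "\<bar>f a - f b\<bar> \<le> B * \<bar>a - b\<bar>" for a b
    using field_differentiable_bound[of UNIV f f' B a b] der B by (auto simp: has_field_derivative_at_within)
  have gradf: "has_weak_gradient \<Omega> (\<lambda>x. f (\<zeta> n x)) (\<lambda>x. f' (\<zeta> n x) *\<^sub>R grad (\<zeta> n) x)" for n
  proof -
    have "((\<lambda>x. f (\<zeta> n x)) has_derivative (\<lambda>h. f' (\<zeta> n x) * (grad (\<zeta> n) x \<bullet> h))) (at x)" for x
      using has_derivative_compose[OF smooth_deriv[OF D_smooth[OF z(1)[of n]], of x] der[unfolded has_field_derivative_def, of "\<zeta> n x"]] .
    from partial_at_eqI[OF this] have "grad (\<lambda>x. f (\<zeta> n x)) x = f' (\<zeta> n x) *\<^sub>R grad (\<zeta> n) x" for x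
      by (simp add: vec_eq_iff inner_axis)
    then show ?thesis using D_grad[OF D[OF z(1)[of n]]] by simp
  qed
  have Lf: "L2 (\<lambda>x. f (u x))"
    unfolding L2_fun_def
  proof
    show "integrable M (\<lambda>x. (norm (f (u x)))\<^sup>2)"
    proof (rule Bochner_Integration.integrable_bound)
      show "integrable M (\<lambda>x. 2 * (f 0)\<^sup>2 + 2 * B\<^sup>2 * (norm (u x))\<^sup>2)" using L2_funD(2)[OF Lu(1)] by auto
      show "AE x in M. norm ((norm (f (u x)))\<^sup>2) \<le> norm (2 * (f 0)\<^sup>2 + 2 * B\<^sup>2 * (norm (u x))\<^sup>2)"
      proof (rule AE_I2)
        fix x
        have "\<bar>f (u x) - f 0\<bar> \<le> B * \<bar>u x\<bar>" using lip[of "u x" 0] by simp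
        then have "\<bar>f (u x)\<bar> \<le> \<bar>f 0\<bar> + B * \<bar>u x\<bar>" by linarith
        from power_mono[OF this abs_ge_zero, of 2] have "(f (u x))\<^sup>2 \<le> (\<bar>f 0\<bar> + B * \<bar>u x\<bar>)\<^sup>2" unfolding power2_abs .
        also have "\<dots> \<le> 2 * (f 0)\<^sup>2 + 2 * B\<^sup>2 * (norm (u x))\<^sup>2"
          using sum_squares_bound[of "\<bar>f 0\<bar>" "B * \<bar>u x\<bar>"] by (simp add: power2_sum power_mult_distrib)
        finally show "norm ((norm (f (u x)))\<^sup>2) \<le> norm (2 * (f 0)\<^sup>2 + 2 * B\<^sup>2 * (norm (u x))\<^sup>2)" by simp
      qed
    qed measurable
  qed measurable
  have Lg: "L2 (\<lambda>x. f' (u x) *\<^sub>R wgrad u x)"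
    unfolding L2_fun_def
  proof
    show "integrable M (\<lambda>x. (norm (f' (u x) *\<^sub>R wgrad u x))\<^sup>2)"
    proof (rule Bochner_Integration.integrable_bound)
      show "integrable M (\<lambda>x. B\<^sup>2 * (norm (wgrad u x))\<^sup>2)" using L2_funD(2)[OF Lu(2)] by auto
      show "AE x in M. norm ((norm (f' (u x) *\<^sub>R wgrad u x))\<^sup>2) \<le> norm (B\<^sup>2 * (norm (wgrad u x))\<^sup>2)"
        using power_mono[OF B abs_ge_zero, of "u _" 2] by (intro AE_I2) (auto simp: power_mult_distrib intro!: mult_right_mono)
    qed measurable
  qed measurable
  have l1: "(\<lambda>n. intg (\<lambda>x. (f (\<zeta> n x) - f (u x))\<^sup>2)) \<longlonglongrightarrow> 0"
  proof (rule tendsto_sandwich[OF _ _ tendsto_const])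
    show "(\<lambda>n. B\<^sup>2 * intg (\<lambda>x. (\<zeta> n x - u x)\<^sup>2)) \<longlonglongrightarrow> 0" by (rule tendsto_mult_right_zero[OF z(2)])
    have "intg (\<lambda>x. (f (\<zeta> n x) - f (u x))\<^sup>2) \<le> intg (\<lambda>x. B\<^sup>2 * (\<zeta> n x - u x)\<^sup>2)" for n
    proof (rule integral_mono)
      show "integrable M (\<lambda>x. (f (\<zeta> n x) - f (u x))\<^sup>2)"
        using L2_funD(2)[OF L2_fun_diff[OF has_weak_gradient_L2(1)[OF gradf[of n]] Lf]] by simp
      show "integrable M (\<lambda>x. B\<^sup>2 * (\<zeta> n x - u x)\<^sup>2)"
        using L2_funD(2)[OF L2_fun_diff[OF Lz(1)[of n] Lu(1)]] by simp
      show "(f (\<zeta> n x) - f (u x))\<^sup>2 \<le> B\<^sup>2 * (\<zeta> n x - u x)\<^sup>2" for x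
        using power_mono[OF lip[of "\<zeta> n x" "u x"] abs_ge_zero, of 2] by (simp add: power_mult_distrib)
    qed
    then show "\<forall>\<^sub>F n in sequentially. intg (\<lambda>x. (f (\<zeta> n x) - f (u x))\<^sup>2) \<le> B\<^sup>2 * intg (\<lambda>x. (\<zeta> n x - u x)\<^sup>2)"
      by simp
  qed simp
  have l2: "(\<lambda>n. intg (\<lambda>x. (norm (f' (\<zeta> n x) *\<^sub>R grad (\<zeta> n) x - f' (u x) *\<^sub>R wgrad u x))\<^sup>2)) \<longlonglongrightarrow> 0"
  proof -
    define w where "w n x = (f' (\<zeta> n x) - f' (u x)) *\<^sub>R wgrad u x" for n x
    define v where "v n x = f' (\<zeta> n x) *\<^sub>R (grad (\<zeta> n) x - wgrad u x)" for n x
    have Lw: "L2 (w n)" "integral\<^sup>L M (\<lambda>x. (norm (w n x))\<^sup>2) \<ge> 0" for n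
    proof -
      have bnd: "(norm (w n x))\<^sup>2 \<le> (2 * B)\<^sup>2 * (norm (wgrad u x))\<^sup>2" for x
      proof -
        have "\<bar>f' (\<zeta> n x) - f' (u x)\<bar> \<le> 2 * B" using B[of "\<zeta> n x"] B[of "u x"] by linarith
        from power_mono[OF this abs_ge_zero, of 2] show ?thesis by (simp add: w_def power_mult_distrib mult_right_mono)
      qed
      have [measurable]: "w n \<in> borel_measurable M" unfolding w_def by measurable
      have "integrable M (\<lambda>x. (norm (w n x))\<^sup>2)"
        by (rule Bochner_Integration.integrable_bound[of M "\<lambda>x. (2 * B)\<^sup>2 * (norm (wgrad u x))\<^sup>2"])
          (use L2_funD(2)[OF Lu(2)] bnd in auto)
      then show "L2 (w n)" by (simp add: L2_fun_def)
    qed simp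
    have Lv: "L2 (v n)" "integral\<^sup>L M (\<lambda>x. (norm (v n x))\<^sup>2) \<le> B\<^sup>2 * integral\<^sup>L M (\<lambda>x. (norm (grad (\<zeta> n) x - wgrad u x))\<^sup>2)" for n
    proof -
      have bnd: "(norm (v n x))\<^sup>2 \<le> B\<^sup>2 * (norm (grad (\<zeta> n) x - wgrad u x))\<^sup>2" for x
        using power_mono[OF B abs_ge_zero, of "\<zeta> n x" 2] by (simp add: v_def power_mult_distrib mult_right_mono)
      have [measurable]: "v n \<in> borel_measurable M" unfolding v_def by measurable
      have iD: "integrable M (\<lambda>x. B\<^sup>2 * (norm (grad (\<zeta> n) x - wgrad u x))\<^sup>2)"
        using L2_funD(2)[OF L2_fun_diff[OF Lz(2)[of n] Lu(2)]] by simp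
      have iv: "integrable M (\<lambda>x. (norm (v n x))\<^sup>2)"
        by (rule Bochner_Integration.integrable_bound[OF iD]) (use bnd in auto)
      then show "L2 (v n)" by (simp add: L2_fun_def)
      show "integral\<^sup>L M (\<lambda>x. (norm (v n x))\<^sup>2) \<le> B\<^sup>2 * integral\<^sup>L M (\<lambda>x. (norm (grad (\<zeta> n) x - wgrad u x))\<^sup>2)"
        using integral_mono[OF iv iD bnd] by simp
    qed
    have wl: "(\<lambda>n. integral\<^sup>L M (\<lambda>x. (norm (w n x))\<^sup>2)) \<longlonglongrightarrow> integral\<^sup>L M (\<lambda>x. 0)"
    proof (rule integral_dominated_convergence[where w="\<lambda>x. (2 * B)\<^sup>2 * (norm (wgrad u x))\<^sup>2"])
      show "(\<lambda>x. (norm (w n x))\<^sup>2) \<in> borel_measurable M" for n unfolding w_def by measurable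
      show "integrable M (\<lambda>x. (2 * B)\<^sup>2 * (norm (wgrad u x))\<^sup>2)" using L2_funD(2)[OF Lu(2)] by simp
      show "AE x in M. (\<lambda>n. (norm (w n x))\<^sup>2) \<longlonglongrightarrow> 0"
        using z(4)
      proof eventually_elim
        case (elim x)
        have "isCont f' (u x)" using cont by (simp add: continuous_on_eq_continuous_at)
        then have "(\<lambda>n. f' (\<zeta> n x)) \<longlonglongrightarrow> f' (u x)" using elim by (rule isCont_tendsto_compose)
        then have "(\<lambda>n. (norm (w n x))\<^sup>2) \<longlonglongrightarrow> (norm ((f' (u x) - f' (u x)) *\<^sub>R wgrad u x))\<^sup>2"
          unfolding w_def by (intro tendsto_intros)
        then show ?case by simp
      qed
      show "AE x in M. norm ((norm (w n x))\<^sup>2) \<le> (2 * B)\<^sup>2 * (norm (wgrad u x))\<^sup>2" for n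
      proof (rule AE_I2)
        fix x
        have "\<bar>f' (\<zeta> n x) - f' (u x)\<bar> \<le> 2 * B" using B[of "\<zeta> n x"] B[of "u x"] by linarith
        from power_mono[OF this abs_ge_zero, of 2]
        show "norm ((norm (w n x))\<^sup>2) \<le> (2 * B)\<^sup>2 * (norm (wgrad u x))\<^sup>2" by (simp add: w_def power_mult_distrib mult_right_mono)
      qed
    qed simp
    show ?thesis
    proof (rule tendsto_sandwich[OF _ _ tendsto_const])
      show "(\<lambda>n. 2 * (B\<^sup>2 * integral\<^sup>L M (\<lambda>x. (norm (grad (\<zeta> n) x - wgrad u x))\<^sup>2)) + 2 * integral\<^sup>L M (\<lambda>x. (norm (w n x))\<^sup>2)) \<longlonglongrightarrow> 0"
        using wl by (intro tendsto_add_zero tendsto_mult_right_zero z(3)) simp_all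
      have "intg (\<lambda>x. (norm (f' (\<zeta> n x) *\<^sub>R grad (\<zeta> n) x - f' (u x) *\<^sub>R wgrad u x))\<^sup>2)
         \<le> 2 * (B\<^sup>2 * integral\<^sup>L M (\<lambda>x. (norm (grad (\<zeta> n) x - wgrad u x))\<^sup>2)) + 2 * integral\<^sup>L M (\<lambda>x. (norm (w n x))\<^sup>2)" for n
      proof -
        have "f' (\<zeta> n x) *\<^sub>R grad (\<zeta> n) x - f' (u x) *\<^sub>R wgrad u x = v n x + w n x" for x
          by (simp add: v_def w_def algebra_simps)
        then show ?thesis using integral_norm_sq_add_le[OF Lv(1)[of n] Lw(1)[of n]] Lv(2)[of n] by simp
      qed
      then show "\<forall>\<^sub>F n in sequentially. intg (\<lambda>x. (norm (f' (\<zeta> n x) *\<^sub>R grad (\<zeta> n) x - f' (u x) *\<^sub>R wgrad u x))\<^sup>2)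
         \<le> 2 * (B\<^sup>2 * integral\<^sup>L M (\<lambda>x. (norm (grad (\<zeta> n) x - wgrad u x))\<^sup>2)) + 2 * integral\<^sup>L M (\<lambda>x. (norm (w n x))\<^sup>2)" by simp
    qed simp
  qed
  note R = X_closed[OF D_subset_X[OF D[OF z(1)]] gradf Lf Lg l1 l2]
  show "(\<lambda>x. f (u x)) \<in> X" by (rule R(1))
  show "has_weak_gradient \<Omega> (\<lambda>x. f (u x)) (\<lambda>x. f' (u x) *\<^sub>R wgrad u x)" by (rule R(2))
qed

text \<open>Extends the chain rule to functions with a kink such as the absolute value. The
  derivatives need only converge pointwise; the uniform bounds give dominating functions built from
  \<open>u\<close> and its gradient.\<close>

lemma X_compose_limit:
  assumes fn: "\<And>n::nat. (\<lambda>x. f n (u x)) \<in> X" "\<And>n. has_weak_gradient \<Omega> (\<lambda>x. f n (u x)) (\<lambda>x. f' n (u x) *\<^sub>R wgrad u x)"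
    and f'm: "\<And>n. f' n \<in> borel_measurable borel"
    and lim: "\<And>y. (\<lambda>n. f n y) \<longlonglongrightarrow> F y" "\<And>y. (\<lambda>n. f' n y) \<longlonglongrightarrow> F' y"
    and B: "\<And>n y. \<bar>f n y\<bar> \<le> B * (1 + \<bar>y\<bar>)" "\<And>n y. \<bar>f' n y\<bar> \<le> B" and u: "u \<in> X"
  shows "(\<lambda>x. F (u x)) \<in> X" "has_weak_gradient \<Omega> (\<lambda>x. F (u x)) (\<lambda>x. F' (u x) *\<^sub>R wgrad u x)"
proof -
  have B0: "B \<ge> 0" using B(2)[of 0 0] by linarith
  note Lu = has_weak_gradient_L2[OF X_grad[OF u]] and Lf = has_weak_gradient_L2[OF fn(2)]
  have [measurable]: "f' n \<in> borel_measurable borel" for n by (rule f'm)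
  have [measurable]: "u \<in> borel_measurable M" "wgrad u \<in> borel_measurable M" "(\<lambda>x. f n (u x)) \<in> borel_measurable M" for n
    using L2_funD(1)[OF Lu(1)] L2_funD(1)[OF Lu(2)] L2_funD(1)[OF Lf(1)] by auto
  have [measurable]: "F' \<in> borel_measurable borel" by (rule borel_measurable_LIMSEQ_real[OF lim(2)]) measurable
  have [measurable]: "(\<lambda>x. F (u x)) \<in> borel_measurable M" by (rule borel_measurable_LIMSEQ_real[OF lim(1)]) measurable
  have BF: "\<bar>F y\<bar> \<le> B * (1 + \<bar>y\<bar>)" "\<bar>F' y\<bar> \<le> B" for y
    using tendsto_rabs[OF lim(1)[of y]] tendsto_rabs[OF lim(2)[of y]] B[of _ y]
    by (auto intro: LIMSEQ_le_const2)
  have sq: "(B * (1 + \<bar>y\<bar>))\<^sup>2 \<le> 2 * B\<^sup>2 + 2 * B\<^sup>2 * y\<^sup>2" for y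
  proof -
    have "(1 + \<bar>y\<bar>)\<^sup>2 \<le> 2 + 2 * y\<^sup>2" using sum_squares_bound[of 1 "\<bar>y\<bar>"] by (simp add: power2_sum)
    then have "B\<^sup>2 * (1 + \<bar>y\<bar>)\<^sup>2 \<le> B\<^sup>2 * (2 + 2 * y\<^sup>2)" by (intro mult_left_mono) auto
    then show ?thesis by (simp only: power_mult_distrib) (simp add: algebra_simps)
  qed
  have i0: "integrable M (\<lambda>x. 4 * (2 * B\<^sup>2 + 2 * B\<^sup>2 * (u x)\<^sup>2))" "integrable M (\<lambda>x. (2 * B)\<^sup>2 * (norm (wgrad u x))\<^sup>2)"
    using L2_funD(2)[OF Lu(1)] L2_funD(2)[OF Lu(2)] by auto
  have LF: "L2 (\<lambda>x. F (u x))"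
    unfolding L2_fun_def
  proof
    show "integrable M (\<lambda>x. (norm (F (u x)))\<^sup>2)"
    proof (rule Bochner_Integration.integrable_bound[OF i0(1)])
      have "(F y)\<^sup>2 \<le> 4 * (2 * B\<^sup>2 + 2 * B\<^sup>2 * y\<^sup>2)" for y
      proof -
        have "(F y)\<^sup>2 \<le> 2 * B\<^sup>2 + 2 * B\<^sup>2 * y\<^sup>2" using power_mono[OF BF(1) abs_ge_zero, of y 2] sq[of y] by simp
        also have "\<dots> \<le> 4 * (2 * B\<^sup>2 + 2 * B\<^sup>2 * y\<^sup>2)" by simp
        finally show ?thesis .
      qed
      then show "AE x in M. norm ((norm (F (u x)))\<^sup>2) \<le> norm (4 * (2 * B\<^sup>2 + 2 * B\<^sup>2 * (u x)\<^sup>2))"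
        by (intro AE_I2) simp
    qed measurable
  qed measurable
  have Lg: "L2 (\<lambda>x. F' (u x) *\<^sub>R wgrad u x)"
    unfolding L2_fun_def
  proof
    show "integrable M (\<lambda>x. (norm (F' (u x) *\<^sub>R wgrad u x))\<^sup>2)"
    proof (rule Bochner_Integration.integrable_bound[OF i0(2)])
      have "\<bar>F' y\<bar> \<le> 2 * B" for y using BF(2)[of y] B0 by linarith
      from power_mono[OF this abs_ge_zero, of _ 2]
      show "AE x in M. norm ((norm (F' (u x) *\<^sub>R wgrad u x))\<^sup>2) \<le> norm ((2 * B)\<^sup>2 * (norm (wgrad u x))\<^sup>2)"
        by (intro AE_I2) (auto simp: power_mult_distrib intro!: mult_right_mono)
    qed measurable
  qed measurable
  have l1: "(\<lambda>n. intg (\<lambda>x. (f n (u x) - F (u x))\<^sup>2)) \<longlonglongrightarrow> intg (\<lambda>x. 0)"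
  proof (rule integral_dominated_convergence[OF _ _ i0(1)])
    show "AE x in M. (\<lambda>n. (f n (u x) - F (u x))\<^sup>2) \<longlonglongrightarrow> 0"
    proof (rule AE_I2)
      fix x
      have "(\<lambda>n. (f n (u x) - F (u x))\<^sup>2) \<longlonglongrightarrow> (F (u x) - F (u x))\<^sup>2" by (intro tendsto_intros lim)
      then show "(\<lambda>n. (f n (u x) - F (u x))\<^sup>2) \<longlonglongrightarrow> 0" by simp
    qed
    have "(f n y - F y)\<^sup>2 \<le> 4 * (2 * B\<^sup>2 + 2 * B\<^sup>2 * y\<^sup>2)" for n y
    proof -
      have "\<bar>f n y - F y\<bar> \<le> 2 * (B * (1 + \<bar>y\<bar>))" using B(1)[of n y] BF(1)[of y] by linarith
      from power_mono[OF this abs_ge_zero, of 2] have "(f n y - F y)\<^sup>2 \<le> 4 * (B * (1 + \<bar>y\<bar>))\<^sup>2" by (simp add: power_mult_distrib)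
      also have "\<dots> \<le> 4 * (2 * B\<^sup>2 + 2 * B\<^sup>2 * y\<^sup>2)" by (rule mult_left_mono[OF sq]) simp
      finally show ?thesis .
    qed
    then show "AE x in M. norm ((f n (u x) - F (u x))\<^sup>2) \<le> 4 * (2 * B\<^sup>2 + 2 * B\<^sup>2 * (u x)\<^sup>2)" for n by (intro AE_I2) simp
  qed measurable
  have l2: "(\<lambda>n. intg (\<lambda>x. (norm (f' n (u x) *\<^sub>R wgrad u x - F' (u x) *\<^sub>R wgrad u x))\<^sup>2)) \<longlonglongrightarrow> intg (\<lambda>x. 0)"
  proof (rule integral_dominated_convergence[OF _ _ i0(2)])
    show "AE x in M. (\<lambda>n. (norm (f' n (u x) *\<^sub>R wgrad u x - F' (u x) *\<^sub>R wgrad u x))\<^sup>2) \<longlonglongrightarrow> 0"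
    proof (rule AE_I2)
      fix x
      have "(\<lambda>n. (norm (f' n (u x) *\<^sub>R wgrad u x - F' (u x) *\<^sub>R wgrad u x))\<^sup>2)
         \<longlonglongrightarrow> (norm (F' (u x) *\<^sub>R wgrad u x - F' (u x) *\<^sub>R wgrad u x))\<^sup>2" by (intro tendsto_intros lim)
      then show "(\<lambda>n. (norm (f' n (u x) *\<^sub>R wgrad u x - F' (u x) *\<^sub>R wgrad u x))\<^sup>2) \<longlonglongrightarrow> 0" by simp
    qed
    have "\<bar>f' n y - F' y\<bar> \<le> 2 * B" for n y using B(2)[of n y] BF(2)[of y] by linarith
    from power_mono[OF this abs_ge_zero, of _ _ 2]
    show "AE x in M. norm ((norm (f' n (u x) *\<^sub>R wgrad u x - F' (u x) *\<^sub>R wgrad u x))\<^sup>2) \<le> (2 * B)\<^sup>2 * (norm (wgrad u x))\<^sup>2" for n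
      by (intro AE_I2) (auto simp: power_mult_distrib mult_right_mono simp flip: scaleR_left_diff_distrib)
  qed measurable
  note R = X_closed[OF fn LF Lg l1[simplified] l2[simplified]]
  show "(\<lambda>x. F (u x)) \<in> X" by (rule R(1))
  show "has_weak_gradient \<Omega> (\<lambda>x. F (u x)) (\<lambda>x. F' (u x) *\<^sub>R wgrad u x)" by (rule R(2))
qed

end

section \<open>The two spaces of trial functions\<close>

locale sobolev_space = trial_space +
  fixes S :: real
  assumes S_pos: "S > 0"
    and D_L4: "\<zeta> \<in> D \<Longrightarrow> (\<integral>\<^sup>+x. ennreal (\<zeta> x ^ 4) \<partial>M) \<le> ennreal (S * (h1_sq \<zeta>)\<^sup>2)"
begin

lemma X_integrable4: "u \<in> X \<Longrightarrow> integrable M (\<lambda>x. u x ^ 4)"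
  and X_bound4: "u \<in> X \<Longrightarrow> intg (\<lambda>x. u x ^ 4) \<le> S * (h1_sq u)\<^sup>2"
  using X_L4[OF D_L4 less_imp_le[OF S_pos]] by auto

end

lemma smooth_coordinate: "smooth_on UNIV (\<lambda>x::pt. x $ i)"
proof -
  have D: "((\<lambda>x::pt. x $ i) has_derivative (\<lambda>h. h $ i)) (at x)" for x
    by (rule bounded_linear.has_derivative[OF bounded_linear_vec_nth has_derivative_ident])
  have "Ck_on k UNIV (\<lambda>x::pt. x $ i)" for k
  proof (cases k)
    case 0
    then show ?thesis by (auto intro!: continuous_intros)
  next
    case (Suc k)
    have "Ck_on k UNIV (partial_at j (\<lambda>x::pt. x $ i))" for j
      unfolding partial_at_eqI[OF D] using smooth_on_UNIV_intros(1) unfolding smooth_on_def by blast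
    then show ?thesis using Suc D by (auto simp: differentiable_on_def differentiable_def)
  qed
  then show ?thesis by (simp add: smooth_on_def)
qed

section \<open>Test functions on a bounded domain\<close>

context bounded_open
begin

lemma trial_space_test_functions: "trial_space \<Omega> (test_functions \<Omega>)"
proof (unfold_locales)
  show "\<eta> \<in> test_functions \<Omega> \<Longrightarrow> smooth_on UNIV \<eta>" for \<eta> by (rule test_functions_vanish(1))
  fix \<eta> \<zeta> c assume e: "\<eta> \<in> test_functions \<Omega>" and z: "\<zeta> \<in> test_functions \<Omega>"
  let ?S = "closure {x. \<eta> x \<noteq> 0} \<union> closure {x. \<zeta> x \<noteq> 0}"
  have "closure {x. \<eta> x + c * \<zeta> x \<noteq> 0} \<subseteq> ?S"
  proof (rule closure_minimal)
    show "{x. \<eta> x + c * \<zeta> x \<noteq> 0} \<subseteq> ?S"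
    proof
      fix x assume "x \<in> {x. \<eta> x + c * \<zeta> x \<noteq> 0}"
      then have "\<eta> x \<noteq> 0 \<or> \<zeta> x \<noteq> 0" by auto
      then show "x \<in> ?S" by (meson UnI1 UnI2 closure_subset mem_Collect_eq subsetD)
    qed
  qed (rule closed_Un[OF closed_closure closed_closure])
  moreover have "compact ?S" "?S \<subseteq> \<Omega>" using e z by (auto simp: test_functions_def)
  moreover have "smooth_on UNIV (\<lambda>x. \<eta> x + c * \<zeta> x)"
    using e z by (intro smooth_on_UNIV_intros) (auto simp: test_functions_def)
  ultimately show "(\<lambda>x. \<eta> x + c * \<zeta> x) \<in> test_functions \<Omega>"
    unfolding test_functions_def mem_Collect_eq compact_eq_bounded_closed
    using bounded_subset closed_closure by (metis (no_types, lifting) order_trans)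
qed

lemma norm_grad_sq: "(norm (grad u x))\<^sup>2 = (\<Sum>i\<in>UNIV. (partial_at i u x)\<^sup>2)"
  unfolding power2_norm_eq_inner by (simp add: inner_vec_def power2_eq_square)

lemma nn_integral_dom_eq_lborel:
  assumes "f \<in> borel_measurable borel" "\<And>x. x \<notin> \<Omega> \<Longrightarrow> f x = 0"
  shows "(\<integral>\<^sup>+x. f x \<partial>M) = (\<integral>\<^sup>+x. f x \<partial>lborel)"
proof -
  have "(\<integral>\<^sup>+x. f x \<partial>M) = (\<integral>\<^sup>+x. f x * indicator \<Omega> x \<partial>lebesgue)"
    by (simp add: nn_integral_restrict_space)
  also have "\<dots> = (\<integral>\<^sup>+x. f x \<partial>lebesgue)"
    by (intro nn_integral_cong) (auto simp: indicator_def assms(2))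
  also have "\<dots> = (\<integral>\<^sup>+x. f x \<partial>lborel)"
    using assms(1) by (intro nn_integral_completion)
  finally show ?thesis .
qed

text \<open>A test function and its partial derivatives vanish outside \<Omega>, so the inequality
  on the whole space applies; its gradient factor is enlarged to the squared H1 norm.\<close>

lemma test_function_L4:
  assumes z: "\<zeta> \<in> test_functions \<Omega>"
  shows "(\<integral>\<^sup>+x. ennreal (\<zeta> x ^ 4) \<partial>M) \<le> ennreal (2 * (h1_sq \<zeta>)\<^sup>2)"
proof -
  note V = test_functions_vanish[OF z]
  note sm = smooth_differentiable[OF V(1)]
  obtain R where R: "\<And>x. x \<notin> cball 0 R \<Longrightarrow> \<zeta> x = 0" using V(3) by blast
  note G = has_weak_gradient_smooth[OF V(1)]
  have I: "integrable M (\<lambda>x. (\<zeta> x)\<^sup>2)" "integrable M (\<lambda>x. (norm (grad \<zeta> x))\<^sup>2)"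
    using L2_funD(2)[OF has_weak_gradient_L2(1)[OF G]] L2_funD(2)[OF has_weak_gradient_L2(2)[OF G]] by simp_all
  have [measurable]: "\<zeta> \<in> borel_measurable borel" "partial_at i \<zeta> \<in> borel_measurable borel" for i
    using sm by (auto intro: borel_measurable_continuous_onI)
  let ?g = "\<lambda>x. \<Sum>i\<in>UNIV. (partial_at i \<zeta> x)\<^sup>2"
  have "(\<integral>\<^sup>+x. ennreal (\<zeta> x ^ 4) \<partial>M) = (\<integral>\<^sup>+x. ennreal (\<zeta> x ^ 4) \<partial>lborel)"
    by (rule nn_integral_dom_eq_lborel) (auto simp: V(2))
  also have "\<dots> \<le> 2 * (\<integral>\<^sup>+x. ennreal ((\<zeta> x)\<^sup>2 + ?g x) \<partial>lborel) * (\<integral>\<^sup>+x. ennreal (?g x) \<partial>lborel)"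
    by (rule Ladyzhenskaya_smooth[OF V(1) R])
  also have "(\<integral>\<^sup>+x. ennreal ((\<zeta> x)\<^sup>2 + ?g x) \<partial>lborel) = (\<integral>\<^sup>+x. ennreal ((\<zeta> x)\<^sup>2 + ?g x) \<partial>M)"
    by (rule nn_integral_dom_eq_lborel[symmetric]) (auto simp: V(2,4))
  also have "\<dots> = ennreal (h1_sq \<zeta>)"
    unfolding norm_grad_sq[symmetric] h1_sq_eq[OF G] using I by (subst nn_integral_eq_integral) auto
  also have "(\<integral>\<^sup>+x. ennreal (?g x) \<partial>lborel) = (\<integral>\<^sup>+x. ennreal (?g x) \<partial>M)"
    by (rule nn_integral_dom_eq_lborel[symmetric]) (auto simp: V(4))
  also have "\<dots> = ennreal (gsq \<zeta>)"
    unfolding norm_grad_sq[symmetric] grad_sq_eq[OF G] using I by (subst nn_integral_eq_integral) auto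
  also have "2 * ennreal (h1_sq \<zeta>) * ennreal (gsq \<zeta>) = ennreal (2 * h1_sq \<zeta> * gsq \<zeta>)"
    by (simp add: ennreal_mult' h1_sq_nonneg flip: ennreal_numeral)
  also have "\<dots> \<le> ennreal (2 * (h1_sq \<zeta>)\<^sup>2)"
    unfolding power2_eq_square mult.assoc
    by (intro ennreal_leI mult_left_mono h1_sq_nonneg) (auto simp: h1_sq_def)
  finally show ?thesis .
qed

text \<open>Integration by parts against the coordinate \<open>x $ 1\<close> expresses the integral
  of \<open>\<zeta>^2\<close> as \<open>-2\<close> times that of
  \<open>x $ 1 * \<zeta> * partial_at 1 \<zeta>\<close>. The coordinate is bounded by
  \<open>R\<close>.\<close>

lemma test_function_Poincare:
  obtains C where "C > 0" "\<And>\<zeta>. \<zeta> \<in> test_functions \<Omega> \<Longrightarrow> intg (\<lambda>x. (\<zeta> x)\<^sup>2) \<le> C * gsq \<zeta>"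
proof -
  obtain R where R: "R > 0" "\<And>x. x \<in> \<Omega> \<Longrightarrow> norm x \<le> R" using bounded_dom bounded_pos by blast
  have "intg (\<lambda>x. (\<zeta> x)\<^sup>2) \<le> 4 * R\<^sup>2 * gsq \<zeta>" if z: "\<zeta> \<in> test_functions \<Omega>" for \<zeta>
  proof -
    note V = test_functions_vanish[OF z]
    note G = has_weak_gradient_smooth[OF V(1)]
    note L = has_weak_gradient_L2[OF G]
    let ?p = "partial_at 1 \<zeta>"
    have Lp: "L2 ?p" using L2_fun_component[OF L(2), of 1] by simp
    have sx: "smooth_on UNIV (\<lambda>x::pt. x $ 1)" by (rule smooth_coordinate)
    have dx: "partial_at 1 (\<lambda>x::pt. x $ 1) x = 1" for x
      by (subst partial_at_eqI[of _ "\<lambda>_ h. h $ 1"]) (auto intro!: bounded_linear.has_derivative[OF bounded_linear_vec_nth] derivative_eq_intros)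
    have sxz: "smooth_on UNIV (\<lambda>x. x $ 1 * \<zeta> x)" by (intro smooth_on_UNIV_intros sx V(1))
    have "intg (\<lambda>x. (x $ 1 * \<zeta> x) * ?p x) = - intg (\<lambda>x. partial_at 1 (\<lambda>x. x $ 1 * \<zeta> x) x * \<zeta> x)"
      by (rule smooth_partial_parts[OF sxz z]) simp
    also have "\<dots> = - intg (\<lambda>x. (x $ 1 * ?p x) * \<zeta> x + (\<zeta> x)\<^sup>2)"
    proof -
      have "partial_at 1 (\<lambda>x. x $ 1 * \<zeta> x) x * \<zeta> x = (x $ 1 * ?p x) * \<zeta> x + (\<zeta> x)\<^sup>2" for x
        unfolding partial_at_mult[OF sx V(1)] dx by (simp add: power2_eq_square algebra_simps)
      then show ?thesis by simp
    qed
    also have "\<dots> = - intg (\<lambda>x. (x $ 1 * \<zeta> x) * ?p x) - intg (\<lambda>x. (\<zeta> x)\<^sup>2)"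
    proof -
      have "integrable M (\<lambda>x. (x $ 1 * \<zeta> x) * ?p x)"
        using L2_fun_inner[OF L2_fun_continuous[OF smooth_differentiable(2)[OF sxz]] Lp] by simp
      moreover have "integrable M (\<lambda>x. (\<zeta> x)\<^sup>2)" using L2_funD(2)[OF L(1)] by simp
      ultimately show ?thesis by (simp add: mult_ac)
    qed
    finally have e: "intg (\<lambda>x. (\<zeta> x)\<^sup>2) = - 2 * intg (\<lambda>x. (x $ 1 * \<zeta> x) * ?p x)" by simp
    have i1: "integrable M (\<lambda>x. (\<zeta> x)\<^sup>2)" "integrable M (\<lambda>x. (norm (grad \<zeta> x))\<^sup>2)"
      using L2_funD(2)[OF L(1)] L2_funD(2)[OF L(2)] by simp_all
    have "- 2 * intg (\<lambda>x. (x $ 1 * \<zeta> x) * ?p x) = intg (\<lambda>x. - 2 * ((x $ 1 * \<zeta> x) * ?p x))" by simp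
    also have "\<dots> \<le> intg (\<lambda>x. (\<zeta> x)\<^sup>2 / 2 + 2 * R\<^sup>2 * (norm (grad \<zeta> x))\<^sup>2)"
    proof (rule integral_mono)
      show "integrable M (\<lambda>x. - 2 * ((x $ 1 * \<zeta> x) * ?p x))"
        using L2_fun_inner[OF L2_fun_continuous[OF smooth_differentiable(2)[OF sxz]] Lp] by simp
      show "integrable M (\<lambda>x. (\<zeta> x)\<^sup>2 / 2 + 2 * R\<^sup>2 * (norm (grad \<zeta> x))\<^sup>2)" using i1 by simp
      fix x assume "x \<in> space M"
      then have x: "\<bar>x $ 1\<bar> \<le> R" using R(2)[of x] component_le_norm_cart[of x 1] by simp
      have p: "\<bar>?p x\<bar> \<le> norm (grad \<zeta> x)" using component_le_norm_cart[of "grad \<zeta> x" 1] by simp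
      have "- 2 * ((x $ 1 * \<zeta> x) * ?p x) \<le> 2 * (\<bar>x $ 1\<bar> * \<bar>\<zeta> x\<bar> * \<bar>?p x\<bar>)"
        using abs_ge_minus_self[of "(x $ 1 * \<zeta> x) * ?p x"] unfolding abs_mult by linarith
      also have "\<dots> \<le> 2 * (R * \<bar>\<zeta> x\<bar> * norm (grad \<zeta> x))"
        using x p R(1) by (intro mult_left_mono mult_mono) auto
      \<comment> \<open>Weighted so that exactly half of the integral of \<open>\<zeta>^2\<close>
        appears and can be moved to the left, which explains the constant
        \<open>4 * R^2\<close>.\<close>
      also have "\<dots> = 2 * ((\<bar>\<zeta> x\<bar> / sqrt 2) * (sqrt 2 * R * norm (grad \<zeta> x)))" by simp
      also have "\<dots> \<le> (\<bar>\<zeta> x\<bar> / sqrt 2)\<^sup>2 + (sqrt 2 * R * norm (grad \<zeta> x))\<^sup>2"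
        using sum_squares_bound[of "\<bar>\<zeta> x\<bar> / sqrt 2" "sqrt 2 * R * norm (grad \<zeta> x)"] by simp
      also have "\<dots> = (\<zeta> x)\<^sup>2 / 2 + 2 * R\<^sup>2 * (norm (grad \<zeta> x))\<^sup>2" by (simp add: power_divide power_mult_distrib)
      finally show "- 2 * ((x $ 1 * \<zeta> x) * ?p x) \<le> (\<zeta> x)\<^sup>2 / 2 + 2 * R\<^sup>2 * (norm (grad \<zeta> x))\<^sup>2" .
    qed
    also have "\<dots> = intg (\<lambda>x. (\<zeta> x)\<^sup>2) / 2 + 2 * R\<^sup>2 * gsq \<zeta>"
      using i1 by (simp add: grad_sq_eq[OF G])
    finally have le: "- 2 * intg (\<lambda>x. (x $ 1 * \<zeta> x) * ?p x) \<le> intg (\<lambda>x. (\<zeta> x)\<^sup>2) / 2 + 2 * R\<^sup>2 * gsq \<zeta>" .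
    have "I \<le> 4 * R\<^sup>2 * G" if "I = J" "J \<le> I / 2 + 2 * R\<^sup>2 * G" for I J G :: real
      using that by simp
    from this[OF e le] show ?thesis .
  qed
  then show thesis using R(1) by (intro that[of "4 * R\<^sup>2"]) auto
qed

end

section \<open>The supercell and its periodic functions\<close>

definition cell_map :: "real ^ 3 ^ 3 \<Rightarrow> pt \<Rightarrow> pt" where
  "cell_map a t = (\<Sum>i\<in>UNIV. t $ i *\<^sub>R a $ i)"

lemma linear_cell_map: "linear (cell_map a)"
  unfolding cell_map_def
  by (intro linearI) (simp_all add: scaleR_add_left sum.distrib scaleR_sum_right)

lemma cell_map_matrix: "cell_map a t = transpose a *v t"
  by (simp add: cell_map_def vec_eq_iff matrix_vector_mult_def transpose_def mult.commute)

lemma cell_map_inverse: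
  assumes "invertible a"
  obtains L where "linear L" "\<And>x. cell_map a (L x) = x" "\<And>t. L (cell_map a t) = t"
proof -
  obtain B where B: "a ** B = mat 1" "B ** a = mat 1" using assms unfolding invertible_def by blast
  have T: "transpose a ** transpose B = mat 1" "transpose B ** transpose a = mat 1"
    unfolding matrix_transpose_mul[symmetric] B by (rule transpose_mat)+
  show thesis
  proof (rule that[of "\<lambda>x. transpose B *v x"])
    show "linear (\<lambda>x. transpose B *v x)" by (rule matrix_vector_mul_linear)
    show "cell_map a (transpose B *v x) = x" "transpose B *v cell_map a x = x" for x
      unfolding cell_map_matrix matrix_vector_mul_assoc T by (rule matrix_vector_mul_lid)+
  qed
qed

lemma bij_cell_map:
  assumes "invertible a" shows "bij (cell_map a)"
proof -
  obtain L where "linear L" and L: "\<And>x. cell_map a (L x) = x" "\<And>t. L (cell_map a t) = t"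
    by (rule cell_map_inverse[OF assms]) (rule that; assumption)
  have "surj (cell_map a)" using L(1) by (rule surjI)
  moreover have "inj (cell_map a)" using L(2) by (rule inj_on_inverseI)
  ultimately show ?thesis by (simp add: bij_def)
qed

lemma periodic_multiple:
  fixes f :: "pt \<Rightarrow> 'b"
  assumes "\<And>x. f (x + v) = f x"
  shows "f (x + of_int m *\<^sub>R v) = f x"
proof -
  have n: "f (x + real n *\<^sub>R v) = f x" for n :: nat and x
  proof (induction n arbitrary: x)
    case (Suc n)
    have "x + real (Suc n) *\<^sub>R v = (x + real n *\<^sub>R v) + v" by (simp add: algebra_simps)
    then show ?case using assms Suc by metis
  qed simp
  show ?thesis
  proof (cases m)
    case (nonneg n) then show ?thesis using n[of x n] by simp
  next
    case (neg n)
    then have "of_int m + real (Suc n) = 0" by simp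
    then have "(x + of_int m *\<^sub>R v) + real (Suc n) *\<^sub>R v = x"
      unfolding add.assoc scaleR_add_left[symmetric] by simp
    then show ?thesis using n[of "x + of_int m *\<^sub>R v" "Suc n"] by metis
  qed
qed

lemma periodic_lattice:
  fixes f :: "pt \<Rightarrow> 'b"
  assumes p: "\<And>x i. f (x + a $ i) = f x"
  shows "f (x + cell_map a (\<chi> i. of_int (n i))) = f x"
proof -
  have "f (x + cell_map a (\<chi> i. of_int (n i))) = f (((x + of_int (n 1) *\<^sub>R a $ 1) + of_int (n 2) *\<^sub>R a $ 2) + of_int (n 3) *\<^sub>R a $ 3)"
    by (simp add: cell_map_def sum_3 add.assoc)
  also have "\<dots> = f x" unfolding periodic_multiple[of f, OF p] ..
  finally show ?thesis .
qed

lemma nn_integral_shift: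
  fixes f :: "pt \<Rightarrow> ennreal"
  assumes "f \<in> borel_measurable borel"
  shows "(\<integral>\<^sup>+x. f (x + v) \<partial>lborel) = (\<integral>\<^sup>+x. f x \<partial>lborel)"
proof -
  have "(\<integral>\<^sup>+x. f x \<partial>lborel) = (\<integral>\<^sup>+x. f x \<partial>distr lborel borel ((+) v))" by (simp add: lborel_distr_plus)
  also have "\<dots> = (\<integral>\<^sup>+x. f (v + x) \<partial>lborel)" using assms by (subst nn_integral_distr) auto
  finally show ?thesis by (simp add: add.commute)
qed

locale cell =
  fixes x0 :: pt and a :: "real ^ 3 ^ 3"
  assumes inv: "invertible a"
begin

abbreviation "\<Omega> \<equiv> supercell x0 a"

definition "closed_cell = (\<lambda>t. x0 + cell_map a t) ` cbox 0 1"

lemma cell_image: "\<Omega> = (\<lambda>t. x0 + cell_map a t) ` box 0 1"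
  by (auto simp: supercell_def cell_map_def mem_box_cart image_def)

lemma bl_cell: "bounded_linear (cell_map a)" by (rule linear_conv_bounded_linear[THEN iffD1, OF linear_cell_map])

lemma cell_open: "open \<Omega>"
proof -
  have "open (cell_map a ` box 0 1)"
    by (rule open_surjective_linear_image[OF open_box linear_cell_map bij_is_surj[OF bij_cell_map[OF inv]]])
  then have "open ((+) x0 ` (cell_map a ` box 0 1))" by (rule open_translation)
  then show ?thesis by (simp add: cell_image image_image)
qed

lemma compact_closed_cell: "compact closed_cell"
  unfolding closed_cell_def
  by (intro compact_continuous_image continuous_intros linear_continuous_on[OF bl_cell] compact_cbox)

lemma cell_subset: "\<Omega> \<subseteq> closed_cell"
  unfolding cell_image closed_cell_def by (intro image_mono box_subset_cbox)

lemma cell_bounded: "bounded \<Omega>"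
  by (rule bounded_subset[OF compact_imp_bounded[OF compact_closed_cell] cell_subset])

lemma cell_nonempty: "\<Omega> \<noteq> {}"
proof -
  have "(\<chi> i. (1/2 :: real)) \<in> box (0::pt) 1" by (simp add: mem_box_cart)
  then show ?thesis unfolding cell_image by blast
qed

lemma cell_boundary_negligible: "negligible (closed_cell - \<Omega>)"
proof -
  have "negligible (cell_map a ` (cbox 0 1 - box 0 1))"
    by (rule negligible_differentiable_image_negligible[OF order_refl negligible_frontier_interval linear_imp_differentiable_on[OF linear_cell_map]])
  then have "negligible ((+) x0 ` (cell_map a ` (cbox 0 1 - box 0 1)))" by (rule negligible_translation)
  then show ?thesis
    by (rule negligible_subset) (auto simp: cell_image closed_cell_def image_image)
qed

sublocale bounded_open \<Omega>
  by unfold_locales (rule cell_open cell_bounded)+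

text \<open>Subtracting the integer parts of the lattice coordinates moves a point into the closed
  cell; on a bounded set only finitely many integer parts occur. The shifts are described by the
  periodic functions they leave invariant, which is the form used under the integral.\<close>

lemma lattice_cover:
  assumes B: "bounded B"
  obtains V where "finite V" "\<forall>v\<in>V. \<forall>f :: pt \<Rightarrow> ennreal. (\<forall>x i. f (x + a $ i) = f x) \<longrightarrow> (\<forall>x. f (x + v) = f x)"
    "\<forall>x\<in>B. \<exists>v\<in>V. x - v \<in> closed_cell"
proof -
  let ?L = "cell_map a"
  obtain L' where "linear L'" and L': "\<And>x. ?L (L' x) = x" "\<And>t. L' (?L t) = t" by (rule cell_map_inverse[OF inv]) (rule that; assumption)
  have "bounded ((\<lambda>x. x - x0) ` B)" using B by (rule bounded_translation_minus)
  then have "bounded (L' ` ((\<lambda>x. x - x0) ` B))"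
    by (rule bounded_linear_image) (use \<open>linear L'\<close> in \<open>simp add: linear_conv_bounded_linear\<close>)
  then have "bounded ((\<lambda>x. L' (x - x0)) ` B)" by (simp add: image_image)
  then obtain K where K: "\<And>x. x \<in> B \<Longrightarrow> norm (L' (x - x0)) \<le> K" by (auto simp: bounded_iff)
  define N where "N = {n :: 3 \<Rightarrow> int. \<forall>i. n i \<in> {- \<lceil>K\<rceil> - 1 .. \<lceil>K\<rceil> + 1}}"
  define V where "V = (\<lambda>n. ?L (\<chi> i. of_int (n i))) ` N"
  have "N = PiE UNIV (\<lambda>_. {- \<lceil>K\<rceil> - 1 .. \<lceil>K\<rceil> + 1})" by (auto simp: N_def PiE_def)
  then have "finite N" by (simp add: finite_PiE)
  then have "finite V" by (simp add: V_def)
  moreover have "\<forall>v\<in>V. \<forall>f :: pt \<Rightarrow> ennreal. (\<forall>x i. f (x + a $ i) = f x) \<longrightarrow> (\<forall>x. f (x + v) = f x)"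
    using periodic_lattice[of _ a] by (auto simp: V_def)
  moreover have "\<forall>x\<in>B. \<exists>v\<in>V. x - v \<in> closed_cell"
  proof
    fix x assume x: "x \<in> B"
    define t where "t = L' (x - x0)"
    define n where "n i = \<lfloor>t $ i\<rfloor>" for i
    have tK: "\<bar>t $ i\<bar> \<le> K" for i using K[OF x] component_le_norm_cart[of t i] by (simp add: t_def)
    have "n i \<in> {- \<lceil>K\<rceil> - 1 .. \<lceil>K\<rceil> + 1}" for i
      using tK[of i] unfolding n_def atLeastAtMost_iff by linarith
    then have nV: "?L (\<chi> i. of_int (n i)) \<in> V" unfolding V_def N_def by blast
    have "t - (\<chi> i. of_int (n i)) \<in> cbox 0 1"
      unfolding mem_box_cart n_def by (auto simp: of_int_floor_le) linarith
    moreover have "x - ?L (\<chi> i. of_int (n i)) = x0 + ?L (t - (\<chi> i. of_int (n i)))"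
      unfolding linear_diff[OF linear_cell_map] t_def L'(1) by simp
    ultimately show "\<exists>v\<in>V. x - v \<in> closed_cell" using nV unfolding closed_cell_def by blast
  qed
  ultimately show thesis by (rule that)
qed

lemma nn_integral_closed_cell:
  assumes f [measurable]: "f \<in> borel_measurable borel"
  shows "(\<integral>\<^sup>+x. f x * indicator closed_cell x \<partial>lborel) = (\<integral>\<^sup>+x. f x \<partial>M)"
proof -
  have [measurable]: "closed_cell \<in> sets borel" "\<Omega> \<in> sets borel"
    using compact_closed_cell cell_open by (auto intro: borel_compact)
  have "AE x in lborel. x \<notin> closed_cell - \<Omega>"
    using cell_boundary_negligible by (intro AE_not_in) (auto simp: negligible_iff_null_sets null_sets_completion_iff)
  then have "(\<integral>\<^sup>+x. f x * indicator closed_cell x \<partial>lborel) = (\<integral>\<^sup>+x. f x * indicator \<Omega> x \<partial>lborel)"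
    by (intro nn_integral_cong_AE) (auto elim!: eventually_mono simp: indicator_def dest: cell_subset[THEN subsetD])
  also have "\<dots> = (\<integral>\<^sup>+x. f x * indicator \<Omega> x \<partial>lebesgue)"
    by (rule nn_integral_completion[symmetric]) measurable
  also have "\<dots> = (\<integral>\<^sup>+x. f x \<partial>M)" by (simp add: nn_integral_restrict_space)
  finally show ?thesis .
qed

text \<open>\<open>m\<close> is the number of lattice shifts of the cell that cover
  \<open>B\<close>. It depends on \<open>B\<close> alone, so one constant serves all periodic
  functions.\<close>

lemma nn_integral_periodic_bound:
  assumes B: "bounded B" "B \<in> sets borel"
  shows "\<exists>m::nat. \<forall>f. f \<in> borel_measurable borel \<longrightarrow> (\<forall>x i. f (x + a $ i) = f x) \<longrightarrow>
    (\<integral>\<^sup>+x. f x * indicator B x \<partial>lborel) \<le> of_nat m * (\<integral>\<^sup>+x. f x \<partial>M)"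
proof -
  obtain V where V: "finite V" "\<forall>v\<in>V. \<forall>f :: pt \<Rightarrow> ennreal. (\<forall>x i. f (x + a $ i) = f x) \<longrightarrow> (\<forall>x. f (x + v) = f x)"
    "\<forall>x\<in>B. \<exists>v\<in>V. x - v \<in> closed_cell"
    by (rule lattice_cover[OF B(1)]) (rule that; assumption)
  show ?thesis
  proof (intro exI[of _ "card V"] allI impI)
    fix f :: "pt \<Rightarrow> ennreal" assume f [measurable]: "f \<in> borel_measurable borel" and p: "\<forall>x i. f (x + a $ i) = f x"
    have [measurable]: "closed_cell \<in> sets borel" using compact_closed_cell by (auto intro: borel_compact)
    have "(\<integral>\<^sup>+x. f x * indicator B x \<partial>lborel) \<le> (\<integral>\<^sup>+x. (\<Sum>v\<in>V. f (x - v) * indicator closed_cell (x - v)) \<partial>lborel)"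
    proof (rule nn_integral_mono)
      fix x
      show "f x * indicator B x \<le> (\<Sum>v\<in>V. f (x - v) * indicator closed_cell (x - v))"
      proof (cases "x \<in> B")
        case True
        then obtain v where v: "v \<in> V" "x - v \<in> closed_cell" using V(3) by blast
        have "f ((x - v) + v) = f (x - v)" using V(2) v(1) p by blast
        then have "f x = f (x - v)" by simp
        then have "f x * indicator B x = f (x - v) * indicator closed_cell (x - v)" using True v by simp
        also have "\<dots> \<le> (\<Sum>v\<in>V. f (x - v) * indicator closed_cell (x - v))"
          by (rule member_le_sum[OF v(1) _ V(1)]) simp
        finally show ?thesis .
      qed simp
    qed
    also have "\<dots> = (\<Sum>v\<in>V. \<integral>\<^sup>+x. f (x - v) * indicator closed_cell (x - v) \<partial>lborel)"
      by (rule nn_integral_sum) measurable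
    also have "\<dots> = (\<Sum>v\<in>V. \<integral>\<^sup>+x. f x * indicator closed_cell x \<partial>lborel)"
      using nn_integral_shift[of "\<lambda>x. f x * indicator closed_cell x" "- v" for v] by simp
    also have "\<dots> = of_nat (card V) * (\<integral>\<^sup>+x. f x \<partial>M)" by (simp add: nn_integral_closed_cell)
    finally show "(\<integral>\<^sup>+x. f x * indicator B x \<partial>lborel) \<le> of_nat (card V) * (\<integral>\<^sup>+x. f x \<partial>M)" .
  qed
qed

lemma trial_space_periodic: "trial_space \<Omega> (smooth_periodic a)"
  by unfold_locales (auto simp: smooth_periodic_def intro!: smooth_on_UNIV_intros)

lemma periodic_partial:
  assumes "\<eta> \<in> smooth_periodic a" shows "partial_at i \<eta> (x + a $ j) = partial_at i \<eta> x"
proof -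
  have sm: "smooth_on UNIV \<eta>" and p: "\<And>x. \<eta> (x + a $ j) = \<eta> x" using assms by (auto simp: smooth_periodic_def)
  have "((\<lambda>x. \<eta> (x + a $ j)) has_derivative (\<lambda>h. grad \<eta> (x + a $ j) \<bullet> h)) (at x)" for x
  proof -
    have "((\<lambda>x. x + a $ j) has_derivative (\<lambda>h. h)) (at x)" by (auto intro!: derivative_eq_intros)
    from has_derivative_compose[OF this smooth_deriv[OF sm]] show ?thesis .
  qed
  from partial_at_eqI[OF this, of i] show ?thesis unfolding p by (simp add: inner_axis fun_eq_iff)
qed

text \<open>Multiplying by a fixed cutoff that is positive on the closed cell gives a compactly
  supported function to which the inequality on the whole space applies. Periodicity bounds the
  integrals over the support of the cutoff by integrals over one cell.\<close>

lemma periodic_L4: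
  obtains S where "S > 0" "\<And>\<eta>. \<eta> \<in> smooth_periodic a \<Longrightarrow> (\<integral>\<^sup>+x. ennreal (\<eta> x ^ 4) \<partial>M) \<le> ennreal (S * (h1_sq \<eta>)\<^sup>2)"
proof -
  obtain c where c: "closed_cell \<subseteq> box (- c) c"
    using bounded_subset_box_symmetric[OF compact_imp_bounded[OF compact_closed_cell]] by blast
  define cut where "cut = box_bump (- c) c 1"
  have cuts: "smooth_on UNIV cut" unfolding cut_def by (rule box_bump_smooth)
  have cutt: "cut \<in> test_functions (cbox (- c) c)" unfolding cut_def by (rule box_bump_test_function) auto
  note cutv = test_functions_vanish[OF cutt]
  have ne: "closed_cell \<noteq> {}" using cell_subset cell_nonempty by blast
  obtain p where p: "p \<in> closed_cell" "\<And>x. x \<in> closed_cell \<Longrightarrow> cut p \<le> cut x"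
    using continuous_attains_inf[OF compact_closed_cell ne, of cut] smooth_differentiable(2)[OF cuts] continuous_on_subset by blast
  \<comment> \<open>The minimum of the cutoff over the compact closed cell; there
    \<open>\<eta>\<close> is recovered from \<open>u\<close> at the cost of a factor
    \<open>1 / m0\<close>.\<close>
  define m0 where "m0 = cut p"
  have m0: "m0 > 0" unfolding m0_def cut_def using p(1) c by (subst box_bump_pos) auto
  have m0le: "m0 \<le> cut x" if "x \<in> \<Omega>" for x using p(2)[of x] that cell_subset unfolding m0_def by blast
  have "continuous_on UNIV (grad cut)" by (intro continuous_on_vec_lambda smooth_differentiable(3)[OF cuts])
  then have "compact (grad cut ` cbox (- c) c)" by (intro compact_continuous_image compact_cbox) (auto intro: continuous_on_subset)
  then obtain K where "\<forall>y\<in>grad cut ` cbox (- c) c. norm y \<le> K"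
    using compact_imp_bounded[of "grad cut ` cbox (- c) c"] unfolding bounded_iff by auto
  then have K: "norm (grad cut x) \<le> K" if "x \<in> cbox (- c) c" for x using that by simp
  \<comment> \<open>The product rule gives twice the squared gradient of \<open>\<eta>\<close> and
    \<open>2 * K^2\<close> times \<open>\<eta>^2\<close>; the square of \<open>u\<close> itself adds
    at most \<open>\<eta>^2\<close> because the cutoff is at most 1.\<close>
  define K1 where "K1 = 3 + 2 * K\<^sup>2"
  have K1: "K1 > 0" by (simp add: K1_def add_pos_nonneg)
  obtain m :: nat where m': "\<forall>f. f \<in> borel_measurable borel \<longrightarrow> (\<forall>x i. f (x + a $ i) = f x) \<longrightarrow>
    (\<integral>\<^sup>+x. f x * indicator (cbox (- c) c) x \<partial>lborel) \<le> of_nat m * (\<integral>\<^sup>+x. f x \<partial>M)"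
    using nn_integral_periodic_bound[OF bounded_cbox borel_closed[OF closed_cbox]] ..
  note m = m'[rule_format]
  show thesis
  proof (rule that[of "2 * (K1 * (real m + 1))\<^sup>2 / m0 ^ 4"])
    show "2 * (K1 * (real m + 1))\<^sup>2 / m0 ^ 4 > 0" using m0 K1 by simp
    fix \<eta> assume \<eta>: "\<eta> \<in> smooth_periodic a"
    have sm: "smooth_on UNIV \<eta>" and per: "\<And>x i. \<eta> (x + a $ i) = \<eta> x" using \<eta> by (auto simp: smooth_periodic_def)
    note G = has_weak_gradient_smooth[OF sm]
    note Lg = has_weak_gradient_L2[OF G]
    define u where "u x = cut x * \<eta> x" for x
    have us: "smooth_on UNIV u" unfolding u_def by (intro smooth_on_UNIV_intros cuts sm)
    obtain R where R: "\<And>x. x \<notin> cball 0 R \<Longrightarrow> cut x = 0" using cutv(3) by blast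
    have uR: "\<And>x. x \<notin> cball 0 R \<Longrightarrow> u x = 0" using R by (simp add: u_def)
    have [measurable]: "\<eta> \<in> borel_measurable borel" "partial_at i \<eta> \<in> borel_measurable borel" "u \<in> borel_measurable borel" for i
      using smooth_differentiable[OF sm] smooth_differentiable[OF us] by (auto intro: borel_measurable_continuous_onI)
    define e where "e x = (\<eta> x)\<^sup>2 + (\<Sum>i\<in>UNIV. (partial_at i \<eta> x)\<^sup>2)" for x
    have em [measurable]: "e \<in> borel_measurable borel" unfolding e_def by measurable
    have e0: "e x \<ge> 0" for x by (simp add: e_def sum_nonneg)
    have grad_u: "(\<Sum>i\<in>UNIV. (partial_at i u x)\<^sup>2) + (u x)\<^sup>2 \<le> K1 * e x * indicator (cbox (- c) c) x" for x
    proof (cases "x \<in> cbox (- c) c")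
      case True
      have gu: "grad u x = cut x *\<^sub>R grad \<eta> x + \<eta> x *\<^sub>R grad cut x"
        unfolding u_def vec_eq_iff by (simp add: partial_at_mult[OF cuts sm])
      have x1: "0 \<le> cut x" "cut x \<le> 1" using box_bump_bounds[of "- c" c 1 x] by (simp_all add: cut_def)
      have n1: "norm (cut x *\<^sub>R grad \<eta> x) \<le> norm (grad \<eta> x)" using x1 by (simp add: mult_left_le_one_le)
      have n2: "norm (\<eta> x *\<^sub>R grad cut x) \<le> \<bar>\<eta> x\<bar> * K" using K[OF True] by (simp add: mult_left_mono)
      have "norm (grad u x) \<le> norm (grad \<eta> x) + \<bar>\<eta> x\<bar> * K"
        unfolding gu using norm_triangle_ineq[of "cut x *\<^sub>R grad \<eta> x" "\<eta> x *\<^sub>R grad cut x"] n1 n2 by linarith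
      from power_mono[OF this norm_ge_zero, of 2]
      have "(norm (grad u x))\<^sup>2 \<le> 2 * (norm (grad \<eta> x))\<^sup>2 + 2 * ((\<eta> x)\<^sup>2 * K\<^sup>2)"
        using sum_squares_bound[of "norm (grad \<eta> x)" "\<bar>\<eta> x\<bar> * K"] by (simp add: power2_sum power_mult_distrib)
      moreover have "(u x)\<^sup>2 \<le> (\<eta> x)\<^sup>2"
      proof -
        have "\<bar>u x\<bar> \<le> \<bar>\<eta> x\<bar>" using x1 by (simp add: u_def abs_mult mult_left_le_one_le)
        then show ?thesis by (simp add: abs_le_square_iff)
      qed
      moreover have "K1 * e x = K1 * (norm (grad \<eta> x))\<^sup>2 + 3 * (\<eta> x)\<^sup>2 + 2 * ((\<eta> x)\<^sup>2 * K\<^sup>2)"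
        unfolding K1_def e_def norm_grad_sq by (simp add: algebra_simps)
      moreover have "2 * (norm (grad \<eta> x))\<^sup>2 \<le> K1 * (norm (grad \<eta> x))\<^sup>2" by (rule mult_right_mono) (simp_all add: K1_def)
      moreover have "0 \<le> (\<eta> x)\<^sup>2" by simp
      ultimately have "(norm (grad u x))\<^sup>2 + (u x)\<^sup>2 \<le> K1 * e x" by (simp only: )
      then show ?thesis using True by (simp add: norm_grad_sq)
    next
      case False
      have "partial_at i u x = 0" for i
        unfolding u_def partial_at_mult[OF cuts sm] using cutv(2,4) False by simp
      then show ?thesis using False cutv(2)[OF False] by (simp add: u_def)
    qed
    let ?g = "\<lambda>x. \<Sum>i\<in>UNIV. (partial_at i u x)\<^sup>2"
    have I: "(\<integral>\<^sup>+x. ennreal (K1 * e x * indicator (cbox (- c) c) x) \<partial>lborel) \<le> ennreal (K1 * (real m + 1) * h1_sq \<eta>)"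
    proof -
      have ep: "e (x + a $ i) = e x" for x i unfolding e_def per periodic_partial[OF \<eta>] ..
      have "(\<integral>\<^sup>+x. ennreal (K1 * e x * indicator (cbox (- c) c) x) \<partial>lborel) = (\<integral>\<^sup>+x. ennreal (K1 * e x) * indicator (cbox (- c) c) x \<partial>lborel)"
        by (intro nn_integral_cong) (auto simp: indicator_def)
      also have "\<dots> \<le> of_nat m * (\<integral>\<^sup>+x. ennreal (K1 * e x) \<partial>M)" by (rule m) (simp_all add: ep)
      also have "(\<integral>\<^sup>+x. ennreal (K1 * e x) \<partial>M) = ennreal (K1 * h1_sq \<eta>)"
        unfolding e_def norm_grad_sq[symmetric] h1_sq_eq[OF G]
        using L2_funD(2)[OF Lg(1)] L2_funD(2)[OF Lg(2)] K1 by (subst nn_integral_eq_integral) auto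
      also have "of_nat m * ennreal (K1 * h1_sq \<eta>) = ennreal (real m * (K1 * h1_sq \<eta>))"
        using K1 h1_sq_nonneg[of \<eta>] by (simp add: ennreal_mult' ennreal_of_nat_eq_real_of_nat)
      also have "\<dots> \<le> ennreal (K1 * (real m + 1) * h1_sq \<eta>)"
        using K1 h1_sq_nonneg[of \<eta>] by (intro ennreal_leI) (simp add: algebra_simps)
      finally show ?thesis .
    qed
    have I1: "(\<integral>\<^sup>+x. ennreal ((u x)\<^sup>2 + ?g x) \<partial>lborel) \<le> ennreal (K1 * (real m + 1) * h1_sq \<eta>)"
      by (rule order_trans[OF nn_integral_mono I]) (rule ennreal_leI, use grad_u in \<open>simp only: add.commute\<close>)
    have I2: "(\<integral>\<^sup>+x. ennreal (?g x) \<partial>lborel) \<le> ennreal (K1 * (real m + 1) * h1_sq \<eta>)"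
      by (rule order_trans[OF nn_integral_mono I1]) (rule ennreal_leI, simp)
    have "ennreal (m0 ^ 4) * (\<integral>\<^sup>+x. ennreal (\<eta> x ^ 4) \<partial>M) = (\<integral>\<^sup>+x. ennreal (m0 ^ 4 * \<eta> x ^ 4) \<partial>M)"
    proof -
      have [measurable]: "\<eta> \<in> borel_measurable M" using L2_funD(1)[OF Lg(1)] .
      show ?thesis using m0 by (simp add: ennreal_mult' flip: nn_integral_cmult)
    qed
    also have "\<dots> \<le> (\<integral>\<^sup>+x. ennreal (u x ^ 4) \<partial>M)"
    proof (rule nn_integral_mono)
      fix x assume "x \<in> space M"
      then have "m0 ^ 4 \<le> cut x ^ 4" using m0 m0le[of x] by (intro power_mono) auto
      then show "ennreal (m0 ^ 4 * \<eta> x ^ 4) \<le> ennreal (u x ^ 4)"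
        unfolding u_def power_mult_distrib by (intro ennreal_leI mult_right_mono) auto
    qed
    also have "\<dots> = (\<integral>\<^sup>+x. ennreal (u x ^ 4) * indicator closed_cell x \<partial>lborel)"
      by (rule nn_integral_closed_cell[symmetric]) measurable
    also have "\<dots> \<le> (\<integral>\<^sup>+x. ennreal (u x ^ 4) \<partial>lborel)"
      by (intro nn_integral_mono) (auto simp: indicator_def)
    also have "\<dots> \<le> 2 * (\<integral>\<^sup>+x. ennreal ((u x)\<^sup>2 + ?g x) \<partial>lborel) * (\<integral>\<^sup>+x. ennreal (?g x) \<partial>lborel)"
      by (rule Ladyzhenskaya_smooth[OF us uR])
    also have "\<dots> \<le> 2 * ennreal (K1 * (real m + 1) * h1_sq \<eta>) * ennreal (K1 * (real m + 1) * h1_sq \<eta>)"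
      by (intro mult_mono I1 I2) auto
    also have "\<dots> = ennreal (2 * (K1 * (real m + 1))\<^sup>2 * (h1_sq \<eta>)\<^sup>2)"
    proof -
      have "K1 * (real m + 1) * h1_sq \<eta> \<ge> 0" using K1 h1_sq_nonneg[of \<eta>] by simp
      then have "2 * ennreal (K1 * (real m + 1) * h1_sq \<eta>) * ennreal (K1 * (real m + 1) * h1_sq \<eta>)
        = ennreal (2 * (K1 * (real m + 1) * h1_sq \<eta>) * (K1 * (real m + 1) * h1_sq \<eta>))"
        by (simp add: ennreal_mult flip: ennreal_numeral)
      also have "2 * (K1 * (real m + 1) * h1_sq \<eta>) * (K1 * (real m + 1) * h1_sq \<eta>) = 2 * (K1 * (real m + 1))\<^sup>2 * (h1_sq \<eta>)\<^sup>2"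
        by (simp add: power2_eq_square)
      finally show ?thesis .
    qed
    finally have fin: "ennreal (m0 ^ 4) * (\<integral>\<^sup>+x. ennreal (\<eta> x ^ 4) \<partial>M) \<le> ennreal (2 * (K1 * (real m + 1))\<^sup>2 * (h1_sq \<eta>)\<^sup>2)" .
    have "(\<integral>\<^sup>+x. ennreal (\<eta> x ^ 4) \<partial>M) = ennreal (1 / m0 ^ 4) * (ennreal (m0 ^ 4) * (\<integral>\<^sup>+x. ennreal (\<eta> x ^ 4) \<partial>M))"
      using m0 by (simp add: mult.assoc[symmetric] flip: ennreal_mult')
    also have "\<dots> \<le> ennreal (1 / m0 ^ 4) * ennreal (2 * (K1 * (real m + 1))\<^sup>2 * (h1_sq \<eta>)\<^sup>2)"
      by (rule mult_left_mono[OF fin]) simp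
    also have "\<dots> = ennreal (2 * (K1 * (real m + 1))\<^sup>2 / m0 ^ 4 * (h1_sq \<eta>)\<^sup>2)"
      using m0 by (simp flip: ennreal_mult)
    finally show "(\<integral>\<^sup>+x. ennreal (\<eta> x ^ 4) \<partial>M) \<le> ennreal (2 * (K1 * (real m + 1))\<^sup>2 / m0 ^ 4 * (h1_sq \<eta>)\<^sup>2)" .
  qed
qed

text \<open>The difference is the integral of the directional derivative over the segment. Jensen's
  inequality follows because the variance of this derivative on the unit interval is
  nonnegative.\<close>

lemma sq_diff_le_segment:
  assumes sm: "smooth_on UNIV \<eta>"
  shows "ennreal ((\<eta> (y + z) - \<eta> y)\<^sup>2) \<le> (\<integral>\<^sup>+t. ennreal ((norm z)\<^sup>2 * (norm (grad \<eta> (y + t *\<^sub>R z)))\<^sup>2) * indicator {0..1} t \<partial>lborel)"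
proof -
  define h where "h t = grad \<eta> (y + t *\<^sub>R z) \<bullet> z" for t
  have cg: "continuous_on UNIV (grad \<eta>)" by (intro continuous_on_vec_lambda smooth_differentiable(3)[OF sm])
  have cg': "continuous_on S (\<lambda>t. grad \<eta> (y + t *\<^sub>R z))" for S
    by (rule continuous_on_compose2[OF cg]) (auto intro!: continuous_intros)
  have ch: "continuous_on S h" for S unfolding h_def by (intro continuous_intros cg')
  have d: "((\<lambda>t. \<eta> (y + t *\<^sub>R z)) has_real_derivative h t) (at t)" for t
  proof -
    have "((\<lambda>t. y + t *\<^sub>R z) has_derivative (\<lambda>h. h *\<^sub>R z)) (at t)" by (auto intro!: derivative_eq_intros)
    from has_derivative_compose[OF this smooth_deriv[OF sm]]
    show ?thesis by (simp add: h_def has_field_derivative_def mult.commute[of _ "_ \<bullet> _"])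
  qed
  have ih: "h integrable_on {0..1}" "(\<lambda>t. (h t)\<^sup>2) integrable_on {0..1}"
    "(\<lambda>t. (norm z)\<^sup>2 * (norm (grad \<eta> (y + t *\<^sub>R z)))\<^sup>2) integrable_on {0..1}"
    by (intro integrable_continuous_real continuous_intros ch cg')+
  have "(h has_integral \<eta> (y + 1 *\<^sub>R z) - \<eta> (y + 0 *\<^sub>R z)) {0..1}"
    by (intro fundamental_theorem_of_calculus) (auto intro: d has_field_derivative_at_within simp flip: has_real_derivative_iff_has_vector_derivative)
  then have H: "integral {0..1} h = \<eta> (y + z) - \<eta> y" by (simp add: integral_unique)
  let ?H = "\<eta> (y + z) - \<eta> y"
  have sq: "((\<lambda>t. (h t - ?H)\<^sup>2) has_integral integral {0..1} (\<lambda>t. (h t)\<^sup>2) - 2 * ?H * ?H + ?H\<^sup>2) {0..1}"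
  proof -
    have c: "((\<lambda>t. ?H\<^sup>2) has_integral ?H\<^sup>2) {0..1::real}" using has_integral_const_real[of "?H\<^sup>2" 0 1] by simp
    have "((\<lambda>t. (h t)\<^sup>2 - 2 * ?H * h t + ?H\<^sup>2) has_integral integral {0..1} (\<lambda>t. (h t)\<^sup>2) - 2 * ?H * ?H + ?H\<^sup>2) {0..1}"
      using has_integral_add[OF has_integral_diff[OF integrable_integral[OF ih(2)] has_integral_mult_right[OF integrable_integral[OF ih(1)], of "2 * ?H"]] c]
      unfolding H .
    moreover have "(u - v)\<^sup>2 = u\<^sup>2 - 2 * v * u + v\<^sup>2" for u v :: real by (simp add: power2_diff)
    ultimately show ?thesis by (simp only:)
  qed
  have "0 \<le> integral {0..1} (\<lambda>t. (h t)\<^sup>2) - 2 * ?H * ?H + ?H\<^sup>2" by (rule has_integral_nonneg[OF sq]) simp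
  moreover have "v\<^sup>2 \<le> u" if "0 \<le> u - 2 * v * v + v\<^sup>2" for u v :: real using that by (simp add: power2_eq_square)
  ultimately have "?H\<^sup>2 \<le> integral {0..1} (\<lambda>t. (h t)\<^sup>2)" by blast
  also have "\<dots> \<le> integral {0..1} (\<lambda>t. (norm z)\<^sup>2 * (norm (grad \<eta> (y + t *\<^sub>R z)))\<^sup>2)"
  proof (rule integral_le[OF ih(2) ih(3)])
    fix t
    have "\<bar>h t\<bar> \<le> norm z * norm (grad \<eta> (y + t *\<^sub>R z))"
      unfolding h_def using Cauchy_Schwarz_ineq2[of "grad \<eta> (y + t *\<^sub>R z)" z] by (simp add: mult.commute)
    from power_mono[OF this abs_ge_zero, of 2]
    show "(h t)\<^sup>2 \<le> (norm z)\<^sup>2 * (norm (grad \<eta> (y + t *\<^sub>R z)))\<^sup>2" by (simp add: power_mult_distrib)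
  qed
  finally have "ennreal (?H\<^sup>2) \<le> ennreal (integral {0..1} (\<lambda>t. (norm z)\<^sup>2 * (norm (grad \<eta> (y + t *\<^sub>R z)))\<^sup>2))" by (rule ennreal_leI)
  also have "\<dots> = (\<integral>\<^sup>+t. ennreal ((norm z)\<^sup>2 * (norm (grad \<eta> (y + t *\<^sub>R z)))\<^sup>2) * indicator {0..1} t \<partial>lborel)"
    by (rule nn_integral_has_integral_lebesgue'[OF _ integrable_integral[OF ih(3)], symmetric]) simp
  finally show ?thesis .
qed

text \<open>The double integral of \<open>(\<eta> x - \<eta> y)^2\<close> over the cell equals twice
  \<open>vol\<close> times the integral of \<open>\<eta>^2\<close> minus twice the squared integral
  of \<open>\<eta>\<close>. It is bounded by integrating the gradient along the segments between the
  two points, which may leave the cell but are brought back by periodicity.\<close>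

lemma periodic_Poincare:
  obtains C where "C > 0" "\<And>\<eta>. \<eta> \<in> smooth_periodic a \<Longrightarrow>
    intg (\<lambda>x. (\<eta> x)\<^sup>2) - 1 / measure M \<Omega> * (intg \<eta>)\<^sup>2 \<le> C * gsq \<eta>"
proof -
  obtain R where R: "R > 0" "\<And>x. x \<in> \<Omega> \<Longrightarrow> norm x \<le> R" using cell_bounded bounded_pos by blast
  define vol where "vol = measure M \<Omega>"
  have vol: "vol > 0"
  proof -
    have "\<not> negligible \<Omega>" using open_not_negligible[OF cell_open] cell_nonempty by blast
    then have "measure lebesgue \<Omega> \<noteq> 0" using dom_lmeasurable by (simp add: negligible_iff_measure)
    moreover have "vol = measure lebesgue \<Omega>" by (simp add: vol_def measure_restrict_space)
    ultimately show ?thesis by (simp add: less_le)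
  qed
  \<comment> \<open>Points of the cell have norm at most \<open>R\<close>, so their differences lie
    in the ball of radius \<open>2 * R\<close>, and \<open>y + t *\<^sub>R z\<close> stays in the
    ball of radius \<open>3 * R\<close>.\<close>
  let ?B = "cball 0 (3 * R) :: pt set"
  obtain m :: nat where m': "\<forall>f. f \<in> borel_measurable borel \<longrightarrow> (\<forall>x i. f (x + a $ i) = f x) \<longrightarrow>
    (\<integral>\<^sup>+x. f x * indicator (?B) x \<partial>lborel) \<le> of_nat m * (\<integral>\<^sup>+x. f x \<partial>M)"
    using nn_integral_periodic_bound[OF bounded_cball borel_closed[OF closed_cball]] ..
  note m = m'[rule_format]
  let ?Z = "cball 0 (2 * R) :: pt set"
  have O [measurable]: "\<Omega> \<in> sets borel" using cell_open by simp
  have [measurable]: "?B \<in> sets borel" "?Z \<in> sets borel" by (rule borel_closed[OF closed_cball])+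
  define C where "C = (2 * R)\<^sup>2 * (real m + 1) * (measure lborel ?Z + 1) / vol"
  have C: "C > 0" using R(1) vol by (simp add: C_def add_nonneg_pos)
  show thesis
  proof (rule that[OF C])
    fix \<eta> assume \<eta>: "\<eta> \<in> smooth_periodic a"
    have sm: "smooth_on UNIV \<eta>" and per: "\<And>x i. \<eta> (x + a $ i) = \<eta> x" using \<eta> by (auto simp: smooth_periodic_def)
    note G = has_weak_gradient_smooth[OF sm]
    note Lg = has_weak_gradient_L2[OF G]
    have [measurable]: "\<eta> \<in> borel_measurable borel" "partial_at i \<eta> \<in> borel_measurable borel" for i
      using smooth_differentiable[OF sm] by (auto intro: borel_measurable_continuous_onI)
    define D where "D x = (norm (grad \<eta> x))\<^sup>2" for x
    have cD: "continuous_on UNIV D" unfolding D_def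
      by (intro continuous_intros continuous_on_vec_lambda smooth_differentiable(3)[OF sm])
    have [measurable]: "D \<in> borel_measurable borel" by (rule borel_measurable_continuous_onI[OF cD])
    have Dp: "D (x + a $ i) = D x" for x i unfolding D_def periodic_partial[OF \<eta>] ..
    have ID: "(\<integral>\<^sup>+x. ennreal (D x) \<partial>M) = ennreal (gsq \<eta>)"
      unfolding D_def grad_sq_eq[OF G] using L2_funD(2)[OF Lg(2)] by (subst nn_integral_eq_integral) auto
    \<comment> \<open>A bound uniform in the displacement \<open>z\<close>: for each fixed
      \<open>t\<close> the gradient energy of the displaced cell is at most \<open>m\<close> times
      that of the cell.\<close>
    have shift: "(\<integral>\<^sup>+y. ennreal ((\<eta> (y + z) - \<eta> y)\<^sup>2) * indicator \<Omega> y \<partial>lborel) \<le> ennreal ((2 * R)\<^sup>2 * (real m + 1) * gsq \<eta>)"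
      if z: "z \<in> ?Z" for z
    proof -
      have pt: "(\<integral>\<^sup>+y. ennreal ((norm z)\<^sup>2 * D (y + t *\<^sub>R z)) * indicator {0..1} t * indicator \<Omega> y \<partial>lborel)
           \<le> ennreal ((2 * R)\<^sup>2 * (real m + 1) * gsq \<eta>) * indicator {0..1} t" for t :: real
        proof (cases "t \<in> {0..1}")
          case True
          have "(\<integral>\<^sup>+y. ennreal ((norm z)\<^sup>2 * D (y + t *\<^sub>R z)) * indicator {0..1} t * indicator \<Omega> y \<partial>lborel)
             \<le> (\<integral>\<^sup>+y. ennreal ((2 * R)\<^sup>2 * D (y + t *\<^sub>R z)) * indicator ?B (y + t *\<^sub>R z) \<partial>lborel)"
          proof (rule nn_integral_mono)
            fix y
            show "ennreal ((norm z)\<^sup>2 * D (y + t *\<^sub>R z)) * indicator {0..1} t * indicator \<Omega> y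
              \<le> ennreal ((2 * R)\<^sup>2 * D (y + t *\<^sub>R z)) * indicator ?B (y + t *\<^sub>R z)"
            proof (cases "y \<in> \<Omega>")
              case y: True
              have "norm (t *\<^sub>R z) \<le> 1 * norm z" using True mult_right_mono[of t 1 "norm z"] by simp
              then have "norm (y + t *\<^sub>R z) \<le> 3 * R"
                using norm_triangle_ineq[of y "t *\<^sub>R z"] R(2)[OF y] z by simp
              moreover have "(norm z)\<^sup>2 * D (y + t *\<^sub>R z) \<le> (2 * R)\<^sup>2 * D (y + t *\<^sub>R z)"
                using z by (intro mult_right_mono power_mono) (auto simp: D_def)
              ultimately show ?thesis using True y by (simp add: ennreal_leI)
            qed simp
          qed
          also have "\<dots> = (\<integral>\<^sup>+y. ennreal ((2 * R)\<^sup>2 * D y) * indicator ?B y \<partial>lborel)"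
            by (rule nn_integral_shift) measurable
          also have "\<dots> \<le> of_nat m * (\<integral>\<^sup>+y. ennreal ((2 * R)\<^sup>2 * D y) \<partial>M)" by (rule m) (simp_all add: Dp)
          also have "(\<integral>\<^sup>+y. ennreal ((2 * R)\<^sup>2 * D y) \<partial>M) = ennreal ((2 * R)\<^sup>2 * gsq \<eta>)"
          proof -
            have "D \<in> borel_measurable M" by (rule continuous_measurable[OF cD])
            then show ?thesis by (simp add: ennreal_mult' nn_integral_cmult ID)
          qed
          also have "of_nat m * ennreal ((2 * R)\<^sup>2 * gsq \<eta>) = ennreal (real m * ((2 * R)\<^sup>2 * gsq \<eta>))"
            by (simp add: ennreal_mult' ennreal_of_nat_eq_real_of_nat)
          also have "\<dots> \<le> ennreal ((2 * R)\<^sup>2 * (real m + 1) * gsq \<eta>)"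
            using grad_sq_nonneg[of \<eta>] by (intro ennreal_leI) (simp add: algebra_simps)
          finally show ?thesis using True by simp
        qed simp
      have "(\<integral>\<^sup>+y. ennreal ((\<eta> (y + z) - \<eta> y)\<^sup>2) * indicator \<Omega> y \<partial>lborel)
        \<le> (\<integral>\<^sup>+y. (\<integral>\<^sup>+t. ennreal ((norm z)\<^sup>2 * D (y + t *\<^sub>R z)) * indicator {0..1} t \<partial>lborel) * indicator \<Omega> y \<partial>lborel)"
        unfolding D_def by (intro nn_integral_mono mult_right_mono sq_diff_le_segment[OF sm]) auto
      also have "\<dots> = (\<integral>\<^sup>+y. (\<integral>\<^sup>+t. ennreal ((norm z)\<^sup>2 * D (y + t *\<^sub>R z)) * indicator {0..1} t * indicator \<Omega> y \<partial>lborel) \<partial>lborel)"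
        by (intro nn_integral_cong nn_integral_multc[symmetric]) measurable
      also have "\<dots> = (\<integral>\<^sup>+t. (\<integral>\<^sup>+y. ennreal ((norm z)\<^sup>2 * D (y + t *\<^sub>R z)) * indicator {0..1} t * indicator \<Omega> y \<partial>lborel) \<partial>lborel)"
        by (rule lborel_pair.Fubini') measurable
      also have "\<dots> \<le> (\<integral>\<^sup>+t. ennreal ((2 * R)\<^sup>2 * (real m + 1) * gsq \<eta>) * indicator {0..1::real} t \<partial>lborel)"
        by (rule nn_integral_mono[OF pt])
      also have "\<dots> = ennreal ((2 * R)\<^sup>2 * (real m + 1) * gsq \<eta>)"
        by (subst nn_integral_cmult_indicator) simp_all
      finally show ?thesis .
    qed
    \<comment> \<open>The substitution \<open>x = z + y\<close> turns pairs of points into a point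
      and a displacement; the measure of the ball of displacements enters the constant.\<close>
    have tot: "(\<integral>\<^sup>+y. (\<integral>\<^sup>+x. ennreal ((\<eta> x - \<eta> y)\<^sup>2) * indicator \<Omega> x \<partial>lborel) * indicator \<Omega> y \<partial>lborel)
      \<le> ennreal (C * vol * gsq \<eta>)"
    proof -
      have "(\<integral>\<^sup>+y. (\<integral>\<^sup>+x. ennreal ((\<eta> x - \<eta> y)\<^sup>2) * indicator \<Omega> x \<partial>lborel) * indicator \<Omega> y \<partial>lborel)
        = (\<integral>\<^sup>+y. (\<integral>\<^sup>+z. ennreal ((\<eta> (z + y) - \<eta> y)\<^sup>2) * indicator \<Omega> (z + y) \<partial>lborel) * indicator \<Omega> y \<partial>lborel)"
        by (subst nn_integral_shift[of "\<lambda>x. ennreal ((\<eta> x - \<eta> y)\<^sup>2) * indicator \<Omega> x" y for y]) auto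
      also have "\<dots> = (\<integral>\<^sup>+y. (\<integral>\<^sup>+z. ennreal ((\<eta> (z + y) - \<eta> y)\<^sup>2) * indicator \<Omega> (z + y) * indicator \<Omega> y \<partial>lborel) \<partial>lborel)"
        by (intro nn_integral_cong nn_integral_multc[symmetric]) measurable
      also have "\<dots> \<le> (\<integral>\<^sup>+y. (\<integral>\<^sup>+z. ennreal ((\<eta> (y + z) - \<eta> y)\<^sup>2) * indicator \<Omega> y * indicator ?Z z \<partial>lborel) \<partial>lborel)"
      proof (intro nn_integral_mono)
        fix y z
        show "ennreal ((\<eta> (z + y) - \<eta> y)\<^sup>2) * indicator \<Omega> (z + y) * indicator \<Omega> y \<le> ennreal ((\<eta> (y + z) - \<eta> y)\<^sup>2) * indicator \<Omega> y * indicator ?Z z"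
        proof (cases "z + y \<in> \<Omega> \<and> y \<in> \<Omega>")
          case True
          have "norm z \<le> norm (z + y) + norm y" using norm_triangle_ineq4[of "z + y" y] by simp
          then have "z \<in> ?Z" using R(2)[of y] R(2)[of "z + y"] True by simp
          then show ?thesis using True by (simp add: add.commute)
        qed (auto simp: indicator_def)
      qed
      also have "\<dots> = (\<integral>\<^sup>+z. (\<integral>\<^sup>+y. ennreal ((\<eta> (y + z) - \<eta> y)\<^sup>2) * indicator \<Omega> y * indicator ?Z z \<partial>lborel) \<partial>lborel)"
        by (rule lborel_pair.Fubini') measurable
      also have "\<dots> = (\<integral>\<^sup>+z. (\<integral>\<^sup>+y. ennreal ((\<eta> (y + z) - \<eta> y)\<^sup>2) * indicator \<Omega> y \<partial>lborel) * indicator ?Z z \<partial>lborel)"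
        by (intro nn_integral_cong nn_integral_multc) measurable
      also have "\<dots> \<le> (\<integral>\<^sup>+z. ennreal ((2 * R)\<^sup>2 * (real m + 1) * gsq \<eta>) * indicator ?Z z \<partial>lborel)"
        using shift by (intro nn_integral_mono) (auto simp: indicator_def)
      also have "\<dots> = ennreal ((2 * R)\<^sup>2 * (real m + 1) * gsq \<eta>) * emeasure lborel ?Z"
        by (subst nn_integral_cmult_indicator) simp_all
      also have "emeasure lborel ?Z = ennreal (measure lborel ?Z)"
        by (intro emeasure_eq_ennreal_measure) (use emeasure_bounded_finite[OF bounded_cball] in \<open>auto simp: less_top\<close>)
      also have "ennreal ((2 * R)\<^sup>2 * (real m + 1) * gsq \<eta>) * ennreal (measure lborel ?Z) = ennreal ((2 * R)\<^sup>2 * (real m + 1) * gsq \<eta> * measure lborel ?Z)"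
        using grad_sq_nonneg[of \<eta>] by (intro ennreal_mult[symmetric]) simp_all
      also have "\<dots> \<le> ennreal (C * vol * gsq \<eta>)"
      proof (rule ennreal_leI)
        have eC: "C * vol * gsq \<eta> = (2 * R)\<^sup>2 * (real m + 1) * gsq \<eta> * (measure lborel ?Z + 1)"
          using vol by (simp add: C_def)
        have leC: "(2 * R)\<^sup>2 * (real m + 1) * gsq \<eta> * measure lborel ?Z \<le> (2 * R)\<^sup>2 * (real m + 1) * gsq \<eta> * (measure lborel ?Z + 1)"
          using grad_sq_nonneg[of \<eta>] by (intro mult_left_mono) auto
        show "(2 * R)\<^sup>2 * (real m + 1) * gsq \<eta> * measure lborel ?Z \<le> C * vol * gsq \<eta>"
          unfolding eC by (rule leC)
      qed
      finally show ?thesis .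
    qed
    have eqM: "(\<integral>\<^sup>+x. f x * indicator \<Omega> x \<partial>lborel) = (\<integral>\<^sup>+x. f x \<partial>M)" if [measurable]: "f \<in> borel_measurable borel" for f :: "pt \<Rightarrow> ennreal"
    proof -
      have "(\<integral>\<^sup>+x. f x * indicator \<Omega> x \<partial>lborel) = (\<integral>\<^sup>+x. f x * indicator \<Omega> x \<partial>lebesgue)"
        by (rule nn_integral_completion[symmetric]) measurable
      also have "\<dots> = (\<integral>\<^sup>+x. f x \<partial>M)" by (simp add: nn_integral_restrict_space)
      finally show ?thesis .
    qed
    have le: "(\<integral>\<^sup>+y. (\<integral>\<^sup>+x. ennreal ((\<eta> x - \<eta> y)\<^sup>2) \<partial>M) \<partial>M) \<le> ennreal (C * vol * gsq \<eta>)"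
    proof -
      have 1: "(\<integral>\<^sup>+x. ennreal ((\<eta> x - \<eta> y)\<^sup>2) \<partial>M) = (\<integral>\<^sup>+x. ennreal ((\<eta> x - \<eta> y)\<^sup>2) * indicator \<Omega> x \<partial>lborel)" for y
        by (rule eqM[symmetric]) measurable
      have "(\<lambda>y. \<integral>\<^sup>+x. ennreal ((\<eta> x - \<eta> y)\<^sup>2) * indicator \<Omega> x \<partial>lborel) \<in> borel_measurable borel" by measurable
      from eqM[OF this] tot show ?thesis unfolding 1 by (simp only:)
    qed
    have i1: "integrable M \<eta>" "integrable M (\<lambda>x. (\<eta> x)\<^sup>2)" using L2_fun_integrable[OF Lg(1)] L2_funD(2)[OF Lg(1)] by auto
    let ?A = "intg (\<lambda>x. (\<eta> x)\<^sup>2)" and ?E = "intg \<eta>"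
    have exp: "(\<eta> x - s)\<^sup>2 = (\<eta> x)\<^sup>2 - 2 * s * \<eta> x + s\<^sup>2" for x s by (simp add: power2_diff)
    have inner: "(\<integral>\<^sup>+x. ennreal ((\<eta> x - s)\<^sup>2) \<partial>M) = ennreal (?A - 2 * s * ?E + vol * s\<^sup>2)" for s
    proof -
      have "integrable M (\<lambda>x. (\<eta> x - s)\<^sup>2)" unfolding exp using i1 by simp
      then have "(\<integral>\<^sup>+x. ennreal ((\<eta> x - s)\<^sup>2) \<partial>M) = ennreal (intg (\<lambda>x. (\<eta> x - s)\<^sup>2))"
        by (intro nn_integral_eq_integral) auto
      also have "intg (\<lambda>x. (\<eta> x - s)\<^sup>2) = ?A - 2 * s * ?E + vol * s\<^sup>2"
        unfolding exp using i1 by (simp add: vol_def)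
      finally show ?thesis .
    qed
    have nn: "?A - 2 * s * ?E + vol * s\<^sup>2 \<ge> 0" for s
    proof -
      have "0 \<le> intg (\<lambda>x. (\<eta> x - s)\<^sup>2)" by simp
      also have "intg (\<lambda>x. (\<eta> x - s)\<^sup>2) = ?A - 2 * s * ?E + vol * s\<^sup>2"
        unfolding exp using i1 by (simp add: vol_def)
      finally show ?thesis .
    qed
    have "(\<integral>\<^sup>+y. ennreal (?A - 2 * \<eta> y * ?E + vol * (\<eta> y)\<^sup>2) \<partial>M) = ennreal (intg (\<lambda>y. ?A - 2 * \<eta> y * ?E + vol * (\<eta> y)\<^sup>2))"
      using i1 nn by (intro nn_integral_eq_integral) auto
    also have "intg (\<lambda>y. ?A - 2 * \<eta> y * ?E + vol * (\<eta> y)\<^sup>2) = 2 * (vol * ?A - ?E\<^sup>2)"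
      using i1 by (simp add: vol_def power2_eq_square)
    finally have "ennreal (2 * (vol * ?A - ?E\<^sup>2)) \<le> ennreal (C * vol * gsq \<eta>)"
      using le unfolding inner by simp
    then have le2: "2 * (vol * ?A - ?E\<^sup>2) \<le> C * vol * gsq \<eta>"
      using C vol grad_sq_nonneg[of \<eta>] by (subst (asm) ennreal_le_iff) auto
    have cg: "0 \<le> C * vol * gsq \<eta>" using C vol grad_sq_nonneg[of \<eta>] by simp
    have "vol * (?A - 1 / vol * ?E\<^sup>2) = vol * ?A - ?E\<^sup>2" using vol by (simp add: right_diff_distrib)
    also have "\<dots> \<le> vol * (C * gsq \<eta>)" using le2 cg by (simp add: mult_ac)
    finally show "?A - 1 / measure M \<Omega> * ?E\<^sup>2 \<le> C * gsq \<eta>"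
      using vol unfolding vol_def[symmetric] by (simp only: mult_le_cancel_left_pos)
  qed
qed

end

section \<open>Positivity of the ground state\<close>

context bounded_open
begin

lemma has_weak_gradient_cong:
  assumes u: "has_weak_gradient \<Omega> u g" and [measurable]: "g' \<in> borel_measurable M" and eq: "AE x in M. g x = g' x"
  shows "has_weak_gradient \<Omega> u g'"
  unfolding has_weak_gradient_def
proof (intro conjI ballI allI)
  note L = has_weak_gradient_L2[OF u]
  have [measurable]: "g \<in> borel_measurable M" by (rule L2_funD(1)[OF L(2)])
  show "L2 u" by (rule L(1))
  have "integrable M (\<lambda>x. (norm (g' x))\<^sup>2)"
    using L2_funD(2)[OF L(2)] by (rule integrable_cong_AE_imp) (use eq in auto)
  then show L': "L2 g'" by (simp add: L2_fun_def)
  fix \<eta> i assume \<eta>: "\<eta> \<in> test_functions \<Omega>"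
  have [measurable]: "\<eta> \<in> borel_measurable M" by (rule L2_funD(1)[OF L2_fun_test(1)[OF \<eta>]])
  have [measurable]: "(\<lambda>x. g x $ i) \<in> borel_measurable M" "(\<lambda>x. g' x $ i) \<in> borel_measurable M"
    by (rule L2_funD(1)[OF L2_fun_component[OF L(2)]], rule L2_funD(1)[OF L2_fun_component[OF L']])
  have "intg (\<lambda>x. g x $ i * \<eta> x) = intg (\<lambda>x. g' x $ i * \<eta> x)"
    by (rule integral_cong_AE) (use eq in auto)
  then show "intg (\<lambda>x. u x * partial_at i \<eta> x) = - intg (\<lambda>x. g' x $ i * \<eta> x)"
    using has_weak_gradientD[OF u \<eta>] by simp
qed

end

text \<open>The Poincare inequality is relative to the mean. The closure properties of
  \<open>D\<close> make the square root of \<open>\<zeta>^2 + e^2\<close> an element of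
  \<open>D\<close>, which is how absolute values and truncations of trial functions become
  available.\<close>

locale mean_space = sobolev_space +
  fixes P :: real
  assumes P_pos: "P > 0"
    and D_Poincare: "\<zeta> \<in> D \<Longrightarrow> intg (\<lambda>x. (\<zeta> x)\<^sup>2) - 1 / measure M \<Omega> * (intg \<zeta>)\<^sup>2 \<le> P * gsq \<zeta>"
    and D_const: "(\<lambda>x. c) \<in> D"
    and D_mult: "\<eta> \<in> D \<Longrightarrow> \<zeta> \<in> D \<Longrightarrow> (\<lambda>x. \<eta> x * \<zeta> x) \<in> D"
    and D_sqrt: "\<eta> \<in> D \<Longrightarrow> (\<And>x. \<eta> x > 0) \<Longrightarrow> (\<lambda>x. sqrt (\<eta> x)) \<in> D"
    and nonempty: "\<Omega> \<noteq> {}"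
begin

abbreviation "vol \<equiv> measure M \<Omega>"

lemma vol_pos: "vol > 0"
proof -
  have "\<not> negligible \<Omega>" using open_not_negligible[OF open_dom] nonempty by blast
  then have "measure lebesgue \<Omega> \<noteq> 0" using dom_lmeasurable by (simp add: negligible_iff_measure)
  moreover have "vol = measure lebesgue \<Omega>" by (simp add: measure_restrict_space)
  ultimately show ?thesis by (simp add: less_le)
qed

lemma X_Poincare_mean: "u \<in> X \<Longrightarrow> intg (\<lambda>x. (u x)\<^sup>2) - 1 / vol * (intg u)\<^sup>2 \<le> P * gsq u"
  by (rule X_Poincare[OF D_Poincare])

lemma X_const: "(\<lambda>x. c) \<in> X" by (rule D_subset_X[OF D_const])

lemma X_meas: "u \<in> X \<Longrightarrow> u \<in> borel_measurable M"
  using L2_funD(1)[OF has_weak_gradient_L2(1)[OF X_grad]] by blast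

lemma const_grad: "has_weak_gradient \<Omega> (\<lambda>x. c) (\<lambda>x. 0)"
proof -
  have "partial_at i (\<lambda>x::pt. c) = (\<lambda>x. 0)" for i by (rule partial_at_eqI) (rule has_derivative_const)
  then show ?thesis using D_grad[OF D_const, of c] by (simp add: zero_vec_def)
qed

text \<open>The absolute value is the limit of the square roots of \<open>y^2 + e^2\<close>. Their
  derivatives are bounded by 1 and tend to \<open>sgn y\<close>; at \<open>y = 0\<close> they are 0,
  in agreement with \<open>sgn 0 = 0\<close>.\<close>

lemma X_abs:
  assumes u: "u \<in> X"
  shows "(\<lambda>x. \<bar>u x\<bar>) \<in> X" "has_weak_gradient \<Omega> (\<lambda>x. \<bar>u x\<bar>) (\<lambda>x. sgn (u x) *\<^sub>R wgrad u x)"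
proof -
  define e where "e n = inverse (real (Suc n))" for n
  have e: "e n > 0" "e n \<le> 1" for n by (auto simp: e_def inverse_le_1_iff)
  have el: "e \<longlonglongrightarrow> 0" unfolding e_def by (rule LIMSEQ_inverse_real_of_nat)
  define f where "f n y = sqrt (y\<^sup>2 + (e n)\<^sup>2)" for n y
  define f' where "f' n y = y / sqrt (y\<^sup>2 + (e n)\<^sup>2)" for n and y :: real
  have pos: "y\<^sup>2 + (e n)\<^sup>2 > 0" for n y using e(1)[of n] by (simp add: add_nonneg_pos)
  have der: "(f n has_real_derivative f' n y) (at y)" for n y
  proof -
    have "((\<lambda>y. y\<^sup>2 + (e n)\<^sup>2) has_real_derivative 2 * y) (at y)" by (auto intro!: derivative_eq_intros)
    from DERIV_chain2[OF DERIV_real_sqrt[OF pos] this]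
    show ?thesis unfolding f_def f'_def by (simp add: field_simps)
  qed
  have cont: "continuous_on UNIV (f' n)" for n
    unfolding f'_def using pos[of _ n] by (intro continuous_intros) (auto simp: less_le)
  have B: "\<bar>f' n y\<bar> \<le> 1" for n y
  proof -
    have "\<bar>y\<bar> \<le> sqrt (y\<^sup>2 + (e n)\<^sup>2)" by (rule real_le_rsqrt) simp
    then show ?thesis unfolding f'_def abs_divide using pos[of y n] by (simp add: divide_le_eq_1)
  qed
  have D: "(\<lambda>x. f n (\<zeta> x)) \<in> D" if z: "\<zeta> \<in> D" for \<zeta> n
  proof -
    have "(\<lambda>x. \<zeta> x * \<zeta> x + (e n)\<^sup>2 * 1) \<in> D" by (rule D_lincomb[OF D_mult[OF z z] D_const])
    then show ?thesis unfolding f_def power2_eq_square[of "\<zeta> _"] mult_1_right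
      by (rule D_sqrt) (use pos[of "\<zeta> _" n] in \<open>simp add: power2_eq_square\<close>)
  qed
  have lim1: "(\<lambda>n. f n y) \<longlonglongrightarrow> \<bar>y\<bar>" for y
  proof -
    have "(\<lambda>n. f n y) \<longlonglongrightarrow> sqrt (y\<^sup>2 + 0\<^sup>2)" unfolding f_def by (intro tendsto_intros el)
    then show ?thesis by simp
  qed
  have lim2: "(\<lambda>n. f' n y) \<longlonglongrightarrow> sgn y" for y
  proof (cases "y = 0")
    case False
    have "(\<lambda>n. y / sqrt (y\<^sup>2 + (e n)\<^sup>2)) \<longlonglongrightarrow> y / sqrt (y\<^sup>2 + 0\<^sup>2)" using False by (intro tendsto_intros el) simp
    moreover have "y / sqrt (y\<^sup>2 + 0\<^sup>2) = sgn y" using False by (simp add: sgn_real_def)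
    ultimately show ?thesis by (simp add: f'_def)
  qed (simp add: f'_def)
  have B1: "\<bar>f n y\<bar> \<le> 1 * (1 + \<bar>y\<bar>)" for n y
  proof -
    have "f n y \<le> sqrt (y\<^sup>2) + sqrt ((e n)\<^sup>2)" unfolding f_def by (rule sqrt_add_le_add_sqrt) simp_all
    then show ?thesis using e[of n] by (simp add: f_def)
  qed
  note C = X_compose_C1[OF der cont B D u]
  note R = X_compose_limit[OF C borel_measurable_continuous_onI[OF cont] lim1 lim2 B1 B u]
  show "(\<lambda>x. \<bar>u x\<bar>) \<in> X" by (rule R(1))
  show "has_weak_gradient \<Omega> (\<lambda>x. \<bar>u x\<bar>) (\<lambda>x. sgn (u x) *\<^sub>R wgrad u x)" by (rule R(2))
qed

lemma X_abs_grad: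
  assumes u: "u \<in> X" and g: "has_weak_gradient \<Omega> u g"
  shows "has_weak_gradient \<Omega> (\<lambda>x. \<bar>u x\<bar>) (\<lambda>x. sgn (u x) *\<^sub>R g x)"
proof (rule has_weak_gradient_cong[OF X_abs(2)[OF u]])
  have [measurable]: "u \<in> borel_measurable M" "g \<in> borel_measurable M"
    using X_meas[OF u] L2_funD(1)[OF has_weak_gradient_L2(2)[OF g]] by auto
  show "(\<lambda>x. sgn (u x) *\<^sub>R g x) \<in> borel_measurable M" by measurable
  show "AE x in M. sgn (u x) *\<^sub>R wgrad u x = sgn (u x) *\<^sub>R g x"
    using weak_grad_AE[OF g] by eventually_elim simp
qed

lemma integrable_bounded_mult:
  assumes u: "integrable M f" and [measurable]: "g \<in> borel_measurable M" and B: "\<And>x. \<bar>g x\<bar> \<le> B"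
  shows "integrable M (\<lambda>x. g x * f x :: real)"
proof (rule Bochner_Integration.integrable_bound[of M "\<lambda>x. B * f x"])
  show "integrable M (\<lambda>x. B * f x)" using u by simp
  have B0: "B \<ge> 0" using B[of undefined] by linarith
  show "AE x in M. norm (g x * f x) \<le> norm (B * f x)"
    using B B0 by (intro AE_I2) (auto simp: abs_mult intro!: mult_right_mono)
  show "(\<lambda>x. g x * f x) \<in> borel_measurable M" using u by measurable
qed

end

text \<open>A null vector \<open>\<psi>\<close> minimizes the form, so a perturbation in the direction of \<open>(s - \<bar>\<psi>\<bar>)\<^sup>+\<close> cannot
  lower it. This bounds the gradient on the set where \<open>\<bar>\<psi>\<bar> < s\<close> by \<open>O(s)\<close>, which starts a De Giorgi
  iteration and shows that \<open>\<psi>\<close> is bounded away from 0.\<close>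

locale null_vector = mean_space +
  fixes V W \<psi> :: fld
  assumes V_meas: "V \<in> borel_measurable M" and W_meas: "W \<in> borel_measurable M"
    and V_le: "AE x in M. V x \<le> W x" and W_nonneg: "\<And>x. W x \<ge> 0"
    and W4: "integrable M (\<lambda>x. W x ^ 4)"
    and V_int: "v \<in> X \<Longrightarrow> integrable M (\<lambda>x. V x * (v x)\<^sup>2)"
    and form_nonneg: "v \<in> X \<Longrightarrow> 0 \<le> 1/2 * gsq v + intg (\<lambda>x. V x * (v x)\<^sup>2)"
    and \<psi>_X: "\<psi> \<in> X" and \<psi>_null: "1/2 * gsq \<psi> + intg (\<lambda>x. V x * (\<psi> x)\<^sup>2) = 0"
    and \<psi>_norm: "intg (\<lambda>x. (\<psi> x)\<^sup>2) > 0"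
begin

definition trunc :: "real \<Rightarrow> fld" where "trunc s x = max 0 (s - \<bar>\<psi> x\<bar>)"

text \<open>The derivative of the positive part of \<open>v\<close>, obtained from
  \<open>(v + \<bar>v\<bar>) / 2\<close>. Since \<open>sgn 0 = 0\<close>, it takes the value 1/2
  where \<open>\<bar>\<psi>\<bar> = s\<close>.\<close>

definition hfun :: "real \<Rightarrow> fld" where "hfun s x = (1 + sgn (s - \<bar>\<psi> x\<bar>)) / 2"

lemma trunc_X:
  shows "trunc s \<in> X" "has_weak_gradient \<Omega> (trunc s) (\<lambda>x. (- hfun s x * sgn (\<psi> x)) *\<^sub>R wgrad \<psi> x)"
proof -
  define v where "v x = s + (-1) * \<bar>\<psi> x\<bar>" for x
  have vX: "v \<in> X" unfolding v_def by (rule X_lincomb[OF X_const X_abs(1)[OF \<psi>_X]])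
  have gv: "has_weak_gradient \<Omega> v (\<lambda>x. 0 + (-1) *\<^sub>R (sgn (\<psi> x) *\<^sub>R wgrad \<psi> x))"
    unfolding v_def by (rule has_weak_gradient_lincomb[OF const_grad X_abs(2)[OF \<psi>_X]])
  have t: "trunc s = (\<lambda>x. 0 + (1/2) * (v x + 1 * \<bar>v x\<bar>))"
    unfolding trunc_def v_def fun_eq_iff by (auto simp: max_def)
  show "trunc s \<in> X" unfolding t by (intro X_lincomb X_const vX X_abs)
  have "has_weak_gradient \<Omega> (trunc s) (\<lambda>x. 0 + (1/2) *\<^sub>R ((0 + (-1) *\<^sub>R (sgn (\<psi> x) *\<^sub>R wgrad \<psi> x)) +
      1 *\<^sub>R (sgn (v x) *\<^sub>R (0 + (-1) *\<^sub>R (sgn (\<psi> x) *\<^sub>R wgrad \<psi> x)))))"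
    unfolding t by (intro has_weak_gradient_lincomb const_grad gv X_abs_grad[OF vX gv])
  moreover have "0 + (1/2) *\<^sub>R ((0 + (-1) *\<^sub>R (\<sigma> *\<^sub>R w)) + 1 *\<^sub>R (\<tau> *\<^sub>R (0 + (-1) *\<^sub>R (\<sigma> *\<^sub>R w))))
      = (- ((1 + \<tau>) / 2) * \<sigma>) *\<^sub>R w" for \<sigma> \<tau> and w :: pt
    by (simp add: vec_eq_iff field_simps)
  ultimately show "has_weak_gradient \<Omega> (trunc s) (\<lambda>x. (- hfun s x * sgn (\<psi> x)) *\<^sub>R wgrad \<psi> x)"
    by (simp add: hfun_def v_def)
qed

lemma trunc_bounds: "0 \<le> trunc s x" "s \<ge> 0 \<Longrightarrow> trunc s x \<le> s"
  by (auto simp: trunc_def)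

lemma meas [measurable]: "\<psi> \<in> borel_measurable M" "V \<in> borel_measurable M" "W \<in> borel_measurable M" "trunc s \<in> borel_measurable M"
  using X_meas[OF \<psi>_X] V_meas W_meas X_meas[OF trunc_X(1)] by auto

lemma W_integrable: "integrable M W" "integrable M (\<lambda>x. (W x)\<^sup>2)"
proof -
  show "integrable M (\<lambda>x. (W x)\<^sup>2)"
  proof (rule Bochner_Integration.integrable_bound[of M "\<lambda>x. 1 + W x ^ 4"])
    show "integrable M (\<lambda>x. 1 + W x ^ 4)" using W4 by simp
    have "y\<^sup>2 \<le> 1 + y ^ 4" for y :: real
    proof -
      have "2 * y\<^sup>2 \<le> 1 + (y\<^sup>2)\<^sup>2" using sum_squares_bound[of 1 "y\<^sup>2"] by simp
      moreover have "(y\<^sup>2)\<^sup>2 = y ^ 4" by (simp flip: power_mult)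
      moreover have "0 \<le> y\<^sup>2" by simp
      ultimately show ?thesis by linarith
    qed
    then show "AE x in M. norm ((W x)\<^sup>2) \<le> norm (1 + W x ^ 4)" by (intro AE_I2) simp
  qed measurable
  then show "integrable M W" by (intro L2_fun_integrable) (simp add: L2_fun_def)
qed

text \<open>Testing the nonnegative form with \<open>\<bar>\<psi>\<bar> + t * trunc s\<close> lowers
  the gradient energy by \<open>t * (2 - t)\<close> times that of the truncation, while the
  potential term rises by at most the contribution of \<open>W\<close>. Dividing by \<open>t\<close>
  and letting \<open>t\<close> tend to 0 removes the quadratic term.\<close>

lemma trunc_energy:
  assumes s: "s > 0"
  shows "gsq (trunc s) \<le> 2 * intg (\<lambda>x. W x * (\<bar>\<psi> x\<bar> * trunc s x))"
proof -
  note T = trunc_X[of s] and A = X_abs[OF \<psi>_X] and G = X_grad[OF \<psi>_X]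
  define g2 where "g2 x = (norm (wgrad \<psi> x))\<^sup>2" for x
  have ig2: "integrable M g2" unfolding g2_def by (rule L2_funD(2)[OF has_weak_gradient_L2(2)[OF G]])
  have [measurable]: "g2 \<in> borel_measurable M" "hfun s \<in> borel_measurable M"
    using ig2 by (auto simp: hfun_def[abs_def])
  define I where "I = gsq (trunc s)"
  have I: "I = intg (\<lambda>x. (hfun s x)\<^sup>2 * (sgn (\<psi> x))\<^sup>2 * g2 x)"
    unfolding I_def grad_sq_eq[OF T(2)] g2_def by (simp add: power_mult_distrib)
  have h: "hfun s x \<in> {0, 1/2, 1}" for x by (auto simp: hfun_def sgn_real_def)
  have iI: "integrable M (\<lambda>x. (hfun s x)\<^sup>2 * (sgn (\<psi> x))\<^sup>2 * g2 x)"
  proof (rule integrable_bounded_mult[OF ig2, where B=1])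
    show "\<bar>(hfun s x)\<^sup>2 * (sgn (\<psi> x))\<^sup>2\<bar> \<le> 1" for x
    proof -
      have "0 \<le> hfun s x" "hfun s x \<le> 1" using h[of x] by auto
      then have "(hfun s x)\<^sup>2 \<le> 1" by (simp add: power_le_one)
      then show ?thesis by (auto simp: sgn_real_def)
    qed
  qed measurable
  define a where "a = intg (\<lambda>x. W x * (\<bar>\<psi> x\<bar> * trunc s x))"
  define b where "b = intg (\<lambda>x. W x * (trunc s x)\<^sup>2)"
  have pt: "\<bar>\<psi> x\<bar> * trunc s x \<le> s\<^sup>2" "0 \<le> \<bar>\<psi> x\<bar> * trunc s x" "(trunc s x)\<^sup>2 \<le> s\<^sup>2" for x
  proof -
    show "0 \<le> \<bar>\<psi> x\<bar> * trunc s x" by (simp add: trunc_bounds)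
    show "(trunc s x)\<^sup>2 \<le> s\<^sup>2" using trunc_bounds[of s x] s by (intro power_mono) auto
    show "\<bar>\<psi> x\<bar> * trunc s x \<le> s\<^sup>2"
      unfolding power2_eq_square using trunc_bounds[of s x] s
      by (cases "\<bar>\<psi> x\<bar> \<le> s") (auto simp: trunc_def max_def intro!: mult_mono)
  qed
  have iW: "integrable M (\<lambda>x. W x * (\<bar>\<psi> x\<bar> * trunc s x))" "integrable M (\<lambda>x. W x * (trunc s x)\<^sup>2)"
    using integrable_bounded_mult[OF W_integrable(1), of "\<lambda>x. \<bar>\<psi> x\<bar> * trunc s x" "s\<^sup>2"]
      integrable_bounded_mult[OF W_integrable(1), of "\<lambda>x. (trunc s x)\<^sup>2" "s\<^sup>2"] pt
    by (simp_all add: mult.commute)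
  have key: "1/2 * (2 - t) * I \<le> 2 * a + t * b" if t: "0 < t" "t \<le> 1" for t
  proof -
    define F where "F x = \<bar>\<psi> x\<bar> + t * trunc s x" for x
    have FX: "F \<in> X" unfolding F_def by (rule X_lincomb[OF A(1) T(1)])
    have gF: "has_weak_gradient \<Omega> F (\<lambda>x. sgn (\<psi> x) *\<^sub>R wgrad \<psi> x + t *\<^sub>R ((- hfun s x * sgn (\<psi> x)) *\<^sub>R wgrad \<psi> x))"
      unfolding F_def by (rule has_weak_gradient_lincomb[OF A(2) T(2)])
    have "sgn (\<psi> x) *\<^sub>R wgrad \<psi> x + t *\<^sub>R ((- hfun s x * sgn (\<psi> x)) *\<^sub>R wgrad \<psi> x)
       = (sgn (\<psi> x) * (1 - t * hfun s x)) *\<^sub>R wgrad \<psi> x" for x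
      by (simp add: vec_eq_iff algebra_simps)
    then have gsF: "gsq F = intg (\<lambda>x. (sgn (\<psi> x))\<^sup>2 * (1 - t * hfun s x)\<^sup>2 * g2 x)"
      unfolding grad_sq_eq[OF gF] g2_def by (simp add: power_mult_distrib)
    have gs\<psi>: "gsq \<psi> = intg g2" unfolding g2_def grad_sq_def ..
    have iF: "integrable M (\<lambda>x. (sgn (\<psi> x))\<^sup>2 * (1 - t * hfun s x)\<^sup>2 * g2 x)"
    proof (rule integrable_bounded_mult[OF ig2, where B=1])
      show "\<bar>(sgn (\<psi> x))\<^sup>2 * (1 - t * hfun s x)\<^sup>2\<bar> \<le> 1" for x
      proof -
        have "0 \<le> hfun s x" "hfun s x \<le> 1" using h[of x] by auto
        then have "0 \<le> t * hfun s x" "t * hfun s x \<le> 1"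
          using t mult_le_one[of t "hfun s x"] by auto
        then have "(1 - t * hfun s x)\<^sup>2 \<le> 1" by (simp add: power_le_one)
        then show ?thesis by (auto simp: sgn_real_def)
      qed
    qed measurable
    have "gsq F \<le> intg (\<lambda>x. g2 x - t * (2 - t) * ((hfun s x)\<^sup>2 * (sgn (\<psi> x))\<^sup>2 * g2 x))"
      unfolding gsF
    proof (rule integral_mono[OF iF])
      show "integrable M (\<lambda>x. g2 x - t * (2 - t) * ((hfun s x)\<^sup>2 * (sgn (\<psi> x))\<^sup>2 * g2 x))" using ig2 iI by simp
      fix x
      have "(sgn (\<psi> x))\<^sup>2 * (1 - t * hfun s x)\<^sup>2 \<le> 1 - t * (2 - t) * ((hfun s x)\<^sup>2 * (sgn (\<psi> x))\<^sup>2)"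
      proof -
        have *: "(1 - t * hfun s x)\<^sup>2 \<le> 1 - t * (2 - t) * (hfun s x)\<^sup>2"
        proof -
          \<comment> \<open>\<open>hfun\<close> takes only the values 0, 1/2 and 1, so its square
            does not exceed it.\<close>
          have hh: "(hfun s x)\<^sup>2 \<le> hfun s x" using h[of x] by (auto simp: power2_eq_square)
          have "t * (2 * (hfun s x)\<^sup>2) \<le> t * (2 * hfun s x)" using hh t by (intro mult_left_mono) auto
          then show ?thesis by (simp add: power2_eq_square algebra_simps)
        qed
        then show ?thesis by (cases "\<psi> x = 0") (auto simp: sgn_real_def)
      qed
      from mult_right_mono[OF this, of "g2 x"]
      show "(sgn (\<psi> x))\<^sup>2 * (1 - t * hfun s x)\<^sup>2 * g2 x \<le> g2 x - t * (2 - t) * ((hfun s x)\<^sup>2 * (sgn (\<psi> x))\<^sup>2 * g2 x)"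
        by (simp add: g2_def algebra_simps)
    qed
    also have "\<dots> = gsq \<psi> - t * (2 - t) * I" using ig2 iI by (simp add: I gs\<psi>)
    finally have E1: "gsq F \<le> gsq \<psi> - t * (2 - t) * I" .
    have "intg (\<lambda>x. V x * (F x)\<^sup>2) - intg (\<lambda>x. V x * (\<psi> x)\<^sup>2) = intg (\<lambda>x. V x * (F x)\<^sup>2 - V x * (\<psi> x)\<^sup>2)"
      using V_int[OF FX] V_int[OF \<psi>_X] by simp
    also have "\<dots> \<le> intg (\<lambda>x. 2 * t * (W x * (\<bar>\<psi> x\<bar> * trunc s x)) + t\<^sup>2 * (W x * (trunc s x)\<^sup>2))"
    proof (rule integral_mono_AE)
      show "integrable M (\<lambda>x. V x * (F x)\<^sup>2 - V x * (\<psi> x)\<^sup>2)" using V_int[OF FX] V_int[OF \<psi>_X] by simp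
      show "integrable M (\<lambda>x. 2 * t * (W x * (\<bar>\<psi> x\<bar> * trunc s x)) + t\<^sup>2 * (W x * (trunc s x)\<^sup>2))" using iW by simp
      show "AE x in M. V x * (F x)\<^sup>2 - V x * (\<psi> x)\<^sup>2 \<le> 2 * t * (W x * (\<bar>\<psi> x\<bar> * trunc s x)) + t\<^sup>2 * (W x * (trunc s x)\<^sup>2)"
        using V_le
      proof eventually_elim
        case (elim x)
        define p q where "p = \<bar>\<psi> x\<bar>" and "q = trunc s x"
        have pq: "p \<ge> 0" "q \<ge> 0" by (auto simp: p_def q_def trunc_bounds)
        have "V x * (F x)\<^sup>2 - V x * (\<psi> x)\<^sup>2 = V x * (2 * t * p * q + t\<^sup>2 * q\<^sup>2)"
          unfolding F_def p_def[symmetric] q_def[symmetric] power2_abs[symmetric, of "\<psi> x"] by (simp add: power2_eq_square algebra_simps)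
        also have "\<dots> \<le> W x * (2 * t * p * q + t\<^sup>2 * q\<^sup>2)" using elim pq t by (intro mult_right_mono) auto
        also have "\<dots> = 2 * t * (W x * (p * q)) + t\<^sup>2 * (W x * q\<^sup>2)" by (simp add: algebra_simps)
        finally show ?case unfolding p_def q_def .
      qed
    qed
    also have "\<dots> = 2 * t * a + t\<^sup>2 * b" using iW by (simp add: a_def b_def)
    finally have E2: "intg (\<lambda>x. V x * (F x)\<^sup>2) \<le> intg (\<lambda>x. V x * (\<psi> x)\<^sup>2) + (2 * t * a + t\<^sup>2 * b)" by simp
    have "0 \<le> 1/2 * (gsq \<psi> - t * (2 - t) * I) + (intg (\<lambda>x. V x * (\<psi> x)\<^sup>2) + (2 * t * a + t\<^sup>2 * b))"
    proof -
      have "0 \<le> 1/2 * A' + B'" if "0 \<le> 1/2 * A + B" "A \<le> A'" "B \<le> B'" for A B A' B' :: real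
        using that by linarith
      from this[OF form_nonneg[OF FX] E1 E2] show ?thesis .
    qed
    then have "1/2 * (t * (2 - t) * I) \<le> 2 * t * a + t\<^sup>2 * b" using \<psi>_null by (simp add: right_diff_distrib)
    then have "t * (1/2 * (2 - t) * I) \<le> t * (2 * a + t * b)" by (simp add: power2_eq_square algebra_simps)
    then show ?thesis using t by simp
  qed
  have "((\<lambda>t. 2 * a + t * b - 1/2 * (2 - t) * I) \<longlongrightarrow> 2 * a + 0 * b - 1/2 * (2 - 0) * I) (at_right 0)"
    by (intro tendsto_intros)
  then have "0 \<le> 2 * a + 0 * b - 1/2 * (2 - 0) * I"
  proof (rule tendsto_lowerbound)
    have "\<forall>\<^sub>F t in at_right 0. t \<in> {0<..<1::real}" by (rule eventually_at_right_real) simp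
    then show "\<forall>\<^sub>F t in at_right 0. 0 \<le> 2 * a + t * b - 1/2 * (2 - t) * I"
      by eventually_elim (use key in force)
  qed simp
  then show ?thesis by (simp add: I_def a_def)
qed

definition small :: "real \<Rightarrow> real" where "small s = measure M {x \<in> \<Omega>. \<bar>\<psi> x\<bar> < s}"

lemma small_sets [measurable]: "{x \<in> \<Omega>. \<bar>\<psi> x\<bar> < s} \<in> sets M"
proof -
  have "{x \<in> space M. \<bar>\<psi> x\<bar> < s} \<in> sets M" by measurable
  then show ?thesis by simp
qed

lemma small_integral: "small s = intg (\<lambda>x. if \<bar>\<psi> x\<bar> < s then 1 else 0)"
proof -
  have "small s = intg (indicator {x \<in> \<Omega>. \<bar>\<psi> x\<bar> < s})" by (simp add: small_def Int_absorb2 subset_eq)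
  also have "\<dots> = intg (\<lambda>x. if \<bar>\<psi> x\<bar> < s then 1 else 0)"
    by (rule Bochner_Integration.integral_cong) (auto simp: indicator_def)
  finally show ?thesis .
qed

text \<open>The rescaled truncations \<open>trunc s / s\<close> tend to the indicator of the zero
  set, while their gradient energies tend to 0. In the limit the Poincare inequality leaves only the
  measures 0 and \<open>vol\<close> for the zero set, and full measure is excluded because \<psi> is
  not null.\<close>

lemma psi_nonzero_AE: "AE x in M. \<psi> x \<noteq> 0"
proof -
  define s where "s n = inverse (real (Suc n))" for n
  have s: "s n > 0" for n by (simp add: s_def)
  have sl: "s \<longlonglongrightarrow> 0" unfolding s_def by (rule LIMSEQ_inverse_real_of_nat)
  define u where "u n x = 0 + (1 / s n) * trunc (s n) x" for n x
  define Z where "Z x = (if \<psi> x = 0 then 1 else 0 :: real)" for x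
  have [measurable]: "Z \<in> borel_measurable M" unfolding Z_def by measurable
  have [measurable]: "u n \<in> borel_measurable M" for n unfolding u_def by measurable
  have uX: "u n \<in> X" for n unfolding u_def by (rule X_lincomb[OF X_const trunc_X(1)])
  have u01: "0 \<le> u n x" "u n x \<le> 1" for n x
    using trunc_bounds[of "s n" x] s[of n] by (auto simp: u_def)
  have ev: "\<forall>\<^sub>F n in sequentially. \<bar>\<psi> x\<bar> > s n" if "\<psi> x \<noteq> 0" for x
    using order_tendstoD(2)[OF sl, of "\<bar>\<psi> x\<bar>"] that by simp
  have lim: "(\<lambda>n. u n x) \<longlonglongrightarrow> Z x" for x
  proof (cases "\<psi> x = 0")
    case True then show ?thesis using s by (simp add: u_def trunc_def Z_def less_imp_le less_imp_neq[symmetric])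
  next
    case False
    have "\<forall>\<^sub>F n in sequentially. u n x = Z x" using ev[OF False]
      by eventually_elim (use False in \<open>auto simp: u_def trunc_def Z_def\<close>)
    then show ?thesis by (rule tendsto_eventually)
  qed
  have l1: "(\<lambda>n. intg (u n)) \<longlonglongrightarrow> intg Z"
    by (rule integral_dominated_convergence[where w="\<lambda>_. 1"]) (use lim u01 in auto)
  have l2: "(\<lambda>n. intg (\<lambda>x. (u n x)\<^sup>2)) \<longlonglongrightarrow> intg (\<lambda>x. (Z x)\<^sup>2)"
  proof (rule integral_dominated_convergence[where w="\<lambda>_. 1"])
    show "AE x in M. (\<lambda>n. (u n x)\<^sup>2) \<longlonglongrightarrow> (Z x)\<^sup>2" by (intro AE_I2 tendsto_power lim)
    show "AE x in M. norm ((u n x)\<^sup>2) \<le> 1" for n using u01 by (intro AE_I2) (simp add: power_le_one)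
  qed auto
  define \<mu> where "\<mu> = intg Z"
  have Z2: "(\<lambda>x. (Z x)\<^sup>2) = Z" by (auto simp: Z_def fun_eq_iff)
  \<comment> \<open>Half the bound of \<open>trunc_energy\<close> after rescaling. The factor
    \<open>\<bar>\<psi> x\<bar> / s n * u n x\<close> is at most 1 and eventually 0 at each point,
    so \<open>W\<close> dominates and the integrals tend to 0.\<close>
  define R where "R n = intg (\<lambda>x. W x * (\<bar>\<psi> x\<bar> / s n * u n x))" for n
  have R0: "R \<longlonglongrightarrow> intg (\<lambda>x. 0)"
    unfolding R_def
  proof (rule integral_dominated_convergence[OF _ _ W_integrable(1)])
    show "AE x in M. (\<lambda>n. W x * (\<bar>\<psi> x\<bar> / s n * u n x)) \<longlonglongrightarrow> 0"
    proof (intro AE_I2 tendsto_eventually)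
      fix x
      show "\<forall>\<^sub>F n in sequentially. W x * (\<bar>\<psi> x\<bar> / s n * u n x) = 0"
      proof (cases "\<psi> x = 0")
        case False
        show ?thesis using ev[OF False] by eventually_elim (simp add: u_def trunc_def)
      qed simp
    qed
    show "AE x in M. norm (W x * (\<bar>\<psi> x\<bar> / s n * u n x)) \<le> W x" for n
    proof (rule AE_I2)
      fix x
      define y where "y = \<bar>\<psi> x\<bar> / s n * u n x"
      have "0 \<le> y" unfolding y_def using s[of n] u01[of n x] by simp
      moreover have "y \<le> 1"
      proof (cases "\<bar>\<psi> x\<bar> \<le> s n")
        case True
        then have "\<bar>\<psi> x\<bar> / s n \<le> 1" using s[of n] by simp
        then show ?thesis using u01[of n x] s[of n] mult_mono[of "\<bar>\<psi> x\<bar> / s n" 1 "u n x" 1] by (simp add: y_def)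
      next
        case False then show ?thesis by (simp add: y_def u_def trunc_def)
      qed
      ultimately show "norm (W x * (\<bar>\<psi> x\<bar> / s n * u n x)) \<le> W x"
        using W_nonneg[of x] unfolding y_def[symmetric] by (simp add: abs_mult mult_left_le)
    qed
  qed measurable
  have gs: "gsq (u n) \<le> 2 * R n" for n
  proof -
    have "has_weak_gradient \<Omega> (u n) (\<lambda>x. 0 + (1 / s n) *\<^sub>R wgrad (trunc (s n)) x)"
      unfolding u_def by (rule has_weak_gradient_lincomb[OF const_grad X_grad[OF trunc_X(1)]])
    from grad_sq_eq[OF this] have "gsq (u n) = (1 / s n)\<^sup>2 * gsq (trunc (s n))"
      by (simp add: power_mult_distrib grad_sq_def power_divide)
    also have "\<dots> \<le> (1 / s n)\<^sup>2 * (2 * intg (\<lambda>x. W x * (\<bar>\<psi> x\<bar> * trunc (s n) x)))"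
      by (intro mult_left_mono trunc_energy s) simp
    also have "\<dots> = 2 * intg (\<lambda>x. (1 / s n)\<^sup>2 * (W x * (\<bar>\<psi> x\<bar> * trunc (s n) x)))" by simp
    also have "(\<lambda>x. (1 / s n)\<^sup>2 * (W x * (\<bar>\<psi> x\<bar> * trunc (s n) x))) = (\<lambda>x. W x * (\<bar>\<psi> x\<bar> / s n * u n x))"
      by (simp add: u_def power2_eq_square fun_eq_iff)
    finally show ?thesis by (simp add: R_def)
  qed
  have "intg (\<lambda>x. (Z x)\<^sup>2) - 1 / vol * (intg Z)\<^sup>2 \<le> P * (2 * 0)"
  proof (rule LIMSEQ_le)
    show "(\<lambda>n. intg (\<lambda>x. (u n x)\<^sup>2) - 1 / vol * (intg (u n))\<^sup>2) \<longlonglongrightarrow> intg (\<lambda>x. (Z x)\<^sup>2) - 1 / vol * (intg Z)\<^sup>2"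
      by (intro tendsto_intros l1 l2)
    show "(\<lambda>n. P * (2 * R n)) \<longlonglongrightarrow> P * (2 * 0)" using R0 by (intro tendsto_intros) simp
    show "\<exists>N. \<forall>n\<ge>N. intg (\<lambda>x. (u n x)\<^sup>2) - 1 / vol * (intg (u n))\<^sup>2 \<le> P * (2 * R n)"
    proof (intro exI[of _ 0] allI impI)
      fix n
      show "intg (\<lambda>x. (u n x)\<^sup>2) - 1 / vol * (intg (u n))\<^sup>2 \<le> P * (2 * R n)"
        by (rule order_trans[OF X_Poincare_mean[OF uX] mult_left_mono[OF gs less_imp_le[OF P_pos]]])
    qed
  qed
  then have "\<mu> - \<mu>\<^sup>2 / vol \<le> 0" unfolding Z2 \<mu>_def by simp
  then have q: "\<mu> * (vol - \<mu>) \<le> 0" using vol_pos by (simp add: field_simps power2_eq_square)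
  have iZ: "integrable M Z" by (rule integrable_const_bound[where B=1]) (auto simp: Z_def)
  have \<mu>0: "\<mu> \<ge> 0" unfolding \<mu>_def by (rule Bochner_Integration.integral_nonneg) (simp add: Z_def)
  have "\<mu> < vol"
  proof (rule ccontr)
    assume "\<not> \<mu> < vol"
    then have "intg (\<lambda>x. 1 - Z x) \<le> 0" using iZ by (simp add: \<mu>_def)
    moreover have nn: "AE x in M. 0 \<le> 1 - Z x" by (simp add: Z_def)
    ultimately have "intg (\<lambda>x. 1 - Z x) = 0" by (intro antisym integral_nonneg_AE)
    then have "AE x in M. 1 - Z x = 0" using iZ nn by (subst (asm) integral_nonneg_eq_0_iff_AE) auto
    then have "AE x in M. (\<psi> x)\<^sup>2 = 0" by eventually_elim (auto simp: Z_def split: if_splits)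
    then have "intg (\<lambda>x. (\<psi> x)\<^sup>2) = intg (\<lambda>x. 0)" by (intro integral_cong_AE) auto
    then show False using \<psi>_norm by simp
  qed
  then have "\<mu> = 0" using q \<mu>0 by (auto simp: mult_le_0_iff)
  then have "AE x in M. Z x = 0" using iZ unfolding \<mu>_def by (subst (asm) integral_nonneg_eq_0_iff_AE) (auto simp: Z_def)
  then show ?thesis by eventually_elim (auto simp: Z_def split: if_splits)
qed

lemma small_bounds: "0 \<le> small s" "small s \<le> vol"
  unfolding small_def by (auto intro!: finite_measure_mono)

lemma small_tendsto: "(\<lambda>n. small (inverse (real (Suc n)))) \<longlonglongrightarrow> 0"
proof -
  have "(\<lambda>n. intg (\<lambda>x. if \<bar>\<psi> x\<bar> < inverse (real (Suc n)) then 1 else 0)) \<longlonglongrightarrow> intg (\<lambda>x. 0)"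
  proof (rule integral_dominated_convergence[where w="\<lambda>_. 1"])
    show "AE x in M. (\<lambda>n. if \<bar>\<psi> x\<bar> < inverse (real (Suc n)) then 1 else 0) \<longlonglongrightarrow> (0::real)"
      using psi_nonzero_AE
    proof eventually_elim
      case (elim x)
      have "\<forall>\<^sub>F n in sequentially. inverse (real (Suc n)) < \<bar>\<psi> x\<bar>"
        using order_tendstoD(2)[OF LIMSEQ_inverse_real_of_nat, of "\<bar>\<psi> x\<bar>"] elim by simp
      then have "\<forall>\<^sub>F n in sequentially. (if \<bar>\<psi> x\<bar> < inverse (real (Suc n)) then 1 else 0) = (0::real)"
        by eventually_elim simp
      then show ?case by (rule tendsto_eventually)
    qed
  qed auto
  then show ?thesis by (simp add: small_integral)
qed

text \<open>Where \<open>\<bar>\<psi>\<bar> < s'\<close> the truncation at \<open>s\<close> exceeds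
  \<open>s - s'\<close>, so its L4 norm controls \<open>small s'\<close>. The energy bound and the
  integrability of \<open>W^4\<close> estimate that norm by the power 3/2 of \<open>small s\<close>;
  an exponent above 1 is what makes the iteration converge.\<close>

lemma small_step:
  obtains C where "C > 0" "\<And>s s'. 0 < s' \<Longrightarrow> s' < s \<Longrightarrow> small s' \<le> C * (s / (s - s')) ^ 4 * (small s * sqrt (small s))"
proof -
  define K where "K = intg (\<lambda>x. W x ^ 4)"
  have K0: "K \<ge> 0" unfolding K_def by simp
  define C where "C = S * (2 * sqrt vol + 8 * sqrt K) + 1"
  have C: "C > 0" unfolding C_def using S_pos K0 vol_pos by (intro add_nonneg_pos mult_nonneg_nonneg add_nonneg_nonneg) auto
  have "small s' \<le> C * (s / (s - s')) ^ 4 * (small s * sqrt (small s))" if s: "0 < s'" "s' < s" for s s'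
  proof -
    define m where "m = small s"
    have m: "0 \<le> m" "m \<le> vol" unfolding m_def by (rule small_bounds)+
    define A where "A x = (if \<bar>\<psi> x\<bar> < s then 1 else 0 :: real)" for x
    have [measurable]: "A \<in> borel_measurable M" unfolding A_def by measurable
    have A2: "(A x)\<^sup>2 = A x" for x by (simp add: A_def)
    have A01: "\<bar>A x\<bar> \<le> 1" for x by (simp add: A_def)
    have mA: "m = intg A" unfolding m_def small_integral A_def ..
    have iA: "integrable M A" by (rule integrable_const_bound[where B=1]) (use A01 in auto)
    have f: "trunc s x \<le> s * A x" "0 \<le> trunc s x" for x using s by (auto simp: trunc_def A_def)
    have iWA: "integrable M (\<lambda>x. A x * W x)" "integrable M (\<lambda>x. A x * (W x)\<^sup>2)"
      by (rule integrable_bounded_mult[OF W_integrable(1) _ A01], simp) (rule integrable_bounded_mult[OF W_integrable(2) _ A01], simp)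
    define w where "w = intg (\<lambda>x. A x * W x)"
    have w0: "w \<ge> 0" unfolding w_def using W_nonneg by (intro Bochner_Integration.integral_nonneg) (simp add: A_def)
    \<comment> \<open>Cauchy-Schwarz twice: once to reach the integral of \<open>W^2\<close> over
      the sublevel set, and once more to reach that of \<open>W^4\<close>.\<close>
    have w2: "w\<^sup>2 \<le> sqrt K * (m * sqrt m)"
    proof -
      have "(intg (\<lambda>x. A x * (A x * W x)))\<^sup>2 \<le> intg (\<lambda>x. (A x)\<^sup>2) * intg (\<lambda>x. (A x * W x)\<^sup>2)"
        using iA iWA(2) by (intro Cauchy_Schwarz_integral) (auto simp: A2 power_mult_distrib)
      moreover have "(\<lambda>x. A x * (A x * W x)) = (\<lambda>x. A x * W x)" by (auto simp: A_def)
      moreover have "(\<lambda>x. (A x * W x)\<^sup>2) = (\<lambda>x. A x * (W x)\<^sup>2)" by (simp add: power_mult_distrib A2)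
      ultimately have 1: "w\<^sup>2 \<le> m * intg (\<lambda>x. A x * (W x)\<^sup>2)" by (simp add: w_def mA A2)
      have "(intg (\<lambda>x. A x * (W x)\<^sup>2))\<^sup>2 \<le> intg (\<lambda>x. (A x)\<^sup>2) * intg (\<lambda>x. ((W x)\<^sup>2)\<^sup>2)"
        using iA W4 by (intro Cauchy_Schwarz_integral) (auto simp: A2 simp flip: power_mult)
      then have "(intg (\<lambda>x. A x * (W x)\<^sup>2))\<^sup>2 \<le> m * K" by (simp add: A2 mA K_def flip: power_mult)
      from real_sqrt_le_mono[OF this] have "\<bar>intg (\<lambda>x. A x * (W x)\<^sup>2)\<bar> \<le> sqrt m * sqrt K"
        by (simp add: real_sqrt_mult)
      then have "m * intg (\<lambda>x. A x * (W x)\<^sup>2) \<le> m * (sqrt m * sqrt K)" using m by (intro mult_left_mono) auto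
      then show ?thesis using 1 by (simp add: mult_ac)
    qed
    have m2: "m\<^sup>2 \<le> sqrt vol * (m * sqrt m)"
    proof -
      have "m = sqrt m * sqrt m" using m by simp
      also have "\<dots> \<le> sqrt vol * sqrt m" using m by (intro mult_right_mono) auto
      finally have "m * m \<le> m * (sqrt vol * sqrt m)" using m by (intro mult_left_mono) auto
      then show ?thesis by (simp add: power2_eq_square mult_ac)
    qed
    have if2: "integrable M (\<lambda>x. (trunc s x)\<^sup>2)"
      using L2_funD(2)[OF has_weak_gradient_L2(1)[OF trunc_X(2)[of s]]] by simp
    have F2: "intg (\<lambda>x. (trunc s x)\<^sup>2) \<le> s\<^sup>2 * m"
    proof -
      have "intg (\<lambda>x. (trunc s x)\<^sup>2) \<le> intg (\<lambda>x. s\<^sup>2 * A x)"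
      proof (rule integral_mono[OF if2])
        show "integrable M (\<lambda>x. s\<^sup>2 * A x)" using iA by simp
        show "(trunc s x)\<^sup>2 \<le> s\<^sup>2 * A x" for x
          using power_mono[OF f, of x 2] by (simp add: power_mult_distrib A2)
      qed
      then show ?thesis by (simp add: mA)
    qed
    have I2: "gsq (trunc s) \<le> 2 * (s\<^sup>2 * w)"
    proof -
      have b: "\<bar>\<psi> x\<bar> * trunc s x \<le> s\<^sup>2 * A x" "0 \<le> \<bar>\<psi> x\<bar> * trunc s x" for x
      proof -
        show "0 \<le> \<bar>\<psi> x\<bar> * trunc s x" by (simp add: trunc_bounds)
        show "\<bar>\<psi> x\<bar> * trunc s x \<le> s\<^sup>2 * A x"
          unfolding power2_eq_square using trunc_bounds[of s x] s
          by (cases "\<bar>\<psi> x\<bar> < s") (auto simp: trunc_def max_def A_def intro!: mult_mono)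
      qed
      have "intg (\<lambda>x. W x * (\<bar>\<psi> x\<bar> * trunc s x)) \<le> intg (\<lambda>x. s\<^sup>2 * (A x * W x))"
      proof (rule integral_mono)
        have "\<bar>\<bar>\<psi> x\<bar> * trunc s x\<bar> \<le> s\<^sup>2" for x
        proof -
          have "s\<^sup>2 * A x \<le> s\<^sup>2" by (simp add: A_def)
          then show ?thesis using b[of x] by linarith
        qed
        from integrable_bounded_mult[OF W_integrable(1) _ this]
        show "integrable M (\<lambda>x. W x * (\<bar>\<psi> x\<bar> * trunc s x))" by (simp add: mult.commute)
        show "integrable M (\<lambda>x. s\<^sup>2 * (A x * W x))" using iWA by simp
        show "W x * (\<bar>\<psi> x\<bar> * trunc s x) \<le> s\<^sup>2 * (A x * W x)" for x
          using mult_left_mono[OF b(1)[of x] W_nonneg[of x]] by (simp add: mult_ac)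
      qed
      also have "\<dots> = s\<^sup>2 * w" by (simp add: w_def)
      finally show ?thesis using trunc_energy[of s] s by simp
    qed
    have if4: "integrable M (\<lambda>x. trunc s x ^ 4)" by (rule X_integrable4[OF trunc_X(1)])
    have "(s - s') ^ 4 * small s' = intg (\<lambda>x. (s - s') ^ 4 * (if \<bar>\<psi> x\<bar> < s' then 1 else 0))"
      by (simp add: small_integral)
    also have "\<dots> \<le> intg (\<lambda>x. trunc s x ^ 4)"
    proof (rule integral_mono[OF _ if4])
      show "integrable M (\<lambda>x. (s - s') ^ 4 * (if \<bar>\<psi> x\<bar> < s' then 1 else 0))"
        by (rule integrable_const_bound[where B="(s - s') ^ 4"]) auto
      show "(s - s') ^ 4 * (if \<bar>\<psi> x\<bar> < s' then 1 else 0) \<le> trunc s x ^ 4" for x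
        using s by (auto simp: trunc_def intro!: power_mono)
    qed
    also have "\<dots> \<le> S * (h1_sq (trunc s))\<^sup>2" by (rule X_bound4[OF trunc_X(1)])
    also have "\<dots> \<le> S * (s\<^sup>2 * m + 2 * (s\<^sup>2 * w))\<^sup>2"
      using F2 I2 S_pos h1_sq_nonneg by (intro mult_left_mono power_mono) (auto simp: h1_sq_def)
    also have "\<dots> \<le> S * (s ^ 4 * (2 * m\<^sup>2 + 8 * w\<^sup>2))"
    proof (rule mult_left_mono)
      have "(m + 2 * w)\<^sup>2 \<le> 2 * m\<^sup>2 + 8 * w\<^sup>2"
        using sum_squares_bound[of m "2 * w"] by (simp add: power2_sum)
      then have "s ^ 4 * (m + 2 * w)\<^sup>2 \<le> s ^ 4 * (2 * m\<^sup>2 + 8 * w\<^sup>2)" by (intro mult_left_mono) auto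
      moreover have "(s\<^sup>2 * m + 2 * (s\<^sup>2 * w))\<^sup>2 = s ^ 4 * (m + 2 * w)\<^sup>2"
        by (simp add: power2_eq_square power4_eq_xxxx algebra_simps)
      ultimately show "(s\<^sup>2 * m + 2 * (s\<^sup>2 * w))\<^sup>2 \<le> s ^ 4 * (2 * m\<^sup>2 + 8 * w\<^sup>2)" by simp
    qed (use S_pos in simp)
    also have "\<dots> \<le> S * (s ^ 4 * (2 * (sqrt vol * (m * sqrt m)) + 8 * (sqrt K * (m * sqrt m))))"
      using m2 w2 S_pos by (intro mult_left_mono add_mono) auto
    also have "\<dots> = S * (2 * sqrt vol + 8 * sqrt K) * (s ^ 4 * (m * sqrt m))" by (simp add: algebra_simps)
    also have "\<dots> \<le> C * (s ^ 4 * (m * sqrt m))"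
      using m by (intro mult_right_mono) (auto simp: C_def)
    finally have "(s - s') ^ 4 * small s' \<le> C * (s ^ 4 * (m * sqrt m))" .
    then have "small s' \<le> C * (s ^ 4 * (m * sqrt m)) / (s - s') ^ 4"
      using s by (simp add: pos_le_divide_eq mult.commute)
    also have "\<dots> = C * (s / (s - s')) ^ 4 * (m * sqrt m)" by (simp add: power_divide)
    finally show ?thesis by (simp add: m_def)
  qed
  then show thesis using that C by blast
qed

text \<open>De Giorgi iteration along levels that decrease from \<open>s0\<close> to
  \<open>s0 / 2\<close>. If the sublevel set at \<open>s0\<close> is small enough, the measures
  decay geometrically, so the sublevel set at \<open>s0 / 2\<close> is null.\<close>

lemma bounded_away_from_zero: "\<exists>c>0. AE x in M. c \<le> \<bar>\<psi> x\<bar>"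
proof -
  obtain C where C: "C > 0" "\<And>s s'. 0 < s' \<Longrightarrow> s' < s \<Longrightarrow> small s' \<le> C * (s / (s - s')) ^ 4 * (small s * sqrt (small s))"
    by (rule small_step) (rule that; assumption)
  \<comment> \<open>Makes \<open>256 * C * q \<le> 1 / 256\<close>, the factor by which one step of
    the induction has to gain.\<close>
  define d where "d = 1 / (256 * 256 * C)"
  have d: "d > 0" using C by (simp add: d_def)
  have "\<forall>\<^sub>F n in sequentially. small (inverse (real (Suc n))) < d\<^sup>2"
    using small_tendsto d by (intro order_tendstoD) auto
  then obtain n where n: "small (inverse (real (Suc n))) < d\<^sup>2" by (auto simp: eventually_sequentially)
  define s0 where "s0 = inverse (real (Suc n))"
  have s0: "s0 > 0" by (simp add: s0_def)
  define q where "q = sqrt (small s0)"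
  have q: "q \<ge> 0" "256 * 256 * C * q \<le> 1"
  proof -
    show "q \<ge> 0" by (simp add: q_def small_bounds)
    have "q \<le> d" unfolding q_def using n d by (intro real_le_lsqrt) (auto simp: s0_def small_bounds)
    then have "256 * 256 * C * q \<le> 256 * 256 * C * d" using C by (intro mult_left_mono) auto
    then show "256 * 256 * C * q \<le> 1" using C by (simp add: d_def)
  qed
  \<comment> \<open>With these levels the constant of the step grows like \<open>16^k\<close>. This
    is compensated by the square root of the measure, which by induction decays like
    \<open>16^(-k)\<close>.\<close>
  define r where "r k = s0 / 2 * (1 + 1 / 2 ^ k)" for k :: nat
  have rb: "r k > 0" "r k \<le> s0" "r k > s0 / 2" "r k - r (Suc k) = s0 / (4 * 2 ^ k)" for k
    using s0 by (auto simp: r_def field_simps add_pos_pos)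
  have it: "small (r k) \<le> small s0 / 256 ^ k" for k
  proof (induction k)
    case 0 then show ?case by (simp add: r_def)
  next
    case (Suc k)
    have "s0 / (4 * 2 ^ k) > 0" using s0 by simp
    then have lt: "r (Suc k) < r k" using rb(4)[of k] by linarith
    have ratio: "r k / (r k - r (Suc k)) \<le> 4 * 2 ^ k"
    proof -
      have "r k / (r k - r (Suc k)) \<le> s0 / (r k - r (Suc k))" using lt rb(2)[of k] by (intro divide_right_mono) simp_all
      also have "\<dots> = 4 * 2 ^ k" unfolding rb(4) using s0 by simp
      finally show ?thesis .
    qed
    have "(r k / (r k - r (Suc k))) ^ 4 \<le> (4 * 2 ^ k) ^ 4"
      using ratio lt rb(1)[of k] by (intro power_mono) auto
    also have "(4 * 2 ^ k) ^ 4 = (256 * 16 ^ k :: real)" 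
    proof -
      have "((2::real) ^ k) ^ 4 = (2 ^ 4) ^ k" unfolding power_mult[symmetric] by (simp only: mult.commute)
      then show ?thesis by (simp add: power_mult_distrib)
    qed
    finally have p4: "(r k / (r k - r (Suc k))) ^ 4 \<le> 256 * 16 ^ k" .
    have sq: "sqrt (small (r k)) \<le> q / 16 ^ k"
    proof -
      have "sqrt (small (r k)) \<le> sqrt (small s0 / 256 ^ k)" using Suc by simp
      also have "\<dots> = q / sqrt (256 ^ k)" by (simp add: q_def real_sqrt_divide)
      also have "sqrt (256 ^ k) = (16 ^ k :: real)"
      proof -
        have "(256 :: real) ^ k = (16 ^ k)\<^sup>2" by (simp add: power2_eq_square flip: power_mult_distrib)
        then show ?thesis by simp
      qed
      finally show ?thesis .
    qed
    have "small (r (Suc k)) \<le> C * (r k / (r k - r (Suc k))) ^ 4 * (small (r k) * sqrt (small (r k)))"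
      by (rule C(2)[OF rb(1) lt])
    also have "\<dots> \<le> C * (256 * 16 ^ k) * ((small s0 / 256 ^ k) * (q / 16 ^ k))"
      using C(1) p4 Suc sq q small_bounds by (intro mult_mono mult_nonneg_nonneg) auto
    also have "\<dots> = (256 * C * q) * (small s0 / 256 ^ k)" by simp
    also have "\<dots> \<le> (1 / 256) * (small s0 / 256 ^ k)"
      using q small_bounds(1)[of s0] by (intro mult_right_mono) auto
    finally show ?case by simp
  qed
  have mono: "small (s0 / 2) \<le> small (r k)" for k
    unfolding small_def using rb(3)[of k] by (intro finite_measure_mono small_sets) auto
  have "(\<lambda>k. small s0 * (1 / 256) ^ k) \<longlonglongrightarrow> small s0 * 0" by (intro tendsto_intros LIMSEQ_power_zero) simp
  moreover have "small (s0 / 2) \<le> small s0 * (1 / 256) ^ k" for k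
    using order_trans[OF mono[of k] it[of k]] by (simp add: power_divide)
  ultimately have "small (s0 / 2) \<le> small s0 * 0" by (intro LIMSEQ_le_const) auto
  then have "measure M {x \<in> \<Omega>. \<bar>\<psi> x\<bar> < s0 / 2} = 0" using small_bounds(1)[of "s0 / 2"] unfolding small_def by linarith
  then have "{x \<in> \<Omega>. \<bar>\<psi> x\<bar> < s0 / 2} \<in> null_sets M" by (intro null_setsI small_sets) (simp only: emeasure_eq_measure ennreal_0)
  then have "AE x in M. s0 / 2 \<le> \<bar>\<psi> x\<bar>" by (rule AE_I') (auto simp: not_le)
  then show ?thesis using s0 by (intro exI[of _ "s0 / 2"]) auto
qed

text \<open>The function \<open>w = (\<bar>\<psi> + c\<bar> - \<bar>\<psi> - c\<bar>) / (2 *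
  c)\<close> equals the sign of \<psi> wherever \<open>\<bar>\<psi>\<bar> > c\<close>, that is
  almost everywhere, and has zero gradient there. By the Poincare inequality the modulus of its
  integral is at least \<open>vol\<close>, so the sign is constant.\<close>

lemma constant_sign: "\<exists>c>0. (AE x in M. c \<le> \<psi> x) \<or> (AE x in M. \<psi> x \<le> - c)"
proof -
  obtain c0 where c0: "c0 > 0" "AE x in M. c0 \<le> \<bar>\<psi> x\<bar>" using bounded_away_from_zero by blast
  define c where "c = c0 / 2"
  have c: "c > 0" using c0 by (simp add: c_def)
  have big: "AE x in M. \<bar>\<psi> x\<bar> > c" using c0(2) by eventually_elim (use c0(1) in \<open>simp add: c_def\<close>)
  define v1 v2 where "v1 x = \<psi> x + c * 1" and "v2 x = \<psi> x + (- c) * 1" for x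
  have vX: "v1 \<in> X" "v2 \<in> X" unfolding v1_def v2_def by (intro X_lincomb \<psi>_X X_const)+
  have gv: "has_weak_gradient \<Omega> v1 (\<lambda>x. wgrad \<psi> x + c *\<^sub>R 0)" "has_weak_gradient \<Omega> v2 (\<lambda>x. wgrad \<psi> x + (- c) *\<^sub>R 0)"
    unfolding v1_def v2_def by (intro has_weak_gradient_lincomb X_grad[OF \<psi>_X] const_grad)+
  define w where "w x = 0 + (1 / (2 * c)) * (\<bar>v1 x\<bar> + (-1) * \<bar>v2 x\<bar>)" for x
  have wX: "w \<in> X" unfolding w_def by (intro X_lincomb X_const X_abs vX)
  have gw: "has_weak_gradient \<Omega> w (\<lambda>x. 0 + (1 / (2 * c)) *\<^sub>R (sgn (v1 x) *\<^sub>R (wgrad \<psi> x + c *\<^sub>R 0) + (-1) *\<^sub>R (sgn (v2 x) *\<^sub>R (wgrad \<psi> x + (- c) *\<^sub>R 0))))"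
    unfolding w_def by (intro has_weak_gradient_lincomb const_grad X_abs_grad vX gv)
  have [measurable]: "w \<in> borel_measurable M" "v1 \<in> borel_measurable M" "v2 \<in> borel_measurable M"
    using X_meas wX vX by auto
  have "AE x in M. (norm (0 + (1 / (2 * c)) *\<^sub>R (sgn (v1 x) *\<^sub>R (wgrad \<psi> x + c *\<^sub>R 0) + (-1) *\<^sub>R (sgn (v2 x) *\<^sub>R (wgrad \<psi> x + (- c) *\<^sub>R 0)))))\<^sup>2 = 0"
    using big
  proof eventually_elim
    case (elim x)
    then have "sgn (v1 x) = sgn (v2 x)" using c by (auto simp: v1_def v2_def sgn_real_def)
    then show ?case by simp
  qed
  then have "intg (\<lambda>x. (norm (0 + (1 / (2 * c)) *\<^sub>R (sgn (v1 x) *\<^sub>R (wgrad \<psi> x + c *\<^sub>R 0) + (-1) *\<^sub>R (sgn (v2 x) *\<^sub>R (wgrad \<psi> x + (- c) *\<^sub>R 0)))))\<^sup>2) = 0"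
    by (rule integral_eq_zero_AE)
  then have g0: "gsq w = 0" unfolding grad_sq_eq[OF gw] .
  have wAE: "AE x in M. (\<psi> x > c \<and> w x = 1) \<or> (\<psi> x < - c \<and> w x = -1)"
    using big
  proof eventually_elim
    case (elim x)
    then show ?case using c by (cases "\<psi> x > 0") (auto simp: w_def v1_def v2_def field_simps)
  qed
  have "AE x in M. (w x)\<^sup>2 = 1" using wAE by eventually_elim auto
  then have "intg (\<lambda>x. (w x)\<^sup>2) = intg (\<lambda>x. 1)" by (intro integral_cong_AE) auto
  then have w2: "intg (\<lambda>x. (w x)\<^sup>2) = vol" by simp
  have iw: "integrable M w" by (rule L2_fun_integrable[OF has_weak_gradient_L2(1)[OF gw]])
  have "vol - 1 / vol * (intg w)\<^sup>2 \<le> 0" using X_Poincare_mean[OF wX] by (simp add: w2 g0)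
  then have "vol\<^sup>2 \<le> (intg w)\<^sup>2" using vol_pos by (simp add: field_simps power2_eq_square)
  then have "vol \<le> \<bar>intg w\<bar>" using vol_pos by (simp add: abs_le_square_iff[symmetric])
  then consider "vol \<le> intg w" | "intg w \<le> - vol" by linarith
  then show ?thesis
  proof cases
    case 1
    have nn: "AE x in M. 0 \<le> 1 - w x" using wAE by eventually_elim auto
    have "intg (\<lambda>x. 1 - w x) \<le> 0" using 1 iw by simp
    then have "intg (\<lambda>x. 1 - w x) = 0" using integral_nonneg_AE[OF nn] by linarith
    then have "AE x in M. 1 - w x = 0" using iw nn by (subst (asm) integral_nonneg_eq_0_iff_AE) auto
    then have "AE x in M. c \<le> \<psi> x" using wAE by eventually_elim auto
    then show ?thesis using c by blast
  next
    case 2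
    have nn: "AE x in M. 0 \<le> 1 + w x" using wAE by eventually_elim auto
    have "intg (\<lambda>x. 1 + w x) \<le> 0" using 2 iw by simp
    then have "intg (\<lambda>x. 1 + w x) = 0" using integral_nonneg_AE[OF nn] by linarith
    then have "AE x in M. 1 + w x = 0" using iw nn by (subst (asm) integral_nonneg_eq_0_iff_AE) auto
    then have "AE x in M. \<psi> x \<le> - c" using wAE by eventually_elim auto
    then show ?thesis using c by blast
  qed
qed

end

section \<open>Perturbations of the density\<close>

text \<open>A concave function lies below its tangents. The point 0 enters through continuity and
  the value \<open>G' 0\<close> only, so no derivative at 0 is involved.\<close>

lemma antitone_deriv_tangent:
  fixes G G' :: "real \<Rightarrow> real"
  assumes cont: "continuous_on {0..} G" and der: "\<And>y. y > 0 \<Longrightarrow> (G has_real_derivative G' y) (at y)"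
    and anti: "\<And>x y. 0 \<le> x \<Longrightarrow> x \<le> y \<Longrightarrow> G' y \<le> G' x" and st: "0 \<le> s" "0 \<le> t"
  shows "G t \<le> G s + G' s * (t - s)"
proof -
  consider "s = t" | "s < t" | "t < s" by linarith
  then show ?thesis
  proof cases
    case 2
    have "continuous_on {s..t} G" using cont by (rule continuous_on_subset) (use st in auto)
    moreover have "(G has_real_derivative G' y) (at y)" if "s < y" "y < t" for y using der that st by auto
    ultimately obtain z where z: "s < z" "z < t" "G t - G s = (t - s) * G' z"
      using mvt[of s t G "\<lambda>y h. h * G' y"] 2 by (auto simp: has_field_derivative_def mult.commute[of _ "G' _"])
    have "(t - s) * G' z \<le> (t - s) * G' s" by (rule mult_left_mono[OF anti]) (use st z in auto)
    then have "G t - G s \<le> (t - s) * G' s" unfolding z(3) .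
    then show ?thesis by (simp add: mult.commute)
  next
    case 3
    have "continuous_on {t..s} G" using cont by (rule continuous_on_subset) (use st in auto)
    moreover have "(G has_real_derivative G' y) (at y)" if "t < y" "y < s" for y using der that st by auto
    ultimately obtain z where z: "t < z" "z < s" "G s - G t = (s - t) * G' z"
      using mvt[of t s G "\<lambda>y h. h * G' y"] 3 by (auto simp: has_field_derivative_def mult.commute[of _ "G' _"])
    have "(s - t) * G' s \<le> (s - t) * G' z" by (rule mult_left_mono[OF anti]) (use st z in auto)
    then have "(s - t) * G' s \<le> G s - G t" unfolding z(3) .
    moreover have "G' s * (t - s) = - ((s - t) * G' s)" by (simp add: algebra_simps)
    ultimately show ?thesis by linarith
  qed simp
qed

lemma powr_superadd:
  fixes x y p :: real
  assumes "0 \<le> x" "0 \<le> y" "p \<ge> 1"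
  shows "x powr p + y powr p \<le> (x + y) powr p"
proof -
  have e: "z powr p = z * z powr (p - 1)" if "0 \<le> z" for z
    using that by (cases "z = 0") (auto simp: powr_diff)
  have "x powr p + y powr p \<le> x * (x + y) powr (p - 1) + y * (x + y) powr (p - 1)"
    using assms by (simp only: e) (intro add_mono mult_left_mono powr_mono2; simp)
  also have "\<dots> = (x + y) powr p" using assms by (simp only: e[of "x + y"] add_nonneg_nonneg distrib_right)
  finally show ?thesis .
qed

lemma continuous_on_powr_nonneg:
  fixes p :: real
  shows "p > 0 \<Longrightarrow> continuous_on {0..} (\<lambda>t. t powr p)"
  by (rule continuous_on_powr') auto

text \<open>Both sides agree at \<open>t = s\<close>, and the derivatives in \<open>t\<close> are
  compared by the superadditivity of the power 5/3.\<close>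

lemma powr_Bregman:
  fixes s t :: real
  assumes "0 \<le> s" "s \<le> t"
  shows "(t - s) powr (8/3) \<le> t powr (8/3) - s powr (8/3) - 8/3 * s powr (5/3) * (t - s)"
proof -
  let ?\<phi> = "\<lambda>t. t powr (8/3) - s powr (8/3) - 8/3 * s powr (5/3) * (t - s) - (t - s) powr (8/3)"
  have "?\<phi> s \<le> ?\<phi> t"
  proof (rule DERIV_nonneg_imp_increasing_open[OF assms(2)])
    fix x assume x: "s < x" "x < t"
    have d: "(?\<phi> has_real_derivative 8/3 * x powr (5/3) - 8/3 * s powr (5/3) - 8/3 * (x - s) powr (5/3)) (at x)"
      using x assms by (auto intro!: derivative_eq_intros)
    have p: "0 \<le> 8/3 * x powr (5/3) - 8/3 * s powr (5/3) - 8/3 * (x - s) powr (5/3)"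
      using powr_superadd[of s "x - s" "5/3"] x assms by simp
    show "\<exists>d. (?\<phi> has_real_derivative d) (at x) \<and> 0 \<le> d" by (rule exI, rule conjI, rule d, rule p)
  next
    show "continuous_on {s..t} ?\<phi>"
      by (intro continuous_on_diff continuous_on_mult_left continuous_on_const continuous_on_id
          continuous_on_compose2[OF continuous_on_powr_nonneg[of "8/3"]]) (use assms in auto)
  qed
  then show ?thesis by simp
qed

text \<open>As \<open>F'\<close> behaves like \<open>- \<rho> powr (1/3)\<close> near 0, \<open>F''\<close> is unbounded. In the variable \<open>s = sqrt \<rho>\<close> this
  is harmless: \<open>F (s\<^sup>2)\<close> is concave, with a margin coming from the exchange energy (\<open>up\<close>), and becomes
  convex after adding a polynomial (\<open>lo\<close>).\<close>

locale lda =
  fixes F f :: "real \<Rightarrow> real" and a K :: real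
  assumes F0: "F 0 = 0" and f0: "f 0 = 0"
    and F_der: "\<rho> > 0 \<Longrightarrow> (F has_real_derivative f \<rho>) (at \<rho>)"
    and F_der0: "(F has_real_derivative 0) (at 0 within {0..})"
    and a_pos: "a > 0" and K_pos: "K > 0"
    and up: "0 \<le> x \<Longrightarrow> x \<le> y \<Longrightarrow> y * f (y\<^sup>2) + a * y powr (5/3) \<le> x * f (x\<^sup>2) + a * x powr (5/3)"
    and lo: "0 \<le> x \<Longrightarrow> x \<le> y \<Longrightarrow> x * f (x\<^sup>2) + K * (x + x ^ 3) \<le> y * f (y\<^sup>2) + K * (y + y ^ 3)"
begin

lemma f_le: "s \<ge> 0 \<Longrightarrow> f (s\<^sup>2) \<le> - a * s powr (2/3)"
proof (cases "s = 0")
  case False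
  assume "s \<ge> 0"
  then have s: "s > 0" using False by simp
  have "s * f (s\<^sup>2) + a * s powr (5/3) \<le> 0" using up[of 0 s] s by simp
  moreover have "s powr (5/3) = s * s powr (2/3)" using s powr_add[of s 1 "2/3"] by simp
  ultimately have "s * (f (s\<^sup>2) + a * s powr (2/3)) \<le> 0" by (simp add: algebra_simps)
  then have "f (s\<^sup>2) + a * s powr (2/3) \<le> 0" using s by (simp add: mult_le_0_iff)
  then show ?thesis by simp
qed (simp add: f0)

lemma f_le_sqrt: "\<rho> \<ge> 0 \<Longrightarrow> f \<rho> \<le> - a * sqrt \<rho> powr (2/3)"
  using f_le[of "sqrt \<rho>"] by simp

lemma f_nonpos: "\<rho> \<ge> 0 \<Longrightarrow> f \<rho> \<le> 0"
  using f_le_sqrt[of \<rho>] a_pos by (smt (verit) mult_nonneg_nonneg powr_ge_zero mult_minus_left)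

lemma f_ge: "\<rho> \<ge> 0 \<Longrightarrow> f \<rho> \<ge> - K * (1 + \<rho>)"
proof (cases "\<rho> = 0")
  case True then show ?thesis using K_pos f0 by simp
next
  case False
  assume "\<rho> \<ge> 0"
  define s where "s = sqrt \<rho>"
  have s: "s > 0" "s\<^sup>2 = \<rho>" using False \<open>\<rho> \<ge> 0\<close> by (auto simp: s_def)
  have "0 \<le> s * f (s\<^sup>2) + K * (s + s ^ 3)" using lo[of 0 s] s by simp
  also have "\<dots> = s * (f (s\<^sup>2) + K * (1 + s\<^sup>2))" by (simp add: algebra_simps power2_eq_square power3_eq_cube)
  finally have "0 \<le> f (s\<^sup>2) + K * (1 + s\<^sup>2)" using s by (simp add: zero_le_mult_iff)
  then show ?thesis by (simp add: s)
qed

lemma g_deriv: "y > 0 \<Longrightarrow> ((\<lambda>y. F (y\<^sup>2)) has_real_derivative 2 * y * f (y\<^sup>2)) (at y)"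
proof -
  assume y: "y > 0"
  have "((\<lambda>y. y\<^sup>2) has_real_derivative 2 * y) (at y)" by (auto intro!: derivative_eq_intros)
  from DERIV_chain2[OF F_der this] y show ?thesis by (simp add: mult_ac)
qed

lemma F_cont: "continuous_on {0..} F"
  unfolding continuous_on_eq_continuous_within
proof
  fix x :: real assume "x \<in> {0..}"
  then consider "x = 0" | "x > 0" by fastforce
  then show "continuous (at x within {0..}) F"
  proof cases
    case 1 then show ?thesis using F_der0 DERIV_continuous by blast
  next
    case 2 then show ?thesis using DERIV_continuous[OF has_field_derivative_at_within[OF F_der]] by blast
  qed
qed

lemma g_cont: "continuous_on {0..} (\<lambda>y. F (y\<^sup>2))"
  by (rule continuous_on_compose2[OF F_cont]) (auto intro!: continuous_intros)

text \<open>By \<open>up\<close>, the function \<open>F (y^2) + 3/4 * a * y powr (8/3)\<close> is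
  concave, so it lies below its tangent. Subtracting the convex power leaves its Bregman distance as
  a gain, which is either dropped or bounded from below by a power of \<open>t - s\<close>.\<close>

lemma F_upper:
  assumes st: "0 \<le> s" "0 \<le> t"
  shows "F (t\<^sup>2) \<le> F (s\<^sup>2) + 2 * s * f (s\<^sup>2) * (t - s)"
    "s \<le> t \<Longrightarrow> F (t\<^sup>2) \<le> F (s\<^sup>2) + 2 * s * f (s\<^sup>2) * (t - s) - 3/4 * a * (t - s) powr (8/3)"
proof -
  let ?G = "\<lambda>y. F (y\<^sup>2) + 3/4 * a * y powr (8/3)" and ?G' = "\<lambda>y. 2 * (y * f (y\<^sup>2) + a * y powr (5/3))"
  have cont: "continuous_on {0..} ?G"
    by (intro continuous_on_add continuous_on_mult_left g_cont continuous_on_powr_nonneg) auto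
  have der: "(?G has_real_derivative ?G' y) (at y)" if "y > 0" for y
    using that by (auto intro!: derivative_eq_intros g_deriv simp: algebra_simps)
  have T: "?G t \<le> ?G s + ?G' s * (t - s)"
    by (rule antitone_deriv_tangent[OF cont der _ st]) (assumption, rule mult_left_mono[OF up], auto)
  have e: "?G' s * (t - s) = 2 * s * f (s\<^sup>2) * (t - s) + 2 * (a * s powr (5/3)) * (t - s)" by (simp add: algebra_simps)
  show "F (t\<^sup>2) \<le> F (s\<^sup>2) + 2 * s * f (s\<^sup>2) * (t - s) - 3/4 * a * (t - s) powr (8/3)" if "s \<le> t"
  proof -
    have "3/4 * a * (t - s) powr (8/3) \<le> 3/4 * a * (t powr (8/3) - s powr (8/3) - 8/3 * s powr (5/3) * (t - s))"
      using powr_Bregman[OF st(1) that] a_pos by (intro mult_left_mono) auto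
    also have "\<dots> = 3/4 * a * t powr (8/3) - 3/4 * a * s powr (8/3) - 2 * (a * s powr (5/3)) * (t - s)"
      by (simp add: field_simps)
    finally show ?thesis using T e by linarith
  qed
  show "F (t\<^sup>2) \<le> F (s\<^sup>2) + 2 * s * f (s\<^sup>2) * (t - s)"
  proof -
    have "- (t powr (8/3)) \<le> - (s powr (8/3)) + (- (8/3 * s powr (5/3))) * (t - s)"
    proof (rule antitone_deriv_tangent[OF _ _ _ st])
      show "continuous_on {0..} (\<lambda>t::real. - (t powr (8/3)))"
        by (intro continuous_on_minus continuous_on_powr_nonneg) auto
      show "((\<lambda>t. - (t powr (8/3))) has_real_derivative - (8/3 * y powr (5/3))) (at y)" if "y > 0" for y
        using that by (auto intro!: derivative_eq_intros)
      show "- (8/3 * y powr (5/3)) \<le> - (8/3 * x powr (5/3))" if "0 \<le> x" "x \<le> y" for x y :: real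
        using that by (simp add: powr_mono2)
    qed
    then have "0 \<le> t powr (8/3) - s powr (8/3) - 8/3 * s powr (5/3) * (t - s)" by (simp add: algebra_simps)
    then have "0 \<le> 3/4 * a * (t powr (8/3) - s powr (8/3) - 8/3 * s powr (5/3) * (t - s))" using a_pos by simp
    also have "\<dots> = 3/4 * a * t powr (8/3) - 3/4 * a * s powr (8/3) - 2 * (a * s powr (5/3)) * (t - s)"
      by (simp add: field_simps)
    finally show ?thesis using T e by linarith
  qed
qed

text \<open>By \<open>lo\<close>, the function \<open>F (y^2) + K * (y^2 + y^4 / 2)\<close> is
  convex, so it lies above its tangent. The Bregman distance of the polynomial is computed exactly
  and then bounded.\<close>

lemma F_lower:
  assumes st: "0 \<le> s" "0 \<le> t"
  shows "F (t\<^sup>2) \<ge> F (s\<^sup>2) + 2 * s * f (s\<^sup>2) * (t - s) - K * (t - s)\<^sup>2 * (1 + 4 * s\<^sup>2 + 3/2 * (t - s)\<^sup>2)"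
proof -
  let ?G = "\<lambda>y. - (F (y\<^sup>2) + K * (y\<^sup>2 + y ^ 4 / 2))" and ?G' = "\<lambda>y. - (2 * (y * f (y\<^sup>2) + K * (y + y ^ 3)))"
  have cont: "continuous_on {0..} ?G" by (intro continuous_intros g_cont) auto
  have der: "(?G has_real_derivative ?G' y) (at y)" if "y > 0" for y
    using that by (auto intro!: derivative_eq_intros g_deriv simp: algebra_simps)
  have T: "?G t \<le> ?G s + ?G' s * (t - s)"
    by (rule antitone_deriv_tangent[OF cont der _ st]) (assumption, rule le_imp_neg_le, rule mult_left_mono[OF lo], auto)
  define \<tau> where "\<tau> = t - s"
  have e: "(t\<^sup>2 + t ^ 4 / 2) - (s\<^sup>2 + s ^ 4 / 2) - 2 * (s + s ^ 3) * \<tau> = \<tau>\<^sup>2 * (1 + (6 * s\<^sup>2 + 4 * s * \<tau> + \<tau>\<^sup>2) / 2)"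
    unfolding \<tau>_def by (simp add: power2_eq_square power4_eq_xxxx power3_eq_cube algebra_simps add_divide_distrib diff_divide_distrib)
  have "4 * s * \<tau> \<le> 2 * s\<^sup>2 + 2 * \<tau>\<^sup>2" using sum_squares_bound[of s \<tau>] by simp
  then have "\<tau>\<^sup>2 * (1 + (6 * s\<^sup>2 + 4 * s * \<tau> + \<tau>\<^sup>2) / 2) \<le> \<tau>\<^sup>2 * (1 + 4 * s\<^sup>2 + 3/2 * \<tau>\<^sup>2)"
    by (intro mult_left_mono) (auto simp: field_simps)
  then have "K * ((t\<^sup>2 + t ^ 4 / 2) - (s\<^sup>2 + s ^ 4 / 2) - 2 * (s + s ^ 3) * \<tau>) \<le> K * (\<tau>\<^sup>2 * (1 + 4 * s\<^sup>2 + 3/2 * \<tau>\<^sup>2))"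
    unfolding e by (rule mult_left_mono[OF _ less_imp_le[OF K_pos]])
  then show ?thesis using T unfolding \<tau>_def[symmetric] by (simp add: algebra_simps)
qed

lemma F_bounds: "\<rho> \<ge> 0 \<Longrightarrow> F \<rho> \<le> 0" "\<rho> \<ge> 0 \<Longrightarrow> F \<rho> \<ge> - K * \<rho> * (1 + 2 * \<rho>)"
proof -
  assume \<rho>: "\<rho> \<ge> 0"
  show "F \<rho> \<le> 0" using F_upper(1)[of 0 "sqrt \<rho>"] \<rho> F0 by simp
  have "F \<rho> \<ge> - (K * \<rho> * (1 + 3/2 * \<rho>))" using F_lower[of 0 "sqrt \<rho>"] \<rho> F0 by simp
  moreover have "K * \<rho> * (1 + 3/2 * \<rho>) \<le> K * \<rho> * (1 + 2 * \<rho>)" using \<rho> K_pos by (intro mult_left_mono) auto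
  ultimately show "F \<rho> \<ge> - K * \<rho> * (1 + 2 * \<rho>)" by simp
qed

section \<open>Pointwise estimates for one perturbed density\<close>

context
  fixes \<rho> \<sigma> D :: real
  assumes \<rho>: "\<rho> \<ge> 0" and D: "D \<ge> 0" and \<sigma>: "\<sigma>\<^sup>2 \<le> \<rho> * D / 2"
begin

text \<open>The density of the perturbed orbitals, where \<open>\<rho>\<close> is twice the sum of
  the squared orbitals, \<open>\<sigma>\<close> the sum of the orbitals times their errors and
  \<open>D\<close> the sum of the squared errors. The hypothesis on \<open>\<sigma>\<close> is the
  Cauchy-Schwarz inequality for these sums.\<close>

abbreviation (input) "\<rho>h \<equiv> \<rho> + 4 * \<sigma> + 2 * D"

text \<open>The difference of the two sides is
  \<open>2 * \<rho> * D - 4 * \<sigma>^2\<close>.\<close>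

lemma dens_product: "(\<rho> + 2 * \<sigma>)\<^sup>2 \<le> \<rho> * \<rho>h"
  using \<sigma> by (simp add: power2_eq_square algebra_simps)

lemma dens_nonneg: "\<rho>h \<ge> 0"
proof (cases "\<rho> = 0")
  case True then show ?thesis using \<sigma> D by simp
next
  case False
  have "0 \<le> \<rho> * \<rho>h" using dens_product zero_le_power2 order_trans by blast
  then show ?thesis using False \<rho> by (simp add: zero_le_mult_iff)
qed

text \<open>The reverse triangle inequality for the vector of orbitals, whose Euclidean norm is the
  root of half the density.\<close>

lemma sqrt_diff_le: "(sqrt \<rho>h - sqrt \<rho>)\<^sup>2 \<le> 2 * D"
proof -
  have "\<rho> + 2 * \<sigma> \<le> sqrt (\<rho> * \<rho>h)" by (rule real_le_rsqrt[OF dens_product])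
  then have "\<rho> + 2 * \<sigma> \<le> sqrt \<rho> * sqrt \<rho>h" by (simp add: real_sqrt_mult)
  moreover have "(sqrt \<rho>h - sqrt \<rho>)\<^sup>2 = \<rho>h + \<rho> - 2 * (sqrt \<rho> * sqrt \<rho>h)"
    using \<rho> dens_nonneg by (simp add: power2_diff mult_ac)
  ultimately show ?thesis by simp
qed

lemma dens_diff: "\<rho>h - \<rho> = (sqrt \<rho>h - sqrt \<rho>)\<^sup>2 + 2 * sqrt \<rho> * (sqrt \<rho>h - sqrt \<rho>)"
  using \<rho> dens_nonneg by (simp add: power2_eq_square algebra_simps)

text \<open>Concavity in the root of the density gives the first bound. For the second, if
  \<open>\<rho>\<close> is not small against \<open>D\<close>, the term
  \<open>- 2 * f \<rho> * D\<close> is large enough by itself; otherwise the root of the density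
  increases by at least a multiple of the root of \<open>D\<close>, and the gain in
  \<open>F_upper\<close> applies.\<close>

lemma slack_ge_f: "- 2 * f \<rho> * D - (F \<rho>h - F \<rho> - 4 * f \<rho> * \<sigma>) \<ge> - 2 * f \<rho> * D"
  and slack_ge_powr: "- 2 * f \<rho> * D - (F \<rho>h - F \<rho> - 4 * f \<rho> * \<sigma>) \<ge> a / 4 * D powr (4/3)"
proof -
  define s t where "s = sqrt \<rho>" and "t = sqrt \<rho>h"
  have s: "s \<ge> 0" "s\<^sup>2 = \<rho>" and t: "t \<ge> 0" "t\<^sup>2 = \<rho>h" using \<rho> dens_nonneg by (auto simp: s_def t_def)
  have td: "(t - s)\<^sup>2 \<le> 2 * D" using sqrt_diff_le by (simp add: s_def t_def)
  have dd: "2 * s * (t - s) - 4 * \<sigma> = 2 * D - (t - s)\<^sup>2" using dens_diff by (simp add: s_def t_def)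
  have fn: "f \<rho> \<le> 0" by (rule f_nonpos[OF \<rho>])
  have e: "2 * s * f \<rho> * (t - s) - 4 * f \<rho> * \<sigma> = f \<rho> * (2 * D - (t - s)\<^sup>2)"
    unfolding dd[symmetric] by (simp add: algebra_simps)
  have neg: "f \<rho> * (2 * D - (t - s)\<^sup>2) \<le> 0" using fn td by (intro mult_nonpos_nonneg) auto
  have G0: "F \<rho>h - F \<rho> - 4 * f \<rho> * \<sigma> \<le> 0"
    using F_upper(1)[OF s(1) t(1)] e neg unfolding s(2) t(2) by linarith
  then show "- 2 * f \<rho> * D - (F \<rho>h - F \<rho> - 4 * f \<rho> * \<sigma>) \<ge> - 2 * f \<rho> * D" by simp
  show "- 2 * f \<rho> * D - (F \<rho>h - F \<rho> - 4 * f \<rho> * \<sigma>) \<ge> a / 4 * D powr (4/3)"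
  \<comment> \<open>The threshold serves both sides: above it
    \<open>D powr (1/3) \<le> 2 * s powr (2/3)\<close>, below it \<open>2 * s\<close> is at most the
    root of \<open>D / 2\<close>.\<close>
  proof (cases "s\<^sup>2 \<ge> D / 8")
    case True
    have "D powr (4/3) = D * D powr (1/3)" using D powr_add[of D 1 "1/3"] by simp
    also have "\<dots> \<le> D * (2 * s powr (2/3))"
    proof (rule mult_left_mono[OF _ D])
      have "(D / 8) powr (1/3) \<le> (s\<^sup>2) powr (1/3)" using True D by (intro powr_mono2) auto
      also have "(s\<^sup>2) powr (1/3) = s powr (2/3)"
        using s by (cases "s = 0") (auto simp: powr_powr simp flip: powr_numeral)
      also have "(D / 8) powr (1/3) = D powr (1/3) / 2"
      proof -
        have "(8::real) powr (1/3) = 2" using powr_powr[of 2 3 "1/3"] by simp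
        then show ?thesis using D by (simp add: powr_divide)
      qed
      finally show "D powr (1/3) \<le> 2 * s powr (2/3)" by simp
    qed
    finally have "a / 4 * D powr (4/3) \<le> a / 4 * (D * (2 * s powr (2/3)))" using a_pos by (intro mult_left_mono) auto
    also have "\<dots> \<le> - 2 * (- a * s powr (2/3)) * D" using a_pos D by simp
    also have "\<dots> \<le> - 2 * f \<rho> * D"
      using f_le[OF s(1)] D unfolding s(2) by (intro mult_right_mono) auto
    finally show ?thesis using G0 by linarith
  next
    case False
    have t2: "sqrt (2 * D) - s \<le> t"
    proof -
      have "\<bar>\<sigma>\<bar> \<le> s * sqrt (D / 2)"
      proof -
        have "sqrt (\<sigma>\<^sup>2) \<le> sqrt (\<rho> * D / 2)" using \<sigma> by (rule real_sqrt_le_mono)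
        also have "\<dots> = s * sqrt (D / 2)" unfolding s_def by (simp flip: real_sqrt_mult)
        finally show ?thesis by simp
      qed
      moreover have "sqrt (2 * D) = 2 * sqrt (D / 2)"
      proof -
        have "2 * D = 2\<^sup>2 * (D / 2)" by simp
        then show ?thesis by (metis real_sqrt_mult real_sqrt_abs abs_numeral)
      qed
      ultimately have "4 * \<sigma> \<ge> - (2 * s * sqrt (2 * D))" by (simp only: abs_le_iff) simp
      moreover have "(sqrt (2 * D) - s)\<^sup>2 = 2 * D - 2 * s * sqrt (2 * D) + \<rho>"
        using D by (simp add: power2_diff s(2))
      ultimately have "(sqrt (2 * D) - s)\<^sup>2 \<le> t\<^sup>2" unfolding t(2) by linarith
      then show ?thesis using t(1) by (rule power2_le_imp_le)
    qed
    define q where "q = sqrt (D / 2)"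
    have q: "q \<ge> 0" "sqrt (2 * D) = 2 * q" "q\<^sup>2 = D / 2"
    proof -
      have "2 * D = 2\<^sup>2 * (D / 2)" by simp
      then show "sqrt (2 * D) = 2 * q" unfolding q_def by (metis real_sqrt_mult real_sqrt_abs abs_numeral)
    qed (use D in \<open>auto simp: q_def\<close>)
    have "(2 * s)\<^sup>2 \<le> q\<^sup>2" using False q by (simp add: power_mult_distrib)
    then have "2 * s \<le> q" using q(1) by (rule power2_le_imp_le)
    then have ts: "q \<le> t - s" using t2 q by linarith
    have "D powr (4/3) = (2 * q\<^sup>2) powr (4/3)" using q(3) by (simp only:) simp
    also have "\<dots> = 2 powr (4/3) * q powr (8/3)"
      using q by (cases "q = 0") (auto simp: powr_mult powr_powr simp flip: powr_numeral)
    \<comment> \<open>The factor 3 turns \<open>a / 4\<close> into the coefficient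
      \<open>3/4 * a\<close> of \<open>F_upper\<close>.\<close>
    also have "\<dots> \<le> 3 * (t - s) powr (8/3)"
    proof (intro mult_mono powr_mono2)
      have "(2::real) powr (4/3) \<le> 2 powr (3/2)" by (intro powr_mono) auto
      also have "(2::real) powr (3/2) = 2 * sqrt 2" using powr_add[of 2 1 "1/2::real"] by (simp add: powr_half_sqrt)
      also have "\<dots> \<le> 3" using real_le_lsqrt[of "3/2" 2] by (simp add: power2_eq_square)
      finally show "(2::real) powr (4/3) \<le> 3" .
    qed (use ts q in auto)
    finally have "a / 4 * D powr (4/3) \<le> a / 4 * (3 * (t - s) powr (8/3))" using a_pos by (intro mult_left_mono) auto
    moreover have "F \<rho>h - F \<rho> - 4 * f \<rho> * \<sigma> \<le> - 3/4 * a * (t - s) powr (8/3)"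
      using F_upper(2)[OF s(1) t(1)] ts q e neg unfolding s(2) t(2) by linarith
    moreover have "- 2 * f \<rho> * D \<ge> 0" using fn D by (simp add: mult_nonpos_nonneg)
    ultimately show ?thesis by linarith
  qed
qed

text \<open>A bound without smallness, from which the dominating function for the Taylor remainder
  is built. The term \<open>f \<rho> * (t - s)^2\<close> is nonpositive and is dropped.\<close>

lemma Taylor_crude: "F \<rho> + f \<rho> * (\<rho>h - \<rho>) - F \<rho>h \<le> 2 * K * D * (1 + 4 * \<rho> + 3 * D)"
proof -
  define s t where "s = sqrt \<rho>" and "t = sqrt \<rho>h"
  have s: "s \<ge> 0" "s\<^sup>2 = \<rho>" and t: "t \<ge> 0" "t\<^sup>2 = \<rho>h" using \<rho> dens_nonneg by (auto simp: s_def t_def)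
  have td: "(t - s)\<^sup>2 \<le> 2 * D" using sqrt_diff_le by (simp add: s_def t_def)
  have dd: "\<rho>h - \<rho> = (t - s)\<^sup>2 + 2 * s * (t - s)" using dens_diff by (simp add: s_def t_def)
  have "f \<rho> * (t - s)\<^sup>2 \<le> 0" using f_nonpos[OF \<rho>] by (simp add: mult_nonpos_nonneg)
  moreover have "f \<rho> * (\<rho>h - \<rho>) = f \<rho> * (t - s)\<^sup>2 + 2 * s * f \<rho> * (t - s)" unfolding dd by (simp add: algebra_simps)
  ultimately have "F \<rho> + f \<rho> * (\<rho>h - \<rho>) - F \<rho>h \<le> K * (t - s)\<^sup>2 * (1 + 4 * \<rho> + 3/2 * (t - s)\<^sup>2)"
    using F_lower[OF s(1) t(1)] unfolding s(2) t(2) by linarith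
  also have "\<dots> \<le> K * (2 * D) * (1 + 4 * \<rho> + 3 * D)"
    using td K_pos \<rho> D by (intro mult_mono) auto
  finally show ?thesis by (simp add: mult_ac)
qed

end

text \<open>At \<open>s = sqrt \<rho>\<close> the derivative of \<open>y * f (y^2)\<close> is
  \<open>f \<rho> + 2 * \<rho> * c\<close>, and the two monotonicity properties enclose it. Hence
  the second derivative of \<open>F\<close> is at worst of the order of \<open>1 / \<rho>\<close>
  near 0.\<close>

lemma second_deriv_bound:
  assumes \<rho>: "\<rho> > 0" and d: "(f has_real_derivative c) (at \<rho>)"
  shows "\<bar>c * \<rho>\<bar> \<le> K * (1 + 2 * \<rho>)"
proof -
  define s where "s = sqrt \<rho>"
  have s: "s > 0" "s\<^sup>2 = \<rho>" using \<rho> by (auto simp: s_def)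
  have d2: "((\<lambda>y. y * f (y\<^sup>2)) has_real_derivative f \<rho> + 2 * \<rho> * c) (at s)"
  proof -
    have "((\<lambda>y. y\<^sup>2) has_real_derivative 2 * s) (at s)" by (auto intro!: derivative_eq_intros)
    from DERIV_mult[OF DERIV_ident DERIV_chain2[OF d[folded s(2)] this]]
    show ?thesis by (simp add: s(2)[symmetric] power2_eq_square mult_ac)
  qed
  have int: "s \<in> interior {0..}" using s by simp
  have "- (f \<rho> + 2 * \<rho> * c) \<ge> 0"
  proof (rule mono_on_imp_deriv_nonneg[where A="{0..}" and f="\<lambda>y. - (y * f (y\<^sup>2))"])
    show "mono_on {0..} (\<lambda>y. - (y * f (y\<^sup>2)))"
    proof (rule mono_onI)
      fix x y :: real assume xy: "x \<in> {0..}" "y \<in> {0..}" "x \<le> y"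
      have "a * x powr (5/3) \<le> a * y powr (5/3)" using xy a_pos by (intro mult_left_mono powr_mono2) auto
      then show "- (x * f (x\<^sup>2)) \<le> - (y * f (y\<^sup>2))" using up[of x y] xy by simp
    qed
    show "((\<lambda>y. - (y * f (y\<^sup>2))) has_real_derivative - (f \<rho> + 2 * \<rho> * c)) (at s)" by (rule DERIV_minus[OF d2])
  qed (rule int)
  moreover have "f \<rho> + 2 * \<rho> * c + K * (1 + 3 * s\<^sup>2) \<ge> 0"
  proof (rule mono_on_imp_deriv_nonneg[where A="{0..}" and f="\<lambda>y. y * f (y\<^sup>2) + K * (y + y ^ 3)"])
    show "mono_on {0..} (\<lambda>y. y * f (y\<^sup>2) + K * (y + y ^ 3))" using lo by (intro mono_onI) auto
    have "((\<lambda>y. K * (y + y ^ 3)) has_real_derivative K * (1 + 3 * s\<^sup>2)) (at s)" by (auto intro!: derivative_eq_intros)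
    then show "((\<lambda>y. y * f (y\<^sup>2) + K * (y + y ^ 3)) has_real_derivative f \<rho> + 2 * \<rho> * c + K * (1 + 3 * s\<^sup>2)) (at s)"
      by (rule DERIV_add[OF d2])
  qed (rule int)
  moreover have "f \<rho> \<ge> - K * (1 + \<rho>)" "f \<rho> \<le> 0" using f_ge[of \<rho>] f_nonpos[of \<rho>] \<rho> by auto
  ultimately have "2 * (\<rho> * c) \<le> K * (1 + \<rho>)" "- (2 * (\<rho> * c)) \<le> K * (1 + 3 * \<rho>)"
    unfolding s(2) by (simp_all add: algebra_simps)
  moreover have "K * (1 + \<rho>) \<le> 2 * (K * (1 + 2 * \<rho>))" "K * (1 + 3 * \<rho>) \<le> 2 * (K * (1 + 2 * \<rho>))"
    using K_pos \<rho> by (simp_all add: algebra_simps)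
  ultimately show ?thesis by (simp add: abs_le_iff mult.commute)
qed

text \<open>\<open>f\<close> is differentiable at the single point \<open>\<rho>\<close>. The mean
  value theorem is applied to the remainder \<open>r\<close>, whose derivative is the first order
  remainder of \<open>f\<close>.\<close>

lemma Taylor_Peano:
  assumes \<rho>: "\<rho> > 0" and d: "(f has_real_derivative c) (at \<rho>)" and e: "e > 0"
  obtains \<eta> where "\<eta> > 0" "\<And>x. \<bar>x - \<rho>\<bar> < \<eta> \<Longrightarrow> \<bar>F x - F \<rho> - f \<rho> * (x - \<rho>) - c / 2 * (x - \<rho>)\<^sup>2\<bar> \<le> e * (x - \<rho>)\<^sup>2"
proof -
  have "\<forall>\<^sub>F x in at \<rho>. dist ((f x - f \<rho>) / (x - \<rho>)) c < e"
    using d e unfolding has_field_derivative_iff tendsto_iff by blast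
  then obtain \<eta>1 where \<eta>1: "\<eta>1 > 0" "\<And>x. x \<noteq> \<rho> \<Longrightarrow> dist x \<rho> < \<eta>1 \<Longrightarrow> dist ((f x - f \<rho>) / (x - \<rho>)) c < e"
    unfolding eventually_at by auto
  have b: "\<bar>f x - f \<rho> - c * (x - \<rho>)\<bar> \<le> e * \<bar>x - \<rho>\<bar>" if "\<bar>x - \<rho>\<bar> < \<eta>1" for x
  proof (cases "x = \<rho>")
    case False
    have "\<bar>(f x - f \<rho>) / (x - \<rho>) - c\<bar> \<le> e" using \<eta>1(2)[of x] False that by (simp add: dist_real_def)
    moreover have "(f x - f \<rho>) / (x - \<rho>) - c = (f x - f \<rho> - c * (x - \<rho>)) / (x - \<rho>)" using False by (simp add: field_simps)
    ultimately show ?thesis using False by (simp add: abs_divide pos_divide_le_eq)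
  qed simp
  define r where "r x = F x - F \<rho> - f \<rho> * (x - \<rho>) - c / 2 * (x - \<rho>)\<^sup>2" for x
  show thesis
  proof (rule that[of "min \<eta>1 \<rho>"])
    show "min \<eta>1 \<rho> > 0" using \<eta>1 \<rho> by simp
    fix x assume x: "\<bar>x - \<rho>\<bar> < min \<eta>1 \<rho>"
    have der: "(r has_real_derivative f z - f \<rho> - c * (z - \<rho>)) (at z)" if "z > 0" for z
      unfolding r_def by (auto intro!: derivative_eq_intros F_der[OF that])
    have r0: "r \<rho> = 0" by (simp add: r_def)
    have main: "\<bar>r x\<bar> \<le> e * (x - \<rho>)\<^sup>2"
    proof -
      have "\<exists>z. \<bar>z - \<rho>\<bar> \<le> \<bar>x - \<rho>\<bar> \<and> r x = (x - \<rho>) * (f z - f \<rho> - c * (z - \<rho>))"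
      proof -
        consider "x = \<rho>" | "x < \<rho>" | "\<rho> < x" by linarith
        then show ?thesis
        proof cases
          case 1 then show ?thesis by (intro exI[of _ \<rho>]) (simp add: r0)
        next
          case 2
          obtain z where "x < z" "z < \<rho>" "r \<rho> - r x = (\<rho> - x) * (f z - f \<rho> - c * (z - \<rho>))"
            using MVT2[OF 2 der] x by (auto simp: abs_less_iff)
          then show ?thesis using r0 by (intro exI[of _ z]) (auto simp: algebra_simps)
        next
          case 3
          obtain z where "\<rho> < z" "z < x" "r x - r \<rho> = (x - \<rho>) * (f z - f \<rho> - c * (z - \<rho>))"
            using MVT2[OF 3 der] \<rho> by auto
          then show ?thesis using r0 by (intro exI[of _ z]) auto
        qed
      qed
      then obtain z where z: "\<bar>z - \<rho>\<bar> \<le> \<bar>x - \<rho>\<bar>" "r x = (x - \<rho>) * (f z - f \<rho> - c * (z - \<rho>))" by blast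
      have "\<bar>r x\<bar> \<le> \<bar>x - \<rho>\<bar> * (e * \<bar>z - \<rho>\<bar>)" unfolding z(2) abs_mult using b[of z] z(1) x by (intro mult_left_mono) auto
      also have "\<dots> \<le> \<bar>x - \<rho>\<bar> * (e * \<bar>x - \<rho>\<bar>)" using z(1) e by (intro mult_left_mono) auto
      also have "\<dots> = e * (x - \<rho>)\<^sup>2" by (simp add: power2_eq_square)
      finally show ?thesis .
    qed
    show "\<bar>F x - F \<rho> - f \<rho> * (x - \<rho>) - c / 2 * (x - \<rho>)\<^sup>2\<bar> \<le> e * (x - \<rho>)\<^sup>2" using main by (simp add: r_def)
  qed
qed

text \<open>At vanishing density the term with the second derivative drops out, because \<open>\<sigma> = 0\<close> there.\<close>

lemma remainder_small:
  assumes \<rho>: "\<rho> \<ge> 0" and d: "\<rho> > 0 \<Longrightarrow> (f has_real_derivative c) (at \<rho>)" and e: "e > 0"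
  obtains \<eta> where "\<eta> > 0" "\<And>\<sigma> D. 0 \<le> D \<Longrightarrow> D < \<eta> \<Longrightarrow> \<sigma>\<^sup>2 \<le> \<rho> * D / 2 \<Longrightarrow>
    F \<rho> + f \<rho> * (4 * \<sigma> + 2 * D) - F (\<rho> + 4 * \<sigma> + 2 * D) + 8 * c * \<sigma>\<^sup>2 \<le> e * D"
proof (cases "\<rho> = 0")
  case True
  have "\<forall>\<^sub>F x in at 0 within {0..}. dist ((F x - F 0) / (x - 0)) 0 < e / 2"
    using F_der0 e unfolding has_field_derivative_iff tendsto_iff by (meson half_gt_zero)
  then obtain \<eta> where \<eta>: "\<eta> > 0" "\<And>x. 0 < x \<Longrightarrow> x < \<eta> \<Longrightarrow> \<bar>F x / x\<bar> < e / 2"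
    unfolding eventually_at using F0 by (auto simp: dist_real_def)
  show thesis
  proof (rule that[of "\<eta> / 2"])
    fix \<sigma> D assume D: "0 \<le> D" "D < \<eta> / 2" "\<sigma>\<^sup>2 \<le> \<rho> * D / 2"
    have \<sigma>: "\<sigma> = 0" using D(3) True by simp
    have "- F (2 * D) \<le> e * D"
    proof (cases "D = 0")
      case False
      have "\<bar>F (2 * D) / (2 * D)\<bar> < e / 2" using \<eta>(2)[of "2 * D"] D False by simp
      then have "\<bar>F (2 * D)\<bar> < e * D" using D False by (simp add: abs_divide pos_divide_less_eq)
      then show ?thesis by linarith
    qed (simp add: F0)
    then show "F \<rho> + f \<rho> * (4 * \<sigma> + 2 * D) - F (\<rho> + 4 * \<sigma> + 2 * D) + 8 * c * \<sigma>\<^sup>2 \<le> e * D"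
      using True \<sigma> F0 f0 by simp
  qed (use \<eta> in simp)
next
  case False
  then have \<rho>p: "\<rho> > 0" using \<rho> by simp
  \<comment> \<open>The squared change of the density is at most
    \<open>(16 * \<rho> + 8) * D\<close>, so the error of the Taylor formula uses half of
    \<open>e\<close>.\<close>
  define e1 where "e1 = e / (2 * (16 * \<rho> + 8))"
  have e1: "e1 > 0" using e \<rho>p by (simp add: e1_def)
  obtain \<eta>1 where \<eta>1: "\<eta>1 > 0" "\<And>x. \<bar>x - \<rho>\<bar> < \<eta>1 \<Longrightarrow> \<bar>F x - F \<rho> - f \<rho> * (x - \<rho>) - c / 2 * (x - \<rho>)\<^sup>2\<bar> \<le> e1 * (x - \<rho>)\<^sup>2"
    by (rule Taylor_Peano[OF \<rho>p d[OF \<rho>p] e1]) (rule that; assumption)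
  define L where "L = 8 * sqrt \<rho> + 2"
  have L: "L > 0" using \<rho>p by (simp add: L_def add_nonneg_pos)
  \<comment> \<open>The entry 1 gives \<open>D \<le> sqrt D\<close>, the second keeps the density
    inside the range of the Taylor formula, and the third bounds the part of
    \<open>c / 2 * \<delta>^2\<close> beyond \<open>8 * c * \<sigma>^2\<close> by the other half of
    \<open>e\<close>.\<close>
  define \<eta> where "\<eta> = min 1 (min ((\<eta>1 / L)\<^sup>2) ((e / (2 * (\<bar>c\<bar> + 1) * L))\<^sup>2))"
  show thesis
  proof (rule that[of \<eta>])
    show "\<eta> > 0" using \<eta>1 L e by (simp add: \<eta>_def)
    fix \<sigma> D assume D: "0 \<le> D" "D < \<eta>" and \<sigma>: "\<sigma>\<^sup>2 \<le> \<rho> * D / 2"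
    define q where "q = sqrt D"
    have q: "q \<ge> 0" "q\<^sup>2 = D" "q \<le> 1" using D by (auto simp: q_def \<eta>_def)
    have qD: "D \<le> q" using q by (metis mult_left_le power2_eq_square)
    have s1: "\<bar>\<sigma>\<bar> \<le> sqrt \<rho> * q"
    proof -
      have "\<sigma>\<^sup>2 \<le> \<rho> * D" using \<sigma> \<rho> D by (smt (verit) mult_nonneg_nonneg field_sum_of_halves)
      then have "sqrt (\<sigma>\<^sup>2) \<le> sqrt (\<rho> * D)" by (rule real_sqrt_le_mono)
      then show ?thesis by (simp add: real_sqrt_mult q_def)
    qed
    have lin: "8 * \<bar>\<sigma>\<bar> + 2 * D \<le> L * q" using s1 qD by (simp add: L_def algebra_simps)
    have q1: "L * q < \<eta>1"
    proof -
      have "D < (\<eta>1 / L)\<^sup>2" using D by (simp add: \<eta>_def)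
      then have "q < sqrt ((\<eta>1 / L)\<^sup>2)" unfolding q_def by (rule real_sqrt_less_mono)
      then have "q < \<eta>1 / L" using \<eta>1 L by simp
      then show ?thesis using L by (simp add: pos_less_divide_eq mult.commute)
    qed
    have q2: "(\<bar>c\<bar> + 1) * (L * q) \<le> e / 2"
    proof -
      have "D \<le> (e / (2 * (\<bar>c\<bar> + 1) * L))\<^sup>2" using D by (simp add: \<eta>_def)
      then have "q \<le> sqrt ((e / (2 * (\<bar>c\<bar> + 1) * L))\<^sup>2)" unfolding q_def by (rule real_sqrt_le_mono)
      then have "q \<le> e / (2 * (\<bar>c\<bar> + 1) * L)" using e L by simp
      then have "q * (2 * (\<bar>c\<bar> + 1) * L) \<le> e" using L by (subst (asm) pos_le_divide_eq) auto
      then show ?thesis by (simp add: algebra_simps)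
    qed
    define \<delta> where "\<delta> = 4 * \<sigma> + 2 * D"
    have "\<bar>\<delta>\<bar> < \<eta>1" using lin q1 D unfolding \<delta>_def by linarith
    then have T: "F \<rho> + f \<rho> * \<delta> - F (\<rho> + \<delta>) \<le> - c / 2 * \<delta>\<^sup>2 + e1 * \<delta>\<^sup>2" using \<eta>1(2)[of "\<rho> + \<delta>"] by (simp add: abs_le_iff)
    have d2: "\<delta>\<^sup>2 = 16 * \<sigma>\<^sup>2 + (16 * \<sigma> + 4 * D) * D" by (simp add: \<delta>_def power2_eq_square algebra_simps)
    have "- c / 2 * \<delta>\<^sup>2 + 8 * c * \<sigma>\<^sup>2 = - c * (8 * \<sigma> + 2 * D) * D" unfolding d2 by (simp add: algebra_simps)
    also have "\<dots> \<le> (\<bar>c\<bar> + 1) * (L * q) * D"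
    proof (rule mult_right_mono[OF _ D(1)])
      have "- c * (8 * \<sigma> + 2 * D) \<le> \<bar>c * (8 * \<sigma> + 2 * D)\<bar>" by simp
      also have "\<dots> \<le> (\<bar>c\<bar> + 1) * (L * q)"
        unfolding abs_mult using lin D by (intro mult_mono) auto
      finally show "- c * (8 * \<sigma> + 2 * D) \<le> (\<bar>c\<bar> + 1) * (L * q)" .
    qed
    also have "\<dots> \<le> e / 2 * D" by (rule mult_right_mono[OF q2 D(1)])
    finally have P1: "- c / 2 * \<delta>\<^sup>2 + 8 * c * \<sigma>\<^sup>2 \<le> e / 2 * D" .
    have "\<delta>\<^sup>2 \<le> 32 * \<sigma>\<^sup>2 + 8 * D\<^sup>2" using sum_squares_bound[of "4 * \<sigma>" "2 * D"] by (simp add: \<delta>_def power2_sum)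
    also have "\<dots> \<le> (16 * \<rho> + 8) * D"
    proof -
      have "D\<^sup>2 \<le> D" using D q qD by (simp add: power2_eq_square mult_left_le \<eta>_def)
      then show ?thesis using \<sigma> by (simp add: algebra_simps)
    qed
    finally have "e1 * \<delta>\<^sup>2 \<le> e1 * ((16 * \<rho> + 8) * D)" using e1 by (intro mult_left_mono) auto
    also have "\<dots> = e / 2 * D" using \<rho>p by (simp add: e1_def field_simps)
    finally have "e1 * \<delta>\<^sup>2 \<le> e / 2 * D" .
    then show "F \<rho> + f \<rho> * (4 * \<sigma> + 2 * D) - F (\<rho> + 4 * \<sigma> + 2 * D) + 8 * c * \<sigma>\<^sup>2 \<le> e * D"
      using T P1 unfolding \<delta>_def by (simp add: add.assoc)
  qed
qed

end

section \<open>The error in the energy\<close>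

context bounded_open
begin

lemma L2_prod: "L2 u \<Longrightarrow> L2 v \<Longrightarrow> integrable M (\<lambda>x. u x * v x)" for u v :: fld
  using L2_fun_inner[of \<Omega> u v] by simp

lemma L2_meas: "L2 u \<Longrightarrow> u \<in> borel_measurable M" for u :: fld
  by (rule L2_funD(1))

lemma L2_const: "L2 (\<lambda>x. c :: real)"
  by (rule L2_fun_continuous) simp

lemma L2_scale: "L2 u \<Longrightarrow> L2 (\<lambda>x. c * u x)" for u :: fld
  using L2_fun_lincomb[OF L2_const[of 0], of u c] by simp

lemma L2_add: "L2 u \<Longrightarrow> L2 v \<Longrightarrow> L2 (\<lambda>x. u x + v x)" for u v :: fld
  using L2_fun_lincomb[of \<Omega> u v 1] by simp

lemma L2_sum: "(\<And>i. i < n \<Longrightarrow> L2 (u i)) \<Longrightarrow> L2 (\<lambda>x. \<Sum>i<n. u i x)" for u :: "nat \<Rightarrow> fld"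
proof (induction n)
  case 0 then show ?case using L2_const[of 0] by simp
next
  case (Suc n) then show ?case using L2_add[of "\<lambda>x. \<Sum>i<n. u i x" "u n"] by simp
qed

lemma L2_bound:
  fixes g h :: fld
  assumes h: "L2 h" and [measurable]: "g \<in> borel_measurable M" and le: "\<And>x. \<bar>g x\<bar> \<le> \<bar>h x\<bar>"
  shows "L2 g"
  unfolding L2_fun_def
proof
  show "integrable M (\<lambda>x. (norm (g x))\<^sup>2)"
  proof (rule Bochner_Integration.integrable_bound[OF L2_funD(2)[OF h]])
    show "AE x in M. norm ((norm (g x))\<^sup>2) \<le> norm ((norm (h x))\<^sup>2)"
      using le by (simp add: abs_le_square_iff)
  qed measurable
qed fact

lemma L2_prod_bound:
  fixes g u v :: fld
  assumes u: "L2 u" and v: "L2 v" and g: "g \<in> borel_measurable M"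
    and le: "AE x in M. \<bar>g x\<bar> \<le> u x * v x"
  shows "integrable M g"
proof (rule Bochner_Integration.integrable_bound[OF L2_prod[OF u v] g])
  show "AE x in M. norm (g x) \<le> norm (u x * v x)" using le by eventually_elim simp
qed

text \<open>Lebesgue measure restricted to \<Omega> is complete. This is used for the second
  derivative of \<open>F\<close> along the density, which is identified with a measurable limit only
  almost everywhere.\<close>

lemma measurable_AE_eq:
  fixes g h :: fld
  assumes [measurable]: "g \<in> borel_measurable M" and eq: "AE x in M. g x = h x"
  shows "h \<in> borel_measurable M"
proof (rule measurableI)
  interpret complete_measure M
  proof
    fix A B assume "B \<subseteq> A" "A \<in> null_sets M"
    then have "A \<subseteq> \<Omega>" "A \<in> null_sets lebesgue" "B \<subseteq> \<Omega>" by (auto simp: null_sets_restrict_space)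
    then have "B \<in> null_sets lebesgue" using completion.complete2 \<open>B \<subseteq> A\<close> by blast
    then have "B \<in> null_sets M" using \<open>B \<subseteq> \<Omega>\<close> by (simp add: null_sets_restrict_space)
    then show "B \<in> sets M" by auto
  qed
  fix A :: "real set" assume [measurable]: "A \<in> sets borel"
  show "h -` A \<inter> space M \<in> sets M"
  proof (rule in_sets_AE)
    show "g -` A \<inter> space M \<in> sets M" by measurable
    show "AE x in M. x \<in> g -` A \<inter> space M \<longleftrightarrow> x \<in> h -` A \<inter> space M" using eq by eventually_elim simp
  qed simp
qed simp

end

context sobolev_space
begin

lemma X_L2: "u \<in> X \<Longrightarrow> L2 u"
  using has_weak_gradient_L2(1)[OF X_grad] .

text \<open>By the L4 bound. Densities and products of orbitals with their errors are thereby square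
  integrable, so that all pairings below are L2 inner products.\<close>

lemma X_mult_L2:
  assumes u: "u \<in> X" and v: "v \<in> X" shows "L2 (\<lambda>x. u x * v x)"
  unfolding L2_fun_def
proof
  note [measurable] = L2_meas[OF X_L2[OF u]] L2_meas[OF X_L2[OF v]]
  show m: "(\<lambda>x. u x * v x) \<in> borel_measurable M" by measurable
  show "integrable M (\<lambda>x. (norm (u x * v x))\<^sup>2)"
  proof (rule Bochner_Integration.integrable_bound[OF Bochner_Integration.integrable_add[OF X_integrable4[OF u] X_integrable4[OF v]]])
    have "(norm (u x * v x))\<^sup>2 \<le> u x ^ 4 + v x ^ 4" for x
    proof -
      have "2 * ((u x)\<^sup>2 * (v x)\<^sup>2) \<le> ((u x)\<^sup>2)\<^sup>2 + ((v x)\<^sup>2)\<^sup>2" using sum_squares_bound[of "(u x)\<^sup>2" "(v x)\<^sup>2"] by simp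
      moreover have "0 \<le> (u x)\<^sup>2 * (v x)\<^sup>2" by simp
      ultimately have "(u x)\<^sup>2 * (v x)\<^sup>2 \<le> ((u x)\<^sup>2)\<^sup>2 + ((v x)\<^sup>2)\<^sup>2" by linarith
      then show ?thesis by (simp add: power_mult_distrib)
    qed
    then show "AE x in M. norm ((norm (u x * v x))\<^sup>2) \<le> norm (u x ^ 4 + v x ^ 4)" by simp
  qed (use m in measurable)
qed

lemma X_sq_L2: "u \<in> X \<Longrightarrow> L2 (\<lambda>x. (u x)\<^sup>2)"
  using X_mult_L2[of u u] by (simp add: power2_eq_square)

lemma X_add: "u \<in> X \<Longrightarrow> v \<in> X \<Longrightarrow> (\<lambda>x. u x + v x) \<in> X"
  using X_lincomb[of u v 1] by simp

lemma grad_sq_inner: "gsq u = grad_inner \<Omega> u u"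
  by (simp add: grad_sq_def grad_inner_def power2_norm_eq_inner)

lemma grad_sq_lincomb:
  assumes u: "u \<in> X" and v: "v \<in> X"
  shows "gsq (\<lambda>x. u x + t * v x) = gsq u + 2 * t * grad_inner \<Omega> v u + t\<^sup>2 * grad_inner \<Omega> v v"
proof -
  let ?g = "wgrad u" and ?h = "wgrad v"
  have g: "L2 ?g" and h: "L2 ?h" using has_weak_gradient_L2(2) X_grad u v by auto
  have i: "integrable M (\<lambda>x. ?g x \<bullet> ?g x)" "integrable M (\<lambda>x. ?h x \<bullet> ?h x)" "integrable M (\<lambda>x. ?h x \<bullet> ?g x)"
    by (rule L2_fun_inner[OF g g], rule L2_fun_inner[OF h h], rule L2_fun_inner[OF h g])
  have "gsq (\<lambda>x. u x + t * v x) = intg (\<lambda>x. (norm (?g x + t *\<^sub>R ?h x))\<^sup>2)"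
    by (rule grad_sq_eq[OF has_weak_gradient_lincomb[OF X_grad[OF u] X_grad[OF v]]])
  also have "\<dots> = intg (\<lambda>x. ?g x \<bullet> ?g x + 2 * t * (?h x \<bullet> ?g x) + t\<^sup>2 * (?h x \<bullet> ?h x))"
    by (simp only: power2_norm_eq_inner) (simp add: inner_add inner_commute power2_eq_square algebra_simps)
  also have "\<dots> = gsq u + 2 * t * grad_inner \<Omega> v u + t\<^sup>2 * grad_inner \<Omega> v v"
    using i by (simp add: grad_sq_def grad_inner_def power2_norm_eq_inner)
  finally show ?thesis .
qed

end

context lda
begin

text \<open>No continuity of \<open>f\<close> is assumed in the locale. Measurability comes from
  \<open>up\<close>: the function \<open>y * f (y^2) + a * y powr (5/3)\<close> is monotone, and
  \<open>f\<close> is recovered by division.\<close>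

lemma f_measurable: "(\<lambda>\<rho>. f (max 0 \<rho>)) \<in> borel_measurable borel"
proof -
  define h where "h y = - (max 0 y * f ((max 0 y)\<^sup>2) + a * max 0 y powr (5/3))" for y
  have "mono h"
  proof (rule monoI)
    fix x y :: real assume "x \<le> y"
    then show "h x \<le> h y" unfolding h_def by (intro le_imp_neg_le up) auto
  qed
  then have [measurable]: "h \<in> borel_measurable borel" by (rule borel_measurable_mono)
  have "f (max 0 \<rho>) = (- h (sqrt (max 0 \<rho>)) - a * sqrt (max 0 \<rho>) powr (5/3)) / sqrt (max 0 \<rho>)" for \<rho>
    by (cases "max 0 \<rho> = 0") (auto simp: h_def f0)
  then have "(\<lambda>\<rho>. f (max 0 \<rho>)) = (\<lambda>\<rho>. (- h (sqrt (max 0 \<rho>)) - a * sqrt (max 0 \<rho>) powr (5/3)) / sqrt (max 0 \<rho>))"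
    by (rule ext)
  then show ?thesis by simp
qed

lemma F_measurable: "(\<lambda>\<rho>. F (max 0 \<rho>)) \<in> borel_measurable borel"
  by (rule borel_measurable_continuous_onI, rule continuous_on_compose2[OF F_cont]) (auto intro!: continuous_intros)

end

section \<open>The continuous problem and the exact expansion of the energy\<close>

locale ks_problem = sobolev_space \<Omega> D S + lda F f a K
  for \<Omega> :: "pt set" and D :: "fld set" and S :: real and F f :: "real \<Rightarrow> real" and a K :: real +
  fixes N :: nat and \<Psi> :: "nat \<Rightarrow> fld" and \<phi> :: fld and \<epsilon> :: "nat \<Rightarrow> real" and \<beta> c :: fld
  assumes \<Psi>_X: "i < N \<Longrightarrow> \<Psi> i \<in> X" and \<phi>_X: "\<phi> \<in> X" and \<beta>_L2: "L2 \<beta>"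
    and orth: "i < N \<Longrightarrow> j < N \<Longrightarrow> intg (\<lambda>x. \<Psi> i x * \<Psi> j x) = (if i = j then 1 else 0)"
    and ks: "i < N \<Longrightarrow> v \<in> X \<Longrightarrow> 1 / 2 * grad_inner \<Omega> (\<Psi> i) v
        + intg (\<lambda>x. f (ks_density N \<Psi> x) * \<Psi> i x * v x) + intg (\<lambda>x. \<phi> x * \<Psi> i x * v x)
      = \<epsilon> i * intg (\<lambda>x. \<Psi> i x * v x)"
    and poisson: "v \<in> X \<Longrightarrow> 1 / (4 * pi) * grad_inner \<Omega> \<phi> v = intg (\<lambda>x. (ks_density N \<Psi> x + \<beta> x) * v x)"
    and c_deriv: "AE x in M. ks_density N \<Psi> x > 0 \<longrightarrow> (f has_real_derivative c x) (at (ks_density N \<Psi> x))"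
begin

abbreviation "\<rho> \<equiv> ks_density N \<Psi>"

definition sig :: "(nat \<Rightarrow> fld) \<Rightarrow> fld" where "sig \<delta> x = (\<Sum>i<N. \<Psi> i x * \<delta> i x)"

definition dsq :: "(nat \<Rightarrow> fld) \<Rightarrow> fld" where "dsq \<delta> x = (\<Sum>i<N. (\<delta> i x)\<^sup>2)"

definition en :: "(nat \<Rightarrow> fld) \<Rightarrow> fld \<Rightarrow> real" where
  "en \<Phi> u = (\<Sum>i<N. gsq (\<Phi> i)) + intg (\<lambda>x. F (ks_density N \<Phi> x))
     - 1 / (8 * pi) * gsq u + intg (\<lambda>x. (ks_density N \<Phi> x + \<beta> x) * u x)"

lemma density_nonneg: "ks_density N \<Phi> x \<ge> 0" by (simp add: ks_density_def sum_nonneg)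

lemma dsq_nonneg: "dsq \<delta> x \<ge> 0" by (simp add: dsq_def sum_nonneg)

lemma density_perturb: "ks_density N (\<lambda>i x. \<Psi> i x + \<delta> i x) x = \<rho> x + 4 * sig \<delta> x + 2 * dsq \<delta> x"
  by (simp add: ks_density_def sig_def dsq_def power2_sum sum.distrib sum_distrib_left algebra_simps)

lemma sig_sq: "(sig \<delta> x)\<^sup>2 \<le> \<rho> x * dsq \<delta> x / 2"
  using Cauchy_Schwarz_ineq_sum[of "\<lambda>i. \<Psi> i x" "\<lambda>i. \<delta> i x" "{..<N}"] by (simp add: sig_def dsq_def ks_density_def)

lemma density_L2: "(\<And>i. i < N \<Longrightarrow> \<Phi> i \<in> X) \<Longrightarrow> L2 (ks_density N \<Phi>)"
  unfolding ks_density_def[abs_def] by (intro L2_scale L2_sum X_sq_L2)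

lemma sig_L2: "(\<And>i. i < N \<Longrightarrow> \<delta> i \<in> X) \<Longrightarrow> L2 (sig \<delta>)"
  unfolding sig_def[abs_def] by (intro L2_sum X_mult_L2 \<Psi>_X)

lemma dsq_L2: "(\<And>i. i < N \<Longrightarrow> \<delta> i \<in> X) \<Longrightarrow> L2 (dsq \<delta>)"
  unfolding dsq_def[abs_def] by (intro L2_sum X_sq_L2)

lemma f_density_L2: "L2 (\<lambda>x. f (\<rho> x))"
proof (rule L2_bound)
  have [measurable]: "\<rho> \<in> borel_measurable M" by (rule L2_meas[OF density_L2[OF \<Psi>_X]])
  have "(\<lambda>x. f (max 0 (\<rho> x))) \<in> borel_measurable M" by (rule measurable_compose[OF _ f_measurable]) measurable
  then show "(\<lambda>x. f (\<rho> x)) \<in> borel_measurable M" by (simp add: density_nonneg max_absorb2)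
  show "L2 (\<lambda>x. K * (1 + \<rho> x))" by (intro L2_scale L2_add L2_const density_L2 \<Psi>_X)
  show "\<bar>f (\<rho> x)\<bar> \<le> \<bar>K * (1 + \<rho> x)\<bar>" for x
    using f_ge[OF density_nonneg, of \<Psi> x] f_nonpos[OF density_nonneg, of \<Psi> x] K_pos density_nonneg[of \<Psi> x] by simp
qed

lemma F_density_integrable:
  assumes \<Phi>: "\<And>i. i < N \<Longrightarrow> \<Phi> i \<in> X"
  shows "integrable M (\<lambda>x. F (ks_density N \<Phi> x))"
proof (rule L2_prod_bound)
  note r = density_L2[OF \<Phi>]
  have [measurable]: "ks_density N \<Phi> \<in> borel_measurable M" by (rule L2_meas[OF r])
  have "(\<lambda>x. F (max 0 (ks_density N \<Phi> x))) \<in> borel_measurable M" by (rule measurable_compose[OF _ F_measurable]) measurable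
  then show "(\<lambda>x. F (ks_density N \<Phi> x)) \<in> borel_measurable M" by (simp add: density_nonneg max_absorb2)
  show "L2 (\<lambda>x. K * ks_density N \<Phi> x)" by (rule L2_scale[OF r])
  show "L2 (\<lambda>x. 1 + 2 * ks_density N \<Phi> x)" by (rule L2_add[OF L2_const L2_scale[OF r]])
  show "AE x in M. \<bar>F (ks_density N \<Phi> x)\<bar> \<le> K * ks_density N \<Phi> x * (1 + 2 * ks_density N \<Phi> x)"
  proof (rule AE_I2)
    fix x show "\<bar>F (ks_density N \<Phi> x)\<bar> \<le> K * ks_density N \<Phi> x * (1 + 2 * ks_density N \<Phi> x)"
      using F_bounds[OF density_nonneg[of \<Phi> x]] by (simp add: abs_le_iff)
  qed
qed

context
  fixes \<delta> :: "nat \<Rightarrow> fld"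
  assumes \<delta>_X: "\<And>i. i < N \<Longrightarrow> \<delta> i \<in> X"
begin

text \<open>Each linear term is removed by an equation of the continuous problem: the Kohn-Sham
  equation tested with \<open>\<delta> i\<close> replaces the mixed gradient term, and the Poisson
  equation tested with \<open>\<eta>\<close> replaces that of the potential. The eigenvalue term
  becomes quadratic because the perturbed orbitals are normalized too.\<close>

lemma energy_identity:
  assumes \<eta>: "\<eta> \<in> X"
    and norm: "\<And>i. i < N \<Longrightarrow> intg (\<lambda>x. (\<Psi> i x + \<delta> i x) * (\<Psi> i x + \<delta> i x)) = 1"
  shows "en (\<lambda>i x. \<Psi> i x + \<delta> i x) (\<lambda>x. \<phi> x + \<eta> x) - en \<Psi> \<phi> =
      (\<Sum>i<N. gsq (\<delta> i) - 2 * (\<epsilon> i * intg (\<lambda>x. (\<delta> i x)\<^sup>2)) + 2 * intg (\<lambda>x. (\<delta> i x)\<^sup>2 * \<phi> x)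
        + 4 * intg (\<lambda>x. \<Psi> i x * \<delta> i x * \<eta> x) + 2 * intg (\<lambda>x. (\<delta> i x)\<^sup>2 * \<eta> x))
      + intg (\<lambda>x. F (\<rho> x + 4 * sig \<delta> x + 2 * dsq \<delta> x) - F (\<rho> x) - 4 * f (\<rho> x) * sig \<delta> x)
      - 1 / (8 * pi) * gsq \<eta>"
proof -
  have \<Psi>\<delta>: "\<Psi> i \<in> X" "\<delta> i \<in> X" if "i < N" for i using that \<Psi>_X \<delta>_X by auto
  have g: "gsq (\<lambda>x. \<Psi> i x + \<delta> i x) - gsq (\<Psi> i) = gsq (\<delta> i) - 2 * (\<epsilon> i * intg (\<lambda>x. (\<delta> i x)\<^sup>2))
      - 4 * intg (\<lambda>x. f (\<rho> x) * (\<Psi> i x * \<delta> i x)) - 4 * intg (\<lambda>x. \<phi> x * (\<Psi> i x * \<delta> i x))" if i: "i < N" for i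
  proof -
    have "intg (\<lambda>x. (\<Psi> i x + \<delta> i x) * (\<Psi> i x + \<delta> i x)) =
        intg (\<lambda>x. \<Psi> i x * \<Psi> i x + 2 * (\<Psi> i x * \<delta> i x) + (\<delta> i x)\<^sup>2)"
      by (simp add: power2_eq_square algebra_simps)
    also have "\<dots> = intg (\<lambda>x. \<Psi> i x * \<Psi> i x) + 2 * intg (\<lambda>x. \<Psi> i x * \<delta> i x) + intg (\<lambda>x. (\<delta> i x)\<^sup>2)"
      using L2_prod[OF X_L2[OF \<Psi>\<delta>(1)] X_L2[OF \<Psi>\<delta>(1)]] L2_prod[OF X_L2[OF \<Psi>\<delta>(1)] X_L2[OF \<Psi>\<delta>(2)]] L2_fun_integrable[OF X_sq_L2[OF \<Psi>\<delta>(2)]] i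
      by simp
    \<comment> \<open>Both the orbital and its perturbation have norm 1, so the inner product with
      the error is itself of second order.\<close>
    finally have "intg (\<lambda>x. \<Psi> i x * \<delta> i x) = - (1/2) * intg (\<lambda>x. (\<delta> i x)\<^sup>2)"
      using norm[OF i] orth[OF i i] by simp
    with ks[OF i \<Psi>\<delta>(2)[OF i]] grad_sq_lincomb[OF \<Psi>\<delta>(2)[OF i] \<Psi>\<delta>(1)[OF i], of 1] show ?thesis
      by (simp add: mult.assoc add.commute grad_sq_inner[of "\<Psi> i"])
  qed
  have E1: "(\<Sum>i<N. gsq (\<lambda>x. \<Psi> i x + \<delta> i x)) - (\<Sum>i<N. gsq (\<Psi> i)) =
      (\<Sum>i<N. gsq (\<delta> i) - 2 * (\<epsilon> i * intg (\<lambda>x. (\<delta> i x)\<^sup>2))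
      - 4 * intg (\<lambda>x. f (\<rho> x) * (\<Psi> i x * \<delta> i x)) - 4 * intg (\<lambda>x. \<phi> x * (\<Psi> i x * \<delta> i x)))"
    unfolding sum_subtractf[symmetric] by (rule sum.cong[OF refl]) (simp add: g)
  have rh: "ks_density N (\<lambda>i x. \<Psi> i x + \<delta> i x) = (\<lambda>x. \<rho> x + 4 * sig \<delta> x + 2 * dsq \<delta> x)" by (rule ext) (rule density_perturb)
  have Fi: "integrable M (\<lambda>x. F (\<rho> x + 4 * sig \<delta> x + 2 * dsq \<delta> x))" "integrable M (\<lambda>x. F (\<rho> x))"
    using F_density_integrable[of "\<lambda>i x. \<Psi> i x + \<delta> i x"] F_density_integrable[OF \<Psi>_X] X_add[OF \<Psi>\<delta>] by (auto simp: rh)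
  have fs: "intg (\<lambda>x. f (\<rho> x) * sig \<delta> x) = (\<Sum>i<N. intg (\<lambda>x. f (\<rho> x) * (\<Psi> i x * \<delta> i x)))"
    unfolding sig_def sum_distrib_left
    by (rule Bochner_Integration.integral_sum) (auto intro!: L2_prod[OF f_density_L2] X_mult_L2 \<Psi>\<delta>)
  have fi: "integrable M (\<lambda>x. f (\<rho> x) * sig \<delta> x)" by (rule L2_prod[OF f_density_L2 sig_L2[OF \<delta>_X]])
  have "intg (\<lambda>x. F (\<rho> x + 4 * sig \<delta> x + 2 * dsq \<delta> x) - F (\<rho> x) - 4 * f (\<rho> x) * sig \<delta> x) =
      intg (\<lambda>x. F (\<rho> x + 4 * sig \<delta> x + 2 * dsq \<delta> x) - F (\<rho> x) - 4 * (f (\<rho> x) * sig \<delta> x))" by (simp add: mult.assoc)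
  then have E2: "intg (\<lambda>x. F (\<rho> x + 4 * sig \<delta> x + 2 * dsq \<delta> x) - F (\<rho> x) - 4 * f (\<rho> x) * sig \<delta> x) =
      intg (\<lambda>x. F (\<rho> x + 4 * sig \<delta> x + 2 * dsq \<delta> x)) - intg (\<lambda>x. F (\<rho> x))
      - 4 * (\<Sum>i<N. intg (\<lambda>x. f (\<rho> x) * (\<Psi> i x * \<delta> i x)))"
    using Fi fi fs by simp
  have dens: "intg (\<lambda>x. (4 * sig \<delta> x + 2 * dsq \<delta> x) * u x) =
      (\<Sum>i<N. 4 * intg (\<lambda>x. \<Psi> i x * \<delta> i x * u x) + 2 * intg (\<lambda>x. (\<delta> i x)\<^sup>2 * u x))"
    and densi: "integrable M (\<lambda>x. (4 * sig \<delta> x + 2 * dsq \<delta> x) * u x)" if u: "u \<in> X" for u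
  proof -
    have i: "integrable M (\<lambda>x. \<Psi> i x * \<delta> i x * u x)" "integrable M (\<lambda>x. (\<delta> i x)\<^sup>2 * u x)" if "i < N" for i
      by (intro L2_prod X_mult_L2 X_sq_L2 X_L2 \<Psi>\<delta> that u)+
    have "(4 * sig \<delta> x + 2 * dsq \<delta> x) * u x = (\<Sum>i<N. 4 * (\<Psi> i x * \<delta> i x * u x) + 2 * ((\<delta> i x)\<^sup>2 * u x))" for x
      unfolding sig_def dsq_def by (simp add: sum.distrib sum_distrib_left sum_distrib_right algebra_simps)
    then have e: "(\<lambda>x. (4 * sig \<delta> x + 2 * dsq \<delta> x) * u x) = (\<lambda>x. \<Sum>i<N. 4 * (\<Psi> i x * \<delta> i x * u x) + 2 * ((\<delta> i x)\<^sup>2 * u x))" by (rule ext)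
    show "integrable M (\<lambda>x. (4 * sig \<delta> x + 2 * dsq \<delta> x) * u x)"
      unfolding e using i by (intro Bochner_Integration.integrable_sum Bochner_Integration.integrable_add integrable_mult_right) auto
    have "intg (\<lambda>x. (4 * sig \<delta> x + 2 * dsq \<delta> x) * u x) = (\<Sum>i<N. intg (\<lambda>x. 4 * (\<Psi> i x * \<delta> i x * u x) + 2 * ((\<delta> i x)\<^sup>2 * u x)))"
      unfolding e using i by (intro Bochner_Integration.integral_sum Bochner_Integration.integrable_add integrable_mult_right) auto
    also have "\<dots> = (\<Sum>i<N. 4 * intg (\<lambda>x. \<Psi> i x * \<delta> i x * u x) + 2 * intg (\<lambda>x. (\<delta> i x)\<^sup>2 * u x))"
      by (rule sum.cong[OF refl]) (simp add: i)
    finally show "intg (\<lambda>x. (4 * sig \<delta> x + 2 * dsq \<delta> x) * u x) =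
      (\<Sum>i<N. 4 * intg (\<lambda>x. \<Psi> i x * \<delta> i x * u x) + 2 * intg (\<lambda>x. (\<delta> i x)\<^sup>2 * u x))" .
  qed
  have Ri: "integrable M (\<lambda>x. (\<rho> x + \<beta> x) * u x)" if "u \<in> X" for u
    by (intro L2_prod L2_add density_L2 \<Psi>_X \<beta>_L2 X_L2 that)
  have "intg (\<lambda>x. (\<rho> x + 4 * sig \<delta> x + 2 * dsq \<delta> x + \<beta> x) * (\<phi> x + \<eta> x)) =
      intg (\<lambda>x. (\<rho> x + \<beta> x) * \<phi> x + (\<rho> x + \<beta> x) * \<eta> x
        + (4 * sig \<delta> x + 2 * dsq \<delta> x) * \<phi> x + (4 * sig \<delta> x + 2 * dsq \<delta> x) * \<eta> x)"
    by (simp add: algebra_simps)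
  also have "\<dots> = intg (\<lambda>x. (\<rho> x + \<beta> x) * \<phi> x) + intg (\<lambda>x. (\<rho> x + \<beta> x) * \<eta> x)
      + intg (\<lambda>x. (4 * sig \<delta> x + 2 * dsq \<delta> x) * \<phi> x) + intg (\<lambda>x. (4 * sig \<delta> x + 2 * dsq \<delta> x) * \<eta> x)"
    using Ri[OF \<phi>_X] Ri[OF \<eta>] densi[OF \<phi>_X] densi[OF \<eta>] by simp
  finally have E3: "intg (\<lambda>x. (\<rho> x + 4 * sig \<delta> x + 2 * dsq \<delta> x + \<beta> x) * (\<phi> x + \<eta> x)) = \<dots>" .
  have E4: "1 / (8 * pi) * gsq (\<lambda>x. \<phi> x + \<eta> x) =
      1 / (8 * pi) * gsq \<phi> + intg (\<lambda>x. (\<rho> x + \<beta> x) * \<eta> x) + 1 / (8 * pi) * gsq \<eta>"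
    using grad_sq_lincomb[OF \<eta> \<phi>_X, of 1] poisson[OF \<eta>] by (simp add: grad_sq_inner[of \<phi>] add.commute field_simps)
  have comm: "intg (\<lambda>x. \<Psi> i x * \<delta> i x * \<phi> x) = intg (\<lambda>x. \<phi> x * (\<Psi> i x * \<delta> i x))" for i
    by (simp add: mult.commute)
  show ?thesis
    unfolding en_def rh E3 E2 E4 dens[OF \<phi>_X] dens[OF \<eta>] comm
    using E1 by (simp add: sum.distrib sum_subtractf sum_distrib_left)
qed

end

end

section \<open>The Taylor remainder of the exchange-correlation energy\<close>

context ks_problem
begin

text \<open>The negative of the Taylor remainder at second order, with the square of the change of
  density replaced by its leading part: \<open>c / 2 * (4 * sig)^2 = 8 * c * sig^2\<close>. The sign
  is chosen for the estimate from below, where an upper bound of this quantity enters.\<close>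

definition rem :: "(nat \<Rightarrow> fld) \<Rightarrow> fld" where
  "rem \<delta> x = F (\<rho> x) + f (\<rho> x) * (4 * sig \<delta> x + 2 * dsq \<delta> x) - F (\<rho> x + 4 * sig \<delta> x + 2 * dsq \<delta> x) + 8 * c x * (sig \<delta> x)\<^sup>2"

lemma density_meas: "\<rho> \<in> borel_measurable M"
  by (rule L2_meas[OF density_L2[OF \<Psi>_X]])

text \<open>At positive density \<open>c\<close> is a limit of difference quotients of
  \<open>f\<close>, which are measurable in \<open>x\<close>. Where the density vanishes,
  \<open>sig\<close> vanishes too, so any value of \<open>c\<close> gives 0.\<close>

lemma c_sig_measurable:
  assumes \<delta>: "\<And>i. i < N \<Longrightarrow> \<delta> i \<in> X"
  shows "(\<lambda>x. c x * (sig \<delta> x)\<^sup>2) \<in> borel_measurable M"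
proof (rule measurable_AE_eq)
  note [measurable] = density_meas L2_meas[OF sig_L2[OF \<delta>]]
  define g where "g n x = (f (max 0 (\<rho> x + inverse (real (Suc n)))) - f (max 0 (\<rho> x))) / inverse (real (Suc n))" for n x
  have fm: "(\<lambda>x. f (max 0 (u x))) \<in> borel_measurable M" if "u \<in> borel_measurable M" for u
    by (rule measurable_compose[OF that f_measurable])
  have [measurable]: "g n \<in> borel_measurable M" for n
    unfolding g_def by (intro borel_measurable_divide borel_measurable_diff borel_measurable_const fm borel_measurable_add density_meas)
  show "(\<lambda>x. lim (\<lambda>n. g n x) * (sig \<delta> x)\<^sup>2) \<in> borel_measurable M" by measurable
  show "AE x in M. lim (\<lambda>n. g n x) * (sig \<delta> x)\<^sup>2 = c x * (sig \<delta> x)\<^sup>2"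
    using c_deriv
  proof eventually_elim
    case (elim x)
    show ?case
    proof (cases "\<rho> x = 0")
      case True
      then show ?thesis using sig_sq[of \<delta> x] by simp
    next
      case False
      then have p: "\<rho> x > 0" using density_nonneg[of \<Psi> x] by simp
      then have d: "(f has_real_derivative c x) (at (\<rho> x))" using elim by simp
      have "filterlim (\<lambda>n. inverse (real (Suc n))) (at 0) sequentially"
        unfolding filterlim_at using LIMSEQ_inverse_real_of_nat by simp
      from filterlim_compose[OF d[unfolded DERIV_def] this]
      have "(\<lambda>n. (f (\<rho> x + inverse (real (Suc n))) - f (\<rho> x)) / inverse (real (Suc n))) \<longlonglongrightarrow> c x" .
      moreover have "g n x = (f (\<rho> x + inverse (real (Suc n))) - f (\<rho> x)) / inverse (real (Suc n))" for n
      proof -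
        have "\<rho> x + inverse (real (Suc n)) > 0" using p by (simp add: add_pos_pos)
        then show ?thesis using p by (simp add: g_def max_absorb2)
      qed
      ultimately have "(\<lambda>n. g n x) \<longlonglongrightarrow> c x" by (simp only:)
      then show ?thesis by (simp add: limI)
    qed
  qed
qed

text \<open>\<open>c * \<rho>\<close> is bounded by a multiple of \<open>1 + 2 * \<rho>\<close>, and
  the squared sum brings the missing factor \<open>\<rho>\<close> by Cauchy-Schwarz. The quantifier
  over \<open>\<delta>\<close> stands inside, so that one null set serves a whole sequence of
  perturbations.\<close>

lemma c_sig_bound: "AE x in M. \<forall>\<delta>. \<bar>c x * (sig \<delta> x)\<^sup>2\<bar> \<le> K * (1 + 2 * \<rho> x) * dsq \<delta> x / 2"
  using c_deriv
proof eventually_elim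
  case (elim x)
  show ?case
  proof
    fix \<delta>
    show "\<bar>c x * (sig \<delta> x)\<^sup>2\<bar> \<le> K * (1 + 2 * \<rho> x) * dsq \<delta> x / 2"
    proof (cases "\<rho> x = 0")
      case True
      then show ?thesis using sig_sq[of \<delta> x] K_pos dsq_nonneg[of \<delta> x] by simp
    next
      case False
      then have p: "\<rho> x > 0" using density_nonneg[of \<Psi> x] by simp
      have "\<bar>c x * (sig \<delta> x)\<^sup>2\<bar> \<le> \<bar>c x\<bar> * (\<rho> x * dsq \<delta> x / 2)"
        unfolding abs_mult by (rule mult_left_mono) (use sig_sq[of \<delta> x] in auto)
      also have "\<dots> = \<bar>c x * \<rho> x\<bar> * (dsq \<delta> x / 2)" using p by (simp add: abs_mult)
      also have "\<dots> \<le> K * (1 + 2 * \<rho> x) * (dsq \<delta> x / 2)"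
        by (rule mult_right_mono[OF second_deriv_bound[OF p]]) (use elim p dsq_nonneg in auto)
      finally show ?thesis by simp
    qed
  qed
qed

lemma rem_bound: "AE x in M. \<forall>\<delta>. rem \<delta> x \<le> 16 * K * (dsq \<delta> x * (1 + \<rho> x) + (dsq \<delta> x)\<^sup>2)"
  using c_sig_bound
proof eventually_elim
  case (elim x)
  show ?case
  proof
    fix \<delta>
    let ?D = "dsq \<delta> x"
    note r = density_nonneg[of \<Psi> x] and D = dsq_nonneg[of \<delta> x]
    have "F (\<rho> x) + f (\<rho> x) * (4 * sig \<delta> x + 2 * ?D) - F (\<rho> x + 4 * sig \<delta> x + 2 * ?D) \<le> 2 * K * ?D * (1 + 4 * \<rho> x + 3 * ?D)"
      using Taylor_crude[OF r D sig_sq] by simp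
    moreover have "8 * c x * (sig \<delta> x)\<^sup>2 \<le> 4 * (K * (1 + 2 * \<rho> x) * ?D)"
    proof -
      have "c x * (sig \<delta> x)\<^sup>2 \<le> K * (1 + 2 * \<rho> x) * ?D / 2" using elim[rule_format, of \<delta>] abs_ge_self by (rule order_trans[rotated])
      then show ?thesis by (simp add: mult_ac)
    qed
    moreover have "2 * K * ?D * (1 + 4 * \<rho> x + 3 * ?D) + 4 * (K * (1 + 2 * \<rho> x) * ?D) = K * (?D * (6 + 16 * \<rho> x) + 6 * ?D\<^sup>2)"
      by (simp add: power2_eq_square algebra_simps)
    moreover have "K * (?D * (6 + 16 * \<rho> x) + 6 * ?D\<^sup>2) \<le> K * (16 * (?D * (1 + \<rho> x) + ?D\<^sup>2))"
      using r D K_pos by (intro mult_left_mono) (auto simp: algebra_simps)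
    ultimately show "rem \<delta> x \<le> 16 * K * (?D * (1 + \<rho> x) + ?D\<^sup>2)" unfolding rem_def by (simp only: mult.assoc[of 16] mult.left_commute[of 16])
  qed
qed

lemma rem_small: "AE x in M. \<forall>e>0. \<exists>t>0. \<forall>\<delta>. dsq \<delta> x < t \<longrightarrow> rem \<delta> x \<le> e * dsq \<delta> x"
  using c_deriv
proof eventually_elim
  case (elim x)
  show ?case
  proof (intro allI impI)
    fix e :: real assume e: "e > 0"
    obtain t where t: "t > 0" "\<And>\<sigma> D. 0 \<le> D \<Longrightarrow> D < t \<Longrightarrow> \<sigma>\<^sup>2 \<le> \<rho> x * D / 2 \<Longrightarrow>
        F (\<rho> x) + f (\<rho> x) * (4 * \<sigma> + 2 * D) - F (\<rho> x + 4 * \<sigma> + 2 * D) + 8 * c x * \<sigma>\<^sup>2 \<le> e * D"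
      by (rule remainder_small[OF density_nonneg elim[rule_format] e]) (assumption, (rule that; assumption))
    have "\<forall>\<delta>. dsq \<delta> x < t \<longrightarrow> rem \<delta> x \<le> e * dsq \<delta> x"
      unfolding rem_def using t(2)[OF dsq_nonneg _ sig_sq] by simp
    then show "\<exists>t>0. \<forall>\<delta>. dsq \<delta> x < t \<longrightarrow> rem \<delta> x \<le> e * dsq \<delta> x" using t(1) by auto
  qed
qed

context
  fixes \<delta> :: "nat \<Rightarrow> fld"
  assumes \<delta>_X: "\<And>i. i < N \<Longrightarrow> \<delta> i \<in> X"
begin

lemma c_sig_integrable: "integrable M (\<lambda>x. c x * (sig \<delta> x)\<^sup>2)"
proof (rule L2_prod_bound[OF _ dsq_L2[OF \<delta>_X] c_sig_measurable[OF \<delta>_X]])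
  show "L2 (\<lambda>x. K / 2 * (1 + 2 * \<rho> x))" by (intro L2_scale L2_add L2_const density_L2 \<Psi>_X)
  show "AE x in M. \<bar>c x * (sig \<delta> x)\<^sup>2\<bar> \<le> K / 2 * (1 + 2 * \<rho> x) * dsq \<delta> x"
    using c_sig_bound by eventually_elim simp
qed

lemma perturbed_integrable:
  "integrable M (\<lambda>x. F (\<rho> x))" "integrable M (\<lambda>x. F (\<rho> x + 4 * sig \<delta> x + 2 * dsq \<delta> x))"
  "integrable M (\<lambda>x. f (\<rho> x) * sig \<delta> x)" "integrable M (\<lambda>x. f (\<rho> x) * dsq \<delta> x)"
proof -
  show "integrable M (\<lambda>x. F (\<rho> x))" by (rule F_density_integrable[OF \<Psi>_X])
  have "integrable M (\<lambda>x. F (ks_density N (\<lambda>i x. \<Psi> i x + \<delta> i x) x))"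
    by (rule F_density_integrable) (intro X_add \<Psi>_X \<delta>_X)
  then show "integrable M (\<lambda>x. F (\<rho> x + 4 * sig \<delta> x + 2 * dsq \<delta> x))" by (simp only: density_perturb)
  show "integrable M (\<lambda>x. f (\<rho> x) * sig \<delta> x)" by (rule L2_prod[OF f_density_L2 sig_L2[OF \<delta>_X]])
  show "integrable M (\<lambda>x. f (\<rho> x) * dsq \<delta> x)" by (rule L2_prod[OF f_density_L2 dsq_L2[OF \<delta>_X]])
qed

lemma rem_integral:
  "integrable M (rem \<delta>)"
  "intg (rem \<delta>) = - intg (\<lambda>x. F (\<rho> x + 4 * sig \<delta> x + 2 * dsq \<delta> x) - F (\<rho> x) - 4 * f (\<rho> x) * sig \<delta> x)
     + 2 * intg (\<lambda>x. f (\<rho> x) * dsq \<delta> x) + 8 * intg (\<lambda>x. c x * (sig \<delta> x)\<^sup>2)"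
proof -
  have e: "rem \<delta> = (\<lambda>x. F (\<rho> x) + 4 * (f (\<rho> x) * sig \<delta> x) + 2 * (f (\<rho> x) * dsq \<delta> x)
      - F (\<rho> x + 4 * sig \<delta> x + 2 * dsq \<delta> x) + 8 * (c x * (sig \<delta> x)\<^sup>2))"
    by (rule ext) (simp add: rem_def algebra_simps)
  show "integrable M (rem \<delta>)" unfolding e using perturbed_integrable c_sig_integrable by simp
  have g: "(\<lambda>x. F (\<rho> x + 4 * sig \<delta> x + 2 * dsq \<delta> x) - F (\<rho> x) - 4 * f (\<rho> x) * sig \<delta> x) =
      (\<lambda>x. F (\<rho> x + 4 * sig \<delta> x + 2 * dsq \<delta> x) - F (\<rho> x) - 4 * (f (\<rho> x) * sig \<delta> x))"
    by (simp add: mult.assoc)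
  show "intg (rem \<delta>) = - intg (\<lambda>x. F (\<rho> x + 4 * sig \<delta> x + 2 * dsq \<delta> x) - F (\<rho> x) - 4 * f (\<rho> x) * sig \<delta> x)
     + 2 * intg (\<lambda>x. f (\<rho> x) * dsq \<delta> x) + 8 * intg (\<lambda>x. c x * (sig \<delta> x)\<^sup>2)"
    unfolding g e using perturbed_integrable c_sig_integrable by simp
qed

lemma dsq_integral:
  assumes u: "L2 u"
  shows "intg (\<lambda>x. u x * dsq \<delta> x) = (\<Sum>i<N. intg (\<lambda>x. u x * (\<delta> i x)\<^sup>2))"
  unfolding dsq_def sum_distrib_left
  by (rule Bochner_Integration.integral_sum) (auto intro!: L2_prod[OF u] X_sq_L2 \<delta>_X)

lemma dsq_sq_bound: "intg (\<lambda>x. (dsq \<delta> x)\<^sup>2) \<le> (real N)\<^sup>2 * S * (\<Sum>i<N. h1_sq (\<delta> i))\<^sup>2"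
proof -
  let ?t = "\<Sum>i<N. h1_sq (\<delta> i)"
  have i4: "integrable M (\<lambda>x. \<delta> i x ^ 4)" if "i < N" for i by (rule X_integrable4[OF \<delta>_X[OF that]])
  have "intg (\<lambda>x. (dsq \<delta> x)\<^sup>2) \<le> intg (\<lambda>x. real N * (\<Sum>i<N. \<delta> i x ^ 4))"
  proof (rule integral_mono)
    show "integrable M (\<lambda>x. (dsq \<delta> x)\<^sup>2)" using L2_funD(2)[OF dsq_L2[OF \<delta>_X]] by simp
    show "integrable M (\<lambda>x. real N * (\<Sum>i<N. \<delta> i x ^ 4))" using i4 by auto
    show "(dsq \<delta> x)\<^sup>2 \<le> real N * (\<Sum>i<N. \<delta> i x ^ 4)" for x
      using Cauchy_Schwarz_ineq_sum[of "\<lambda>i. 1" "\<lambda>i. (\<delta> i x)\<^sup>2" "{..<N}"] by (simp add: dsq_def)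
  qed
  also have "\<dots> = real N * (\<Sum>i<N. intg (\<lambda>x. \<delta> i x ^ 4))" using i4 by (subst integral_mult_right_zero, subst Bochner_Integration.integral_sum) auto
  also have "\<dots> \<le> real N * (\<Sum>i<N. S * ?t\<^sup>2)"
  proof (intro mult_left_mono sum_mono)
    fix i assume "i \<in> {..<N}"
    then have i: "i < N" by simp
    have "h1_sq (\<delta> i) \<le> ?t" using i by (intro member_le_sum) (auto simp: h1_sq_nonneg)
    then have "(h1_sq (\<delta> i))\<^sup>2 \<le> ?t\<^sup>2" using h1_sq_nonneg by (rule power_mono)
    then have "S * (h1_sq (\<delta> i))\<^sup>2 \<le> S * ?t\<^sup>2" using S_pos by simp
    then show "intg (\<lambda>x. \<delta> i x ^ 4) \<le> S * ?t\<^sup>2" using X_bound4[OF \<delta>_X[OF i]] by linarith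
  qed simp
  finally show ?thesis by (simp add: power2_eq_square mult_ac)
qed

text \<open>Cauchy-Schwarz and the L4 bound: the cubic integral is of the order of the squared H1
  norm of the orbital error, with a factor that is small together with
  \<open>\<eta>\<close>.\<close>

lemma sq_product_bound:
  assumes i: "i < N" and \<eta>: "\<eta> \<in> X"
  shows "\<bar>intg (\<lambda>x. (\<delta> i x)\<^sup>2 * \<eta> x)\<bar> \<le> sqrt S * sqrt (h1_sq \<eta>) * h1_sq (\<delta> i)"
proof -
  note d = \<delta>_X[OF i]
  have e2: "intg (\<lambda>x. (\<eta> x)\<^sup>2) \<le> h1_sq \<eta>" by (simp add: h1_sq_def grad_sq_nonneg)
  have "(intg (\<lambda>x. (\<delta> i x)\<^sup>2 * \<eta> x))\<^sup>2 \<le> intg (\<lambda>x. ((\<delta> i x)\<^sup>2)\<^sup>2) * intg (\<lambda>x. (\<eta> x)\<^sup>2)"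
    using L2_funD[OF X_sq_L2[OF d]] L2_funD[OF X_L2[OF \<eta>]] by (intro Cauchy_Schwarz_integral(2)) auto
  also have "\<dots> \<le> (S * (h1_sq (\<delta> i))\<^sup>2) * h1_sq \<eta>"
    using X_bound4[OF d] e2 S_pos by (intro mult_mono) auto
  finally have "sqrt ((intg (\<lambda>x. (\<delta> i x)\<^sup>2 * \<eta> x))\<^sup>2) \<le> sqrt (S * (h1_sq (\<delta> i))\<^sup>2 * h1_sq \<eta>)" by (rule real_sqrt_le_mono)
  then show ?thesis using h1_sq_nonneg by (simp add: real_sqrt_mult mult_ac)
qed

end

text \<open>The remainder is only \<open>o(dsq)\<close> pointwise. Dividing by \<open>dsq\<close>, the quotients are dominated in L2
  along any sequence, so that dominated convergence gives a bound that is uniform near 0.\<close>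

lemma rem_integral_small:
  assumes e: "e > 0"
  shows "\<exists>r>0. \<forall>\<delta>. (\<forall>i<N. \<delta> i \<in> X \<and> h1_sq (\<delta> i) < r) \<longrightarrow> intg (rem \<delta>) \<le> e * (\<Sum>i<N. h1_sq (\<delta> i))"
proof (rule ccontr)
  assume neg: "\<not> ?thesis"
  have "\<exists>\<delta>. (\<forall>i<N. \<delta> i \<in> X \<and> h1_sq (\<delta> i) < inverse (real (Suc n))) \<and> e * (\<Sum>i<N. h1_sq (\<delta> i)) < intg (rem \<delta>)" for n
    using neg[unfolded not_ex, rule_format, of "inverse (real (Suc n))"] by (auto simp: not_le)
  then obtain \<Delta> where \<Delta>: "\<And>n i. i < N \<Longrightarrow> \<Delta> n i \<in> X" "\<And>n i. i < N \<Longrightarrow> h1_sq (\<Delta> n i) < inverse (real (Suc n))"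
      "\<And>n. e * (\<Sum>i<N. h1_sq (\<Delta> n i)) < intg (rem (\<Delta> n))"
    by metis
  define t where "t n = (\<Sum>i<N. h1_sq (\<Delta> n i))" for n
  define B where "B = (real N)\<^sup>2 * S"
  define C where "C = 16 * K"
  have B: "B \<ge> 0" using S_pos by (simp add: B_def)
  have C: "C > 0" using K_pos by (simp add: C_def)
  have t0: "t n \<ge> 0" for n by (simp add: t_def sum_nonneg h1_sq_nonneg)
  have tl: "t \<longlonglongrightarrow> 0"
  proof (rule tendsto_zero_bounded[OF t0])
    show "t n \<le> real N * inverse (real (Suc n))" for n
      unfolding t_def using sum_bounded_above[of "{..<N}" "\<lambda>i. h1_sq (\<Delta> n i)" "inverse (real (Suc n))"] \<Delta>(2)[of _ n]
      by (simp add: less_imp_le)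
    show "(\<lambda>n. real N * inverse (real (Suc n))) \<longlonglongrightarrow> 0"
      using tendsto_mult_left[OF LIMSEQ_inverse_real_of_nat, of "real N"] by simp
  qed
  have dL2: "L2 (dsq (\<Delta> n))" for n by (rule dsq_L2[OF \<Delta>(1)])
  have dB: "intg (\<lambda>x. (dsq (\<Delta> n) x)\<^sup>2) \<le> B * (t n)\<^sup>2" for n
    using dsq_sq_bound[OF \<Delta>(1)] by (simp add: B_def t_def)
  have "(\<lambda>n. intg (\<lambda>x. (dsq (\<Delta> n) x - 0)\<^sup>2)) \<longlonglongrightarrow> 0"
  proof (rule tendsto_zero_bounded)
    show "(\<lambda>n. B * (t n)\<^sup>2) \<longlonglongrightarrow> 0" using tendsto_mult_left[OF tendsto_power[OF tl, of 2], of B] by simp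
  qed (use dB in auto)
  then obtain r where r: "strict_mono r" "AE x in M. (\<lambda>n. dsq (\<Delta> (r n)) x) \<longlonglongrightarrow> 0"
    by (rule AE_subseq[OF dL2 L2_const]) (rule that; assumption)
  define d R where "d n = dsq (\<Delta> (r n))" and "R n = rem (\<Delta> (r n))" for n
  \<comment> \<open>Splits the remainder into \<open>v * d\<close> and \<open>C * d^2\<close>; the
    integral of \<open>d^2\<close> is already of the order of \<open>(t n)^2\<close>, and
    \<open>v\<close> stays below \<open>C * (1 + \<rho>)\<close>. Where \<open>d\<close> vanishes
    the quotient is 0, and there the pointwise bound forces \<open>R \<le> 0\<close>.\<close>
  define v where "v n x = max 0 ((R n x - C * (d n x)\<^sup>2) / d n x)" for n x
  have d0: "d n x \<ge> 0" for n x by (simp add: d_def dsq_nonneg)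
  have v0: "v n x \<ge> 0" for n x by (simp add: v_def)
  have Ri: "integrable M (R n)" for n unfolding R_def by (rule rem_integral(1)[OF \<Delta>(1)])
  have dL: "L2 (d n)" for n unfolding d_def by (rule dL2)
  have [measurable]: "R n \<in> borel_measurable M" "d n \<in> borel_measurable M" for n
    using Ri L2_meas[OF dL] by auto
  have [measurable]: "v n \<in> borel_measurable M" for n unfolding v_def by measurable
  have bound: "AE x in M. \<forall>n. R n x \<le> C * (d n x * (1 + \<rho> x) + (d n x)\<^sup>2)"
    using rem_bound by eventually_elim (simp add: R_def d_def C_def)
  have vle: "AE x in M. \<forall>n. v n x \<le> C * (1 + \<rho> x)" and Rle: "AE x in M. \<forall>n. R n x \<le> v n x * d n x + C * (d n x)\<^sup>2"
  proof -
    show "AE x in M. \<forall>n. v n x \<le> C * (1 + \<rho> x)"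
      using bound
    proof eventually_elim
      case (elim x)
      have "(R n x - C * (d n x)\<^sup>2) / d n x \<le> C * (1 + \<rho> x)" for n
      proof (cases "d n x = 0")
        case True then show ?thesis using C density_nonneg[of \<Psi> x] by simp
      next
        case False
        then have "d n x > 0" using d0[of n x] by simp
        then show ?thesis using elim[rule_format, of n] by (simp add: pos_divide_le_eq algebra_simps)
      qed
      then show ?case using C density_nonneg[of \<Psi> x] by (simp add: v_def)
    qed
    show "AE x in M. \<forall>n. R n x \<le> v n x * d n x + C * (d n x)\<^sup>2"
      using bound
    proof eventually_elim
      case (elim x)
      show ?case
      proof
        fix n
        show "R n x \<le> v n x * d n x + C * (d n x)\<^sup>2"
        proof (cases "d n x = 0")
          case True then show ?thesis using elim[rule_format, of n] by simp
        next
          case False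
          then have p: "d n x > 0" using d0[of n x] by simp
          have "(R n x - C * (d n x)\<^sup>2) / d n x \<le> v n x" by (simp add: v_def)
          then have "R n x - C * (d n x)\<^sup>2 \<le> v n x * d n x" unfolding pos_divide_le_eq[OF p] .
          then show ?thesis by simp
        qed
      qed
    qed
  qed
  have vlim: "AE x in M. (\<lambda>n. v n x) \<longlonglongrightarrow> 0"
    using r(2) rem_small
  proof eventually_elim
    case (elim x)
    show ?case
    proof (rule tendstoI)
      fix e' :: real assume e': "e' > 0"
      obtain s where s: "s > 0" "\<forall>\<delta>. dsq \<delta> x < s \<longrightarrow> rem \<delta> x \<le> e' / 2 * dsq \<delta> x"
        using elim(2)[rule_format, of "e' / 2"] e' by auto
      have "\<forall>\<^sub>F n in sequentially. dsq (\<Delta> (r n)) x < s" by (rule order_tendstoD(2)[OF elim(1) s(1)])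
      then show "\<forall>\<^sub>F n in sequentially. dist (v n x) 0 < e'"
      proof eventually_elim
        case (elim n)
        have le: "R n x \<le> e' / 2 * d n x" using s(2) elim by (simp add: R_def d_def)
        have "(R n x - C * (d n x)\<^sup>2) / d n x \<le> e' / 2"
        proof (cases "d n x = 0")
          case False
          then have p: "d n x > 0" using d0[of n x] by simp
          have "R n x - C * (d n x)\<^sup>2 \<le> e' / 2 * d n x" using le C by (smt (verit) mult_nonneg_nonneg zero_le_power2)
          then show ?thesis unfolding pos_divide_le_eq[OF p] .
        qed (use e' in simp)
        then have "v n x \<le> e' / 2" using e' unfolding v_def by (intro max.boundedI) auto
        then show ?case using v0[of n x] e' by (simp add: dist_real_def)
      qed
    qed
  qed
  have W: "L2 (\<lambda>x. C * (1 + \<rho> x))" by (intro L2_scale L2_add L2_const density_L2 \<Psi>_X)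
  have Wi: "integrable M (\<lambda>x. (C * (1 + \<rho> x))\<^sup>2)" using L2_funD(2)[OF W] by simp
  have vsq: "AE x in M. norm ((v n x)\<^sup>2) \<le> (C * (1 + \<rho> x))\<^sup>2" for n
    using vle
  proof eventually_elim
    case (elim x)
    then show ?case using power_mono[OF elim[rule_format, of n] v0, of 2] by simp
  qed
  have vi: "integrable M (\<lambda>x. (v n x)\<^sup>2)" for n
  proof (rule Bochner_Integration.integrable_bound[OF Wi])
    show "AE x in M. norm ((v n x)\<^sup>2) \<le> norm ((C * (1 + \<rho> x))\<^sup>2)" using vsq[of n] by simp
  qed measurable
  have V: "(\<lambda>n. intg (\<lambda>x. (v n x)\<^sup>2)) \<longlonglongrightarrow> intg (\<lambda>x. 0)"
  proof (rule integral_dominated_convergence[OF _ _ Wi _ vsq])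
    show "AE x in M. (\<lambda>n. (v n x)\<^sup>2) \<longlonglongrightarrow> 0"
      using vlim by eventually_elim (use tendsto_power[of _ 0 _ 2] in auto)
  qed measurable
  have di: "integrable M (\<lambda>x. (d n x)\<^sup>2)" for n using L2_funD(2)[OF dL[of n]] by simp
  \<comment> \<open>Cauchy-Schwarz bounds the integral of \<open>R n\<close> by
    \<open>s n * t (r n)\<close>. The counterexamples exceed \<open>e * t (r n)\<close>, so
    \<open>e < s n\<close>, although \<open>s\<close> tends to 0.\<close>
  define s where "s n = sqrt (intg (\<lambda>x. (v n x)\<^sup>2)) * sqrt B + C * B * t (r n)" for n
  have key: "e < s n" for n
  proof -
    let ?\<tau> = "t (r n)"
    have vd: "integrable M (\<lambda>x. v n x * d n x)" "(intg (\<lambda>x. v n x * d n x))\<^sup>2 \<le> intg (\<lambda>x. (v n x)\<^sup>2) * intg (\<lambda>x. (d n x)\<^sup>2)"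
      using vi di by (intro Cauchy_Schwarz_integral; simp)+
    have dn: "intg (\<lambda>x. (d n x)\<^sup>2) \<le> B * ?\<tau>\<^sup>2" unfolding d_def by (rule dB)
    have "(intg (\<lambda>x. v n x * d n x))\<^sup>2 \<le> intg (\<lambda>x. (v n x)\<^sup>2) * (B * ?\<tau>\<^sup>2)"
      by (rule order_trans[OF vd(2) mult_left_mono[OF dn]]) simp
    then have "sqrt ((intg (\<lambda>x. v n x * d n x))\<^sup>2) \<le> sqrt (intg (\<lambda>x. (v n x)\<^sup>2) * (B * ?\<tau>\<^sup>2))" by (rule real_sqrt_le_mono)
    then have vd': "intg (\<lambda>x. v n x * d n x) \<le> sqrt (intg (\<lambda>x. (v n x)\<^sup>2)) * sqrt B * ?\<tau>"
      using t0 by (simp add: real_sqrt_mult mult_ac abs_le_iff)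
    have "e * ?\<tau> < intg (R n)" unfolding R_def t_def by (rule \<Delta>(3))
    also have "\<dots> \<le> intg (\<lambda>x. v n x * d n x + C * (d n x)\<^sup>2)"
      by (rule integral_mono_AE[OF Ri]) (use vd di Rle in auto)
    also have "\<dots> = intg (\<lambda>x. v n x * d n x) + C * intg (\<lambda>x. (d n x)\<^sup>2)" using vd di by simp
    also have "\<dots> \<le> sqrt (intg (\<lambda>x. (v n x)\<^sup>2)) * sqrt B * ?\<tau> + C * (B * ?\<tau>\<^sup>2)"
      by (rule add_mono[OF vd' mult_left_mono[OF dn less_imp_le[OF C]]])
    also have "\<dots> = s n * ?\<tau>" by (simp add: s_def power2_eq_square algebra_simps)
    finally show ?thesis using t0[of "r n"] by (simp add: mult_less_cancel_right)
  qed
  have "s \<longlonglongrightarrow> sqrt (intg (\<lambda>x. 0)) * sqrt B + C * B * 0"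
    unfolding s_def using LIMSEQ_subseq_LIMSEQ[OF tl r(1)]
    by (intro tendsto_add tendsto_mult tendsto_real_sqrt V tendsto_const) (simp add: o_def)
  then have "s \<longlonglongrightarrow> 0" by simp
  from order_tendstoD(2)[OF this e] obtain n where "s n < e" using eventually_happens'[OF sequentially_bot] by blast
  with key[of n] show False by simp
qed

end

text \<open>With \<open>x = D powr (1/3)\<close>, either \<open>2 * w \<le> l * x\<close>, and the
  first term on the right suffices, or \<open>x\<close> is at most \<open>2 * w / l\<close>, and the
  second does.\<close>

lemma Young_quartic:
  fixes D w l :: real
  assumes D: "D \<ge> 0" and l: "l > 0"
  shows "2 * D * w \<le> l * D powr (4/3) + 16 / l ^ 3 * w ^ 4"
proof -
  define x where "x = D powr (1/3)"
  have x: "x \<ge> 0" "x ^ 3 = D" "x ^ 4 = D powr (4/3)"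
    using D by (cases "D = 0"; auto simp: x_def powr_powr simp flip: powr_numeral)+
  have r: "16 / l ^ 3 * w ^ 4 \<ge> 0" using l by simp
  have "2 * x ^ 3 * w \<le> l * x ^ 4 + 16 / l ^ 3 * w ^ 4"
  proof (cases "2 * w \<le> l * x")
    case True
    have "x ^ 3 * (2 * w) \<le> x ^ 3 * (l * x)" using True x(1) by (intro mult_left_mono) auto
    then have "2 * x ^ 3 * w \<le> l * x ^ 4" by (simp add: power3_eq_cube power4_eq_xxxx mult_ac)
    then show ?thesis using r by linarith
  next
    case False
    then have w: "x \<le> 2 * w / l" using l by (simp add: pos_le_divide_eq mult.commute)
    have w0: "w \<ge> 0" using False x(1) l by (smt (verit) mult_nonneg_nonneg)
    have "x ^ 3 \<le> (2 * w / l) ^ 3" by (rule power_mono[OF w x(1)])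
    then have "x ^ 3 * (2 * w) \<le> (2 * w / l) ^ 3 * (2 * w)" using w0 by (intro mult_right_mono) auto
    also have "\<dots> = 16 / l ^ 3 * w ^ 4" by (simp add: power3_eq_cube power4_eq_xxxx)
    finally have "2 * x ^ 3 * w \<le> 16 / l ^ 3 * w ^ 4" by (simp add: mult_ac)
    then show ?thesis using x(1) l by (smt (verit) mult_nonneg_nonneg zero_le_power)
  qed
  then show ?thesis by (simp only: x)
qed

section \<open>Absorption of the remainders\<close>

context ks_problem
begin

text \<open>The change of the exchange-correlation energy after removal of the term linear in the
  orbital errors. The part \<open>2 * f \<rho> * dsq\<close>, which is linear in the density but
  quadratic in the errors, is still contained in it.\<close>

definition gap :: "(nat \<Rightarrow> fld) \<Rightarrow> real" where
  "gap \<delta> = intg (\<lambda>x. F (\<rho> x + 4 * sig \<delta> x + 2 * dsq \<delta> x) - F (\<rho> x) - 4 * f (\<rho> x) * sig \<delta> x)"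

lemma gap_integrable:
  assumes \<delta>: "\<And>i. i < N \<Longrightarrow> \<delta> i \<in> X"
  shows "integrable M (\<lambda>x. F (\<rho> x + 4 * sig \<delta> x + 2 * dsq \<delta> x) - F (\<rho> x) - 4 * f (\<rho> x) * sig \<delta> x)"
  using perturbed_integrable[OF \<delta>] by (simp add: mult.assoc)

text \<open>Everything is decided pointwise before integration. The constant \<open>m\<close> stands
  for the part of the potential error that its gradient does not control; it is paid by
  \<open>- f \<rho>\<close>, and the rest by the power 4/3 of \<open>dsq\<close> together with the
  L4 bound.\<close>

lemma gap_upper:
  assumes \<delta>: "\<And>i. i < N \<Longrightarrow> \<delta> i \<in> X" and \<eta>: "\<eta> \<in> X"
    and i4: "integrable M (\<lambda>x. (\<eta> x - m) ^ 4)" and C1: "intg (\<lambda>x. (\<eta> x - m) ^ 4) \<le> C1 * (gsq \<eta>)\<^sup>2"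
    and m: "N > 0 \<Longrightarrow> AE x in M. 2 * \<bar>m\<bar> \<le> - f (\<rho> x)"
    and small: "16 / (a / 8) ^ 3 * (C1 * gsq \<eta>) \<le> 1 / (4 * pi)"
  shows "gap \<delta> + 2 * intg (\<lambda>x. \<eta> x * dsq \<delta> x) \<le> - 2 * intg (\<lambda>x. f (\<rho> x) * dsq \<delta> x) + 1 / (4 * pi) * gsq \<eta>"
proof -
  define C2 where "C2 = 16 / (a / 8) ^ 3"
  have C2: "C2 \<ge> 0" using a_pos by (simp add: C2_def)
  let ?G = "\<lambda>x. F (\<rho> x + 4 * sig \<delta> x + 2 * dsq \<delta> x) - F (\<rho> x) - 4 * f (\<rho> x) * sig \<delta> x"
  have mD: "AE x in M. 2 * \<bar>m\<bar> * dsq \<delta> x \<le> - (f (\<rho> x) * dsq \<delta> x)"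
  proof (cases "N = 0")
    case True
    have z: "dsq \<delta> x = 0" for x unfolding dsq_def by (simp add: True)
    show ?thesis unfolding z by simp
  next
    case False
    then have "AE x in M. 2 * \<bar>m\<bar> \<le> - f (\<rho> x)" using m by simp
    then show ?thesis
    proof eventually_elim
      case (elim x)
      then show ?case using mult_right_mono[OF elim dsq_nonneg[of \<delta> x]] by simp
    qed
  qed
  have pt: "AE x in M. ?G x + 2 * (\<eta> x * dsq \<delta> x) + 2 * (f (\<rho> x) * dsq \<delta> x) \<le> C2 * (\<eta> x - m) ^ 4"
    using mD
  proof eventually_elim
    case (elim x)
    let ?D = "dsq \<delta> x"
    \<comment> \<open>The mean of the two lower bounds is used: half of the first leaves
      \<open>- f \<rho> * D\<close> for the constant \<open>m\<close>, and half of the second leaves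
      \<open>a / 8 * D powr (4/3)\<close> for Young's inequality.\<close>
    note lower = slack_ge_f[OF density_nonneg[of \<Psi> x] dsq_nonneg[of \<delta> x] sig_sq]
      slack_ge_powr[OF density_nonneg[of \<Psi> x] dsq_nonneg[of \<delta> x] sig_sq]
    have Y: "2 * ?D * (\<eta> x - m) \<le> a / 8 * ?D powr (4/3) + C2 * (\<eta> x - m) ^ 4"
      unfolding C2_def by (rule Young_quartic[OF dsq_nonneg]) (use a_pos in simp)
    have "m * ?D \<le> \<bar>m\<bar> * ?D" using dsq_nonneg by (intro mult_right_mono) auto
    then have "2 * (\<eta> x * ?D) \<le> 2 * ?D * (\<eta> x - m) + 2 * \<bar>m\<bar> * ?D" by (simp add: algebra_simps)
    then show ?case using lower Y elim by simp
  qed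
  have Gi: "integrable M ?G" by (rule gap_integrable[OF \<delta>])
  have Ei: "integrable M (\<lambda>x. \<eta> x * dsq \<delta> x)" by (rule L2_prod[OF X_L2[OF \<eta>] dsq_L2[OF \<delta>]])
  have fi: "integrable M (\<lambda>x. f (\<rho> x) * dsq \<delta> x)" by (rule perturbed_integrable(4)[OF \<delta>])
  have "gap \<delta> + 2 * intg (\<lambda>x. \<eta> x * dsq \<delta> x) + 2 * intg (\<lambda>x. f (\<rho> x) * dsq \<delta> x) =
      intg (\<lambda>x. ?G x + 2 * (\<eta> x * dsq \<delta> x) + 2 * (f (\<rho> x) * dsq \<delta> x))"
    unfolding gap_def
    by (subst Bochner_Integration.integral_add, use Gi Ei fi in simp, use fi in simp,
        subst Bochner_Integration.integral_add, rule Gi, use Ei in simp, simp)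
  also have "\<dots> \<le> intg (\<lambda>x. C2 * (\<eta> x - m) ^ 4)"
  proof (rule integral_mono_AE[OF _ _ pt])
    show "integrable M (\<lambda>x. ?G x + 2 * (\<eta> x * dsq \<delta> x) + 2 * (f (\<rho> x) * dsq \<delta> x))"
      using Gi Ei fi by (intro Bochner_Integration.integrable_add) auto
  qed (use i4 in simp)
  also have "\<dots> \<le> C2 * (C1 * (gsq \<eta>)\<^sup>2)"
    using mult_left_mono[OF C1 C2] by simp
  also have "\<dots> = (C2 * (C1 * gsq \<eta>)) * gsq \<eta>" by (simp add: power2_eq_square)
  also have "\<dots> \<le> 1 / (4 * pi) * gsq \<eta>"
    unfolding C2_def by (rule mult_right_mono[OF small grad_sq_nonneg])
  finally show ?thesis by linarith
qed

text \<open>A predicate, like \<open>potential_split\<close>, so that \<open>error_bound\<close>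
  serves both boundary conditions; each of them proves the two predicates in its own way.\<close>

definition error_controlled :: bool where
  "error_controlled \<longleftrightarrow> (\<exists>C>0. \<exists>r>0. \<forall>\<delta>. (\<forall>i<N. \<delta> i \<in> X \<and> h1_sq (\<delta> i) < r) \<longrightarrow>
      (\<forall>i<N. \<forall>j<N. intg (\<lambda>x. (\<Psi> i x + \<delta> i x) * (\<Psi> j x + \<delta> j x)) = (if i = j then 1 else 0)) \<longrightarrow>
      (\<Sum>i<N. h1_sq (\<delta> i)) \<le> C * (\<Sum>i<N. gsq (\<delta> i)))"

text \<open>The constant \<open>m\<close> is the mean of \<open>v\<close> under periodic conditions, where the gradient does not see
  constants, and 0 under Dirichlet conditions.\<close>

definition potential_split :: bool where
  "potential_split \<longleftrightarrow> (\<exists>C>0. \<exists>r>0. \<forall>v\<in>X. h1_sq v < r \<longrightarrow> (\<exists>m. integrable M (\<lambda>x. (v x - m) ^ 4) \<and>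
      intg (\<lambda>x. (v x - m) ^ 4) \<le> C * (gsq v)\<^sup>2 \<and> (N > 0 \<longrightarrow> (AE x in M. 2 * \<bar>m\<bar> \<le> - f (\<rho> x)))))"

definition err :: "(nat \<Rightarrow> fld) \<Rightarrow> fld \<Rightarrow> real" where
  "err \<delta> \<eta> = 2 * (\<Sum>i<N. 1 / 2 * gsq (\<delta> i)
          + \<bar>\<epsilon> i * intg (\<lambda>x. (\<delta> i x)\<^sup>2)\<bar>
          + \<bar>intg (\<lambda>x. f (\<rho> x) * (\<delta> i x)\<^sup>2)\<bar>
          + \<bar>intg (\<lambda>x. (\<delta> i x)\<^sup>2 * \<phi> x)\<bar>
          + 2 * \<bar>intg (\<lambda>x. \<Psi> i x * \<delta> i x * \<eta> x)\<bar>)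
        + 1 / (8 * pi) * gsq \<eta> + 8 * \<bar>intg (\<lambda>x. c x * (sig \<delta> x)\<^sup>2)\<bar>"

text \<open>From above, \<open>gap_upper\<close> is matched by the terms with
  \<open>f \<rho>\<close> and by the two copies of the gradient of \<open>\<eta>\<close> that lie
  between expansion and bound. From below, the two copies of the orbital gradients pay for
  \<open>rem\<close> and for the cubic integral, one each.\<close>

lemma error_bound:
  assumes A1: error_controlled and A2: potential_split
  shows "\<exists>r>0. \<forall>\<delta> \<eta>. (\<forall>i<N. \<delta> i \<in> X \<and> h1_sq (\<delta> i) < r) \<longrightarrow> \<eta> \<in> X \<longrightarrow> h1_sq \<eta> < r \<longrightarrow>
      (\<forall>i<N. \<forall>j<N. intg (\<lambda>x. (\<Psi> i x + \<delta> i x) * (\<Psi> j x + \<delta> j x)) = (if i = j then 1 else 0)) \<longrightarrow>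
      \<bar>en (\<lambda>i x. \<Psi> i x + \<delta> i x) (\<lambda>x. \<phi> x + \<eta> x) - en \<Psi> \<phi>\<bar> \<le> err \<delta> \<eta>"
proof -
  obtain C r1 where C: "C > 0" and r1: "r1 > 0" "\<And>\<delta>. (\<forall>i<N. \<delta> i \<in> X \<and> h1_sq (\<delta> i) < r1) \<Longrightarrow>
      (\<forall>i<N. \<forall>j<N. intg (\<lambda>x. (\<Psi> i x + \<delta> i x) * (\<Psi> j x + \<delta> j x)) = (if i = j then 1 else 0)) \<Longrightarrow>
      (\<Sum>i<N. h1_sq (\<delta> i)) \<le> C * (\<Sum>i<N. gsq (\<delta> i))"
    using A1 unfolding error_controlled_def by blast
  obtain C1 r2 where C1: "C1 > 0" and r2: "r2 > 0" "\<And>v. v \<in> X \<Longrightarrow> h1_sq v < r2 \<Longrightarrow> (\<exists>m. integrable M (\<lambda>x. (v x - m) ^ 4) \<and>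
      intg (\<lambda>x. (v x - m) ^ 4) \<le> C1 * (gsq v)\<^sup>2 \<and> (N > 0 \<longrightarrow> (AE x in M. 2 * \<bar>m\<bar> \<le> - f (\<rho> x))))"
    using A2 unfolding potential_split_def by blast
  obtain r3 where r3: "r3 > 0" "\<And>\<delta>. (\<forall>i<N. \<delta> i \<in> X \<and> h1_sq (\<delta> i) < r3) \<Longrightarrow>
      intg (rem \<delta>) \<le> 1 / C * (\<Sum>i<N. h1_sq (\<delta> i))"
    using rem_integral_small[of "1 / C"] C by auto
  define C2 where "C2 = 16 / (a / 8) ^ 3 * C1"
  have C2: "C2 > 0" using a_pos C1 by (simp add: C2_def)
  \<comment> \<open>\<open>r4\<close> makes the quartic term in \<open>gap_upper\<close> at most
    \<open>1 / (4 * pi)\<close> times the gradient energy of \<open>\<eta>\<close>;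
    \<open>r5\<close> makes twice the cubic integral at most one copy of the orbital
    gradients.\<close>
  define r4 where "r4 = 1 / (4 * pi * C2)"
  define r5 where "r5 = (1 / (2 * sqrt S * C))\<^sup>2"
  define r where "r = min (min r1 r2) (min r3 (min r4 r5))"
  have r: "r > 0" using r1 r2 r3 C2 S_pos C by (simp add: r_def r4_def r5_def)
  show ?thesis
  proof (intro exI[of _ r] conjI r allI impI)
    fix \<delta> \<eta>
    assume d: "\<forall>i<N. \<delta> i \<in> X \<and> h1_sq (\<delta> i) < r" and \<eta>: "\<eta> \<in> X" and hr: "h1_sq \<eta> < r"
      and o: "\<forall>i<N. \<forall>j<N. intg (\<lambda>x. (\<Psi> i x + \<delta> i x) * (\<Psi> j x + \<delta> j x)) = (if i = j then 1 else 0)"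
    have dX: "\<delta> i \<in> X" if "i < N" for i using d that by simp
    define H where "H = gsq \<eta>"
    have H: "0 \<le> H" "H \<le> h1_sq \<eta>" by (auto simp: H_def grad_sq_nonneg h1_sq_def)
    define A e p q s b where "A i = gsq (\<delta> i)" and "e i = \<epsilon> i * intg (\<lambda>x. (\<delta> i x)\<^sup>2)"
      and "p i = intg (\<lambda>x. f (\<rho> x) * (\<delta> i x)\<^sup>2)" and "q i = intg (\<lambda>x. (\<delta> i x)\<^sup>2 * \<phi> x)"
      and "s i = intg (\<lambda>x. \<Psi> i x * \<delta> i x * \<eta> x)" and "b i = intg (\<lambda>x. (\<delta> i x)\<^sup>2 * \<eta> x)" for i :: nat
    define J where "J = intg (\<lambda>x. c x * (sig \<delta> x)\<^sup>2)"
    have id: "en (\<lambda>i x. \<Psi> i x + \<delta> i x) (\<lambda>x. \<phi> x + \<eta> x) - en \<Psi> \<phi> =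
        (\<Sum>i<N. A i) - 2 * (\<Sum>i<N. e i) + 2 * (\<Sum>i<N. q i) + 4 * (\<Sum>i<N. s i) + 2 * (\<Sum>i<N. b i) + gap \<delta> - 1 / (8 * pi) * H"
      using energy_identity[OF dX \<eta>] o
      by (simp add: A_def e_def q_def s_def b_def gap_def H_def sum.distrib sum_subtractf sum_distrib_left)
    have p0: "p i \<le> 0" for i :: nat
    proof -
      have "0 \<le> intg (\<lambda>x. - (f (\<rho> x) * (\<delta> i x)\<^sup>2))"
        using f_nonpos[OF density_nonneg] by (intro Bochner_Integration.integral_nonneg) (simp add: mult_nonpos_nonneg)
      then show ?thesis by (simp add: p_def)
    qed
    have fp: "intg (\<lambda>x. f (\<rho> x) * dsq \<delta> x) = (\<Sum>i<N. p i)"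
      unfolding p_def by (rule dsq_integral[OF dX f_density_L2])
    have eb: "intg (\<lambda>x. \<eta> x * dsq \<delta> x) = (\<Sum>i<N. b i)"
      unfolding b_def using dsq_integral[OF dX X_L2[OF \<eta>]] by (simp add: mult.commute)
    have "\<exists>m. integrable M (\<lambda>x. (\<eta> x - m) ^ 4) \<and>
      intg (\<lambda>x. (\<eta> x - m) ^ 4) \<le> C1 * (gsq \<eta>)\<^sup>2 \<and> (N > 0 \<longrightarrow> (AE x in M. 2 * \<bar>m\<bar> \<le> - f (\<rho> x)))"
      by (rule r2(2)[OF \<eta>]) (use hr in \<open>simp add: r_def\<close>)
    then obtain m where m: "integrable M (\<lambda>x. (\<eta> x - m) ^ 4)" "intg (\<lambda>x. (\<eta> x - m) ^ 4) \<le> C1 * (gsq \<eta>)\<^sup>2"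
      "N > 0 \<Longrightarrow> AE x in M. 2 * \<bar>m\<bar> \<le> - f (\<rho> x)" by blast
    have up: "gap \<delta> + 2 * (\<Sum>i<N. b i) \<le> - 2 * (\<Sum>i<N. p i) + 1 / (4 * pi) * H"
      unfolding fp[symmetric] eb[symmetric] H_def
    proof (rule gap_upper[OF dX \<eta> m])
      have "C2 * H \<le> C2 * r4" using H hr C2 by (intro mult_left_mono) (auto simp: r_def)
      also have "\<dots> = 1 / (4 * pi)" using C2 by (simp add: r4_def)
      finally show "16 / (a / 8) ^ 3 * (C1 * gsq \<eta>) \<le> 1 / (4 * pi)" by (simp add: C2_def H_def mult.assoc)
    qed
    have R: "intg (rem \<delta>) = - gap \<delta> + 2 * (\<Sum>i<N. p i) + 8 * J"
      unfolding gap_def J_def fp[symmetric] by (rule rem_integral(2)[OF dX])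
    have hA: "(\<Sum>i<N. h1_sq (\<delta> i)) \<le> C * (\<Sum>i<N. A i)"
      unfolding A_def by (rule r1(2)) (use d o in \<open>auto simp: r_def\<close>)
    have "intg (rem \<delta>) \<le> 1 / C * (\<Sum>i<N. h1_sq (\<delta> i))" by (rule r3(2)) (use d in \<open>auto simp: r_def\<close>)
    also have "\<dots> \<le> 1 / C * (C * (\<Sum>i<N. A i))" using hA C by (intro mult_left_mono) auto
    finally have R': "intg (rem \<delta>) \<le> (\<Sum>i<N. A i)" using C by simp
    have bb: "- (2 * (\<Sum>i<N. b i)) \<le> (\<Sum>i<N. A i)"
    proof -
      have "sqrt (h1_sq \<eta>) \<le> sqrt r5" using hr by (intro real_sqrt_le_mono) (simp add: r_def)
      also have "sqrt r5 = 1 / (2 * sqrt S * C)" using S_pos C by (simp add: r5_def)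
      finally have k: "2 * (sqrt S * sqrt (h1_sq \<eta>)) \<le> 1 / C" using S_pos C by (simp add: field_simps)
      have "- (\<Sum>i<N. b i) = (\<Sum>i<N. - b i)" by (simp add: sum_negf)
      also have "\<dots> \<le> (\<Sum>i<N. sqrt S * sqrt (h1_sq \<eta>) * h1_sq (\<delta> i))"
      proof (rule sum_mono)
        fix i assume "i \<in> {..<N}"
        then show "- b i \<le> sqrt S * sqrt (h1_sq \<eta>) * h1_sq (\<delta> i)"
          using sq_product_bound[where \<delta>=\<delta> and i=i, OF dX _ \<eta>] by (simp add: b_def abs_le_iff)
      qed
      also have "\<dots> = sqrt S * sqrt (h1_sq \<eta>) * (\<Sum>i<N. h1_sq (\<delta> i))" by (simp add: sum_distrib_left)
      finally have "- (2 * (\<Sum>i<N. b i)) \<le> 2 * (sqrt S * sqrt (h1_sq \<eta>)) * (\<Sum>i<N. h1_sq (\<delta> i))" by simp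
      also have "\<dots> \<le> 1 / C * (\<Sum>i<N. h1_sq (\<delta> i))" by (rule mult_right_mono[OF k]) (simp add: sum_nonneg h1_sq_nonneg)
      also have "\<dots> \<le> 1 / C * (C * (\<Sum>i<N. A i))" using hA C by (intro mult_left_mono) auto
      finally show ?thesis using C by simp
    qed
    have abs: "\<bar>\<Sum>i<N. e i\<bar> \<le> (\<Sum>i<N. \<bar>e i\<bar>)" "\<bar>\<Sum>i<N. q i\<bar> \<le> (\<Sum>i<N. \<bar>q i\<bar>)" "\<bar>\<Sum>i<N. s i\<bar> \<le> (\<Sum>i<N. \<bar>s i\<bar>)"
      by (rule sum_abs)+
    have pp: "(\<Sum>i<N. \<bar>p i\<bar>) = - (\<Sum>i<N. p i)" using p0 by (simp add: sum_negf[symmetric])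
    have A0: "(\<Sum>i<N. A i) \<ge> 0" by (simp add: A_def sum_nonneg grad_sq_nonneg)
    have h: "1 / (4 * pi) * H = 2 * (1 / (8 * pi) * H)" "1 / (8 * pi) * H \<ge> 0" using H by auto
    have "\<bar>en (\<lambda>i x. \<Psi> i x + \<delta> i x) (\<lambda>x. \<phi> x + \<eta> x) - en \<Psi> \<phi>\<bar> \<le>
        (\<Sum>i<N. A i) + 2 * (\<Sum>i<N. \<bar>e i\<bar>) + 2 * (\<Sum>i<N. \<bar>p i\<bar>) + 2 * (\<Sum>i<N. \<bar>q i\<bar>) + 4 * (\<Sum>i<N. \<bar>s i\<bar>)
          + 1 / (8 * pi) * H + 8 * \<bar>J\<bar>"
    proof (rule abs_leI)
      show "en (\<lambda>i x. \<Psi> i x + \<delta> i x) (\<lambda>x. \<phi> x + \<eta> x) - en \<Psi> \<phi> \<le>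
        (\<Sum>i<N. A i) + 2 * (\<Sum>i<N. \<bar>e i\<bar>) + 2 * (\<Sum>i<N. \<bar>p i\<bar>) + 2 * (\<Sum>i<N. \<bar>q i\<bar>) + 4 * (\<Sum>i<N. \<bar>s i\<bar>)
          + 1 / (8 * pi) * H + 8 * \<bar>J\<bar>"
        unfolding id using up abs h pp by linarith
      show "- (en (\<lambda>i x. \<Psi> i x + \<delta> i x) (\<lambda>x. \<phi> x + \<eta> x) - en \<Psi> \<phi>) \<le>
        (\<Sum>i<N. A i) + 2 * (\<Sum>i<N. \<bar>e i\<bar>) + 2 * (\<Sum>i<N. \<bar>p i\<bar>) + 2 * (\<Sum>i<N. \<bar>q i\<bar>) + 4 * (\<Sum>i<N. \<bar>s i\<bar>)
          + 1 / (8 * pi) * H + 8 * \<bar>J\<bar>"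
        unfolding id using R R' bb abs h pp A0 by linarith
    qed
    also have "\<dots> = 2 * (\<Sum>i<N. 1 / 2 * A i + \<bar>e i\<bar> + \<bar>p i\<bar> + \<bar>q i\<bar> + 2 * \<bar>s i\<bar>) + 1 / (8 * pi) * H + 8 * \<bar>J\<bar>"
      by (simp add: sum.distrib sum_distrib_left)
    finally show "\<bar>en (\<lambda>i x. \<Psi> i x + \<delta> i x) (\<lambda>x. \<phi> x + \<eta> x) - en \<Psi> \<phi>\<bar> \<le> err \<delta> \<eta>"
      unfolding err_def A_def e_def p_def q_def s_def H_def J_def .
  qed
qed

end

context sobolev_space
begin

lemma integral_mult_sq_lincomb:
  assumes w: "L2 w" and u: "u \<in> X" and v: "v \<in> X"
  shows "intg (\<lambda>x. w x * (u x + t * v x)\<^sup>2) =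
    intg (\<lambda>x. w x * (u x)\<^sup>2) + 2 * t * intg (\<lambda>x. w x * v x * u x) + t\<^sup>2 * intg (\<lambda>x. w x * v x * v x)"
proof -
  have i: "integrable M (\<lambda>x. w x * (u x)\<^sup>2)" "integrable M (\<lambda>x. w x * v x * u x)" "integrable M (\<lambda>x. w x * v x * v x)"
    using L2_prod[OF w X_sq_L2[OF u]] L2_prod[OF w X_mult_L2[OF v u]] L2_prod[OF w X_mult_L2[OF v v]]
    by (simp_all add: mult.assoc)
  have "intg (\<lambda>x. w x * (u x + t * v x)\<^sup>2) =
      intg (\<lambda>x. w x * (u x)\<^sup>2 + 2 * t * (w x * v x * u x) + t\<^sup>2 * (w x * v x * v x))"
    by (simp add: power2_eq_square algebra_simps)
  then show ?thesis using i by simp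
qed

end

section \<open>Periodic conditions: the lowest orbital and the role of constants\<close>

locale ks_ground = ks_problem + mean_space \<Omega> D S P for P +
  assumes lowest: "v \<in> X \<Longrightarrow> (\<And>j. j < N \<Longrightarrow> intg (\<lambda>x. \<Psi> j x * v x) = 0) \<Longrightarrow> i < N \<Longrightarrow>
      \<epsilon> i * intg (\<lambda>x. (v x)\<^sup>2) \<le>
        1 / 2 * gsq v + intg (\<lambda>x. f (ks_density N \<Psi> x) * (v x)\<^sup>2) + intg (\<lambda>x. \<phi> x * (v x)\<^sup>2)"
    and N_pos: "N > 0"
begin

text \<open>An index of a lowest occupied eigenvalue. The eigenvalues are not assumed to be sorted,
  and the choice among equal ones does not matter.\<close>

definition i0 :: nat where "i0 = (SOME i. i < N \<and> (\<forall>j<N. \<epsilon> i \<le> \<epsilon> j))"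

lemma i0: "i0 < N" "j < N \<Longrightarrow> \<epsilon> i0 \<le> \<epsilon> j"
proof -
  have "Min (\<epsilon> ` {..<N}) \<in> \<epsilon> ` {..<N}" using N_pos by (intro Min_in) auto
  then obtain i where i: "i < N" "\<epsilon> i = Min (\<epsilon> ` {..<N})" by auto
  have "\<exists>i. i < N \<and> (\<forall>j<N. \<epsilon> i \<le> \<epsilon> j)" by (rule exI[of _ i]) (use i in simp)
  from someI_ex[OF this] show "i0 < N" "j < N \<Longrightarrow> \<epsilon> i0 \<le> \<epsilon> j" by (auto simp: i0_def)
qed

text \<open>The quadratic form of the Kohn-Sham operator shifted by the lowest occupied eigenvalue,
  so that the corresponding orbital becomes a null vector.\<close>

definition Q :: "fld \<Rightarrow> real" where
  "Q v = 1 / 2 * gsq v + intg (\<lambda>x. f (\<rho> x) * (v x)\<^sup>2) + intg (\<lambda>x. \<phi> x * (v x)\<^sup>2)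
     - \<epsilon> i0 * intg (\<lambda>x. (v x)\<^sup>2)"

lemma Q_shift:
  assumes u: "u \<in> X" and j: "j < N"
  shows "Q (\<lambda>x. u x + t * \<Psi> j x) = Q u + (\<epsilon> j - \<epsilon> i0) * (2 * t * intg (\<lambda>x. \<Psi> j x * u x) + t\<^sup>2)"
proof -
  note \<psi> = \<Psi>_X[OF j]
  have one: "intg (\<lambda>x. (u x + t * \<Psi> j x)\<^sup>2) =
      intg (\<lambda>x. (u x)\<^sup>2) + 2 * t * intg (\<lambda>x. \<Psi> j x * u x) + t\<^sup>2"
    using integral_mult_sq_lincomb[OF L2_const[of 1] u \<psi>, of t] orth[OF j j] by simp
  have "Q (\<lambda>x. u x + t * \<Psi> j x) = Q u
      + 2 * t * (1 / 2 * grad_inner \<Omega> (\<Psi> j) u + intg (\<lambda>x. f (\<rho> x) * \<Psi> j x * u x) + intg (\<lambda>x. \<phi> x * \<Psi> j x * u x))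
      + t\<^sup>2 * (1 / 2 * grad_inner \<Omega> (\<Psi> j) (\<Psi> j) + intg (\<lambda>x. f (\<rho> x) * \<Psi> j x * \<Psi> j x) + intg (\<lambda>x. \<phi> x * \<Psi> j x * \<Psi> j x))
      - \<epsilon> i0 * (2 * t * intg (\<lambda>x. \<Psi> j x * u x) + t\<^sup>2)"
    unfolding Q_def grad_sq_lincomb[OF u \<psi>] one
      integral_mult_sq_lincomb[OF f_density_L2 u \<psi>] integral_mult_sq_lincomb[OF X_L2[OF \<phi>_X] u \<psi>]
    by (simp add: algebra_simps)
  also have "\<dots> = Q u + (\<epsilon> j - \<epsilon> i0) * (2 * t * intg (\<lambda>x. \<Psi> j x * u x) + t\<^sup>2)"
    unfolding ks[OF j u] ks[OF j \<psi>] using orth[OF j j] by (simp add: algebra_simps)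
  finally show ?thesis .
qed

text \<open>\<open>lowest\<close> covers the functions orthogonal to all orbitals. The components
  along the orbitals are restored one at a time; each adds
  \<open>\<epsilon> n - \<epsilon> i0\<close> times a square, which is nonnegative.\<close>

lemma Q_nonneg: "v \<in> X \<Longrightarrow> Q v \<ge> 0"
proof -
  have "n \<le> N \<Longrightarrow> v \<in> X \<Longrightarrow> (\<And>j. n \<le> j \<Longrightarrow> j < N \<Longrightarrow> intg (\<lambda>x. \<Psi> j x * v x) = 0) \<Longrightarrow> Q v \<ge> 0" for n v
  proof (induction n arbitrary: v)
    case 0
    have "\<epsilon> i0 * intg (\<lambda>x. (v x)\<^sup>2) \<le>
        1 / 2 * gsq v + intg (\<lambda>x. f (ks_density N \<Psi> x) * (v x)\<^sup>2) + intg (\<lambda>x. \<phi> x * (v x)\<^sup>2)"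
      by (rule lowest[OF 0(2) _ i0(1)]) (use 0(3) in simp)
    then show ?case by (simp add: Q_def)
  next
    case (Suc n)
    then have n: "n < N" by simp
    define t where "t = intg (\<lambda>x. \<Psi> n x * v x)"
    define u where "u = (\<lambda>x. v x + (- t) * \<Psi> n x)"
    have uX: "u \<in> X" unfolding u_def by (rule X_lincomb[OF Suc.prems(2) \<Psi>_X[OF n]])
    have ou: "intg (\<lambda>x. \<Psi> j x * u x) = intg (\<lambda>x. \<Psi> j x * v x) - t * (if j = n then 1 else 0)" if j: "j < N" for j
    proof -
      have "intg (\<lambda>x. \<Psi> j x * u x) = intg (\<lambda>x. \<Psi> j x * v x - t * (\<Psi> j x * \<Psi> n x))"
        by (simp add: u_def algebra_simps)
      also have "\<dots> = intg (\<lambda>x. \<Psi> j x * v x) - t * intg (\<lambda>x. \<Psi> j x * \<Psi> n x)"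
        using L2_prod[OF X_L2[OF \<Psi>_X[OF j]] X_L2[OF Suc.prems(2)]] L2_prod[OF X_L2[OF \<Psi>_X[OF j]] X_L2[OF \<Psi>_X[OF n]]] by simp
      finally show ?thesis using orth[OF j n] by simp
    qed
    have un: "intg (\<lambda>x. \<Psi> n x * u x) = 0" using ou[OF n] by (simp add: t_def)
    have "Q u \<ge> 0"
    proof (rule Suc.IH[OF _ uX])
      fix j assume j: "n \<le> j" "j < N"
      show "intg (\<lambda>x. \<Psi> j x * u x) = 0"
      proof (cases "j = n")
        case False then show ?thesis using ou[OF j(2)] Suc.prems(3)[of j] j by simp
      qed (simp add: un)
    qed (use n in simp)
    moreover have "Q v = Q u + (\<epsilon> n - \<epsilon> i0) * t\<^sup>2"
      using Q_shift[OF uX n, of t] un by (simp add: u_def)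
    ultimately show ?case using i0(2)[OF n] by simp
  qed
  from this[of N v] show "v \<in> X \<Longrightarrow> Q v \<ge> 0" by simp
qed

lemma Q_ground: "Q (\<Psi> i0) = 0"
  using ks[OF i0(1) \<Psi>_X[OF i0(1)]] by (simp add: Q_def power2_eq_square mult.assoc grad_sq_inner)

text \<open>The exchange-correlation potential is nonpositive, so the shifted potential lies below
  \<open>\<bar>\<phi>\<bar> + \<bar>\<epsilon> i0\<bar>\<close>. This is a trial function, hence has
  an integrable fourth power, as \<open>null_vector\<close> requires of \<open>W\<close>.\<close>

lemma ground_state_sign: "\<exists>\<kappa>>0. (AE x in M. \<kappa> \<le> \<Psi> i0 x) \<or> (AE x in M. \<Psi> i0 x \<le> - \<kappa>)"
proof -
  let ?V = "\<lambda>x. f (\<rho> x) + \<phi> x - \<epsilon> i0" and ?W = "\<lambda>x. \<bar>\<phi> x\<bar> + \<bar>\<epsilon> i0\<bar>"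
  note \<psi> = \<Psi>_X[OF i0(1)]
  have W: "?W \<in> X" by (rule X_add[OF X_abs(1)[OF \<phi>_X] X_const])
  have Vi: "integrable M (\<lambda>x. ?V x * (v x)\<^sup>2)" and Vq: "1 / 2 * gsq v + intg (\<lambda>x. ?V x * (v x)\<^sup>2) = Q v" if v: "v \<in> X" for v
  proof -
    have i: "integrable M (\<lambda>x. f (\<rho> x) * (v x)\<^sup>2)" "integrable M (\<lambda>x. \<phi> x * (v x)\<^sup>2)" "integrable M (\<lambda>x. (v x)\<^sup>2)"
      by (rule L2_prod[OF f_density_L2 X_sq_L2[OF v]], rule L2_prod[OF X_L2[OF \<phi>_X] X_sq_L2[OF v]],
          rule L2_fun_integrable[OF X_sq_L2[OF v]])
    have e: "(\<lambda>x. ?V x * (v x)\<^sup>2) = (\<lambda>x. f (\<rho> x) * (v x)\<^sup>2 + \<phi> x * (v x)\<^sup>2 - \<epsilon> i0 * (v x)\<^sup>2)" by (simp add: algebra_simps)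
    show "integrable M (\<lambda>x. ?V x * (v x)\<^sup>2)" unfolding e using i by simp
    show "1 / 2 * gsq v + intg (\<lambda>x. ?V x * (v x)\<^sup>2) = Q v" unfolding e Q_def using i by simp
  qed
  interpret null_vector \<Omega> D S P ?V ?W "\<Psi> i0"
  proof unfold_locales
    show "?V \<in> borel_measurable M"
      by (intro borel_measurable_diff borel_measurable_add borel_measurable_const L2_meas f_density_L2 X_L2 \<phi>_X)
    show "?W \<in> borel_measurable M" by (rule X_meas[OF W])
    show "AE x in M. ?V x \<le> ?W x"
    proof (rule AE_I2)
      fix x show "?V x \<le> ?W x" using f_nonpos[OF density_nonneg[of \<Psi> x]] by simp
    qed
    show "integrable M (\<lambda>x. ?W x ^ 4)" by (rule X_integrable4[OF W])
    show "integrable M (\<lambda>x. ?V x * (v x)\<^sup>2)" if "v \<in> X" for v by (rule Vi[OF that])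
    show "0 \<le> 1 / 2 * gsq v + intg (\<lambda>x. ?V x * (v x)\<^sup>2)" if "v \<in> X" for v
      unfolding Vq[OF that] by (rule Q_nonneg[OF that])
    show "1 / 2 * gsq (\<Psi> i0) + intg (\<lambda>x. ?V x * (\<Psi> i0 x)\<^sup>2) = 0" unfolding Vq[OF \<psi>] by (rule Q_ground)
    show "intg (\<lambda>x. (\<Psi> i0 x)\<^sup>2) > 0" using orth[OF i0(1) i0(1)] by (simp add: power2_eq_square)
  qed (use \<psi> in auto)
  show ?thesis by (rule constant_sign)
qed

text \<open>The lowest orbital alone keeps the density away from 0, and by \<open>f_le_sqrt\<close>
  the exchange margin turns this into a strictly negative upper bound of the potential.\<close>

lemma f_density_negative: "\<exists>\<kappa>>0. AE x in M. \<kappa> \<le> - f (\<rho> x)"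
proof -
  obtain \<kappa> where \<kappa>: "\<kappa> > 0" "(AE x in M. \<kappa> \<le> \<Psi> i0 x) \<or> (AE x in M. \<Psi> i0 x \<le> - \<kappa>)" using ground_state_sign by blast
  have "AE x in M. \<kappa> \<le> \<bar>\<Psi> i0 x\<bar>" using \<kappa>(2) by (elim disjE; elim eventually_mono) auto
  then have "AE x in M. a * \<kappa> powr (2/3) \<le> - f (\<rho> x)"
  proof eventually_elim
    case (elim x)
    have "(\<Psi> i0 x)\<^sup>2 \<le> (\<Sum>i<N. (\<Psi> i x)\<^sup>2)" using i0(1) by (intro member_le_sum) auto
    also have "\<dots> \<le> \<rho> x" by (simp add: ks_density_def sum_nonneg)
    finally have "sqrt ((\<Psi> i0 x)\<^sup>2) \<le> sqrt (\<rho> x)" by (rule real_sqrt_le_mono)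
    then have "\<kappa> \<le> sqrt (\<rho> x)" using elim by simp
    then have "a * \<kappa> powr (2/3) \<le> a * sqrt (\<rho> x) powr (2/3)" using \<kappa>(1) a_pos by (intro mult_left_mono powr_mono2) auto
    then show ?case using f_le_sqrt[OF density_nonneg[of \<Psi> x]] by simp
  qed
  then show ?thesis using \<kappa>(1) a_pos by (intro exI[of _ "a * \<kappa> powr (2/3)"]) auto
qed

lemma ground_state_mean: "intg (\<Psi> i0) \<noteq> 0"
proof -
  have i: "integrable M (\<Psi> i0)" by (rule L2_fun_integrable[OF X_L2[OF \<Psi>_X[OF i0(1)]]])
  obtain \<kappa> where \<kappa>: "\<kappa> > 0" "(AE x in M. \<kappa> \<le> \<Psi> i0 x) \<or> (AE x in M. \<Psi> i0 x \<le> - \<kappa>)" using ground_state_sign by blast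
  have k: "intg (\<lambda>x. \<kappa>) > 0" using \<kappa>(1) vol_pos by (simp add: space_restrict_space)
  from \<kappa>(2) show ?thesis
  proof
    assume "AE x in M. \<kappa> \<le> \<Psi> i0 x"
    then have "intg (\<lambda>x. \<kappa>) \<le> intg (\<Psi> i0)" using i by (intro integral_mono_AE) auto
    then show ?thesis using k by simp
  next
    assume "AE x in M. \<Psi> i0 x \<le> - \<kappa>"
    then have "intg (\<Psi> i0) \<le> intg (\<lambda>x. - \<kappa>)" using i by (intro integral_mono_AE) auto
    then show ?thesis using k by simp
  qed
qed

end

context mean_space
begin

lemma mean_split:
  assumes v: "v \<in> X" and m: "m = intg v / vol"
  shows "(\<lambda>x. v x - m) \<in> X" "gsq (\<lambda>x. v x - m) = gsq v"
    "intg (\<lambda>x. (v x - m)\<^sup>2) = intg (\<lambda>x. (v x)\<^sup>2) - m\<^sup>2 * vol"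
    "intg (\<lambda>x. (v x - m)\<^sup>2) \<le> P * gsq v"
proof -
  show "(\<lambda>x. v x - m) \<in> X" by (rule X_diff[OF v X_const])
  have "has_weak_gradient \<Omega> (\<lambda>x. v x + (- 1) * m) (\<lambda>x. wgrad v x + (- 1) *\<^sub>R 0)"
    by (rule has_weak_gradient_lincomb[OF X_grad[OF v] const_grad])
  then have "has_weak_gradient \<Omega> (\<lambda>x. v x - m) (wgrad v)" by simp
  from grad_sq_eq[OF this] show "gsq (\<lambda>x. v x - m) = gsq v" by (simp add: grad_sq_def)
  have i: "integrable M v" "integrable M (\<lambda>x. (v x)\<^sup>2)"
    by (rule L2_fun_integrable[OF X_L2[OF v]], rule L2_fun_integrable[OF X_sq_L2[OF v]])
  have iv: "intg v = m * vol" using vol_pos m by simp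
  have "intg (\<lambda>x. (v x - m)\<^sup>2) = intg (\<lambda>x. (v x)\<^sup>2 - 2 * m * v x + m\<^sup>2)"
    by (rule Bochner_Integration.integral_cong) (simp_all add: power2_eq_square algebra_simps)
  also have "\<dots> = intg (\<lambda>x. (v x)\<^sup>2) - 2 * m * (m * vol) + m\<^sup>2 * vol"
    using i iv by (simp add: space_restrict_space)
  also have "\<dots> = intg (\<lambda>x. (v x)\<^sup>2) - m\<^sup>2 * vol" by (simp add: power2_eq_square)
  finally show e: "intg (\<lambda>x. (v x - m)\<^sup>2) = intg (\<lambda>x. (v x)\<^sup>2) - m\<^sup>2 * vol" .
  have "1 / vol * (intg v)\<^sup>2 = m\<^sup>2 * vol" unfolding iv using vol_pos by (simp add: power2_eq_square)
  then show "intg (\<lambda>x. (v x - m)\<^sup>2) \<le> P * gsq v" using X_Poincare_mean[OF v] e by simp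
qed

text \<open>Relative to its mean a trial function has H1 norm controlled by its gradient, so the
  fourth power of the difference is bounded by the gradient alone.\<close>

lemma mean_remainder_L4:
  assumes v: "v \<in> X" and m: "m = intg v / vol"
  shows "integrable M (\<lambda>x. (v x - m) ^ 4)" "intg (\<lambda>x. (v x - m) ^ 4) \<le> S * (P + 1)\<^sup>2 * (gsq v)\<^sup>2"
    "m\<^sup>2 \<le> h1_sq v / vol"
proof -
  note s = mean_split[OF v m]
  show "integrable M (\<lambda>x. (v x - m) ^ 4)" by (rule X_integrable4[OF s(1)])
  have "h1_sq (\<lambda>x. v x - m) \<le> (P + 1) * gsq v" using s(2,4) by (simp add: h1_sq_def algebra_simps)
  then have "(h1_sq (\<lambda>x. v x - m))\<^sup>2 \<le> ((P + 1) * gsq v)\<^sup>2" using h1_sq_nonneg by (rule power_mono)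
  then have "S * (h1_sq (\<lambda>x. v x - m))\<^sup>2 \<le> S * ((P + 1) * gsq v)\<^sup>2" using S_pos by simp
  then show "intg (\<lambda>x. (v x - m) ^ 4) \<le> S * (P + 1)\<^sup>2 * (gsq v)\<^sup>2"
    using X_bound4[OF s(1)] by (simp add: power_mult_distrib mult.assoc)
  have "0 \<le> intg (\<lambda>x. (v x - m)\<^sup>2)" by simp
  then have "m\<^sup>2 * vol \<le> h1_sq v" using s(3) grad_sq_nonneg[of v] by (simp add: h1_sq_def)
  then show "m\<^sup>2 \<le> h1_sq v / vol" using vol_pos by (simp add: pos_le_divide_eq)
qed

end

context ks_ground
begin

text \<open>Constants have no gradient, but a nonzero constant cannot be added to all orbitals without
  violating orthonormality with the ground state, whose mean does not vanish.\<close>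

lemma error_controlled: error_controlled
proof -
  define \<kappa> where "\<kappa> = intg (\<Psi> i0)"
  define L where "L = vol / \<kappa>\<^sup>2"
  have k: "\<kappa> \<noteq> 0" unfolding \<kappa>_def by (rule ground_state_mean)
  have L: "L > 0" using k vol_pos by (simp add: L_def)
  \<comment> \<open>The constants come from solving the inequalities \<open>b0\<close> and
    \<open>bj\<close> below for the squared L2 norms; \<open>L\<close> converts the squared product
    of mean and \<open>\<kappa>\<close> into the L2 norm of the constant part.\<close>
  define C0 where "C0 = 2 * P * (1 + 2 * L)"
  define C1 where "C1 = P * (1 + 3 * L)"
  define C where "C = C1 + 1 + real N * (6 * L * C0)"
  have C0: "C0 > 0" using P_pos L by (simp add: C0_def add_pos_pos)
  have "C1 > 0" using P_pos L by (simp add: C1_def add_pos_pos)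
  moreover have "real N * (6 * L * C0) \<ge> 0" using L C0 by simp
  ultimately have C: "C > 0" unfolding C_def by linarith
  have main: "(\<Sum>i<N. h1_sq (\<delta> i)) \<le> C * (\<Sum>i<N. gsq (\<delta> i))"
    if d: "\<forall>i<N. \<delta> i \<in> X \<and> h1_sq (\<delta> i) < min 1 (1 / L)"
      and o: "\<forall>i<N. \<forall>j<N. intg (\<lambda>x. (\<Psi> i x + \<delta> i x) * (\<Psi> j x + \<delta> j x)) = (if i = j then 1 else 0)" for \<delta>
  proof -
    have dX: "\<delta> i \<in> X" if "i < N" for i using d that by simp
    define A x m where "A j = gsq (\<delta> j)" and "x j = intg (\<lambda>y. (\<delta> j y)\<^sup>2)"
      and "m j = intg (\<delta> j) / vol" for j
    have A: "A j \<ge> 0" for j by (simp add: A_def grad_sq_nonneg)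
    have x0: "x j \<ge> 0" for j by (simp add: x_def)
    have hx: "h1_sq (\<delta> j) = x j + A j" for j by (simp add: h1_sq_def x_def A_def)
    have x1: "x j \<le> 1" "x j \<le> 1 / L" if "j < N" for j using d that hx[of j] A[of j] by fastforce+
    have w: "(\<lambda>y. \<delta> j y - m j) \<in> X" "intg (\<lambda>y. (\<delta> j y - m j)\<^sup>2) \<le> P * A j"
      "x j \<le> P * A j + (m j)\<^sup>2 * vol" if "j < N" for j
      using mean_split[OF dX[OF that] m_def] by (auto simp: x_def A_def)
    have prod: "integrable M (\<lambda>y. u y * v y)" if "u \<in> X" "v \<in> X" for u v
      by (rule L2_prod[OF X_L2[OF that(1)] X_L2[OF that(2)]])
    \<comment> \<open>The linear relations between the errors that orthonormality of both families
      leaves, up to a second order term.\<close>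
    have cross: "intg (\<lambda>y. \<Psi> i y * \<delta> j y) + intg (\<lambda>y. \<Psi> j y * \<delta> i y) + intg (\<lambda>y. \<delta> i y * \<delta> j y) = 0"
      if ij: "i < N" "j < N" for i j
    proof -
      have "intg (\<lambda>y. (\<Psi> i y + \<delta> i y) * (\<Psi> j y + \<delta> j y)) =
          intg (\<lambda>y. \<Psi> i y * \<Psi> j y + \<Psi> i y * \<delta> j y + \<Psi> j y * \<delta> i y + \<delta> i y * \<delta> j y)"
        by (rule Bochner_Integration.integral_cong) (simp_all add: algebra_simps)
      also have "\<dots> = intg (\<lambda>y. \<Psi> i y * \<Psi> j y) + intg (\<lambda>y. \<Psi> i y * \<delta> j y)
          + intg (\<lambda>y. \<Psi> j y * \<delta> i y) + intg (\<lambda>y. \<delta> i y * \<delta> j y)"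
        using prod \<Psi>_X dX ij by simp
      finally show ?thesis using o ij orth[OF ij] by simp
    qed
    have mk: "m j * \<kappa> = intg (\<lambda>y. \<Psi> i0 y * \<delta> j y) - intg (\<lambda>y. \<Psi> i0 y * (\<delta> j y - m j))" if j: "j < N" for j
    proof -
      have "intg (\<lambda>y. \<Psi> i0 y * (\<delta> j y - m j)) = intg (\<lambda>y. \<Psi> i0 y * \<delta> j y - m j * \<Psi> i0 y)"
        by (rule Bochner_Integration.integral_cong) (simp_all add: algebra_simps)
      also have "\<dots> = intg (\<lambda>y. \<Psi> i0 y * \<delta> j y) - m j * \<kappa>"
        using prod[OF \<Psi>_X[OF i0(1)] dX[OF j]] L2_fun_integrable[OF X_L2[OF \<Psi>_X[OF i0(1)]]] by (simp add: \<kappa>_def)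
      finally show ?thesis by simp
    qed
    have CS: "(intg (\<lambda>y. u y * v y))\<^sup>2 \<le> intg (\<lambda>y. (u y)\<^sup>2) * intg (\<lambda>y. (v y)\<^sup>2)" if "u \<in> X" "v \<in> X" for u v
      using L2_fun_integrable[OF X_sq_L2[OF that(1)]] L2_fun_integrable[OF X_sq_L2[OF that(2)]]
      by (intro Cauchy_Schwarz_integral(2) X_meas that)
    have one: "intg (\<lambda>y. (\<Psi> j y)\<^sup>2) = 1" if "j < N" for j
      using orth[OF that that] by (simp add: power2_eq_square)
    have gw: "(intg (\<lambda>y. \<Psi> i0 y * (\<delta> j y - m j)))\<^sup>2 \<le> P * A j" if j: "j < N" for j
      using CS[OF \<Psi>_X[OF i0(1)] w(1)[OF j]] w(2)[OF j] one[OF i0(1)] by simp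
    have vk: "(m j)\<^sup>2 * vol = L * (m j * \<kappa>)\<^sup>2" for j using k by (simp add: L_def power_mult_distrib)
    have sq2: "(s - t)\<^sup>2 \<le> 2 * s\<^sup>2 + 2 * t\<^sup>2" for s t :: real
      using sum_squares_bound[of s "- t"] by (simp add: power2_diff)
    have sq3: "(s + t + u)\<^sup>2 \<le> 3 * (s\<^sup>2 + t\<^sup>2 + u\<^sup>2)" for s t u :: real
    proof -
      have "3 * (s\<^sup>2 + t\<^sup>2 + u\<^sup>2) - (s + t + u)\<^sup>2 = (s - t)\<^sup>2 + (t - u)\<^sup>2 + (s - u)\<^sup>2"
        by (simp add: power2_eq_square algebra_simps)
      then show ?thesis by (smt (verit) zero_le_power2)
    qed
    \<comment> \<open>Normalization makes the inner product of the lowest orbital with its own error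
      equal to \<open>- x i0 / 2\<close>, a second order quantity. The radius \<open>1 / L\<close>
      gives \<open>L * (x i0)^2 \<le> x i0\<close>, so its contribution is absorbed on the
      left.\<close>
    have b0: "x i0 \<le> C0 * A i0"
    proof -
      have "intg (\<lambda>y. \<Psi> i0 y * \<delta> i0 y) = - (1/2 * x i0)"
        using cross[OF i0(1) i0(1)] by (simp add: x_def power2_eq_square)
      then have "m i0 * \<kappa> = - (1/2 * x i0) - intg (\<lambda>y. \<Psi> i0 y * (\<delta> i0 y - m i0))" using mk[OF i0(1)] by simp
      then have "(m i0 * \<kappa>)\<^sup>2 \<le> 2 * (- (1/2 * x i0))\<^sup>2 + 2 * (P * A i0)"
        using sq2[of "- (1/2 * x i0)" "intg (\<lambda>y. \<Psi> i0 y * (\<delta> i0 y - m i0))"] gw[OF i0(1)] by simp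
      also have "\<dots> = 1/2 * (x i0)\<^sup>2 + 2 * (P * A i0)" by (simp add: power2_eq_square)
      finally have "(m i0)\<^sup>2 * vol \<le> L * (1/2 * (x i0)\<^sup>2 + 2 * (P * A i0))"
        unfolding vk using L by (intro mult_left_mono) auto
      moreover have "L * (x i0)\<^sup>2 \<le> x i0"
      proof -
        have "L * x i0 \<le> 1" using x1(2)[OF i0(1)] L by (simp add: pos_le_divide_eq mult.commute)
        then have "(L * x i0) * x i0 \<le> 1 * x i0" using x0 by (rule mult_right_mono)
        then show ?thesis by (simp add: power2_eq_square mult.assoc)
      qed
      moreover have "L * (1/2 * (x i0)\<^sup>2 + 2 * (P * A i0)) = 1/2 * (L * (x i0)\<^sup>2) + 2 * (L * (P * A i0))"
        by (simp add: algebra_simps)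
      ultimately have "x i0 \<le> 2 * (P * A i0) + 4 * (L * (P * A i0))" using w(3)[OF i0(1)] by linarith
      also have "\<dots> = C0 * A i0" by (simp add: C0_def algebra_simps)
      finally show ?thesis .
    qed
    \<comment> \<open>Orthogonality to the perturbed lowest orbital expresses the product of the
      lowest orbital with \<open>\<delta> j\<close> by products that contain
      \<open>\<delta> i0\<close>, which \<open>b0\<close> already bounds.\<close>
    have bj: "x j \<le> C1 * A j + 6 * L * C0 * A i0" if j: "j < N" for j
    proof -
      have "m j * \<kappa> = (- intg (\<lambda>y. \<Psi> j y * \<delta> i0 y)) + (- intg (\<lambda>y. \<delta> i0 y * \<delta> j y))
          + (- intg (\<lambda>y. \<Psi> i0 y * (\<delta> j y - m j)))"
        using mk[OF j] cross[OF i0(1) j] by simp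
      then have "(m j * \<kappa>)\<^sup>2 \<le> 3 * ((intg (\<lambda>y. \<Psi> j y * \<delta> i0 y))\<^sup>2 + (intg (\<lambda>y. \<delta> i0 y * \<delta> j y))\<^sup>2
          + (intg (\<lambda>y. \<Psi> i0 y * (\<delta> j y - m j)))\<^sup>2)"
        using sq3[of "- intg (\<lambda>y. \<Psi> j y * \<delta> i0 y)" "- intg (\<lambda>y. \<delta> i0 y * \<delta> j y)"
          "- intg (\<lambda>y. \<Psi> i0 y * (\<delta> j y - m j))"] by simp
      also have "\<dots> \<le> 3 * (x i0 + x i0 + P * A j)"
      proof (intro mult_left_mono add_mono)
        show "(intg (\<lambda>y. \<Psi> j y * \<delta> i0 y))\<^sup>2 \<le> x i0"
          using CS[OF \<Psi>_X[OF j] dX[OF i0(1)]] one[OF j] by (simp add: x_def)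
        have "x i0 * x j \<le> x i0 * 1" using x1(1)[OF j] x0 by (intro mult_left_mono)
        then show "(intg (\<lambda>y. \<delta> i0 y * \<delta> j y))\<^sup>2 \<le> x i0"
          using CS[OF dX[OF i0(1)] dX[OF j]] by (simp add: x_def)
      qed (use gw[OF j] in auto)
      finally have "(m j)\<^sup>2 * vol \<le> L * (3 * (x i0 + x i0 + P * A j))"
        unfolding vk using L by (intro mult_left_mono) auto
      then have "x j \<le> C1 * A j + 6 * L * x i0" using w(3)[OF j] by (simp add: C1_def algebra_simps)
      also have "\<dots> \<le> C1 * A j + 6 * L * (C0 * A i0)" using b0 L by simp
      finally show ?thesis by (simp add: mult.assoc)
    qed
    have "(\<Sum>j<N. h1_sq (\<delta> j)) \<le> (\<Sum>j<N. (C1 + 1) * A j + 6 * L * C0 * A i0)"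
      by (rule sum_mono) (use bj in \<open>simp add: hx algebra_simps\<close>)
    also have "\<dots> = (C1 + 1) * (\<Sum>j<N. A j) + real N * (6 * L * C0) * A i0"
      by (simp add: sum.distrib sum_distrib_left)
    also have "\<dots> \<le> (C1 + 1) * (\<Sum>j<N. A j) + real N * (6 * L * C0) * (\<Sum>j<N. A j)"
    proof -
      have "A i0 \<le> (\<Sum>j<N. A j)" using i0(1) A by (intro member_le_sum) auto
      then have "real N * (6 * L * C0) * A i0 \<le> real N * (6 * L * C0) * (\<Sum>j<N. A j)"
        using L C0 by (intro mult_left_mono) auto
      then show ?thesis by simp
    qed
    also have "\<dots> = C * (\<Sum>j<N. A j)" by (simp add: C_def algebra_simps)
    finally show ?thesis unfolding A_def .
  qed
  show ?thesis unfolding error_controlled_def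
    by (rule exI[of _ C], rule conjI[OF C], rule exI[of _ "min 1 (1 / L)"], rule conjI) (use L main in auto)
qed

lemma potential_split: potential_split
proof -
  obtain \<kappa> where \<kappa>: "\<kappa> > 0" "AE x in M. \<kappa> \<le> - f (\<rho> x)" using f_density_negative by blast
  define C where "C = S * (P + 1)\<^sup>2"
  have C: "C > 0" using S_pos P_pos by (simp add: C_def)
  \<comment> \<open>As \<open>m^2 * vol\<close> is at most the squared H1 norm, this radius yields
    \<open>\<bar>m\<bar> \<le> \<kappa> / 2\<close>.\<close>
  define r where "r = vol * (\<kappa> / 2)\<^sup>2"
  have r: "r > 0" using vol_pos \<kappa>(1) by (simp add: r_def)
  have "\<exists>m. integrable M (\<lambda>x. (v x - m) ^ 4) \<and>
      intg (\<lambda>x. (v x - m) ^ 4) \<le> C * (gsq v)\<^sup>2 \<and> (N > 0 \<longrightarrow> (AE x in M. 2 * \<bar>m\<bar> \<le> - f (\<rho> x)))"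
    if v: "v \<in> X" and h: "h1_sq v < r" for v
  proof -
    define m where "m = intg v / vol"
    note b = mean_remainder_L4[OF v m_def]
    have "m\<^sup>2 \<le> (\<kappa> / 2)\<^sup>2"
    proof -
      have "h1_sq v / vol \<le> r / vol" using h vol_pos by (intro divide_right_mono) auto
      then show ?thesis using b(3) vol_pos by (simp add: r_def)
    qed
    then have "\<bar>m\<bar> \<le> \<kappa> / 2" using \<kappa>(1) by (simp add: abs_le_square_iff[symmetric])
    then have mk: "2 * \<bar>m\<bar> \<le> \<kappa>" by simp
    have "AE x in M. 2 * \<bar>m\<bar> \<le> - f (\<rho> x)" using \<kappa>(2) by eventually_elim (use mk in linarith)
    then show ?thesis using b(1,2) unfolding C_def by blast
  qed
  then show ?thesis unfolding potential_split_def using C r by blast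
qed

end

section \<open>Dirichlet conditions\<close>

locale ks_Poincare = ks_problem + fixes P :: real
  assumes P_pos: "P > 0" and Poincare: "v \<in> X \<Longrightarrow> intg (\<lambda>x. (v x)\<^sup>2) \<le> P * gsq v"
begin

lemma h1_sq_le_grad_sq: "v \<in> X \<Longrightarrow> h1_sq v \<le> (P + 1) * gsq v"
  using Poincare[of v] by (simp add: h1_sq_def algebra_simps)

lemma error_controlled: error_controlled
proof -
  have "(\<Sum>i<N. h1_sq (\<delta> i)) \<le> (P + 1) * (\<Sum>i<N. gsq (\<delta> i))" if "\<forall>i<N. \<delta> i \<in> X \<and> h1_sq (\<delta> i) < 1" for \<delta>
    unfolding sum_distrib_left by (rule sum_mono) (use h1_sq_le_grad_sq that in auto)
  then show ?thesis unfolding error_controlled_def using P_pos by (intro exI[of _ "P + 1"] conjI exI[of _ "1::real"]) auto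
qed

lemma potential_split: potential_split
proof -
  define C where "C = S * (P + 1)\<^sup>2"
  have C: "C > 0" using S_pos P_pos by (simp add: C_def)
  have "\<exists>m. integrable M (\<lambda>x. (v x - m) ^ 4) \<and>
      intg (\<lambda>x. (v x - m) ^ 4) \<le> C * (gsq v)\<^sup>2 \<and> (N > 0 \<longrightarrow> (AE x in M. 2 * \<bar>m\<bar> \<le> - f (\<rho> x)))"
    if v: "v \<in> X" for v
  proof (intro exI[of _ 0] conjI impI)
    show "integrable M (\<lambda>x. (v x - 0) ^ 4)" using X_integrable4[OF v] by simp
    have "(h1_sq v)\<^sup>2 \<le> ((P + 1) * gsq v)\<^sup>2" by (rule power_mono[OF h1_sq_le_grad_sq[OF v] h1_sq_nonneg])
    then have "S * (h1_sq v)\<^sup>2 \<le> S * ((P + 1) * gsq v)\<^sup>2" using S_pos by simp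
    then show "intg (\<lambda>x. (v x - 0) ^ 4) \<le> C * (gsq v)\<^sup>2"
      using X_bound4[OF v] by (simp add: C_def power_mult_distrib mult.assoc)
    show "AE x in M. 2 * \<bar>0\<bar> \<le> - f (\<rho> x)" using f_nonpos[OF density_nonneg] by simp
  qed
  then show ?thesis unfolding potential_split_def using C by (intro exI[of _ C] conjI exI[of _ "1::real"]) auto
qed

end

section \<open>Both boundary conditions as instances of the abstract problem\<close>

lemma ks_problem_intro:
  assumes space: "sobolev_space \<Omega> D S" and X: "X = H1_closure \<Omega> D"
    and b: "smooth_on \<Omega> b" "bounded (b ` \<Omega>)"
    and k: "ceperley_alder_signs k"
    and F': "\<forall>\<rho>>0. xc k differentiable at \<rho>"
    and F'': "AE x in lebesgue_on \<Omega>.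
        ks_density N \<Psi> x > 0 \<longrightarrow> xc' k differentiable at (ks_density N \<Psi> x)"
    and sol: "ks_solution k \<Omega> b N X \<Psi> \<phi> \<epsilon>"
  obtains K where "ks_problem \<Omega> D S (xc k) (xc' k) exchange_const K N \<Psi> \<phi> \<epsilon> b (\<lambda>x. xc'' k (ks_density N \<Psi> x))"
proof -
  interpret sobolev_space \<Omega> D S by (rule space)
  obtain K where K: "K > 0" "\<And>x y. 0 \<le> x \<Longrightarrow> x \<le> y \<Longrightarrow> x * xc' k (x\<^sup>2) + K * (x + x ^ 3) \<le> y * xc' k (y\<^sup>2) + K * (y + y ^ 3)"
    by (rule xc'_lower_mono[OF F' k]) (rule that; assumption)
  interpret lda "xc k" "xc' k" exchange_const K
    by unfold_locales
      (use xc_deriv_0[OF k] xc_has_derivative[OF F'] exchange_const_pos K xc'_upper_mono[OF F' k] in \<open>auto simp: xc_def\<close>)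
  have bm: "b \<in> borel_measurable M"
  proof (rule continuous_imp_measurable_on_sets_lebesgue)
    have "Ck_on 0 \<Omega> b" using b(1) unfolding smooth_on_def by blast
    then show "continuous_on \<Omega> b" by simp
  qed simp
  obtain B where B: "\<And>x. x \<in> \<Omega> \<Longrightarrow> \<bar>b x\<bar> \<le> B" using b(2) unfolding bounded_iff by auto
  have b2: "L2_fun \<Omega> b"
    unfolding L2_fun_def
  proof
    show "integrable M (\<lambda>x. (norm (b x))\<^sup>2)"
    proof (rule integrable_const_bound[of _ "B\<^sup>2"])
      show "AE x in M. norm ((norm (b x))\<^sup>2) \<le> B\<^sup>2"
      proof (rule AE_I2)
        fix x assume "x \<in> space M"
        then have "\<bar>b x\<bar> \<le> B" using B by (simp add: space_restrict_space)
        then have "\<bar>b x\<bar>\<^sup>2 \<le> B\<^sup>2" by (rule power_mono) simp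
        then show "norm ((norm (b x))\<^sup>2) \<le> B\<^sup>2" by simp
      qed
    qed (use bm in measurable)
  qed (rule bm)
  have c: "AE x in M. ks_density N \<Psi> x > 0 \<longrightarrow> (xc' k has_real_derivative xc'' k (ks_density N \<Psi> x)) (at (ks_density N \<Psi> x))"
    using F''
  proof eventually_elim
    case (elim x)
    show ?case
    proof
      \<comment> \<open>At positive density the derivative within the half line is two-sided, so
        \<open>xc''\<close> is the ordinary derivative of \<open>xc'\<close> there.\<close>
      assume p: "ks_density N \<Psi> x > 0"
      then have "at (ks_density N \<Psi> x) within {0..} = at (ks_density N \<Psi> x)" by (intro at_within_interior) simp
      then show "(xc' k has_real_derivative xc'' k (ks_density N \<Psi> x)) (at (ks_density N \<Psi> x))"
        using elim p by (simp add: xc''_def vector_derivative_works has_real_derivative_iff_has_vector_derivative)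
    qed
  qed
  have "ks_problem \<Omega> D S (xc k) (xc' k) exchange_const K N \<Psi> \<phi> \<epsilon> b (\<lambda>x. xc'' k (ks_density N \<Psi> x))"
    by unfold_locales (use sol b2 c in \<open>auto simp: ks_solution_def ks_form_def X\<close>)
  then show thesis by (rule that)
qed

text \<open>\<open>error_bound\<close> applied to the differences between the discrete and the
  continuous solution. The radius becomes \<open>sqrt r\<close> because the abstract estimate
  measures squared H1 norms.\<close>

lemma error_estimate:
  assumes problem: "ks_problem \<Omega> D S (xc k) (xc' k) a K N \<Psi> \<phi> \<epsilon> b (\<lambda>x. xc'' k (ks_density N \<Psi> x))"
    and X: "X = H1_closure \<Omega> D"
    and A1: "ks_problem.error_controlled \<Omega> D N \<Psi>"
    and A2: "ks_problem.potential_split \<Omega> D (xc' k) N \<Psi>"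
  shows "\<exists>r>0. \<forall>Xh \<Psi>h \<phi>h \<epsilon>h.
      finite_dim_subspace Xh X \<longrightarrow>
      ks_solution k \<Omega> b N Xh \<Psi>h \<phi>h \<epsilon>h \<longrightarrow>
      (\<forall>i<N. h1_norm \<Omega> (\<lambda>x. \<Psi>h i x - \<Psi> i x) < r) \<longrightarrow>
      h1_norm \<Omega> (\<lambda>x. \<phi>h x - \<phi> x) < r \<longrightarrow>
      (\<forall>i<N. \<bar>\<epsilon>h i - \<epsilon> i\<bar> < r) \<longrightarrow>
      (let \<delta>\<psi> = (\<lambda>i x. \<Psi>h i x - \<Psi> i x);
           \<delta>\<phi> = (\<lambda>x. \<phi>h x - \<phi> x);
           \<rho> = ks_density N \<Psi>
       in \<bar>energy k \<Omega> b N \<Psi>h \<phi>h - energy k \<Omega> b N \<Psi> \<phi>\<bar> \<le>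
            2 * (\<Sum>i<N.
                1 / 2 * grad_sq \<Omega> (\<delta>\<psi> i)
              + \<bar>\<epsilon> i * int_over \<Omega> (\<lambda>x. (\<delta>\<psi> i x)\<^sup>2)\<bar>
              + \<bar>int_over \<Omega> (\<lambda>x. xc' k (\<rho> x) * (\<delta>\<psi> i x)\<^sup>2)\<bar>
              + \<bar>int_over \<Omega> (\<lambda>x. (\<delta>\<psi> i x)\<^sup>2 * \<phi> x)\<bar>
              + 2 * \<bar>int_over \<Omega> (\<lambda>x. \<Psi> i x * \<delta>\<psi> i x * \<delta>\<phi> x)\<bar>)
            + 1 / (8 * pi) * grad_sq \<Omega> \<delta>\<phi>
            + 8 * \<bar>int_over \<Omega> (\<lambda>x. xc'' k (\<rho> x) * (\<Sum>i<N. \<Psi> i x * \<delta>\<psi> i x)\<^sup>2)\<bar>)"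
    (is "\<exists>r>0. \<forall>Xh \<Psi>h \<phi>h \<epsilon>h. _ \<longrightarrow> _ \<longrightarrow> _ \<longrightarrow> _ \<longrightarrow> _ \<longrightarrow> ?B \<Psi>h \<phi>h")
proof -
  interpret ks_problem \<Omega> D S "xc k" "xc' k" a K N \<Psi> \<phi> \<epsilon> b "\<lambda>x. xc'' k (ks_density N \<Psi> x)" by (rule problem)
  have en: "energy k \<Omega> b N \<Phi> u = en \<Phi> u" for \<Phi> u
    by (simp add: energy_def en_def grad_sq_def sum_divide_distrib[symmetric])
  obtain r where r: "r > 0" and est: "\<And>\<delta> \<eta>. (\<forall>i<N. \<delta> i \<in> X \<and> h1_sq (\<delta> i) < r) \<Longrightarrow> \<eta> \<in> X \<Longrightarrow> h1_sq \<eta> < r \<Longrightarrow>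
      (\<forall>i<N. \<forall>j<N. int_over \<Omega> (\<lambda>x. (\<Psi> i x + \<delta> i x) * (\<Psi> j x + \<delta> j x)) = (if i = j then 1 else 0)) \<Longrightarrow>
      \<bar>en (\<lambda>i x. \<Psi> i x + \<delta> i x) (\<lambda>x. \<phi> x + \<eta> x) - en \<Psi> \<phi>\<bar> \<le> err \<delta> \<eta>"
    using error_bound[OF A1 A2] unfolding X by blast
  show ?thesis
  proof (intro exI[of _ "sqrt r"] conjI allI impI)
    show "sqrt r > 0" using r by simp
    fix Xh \<Psi>h \<phi>h \<epsilon>h
    assume sub: "finite_dim_subspace Xh X" and sol: "ks_solution k \<Omega> b N Xh \<Psi>h \<phi>h \<epsilon>h"
      and near: "\<forall>i<N. h1_norm \<Omega> (\<lambda>x. \<Psi>h i x - \<Psi> i x) < sqrt r" "h1_norm \<Omega> (\<lambda>x. \<phi>h x - \<phi> x) < sqrt r"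
    have XhX: "u \<in> H1_closure \<Omega> D" if "u \<in> Xh" for u using sub that X by (auto simp: finite_dim_subspace_def)
    have \<Psi>h: "\<Psi>h i \<in> H1_closure \<Omega> D" if "i < N" for i using sol that XhX by (simp add: ks_solution_def)
    have \<phi>h: "\<phi>h \<in> H1_closure \<Omega> D" using sol XhX by (simp add: ks_solution_def)
    have small: "h1_sq u < r" if "h1_norm \<Omega> u < sqrt r" for u using h1_sq_less[OF that] r by simp
    have cancel: "\<Psi> i x + (\<Psi>h i x - \<Psi> i x) = \<Psi>h i x" "\<phi> x + (\<phi>h x - \<phi> x) = \<phi>h x" for i x by auto
    have "\<forall>i<N. (\<lambda>x. \<Psi>h i x - \<Psi> i x) \<in> X \<and> h1_sq (\<lambda>x. \<Psi>h i x - \<Psi> i x) < r"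
      unfolding X using X_diff[OF \<Psi>h \<Psi>_X] small near(1) by simp
    note est = est[of "\<lambda>i x. \<Psi>h i x - \<Psi> i x" "\<lambda>x. \<phi>h x - \<phi> x", OF this]
    have "(\<lambda>x. \<phi>h x - \<phi> x) \<in> X" unfolding X by (rule X_diff[OF \<phi>h \<phi>_X])
    note est = est[OF this small[OF near(2)], unfolded cancel]
    have "\<forall>i<N. \<forall>j<N. int_over \<Omega> (\<lambda>x. \<Psi>h i x * \<Psi>h j x) = (if i = j then 1 else 0)"
      using sol unfolding ks_solution_def by blast
    note est = est[OF this]
    show "?B \<Psi>h \<phi>h"
      using est unfolding Let_def en err_def sig_def .
  qed
qed

theorem proposition3p1:
  fixes \<Omega> :: "pt set" and X :: "fld set" and k :: corr_const and b :: fld and N :: nat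
    and \<Psi> :: "nat \<Rightarrow> fld" and \<phi> :: fld and \<epsilon> :: "nat \<Rightarrow> real"
  assumes space: "admissible \<Omega> X"
    and b: "smooth_on \<Omega> b" "bounded (b ` \<Omega>)"
    and k: "ceperley_alder_signs k"
    and F': "\<forall>\<rho>>0. xc k differentiable at \<rho>"
    and F'': "AE x in lebesgue_on \<Omega>.
        ks_density N \<Psi> x > 0 \<longrightarrow> xc' k differentiable at (ks_density N \<Psi> x)"
    and sol: "ks_solution k \<Omega> b N X \<Psi> \<phi> \<epsilon>"
    and ground: "occupies_lowest k \<Omega> N X \<Psi> \<phi> \<epsilon>"
  shows "\<exists>r>0. \<forall>Xh \<Psi>h \<phi>h \<epsilon>h.
      finite_dim_subspace Xh X \<longrightarrow>
      ks_solution k \<Omega> b N Xh \<Psi>h \<phi>h \<epsilon>h \<longrightarrow>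
      (\<forall>i<N. h1_norm \<Omega> (\<lambda>x. \<Psi>h i x - \<Psi> i x) < r) \<longrightarrow>
      h1_norm \<Omega> (\<lambda>x. \<phi>h x - \<phi> x) < r \<longrightarrow>
      (\<forall>i<N. \<bar>\<epsilon>h i - \<epsilon> i\<bar> < r) \<longrightarrow>
      (let \<delta>\<psi> = (\<lambda>i x. \<Psi>h i x - \<Psi> i x);
           \<delta>\<phi> = (\<lambda>x. \<phi>h x - \<phi> x);
           \<rho> = ks_density N \<Psi>
       in \<bar>energy k \<Omega> b N \<Psi>h \<phi>h - energy k \<Omega> b N \<Psi> \<phi>\<bar> \<le>
            2 * (\<Sum>i<N.
                1 / 2 * grad_sq \<Omega> (\<delta>\<psi> i)
              + \<bar>\<epsilon> i * int_over \<Omega> (\<lambda>x. (\<delta>\<psi> i x)\<^sup>2)\<bar>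
              + \<bar>int_over \<Omega> (\<lambda>x. xc' k (\<rho> x) * (\<delta>\<psi> i x)\<^sup>2)\<bar>
              + \<bar>int_over \<Omega> (\<lambda>x. (\<delta>\<psi> i x)\<^sup>2 * \<phi> x)\<bar>
              + 2 * \<bar>int_over \<Omega> (\<lambda>x. \<Psi> i x * \<delta>\<psi> i x * \<delta>\<phi> x)\<bar>)
            + 1 / (8 * pi) * grad_sq \<Omega> \<delta>\<phi>
            + 8 * \<bar>int_over \<Omega> (\<lambda>x. xc'' k (\<rho> x) * (\<Sum>i<N. \<Psi> i x * \<delta>\<psi> i x)\<^sup>2)\<bar>)"
  using space unfolding admissible_def
proof (elim disjE exE conjE)
  assume op: "open \<Omega>" "bounded \<Omega>" and X: "X = H1_0 \<Omega>"
  interpret bounded_open \<Omega> by unfold_locales (use op in auto)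
  interpret trial_space \<Omega> "test_functions \<Omega>" by (rule trial_space_test_functions)
  interpret sobolev_space \<Omega> "test_functions \<Omega>" 2 by unfold_locales (use test_function_L4 in auto)
  note X = X[unfolded H1_0_def]
  obtain P where P: "P > 0" "\<And>\<zeta>. \<zeta> \<in> test_functions \<Omega> \<Longrightarrow> int_over \<Omega> (\<lambda>x. (\<zeta> x)\<^sup>2) \<le> P * grad_sq \<Omega> \<zeta>"
    by (rule test_function_Poincare) (rule that; assumption)
  \<comment> \<open>The case of weight 0 for the mean in the transfer to the closure.\<close>
  have Poincare: "int_over \<Omega> (\<lambda>x. (v x)\<^sup>2) \<le> P * grad_sq \<Omega> v" if "v \<in> H1_closure \<Omega> (test_functions \<Omega>)" for v
    using X_Poincare[of 0 P v] P(2) that by simp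
  obtain K where K: "ks_problem \<Omega> (test_functions \<Omega>) 2 (xc k) (xc' k) exchange_const K N \<Psi> \<phi> \<epsilon> b (\<lambda>x. xc'' k (ks_density N \<Psi> x))"
    by (rule ks_problem_intro[OF sobolev_space_axioms X b k F' F'' sol]) (rule that; assumption)
  interpret ks_Poincare \<Omega> "test_functions \<Omega>" 2 "xc k" "xc' k" exchange_const K N \<Psi> \<phi> \<epsilon> b "\<lambda>x. xc'' k (ks_density N \<Psi> x)" P
    by (rule ks_Poincare.intro[OF K]) (unfold_locales, rule P(1), rule Poincare)
  show ?thesis
    by (rule error_estimate[OF K X error_controlled potential_split])
next
  fix x0 a assume inv: "invertible a" and \<Omega>: "\<Omega> = supercell x0 a" and X: "X = H1_per x0 a"
  interpret cell: cell x0 a by unfold_locales (rule inv)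
  note X = X[unfolded H1_per_def \<Omega>[symmetric]]
  interpret trial_space \<Omega> "smooth_periodic a" unfolding \<Omega> by (rule cell.trial_space_periodic)
  obtain S where S: "S > 0" "\<And>\<eta>. \<eta> \<in> smooth_periodic a \<Longrightarrow> (\<integral>\<^sup>+x. ennreal (\<eta> x ^ 4) \<partial>lebesgue_on \<Omega>) \<le> ennreal (S * (h1_sq \<eta>)\<^sup>2)"
    using cell.periodic_L4 unfolding \<Omega> by blast
  interpret sobolev_space \<Omega> "smooth_periodic a" S by unfold_locales (use S in auto)
  obtain P where P: "P > 0" "\<And>\<eta>. \<eta> \<in> smooth_periodic a \<Longrightarrow>
      int_over \<Omega> (\<lambda>x. (\<eta> x)\<^sup>2) - 1 / measure (lebesgue_on \<Omega>) \<Omega> * (int_over \<Omega> \<eta>)\<^sup>2 \<le> P * grad_sq \<Omega> \<eta>"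
    using cell.periodic_Poincare unfolding \<Omega> by blast
  interpret mean_space \<Omega> "smooth_periodic a" S P
  proof
    show "(\<lambda>x. t) \<in> smooth_periodic a" for t by (simp add: smooth_periodic_def smooth_on_UNIV_intros)
    show "(\<lambda>x. \<eta> x * \<zeta> x) \<in> smooth_periodic a" if "\<eta> \<in> smooth_periodic a" "\<zeta> \<in> smooth_periodic a" for \<eta> \<zeta>
      using that by (simp add: smooth_periodic_def smooth_on_UNIV_intros)
    show "(\<lambda>x. sqrt (\<eta> x)) \<in> smooth_periodic a" if "\<eta> \<in> smooth_periodic a" "\<And>x. \<eta> x > 0" for \<eta>
      using that smooth_closure.sqrt[of \<eta>] by (simp add: smooth_periodic_def smooth_on_closure_iff)
    show "\<Omega> \<noteq> {}" using cell.cell_nonempty unfolding \<Omega> .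
  qed (use P in auto)
  obtain K where K: "ks_problem \<Omega> (smooth_periodic a) S (xc k) (xc' k) exchange_const K N \<Psi> \<phi> \<epsilon> b (\<lambda>x. xc'' k (ks_density N \<Psi> x))"
    by (rule ks_problem_intro[OF sobolev_space_axioms X b k F' F'' sol]) (rule that; assumption)
  interpret ks_problem \<Omega> "smooth_periodic a" S "xc k" "xc' k" exchange_const K N \<Psi> \<phi> \<epsilon> b "\<lambda>x. xc'' k (ks_density N \<Psi> x)"
    by (rule K)
  show ?thesis
  \<comment> \<open>Without orbitals there is no lowest one to start from. Then the sums are empty,
    and the condition on the constant \<open>m\<close> in \<open>potential_split\<close> is void, so
    the mean of the potential error may be any number.\<close>
  proof (cases "N = 0")
    case True
    have "\<exists>m. integrable (lebesgue_on \<Omega>) (\<lambda>x. (v x - m) ^ 4) \<and>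
        int_over \<Omega> (\<lambda>x. (v x - m) ^ 4) \<le> S * (P + 1)\<^sup>2 * (grad_sq \<Omega> v)\<^sup>2" if "v \<in> H1_closure \<Omega> (smooth_periodic a)" for v
      using mean_remainder_L4(1,2)[OF that refl] by blast
    then have "potential_split"
      unfolding potential_split_def using True S(1) P(1) by (intro exI[of _ "S * (P + 1)\<^sup>2"] conjI exI[of _ "1::real"]) auto
    moreover have "error_controlled"
      unfolding error_controlled_def using True by (auto intro: exI[of _ "1::real"])
    ultimately show ?thesis by (intro error_estimate[OF K X])
  next
    case False
    interpret ks_ground \<Omega> "smooth_periodic a" S "xc k" "xc' k" exchange_const K N \<Psi> \<phi> \<epsilon> b "\<lambda>x. xc'' k (ks_density N \<Psi> x)" P
    proof
      fix v i assume v: "v \<in> H1_closure \<Omega> (smooth_periodic a)" "\<And>j. j < N \<Longrightarrow> int_over \<Omega> (\<lambda>x. \<Psi> j x * v x) = 0" and i: "i < N"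
      have "\<epsilon> i * int_over \<Omega> (\<lambda>x. (v x)\<^sup>2) \<le> ks_form k \<Omega> (ks_density N \<Psi>) \<phi> v v"
        using ground v i unfolding occupies_lowest_def X by blast
      then show "\<epsilon> i * int_over \<Omega> (\<lambda>x. (v x)\<^sup>2) \<le> 1 / 2 * grad_sq \<Omega> v
          + int_over \<Omega> (\<lambda>x. xc' k (ks_density N \<Psi> x) * (v x)\<^sup>2) + int_over \<Omega> (\<lambda>x. \<phi> x * (v x)\<^sup>2)"
        by (simp add: ks_form_def grad_sq_inner power2_eq_square mult.assoc)
    qed (use False in auto)
    show ?thesis
      by (rule error_estimate[OF K X error_controlled potential_split])
  qed
qed

end
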